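(* Let $n\ge2$, let $w_1,\dots,w_r\in\mathbb{R}^n$ be pairwise distinct points, and let $f(x)=\sum_{i=1}^r\log|x-w_i|^2$ on $\mathbb{R}^n\setminus\{w_1,\dots,w_r\}$. Then every connected component of a level set $f^{-1}(c)$ that contains no critical point of $f$ is diffeomorphic to the standard unit sphere $\mathbb{S}^{n-1}\subset\mathbb{R}^n$.
   Context: $|\cdot|$ is the Euclidean norm. *)

theory Defs
  imports "HOL-Analysis.Analysis"
begin

fun Ck_on :: "nat \<Rightarrow> 'a::euclidean_space set \<Rightarrow> ('a \<Rightarrow> 'b::euclidean_space) \<Rightarrow> bool" where
  "Ck_on 0 U f = continuous_on U f"
| "Ck_on (Suc k) U f =
     (f differentiable_on U \<and>
      (\<forall>i\<in>Basis. Ck_on k U (\<lambda>x. frechet_derivative f (at x) i)))"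

definition smooth_on_open :: "'a::euclidean_space set \<Rightarrow> ('a \<Rightarrow> 'b::euclidean_space) \<Rightarrow> bool" where
  "smooth_on_open U f \<longleftrightarrow> open U \<and> (\<forall>k. Ck_on k U f)"

definition smooth_map_on :: "'a::euclidean_space set \<Rightarrow> ('a \<Rightarrow> 'b::euclidean_space) \<Rightarrow> bool" where
  "smooth_map_on S f \<longleftrightarrow>
     (\<forall>x\<in>S. \<exists>U g. open U \<and> x \<in> U \<and> smooth_on_open U g \<and> (\<forall>y\<in>S \<inter> U. g y = f y))"

definition diffeomorphic_sets :: "'a::euclidean_space set \<Rightarrow> 'b::euclidean_space set \<Rightarrow> bool" where
  "diffeomorphic_sets S T \<longleftrightarrow>
     (\<exists>h k. h ` S = T \<and> k ` T = S \<and> (\<forall>x\<in>S. k (h x) = x) \<and> (\<forall>y\<in>T. h (k y) = y) \<and>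
            smooth_map_on S h \<and> smooth_map_on T k)"

end

theory Submission
  imports Defs
begin

section \<open>Smooth calculus: stability of smoothness under the operations used later\<close>

section \<open>Smooth calculus\<close>

text \<open>Exponentiating \<open>f\<close> gives the polynomial \<open>P\<close>, the product of
  the |x - w i|^2, and a component of a level of \<open>f\<close> is a component of a positive level
  of \<open>P\<close>. The decisive fact is that log |x - w|^2 is subharmonic on every affine plane
  away from \<open>w\<close>, and that sums keep this property. In terms of the gradient
  \<open>G\<close> and the Hessian \<open>H\<close> of \<open>P\<close> it reads (G.u)^2 + (G.v)^2
  <= P (u.Hu + v.Hv) for orthonormal u, v (\<open>potential_prod\<close>). Hence \<open>H\<close>
  has nonnegative trace on every plane, and an invertible symmetric form with this property has at
  most one negative direction (\<open>diagonalise_index_le_1\<close>).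

  By Sard's theorem (\<open>regular_value_dense\<close>) there are arbitrarily small vectors e such
  that P - e.x has only nondegenerate critical points. Its Hessian is that of \<open>P\<close>, so
  all indices are 0 or 1. A further change near these points makes the function exactly quadratic
  there, with distinct critical values (\<open>tame_perturbation\<close>). A component of a level of
  \<open>P\<close> without critical points is compact and survives small perturbations up to
  diffeomorphism (\<open>level_set_stability\<close>), so it is a component of a regular level of
  such a tame function.

  It remains to see that regular levels of a tame function are disjoint unions of spheres
  (\<open>tame_level_spheres\<close>); this goes by induction on the number of critical values
  below. Between critical values the level does not change (\<open>level_set_isotopy\<close>). A
  minimum adds a round sphere (\<open>min_crossing\<close>). At a point of index one, two caps below
  are replaced by a tube above (\<open>saddle_crossing\<close>). The two caps belong to different
  components: otherwise a loop through the critical point would carry a circle-valued map of degree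
  one, this map would extend over all later handles because they have index 0 or 1, and it would end
  on a contractible sublevel set, where it has a logarithm (\<open>no_self_handle\<close>). So the
  crossing forms the connected sum of two components. One of them is a sphere by induction, and a
  connected sum with a standard sphere changes nothing: the new level is diffeomorphic to the old
  one with that sphere deleted (\<open>remove_sphere_summand\<close>, which rests on
  \<open>punctured_sphere_chart\<close>).\<close>

lemma linear_Basis_expansion:
  fixes L :: "'a::euclidean_space \<Rightarrow> 'b::real_vector"
  assumes "linear L" shows "(\<Sum>j\<in>Basis. (v \<bullet> j) *\<^sub>R L j) = L v"
proof -
  have "L v = L (\<Sum>j\<in>Basis. (v \<bullet> j) *\<^sub>R j)" by (simp add: euclidean_representation)
  also have "\<dots> = (\<Sum>j\<in>Basis. (v \<bullet> j) *\<^sub>R L j)"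
    using assms by (simp add: linear_sum linear_scale)
  finally show ?thesis by simp
qed

text \<open>A derivative depends only on values near the point, so agreement on an open set passes
  to all iterated partial derivatives.\<close>

lemma Ck_on_cong:
  assumes "open U" "\<And>x. x \<in> U \<Longrightarrow> f x = g x" "Ck_on k U f"
  shows "Ck_on k U g"
  using assms(2,3)
proof (induction k arbitrary: f g)
  case 0
  then show ?case by (metis Ck_on.simps(1) continuous_on_cong)
next
  case (Suc k)
  have fd: "f differentiable at x" if "x \<in> U" for x
    using Suc.prems(2) that assms(1) by (simp add: differentiable_on_eq_differentiable_at)
  have eq: "frechet_derivative f (at x) = frechet_derivative g (at x)" if "x \<in> U" for x
    using frechet_derivative_transform_within_open[OF fd[OF that] assms(1) that] Suc.prems(1) by blast
  have "g differentiable at x" if "x \<in> U" for x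
    using fd[OF that] Suc.prems(1) assms(1) that
    unfolding differentiable_def by (metis has_derivative_transform_within_open)
  then have "g differentiable_on U"
    using assms(1) by (simp add: differentiable_on_eq_differentiable_at)
  moreover have "Ck_on k U (\<lambda>x. frechet_derivative g (at x) i)" if "i \<in> Basis" for i
    using Suc.IH[of "\<lambda>x. frechet_derivative f (at x) i" "\<lambda>x. frechet_derivative g (at x) i"]
      eq Suc.prems(2) that by auto
  ultimately show ?case by simp
qed

text \<open>Together with \<open>Ck_on_SucE\<close> this trades \<open>frechet_derivative\<close>
  for an explicit derivative \<open>f'\<close>, which is what the inductions on \<open>k\<close>
  below manipulate.\<close>

lemma Ck_on_SucI:
  assumes "open U" "\<And>x. x \<in> U \<Longrightarrow> (f has_derivative f' x) (at x)"
    "\<And>i. i \<in> Basis \<Longrightarrow> Ck_on k U (\<lambda>x. f' x i)"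
  shows "Ck_on (Suc k) U f"
proof -
  have "f differentiable_on U"
    using assms(1,2) by (auto simp: differentiable_on_eq_differentiable_at differentiable_def)
  moreover have "Ck_on k U (\<lambda>x. frechet_derivative f (at x) i)" if "i \<in> Basis" for i
  proof (rule Ck_on_cong[OF assms(1) _ assms(3)[OF that]])
    fix x assume "x \<in> U"
    from frechet_derivative_at[OF assms(2)[OF this]] show "f' x i = frechet_derivative f (at x) i" by simp
  qed
  ultimately show ?thesis by simp
qed

lemma Ck_on_SucE:
  assumes "open U" "Ck_on (Suc k) U f"
  obtains f' where "\<And>x. x \<in> U \<Longrightarrow> (f has_derivative f' x) (at x)"
    "\<And>i. i \<in> Basis \<Longrightarrow> Ck_on k U (\<lambda>x. f' x i)"
  using assms by (intro that[of "\<lambda>x. frechet_derivative f (at x)"])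
    (auto simp: differentiable_on_eq_differentiable_at frechet_derivative_works[symmetric])

lemma Ck_on_SucD: "open U \<Longrightarrow> Ck_on (Suc k) U f \<Longrightarrow> Ck_on k U f"
proof (induction k arbitrary: f)
  case 0
  then show ?case by (simp add: differentiable_imp_continuous_on)
next
  case (Suc k)
  obtain f' where "\<And>x. x \<in> U \<Longrightarrow> (f has_derivative f' x) (at x)"
    "\<And>i. i \<in> Basis \<Longrightarrow> Ck_on (Suc k) U (\<lambda>x. f' x i)"
    using Ck_on_SucE[OF Suc.prems] by metis
  then show ?case using Suc.IH Suc.prems(1) Ck_on_SucI by metis
qed

lemma Ck_on_continuous: "open U \<Longrightarrow> Ck_on k U f \<Longrightarrow> continuous_on U f"
  by (induction k) (auto dest: Ck_on_SucD simp: differentiable_imp_continuous_on)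

lemma Ck_on_subset:
  assumes "open U" "open V" "V \<subseteq> U" "Ck_on k U f" shows "Ck_on k V f"
  using assms(4)
proof (induction k arbitrary: f)
  case 0
  then show ?case using assms(3) continuous_on_subset by auto
next
  case (Suc k)
  obtain f' where "\<And>x. x \<in> U \<Longrightarrow> (f has_derivative f' x) (at x)"
    "\<And>i. i \<in> Basis \<Longrightarrow> Ck_on k U (\<lambda>x. f' x i)"
    using Ck_on_SucE[OF assms(1) Suc.prems] by metis
  then show ?case using Suc.IH assms(2,3) by (intro Ck_on_SucI[of V f f']) auto
qed

lemma Ck_on_const: "open U \<Longrightarrow> Ck_on k U (\<lambda>x. c)"
proof (induction k arbitrary: c)
  case (Suc k)
  show ?case by (rule Ck_on_SucI[where f'="\<lambda>x h. 0"]) (use Suc in auto)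
qed auto

lemma Ck_on_bounded_linear:
  assumes "open U" "bounded_linear f" shows "Ck_on k U f"
proof (cases k)
  case 0
  then show ?thesis using assms by (simp add: linear_continuous_on)
next
  case (Suc j)
  show ?thesis unfolding Suc
    by (rule Ck_on_SucI[where f'="\<lambda>x. f"])
      (use assms Ck_on_const in \<open>auto intro: bounded_linear_imp_has_derivative\<close>)
qed

lemma Ck_on_add:
  assumes "open U" "Ck_on k U f" "Ck_on k U g" shows "Ck_on k U (\<lambda>x. f x + g x)"
  using assms(2,3)
proof (induction k arbitrary: f g)
  case 0
  then show ?case by (auto intro: continuous_intros)
next
  case (Suc k)
  obtain f' where f': "\<And>x. x \<in> U \<Longrightarrow> (f has_derivative f' x) (at x)"
    "\<And>i. i \<in> Basis \<Longrightarrow> Ck_on k U (\<lambda>x. f' x i)"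
    using Ck_on_SucE[OF assms(1) Suc.prems(1)] by metis
  obtain g' where g': "\<And>x. x \<in> U \<Longrightarrow> (g has_derivative g' x) (at x)"
    "\<And>i. i \<in> Basis \<Longrightarrow> Ck_on k U (\<lambda>x. g' x i)"
    using Ck_on_SucE[OF assms(1) Suc.prems(2)] by metis
  show ?case
    by (rule Ck_on_SucI[where f'="\<lambda>x h. f' x h + g' x h"])
      (use assms(1) f' g' Suc.IH in \<open>auto intro: derivative_intros\<close>)
qed

lemma Ck_on_sum:
  assumes "open U" "finite I" "\<And>i. i \<in> I \<Longrightarrow> Ck_on k U (f i)"
  shows "Ck_on k U (\<lambda>x. \<Sum>i\<in>I. f i x)"
  using assms(2,3) by (induction I) (auto intro: Ck_on_const Ck_on_add assms(1))


text \<open>By the product rule a partial derivative is a sum of two terms of the same bilinear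
  shape and one order less. One proof serves scaling, inner product and multiplication.\<close>

lemma Ck_on_bilinear:
  fixes f :: "'x::euclidean_space \<Rightarrow> 'a::euclidean_space" and g :: "'x \<Rightarrow> 'b::euclidean_space"
    and pr :: "'a \<Rightarrow> 'b \<Rightarrow> 'c::euclidean_space"
  assumes b: "bounded_bilinear pr" and "open U" "Ck_on k U f" "Ck_on k U g"
  shows "Ck_on k U (\<lambda>x. pr (f x) (g x))"
  using assms(3,4)
proof (induction k arbitrary: f g)
  case 0
  then show ?case by (auto intro: bounded_bilinear.continuous_on[OF b])
next
  case (Suc k)
  obtain f' where f': "\<And>x. x \<in> U \<Longrightarrow> (f has_derivative f' x) (at x)"
    "\<And>i. i \<in> Basis \<Longrightarrow> Ck_on k U (\<lambda>x. f' x i)"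
    using Ck_on_SucE[OF assms(2) Suc.prems(1)] by metis
  obtain g' where g': "\<And>x. x \<in> U \<Longrightarrow> (g has_derivative g' x) (at x)"
    "\<And>i. i \<in> Basis \<Longrightarrow> Ck_on k U (\<lambda>x. g' x i)"
    using Ck_on_SucE[OF assms(2) Suc.prems(2)] by metis
  have "Ck_on k U f" "Ck_on k U g" using Suc.prems assms(2) Ck_on_SucD by auto
  then have "Ck_on k U (\<lambda>x. pr (f x) (g' x i) + pr (f' x i) (g x))" if "i \<in> Basis" for i
    using f'(2) g'(2) that by (intro Ck_on_add assms(2) Suc.IH)
  moreover have "((\<lambda>x. pr (f x) (g x)) has_derivative (\<lambda>h. pr (f x) (g' x h) + pr (f' x h) (g x))) (at x)"
    if "x \<in> U" for x
    by (rule bounded_bilinear.FDERIV[OF b f'(1)[OF that] g'(1)[OF that]])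
  ultimately show ?case by (rule_tac Ck_on_SucI[OF assms(2)])
qed

text \<open>The chain rule gives \<open>g' (f x) (f' x i)\<close>, which is not itself a
  composition. Expanding the vector in the basis turns it into a sum of products of compositions, to
  which the induction hypothesis applies.\<close>

lemma Ck_on_compose:
  fixes f :: "'a::euclidean_space \<Rightarrow> 'b::euclidean_space" and g :: "'b \<Rightarrow> 'c::euclidean_space"
  assumes "open U" "open V" "f ` U \<subseteq> V" "Ck_on k U f" "Ck_on k V g"
  shows "Ck_on k U (\<lambda>x. g (f x))"
  using assms(4,5)
proof (induction k arbitrary: g)
  case 0
  then show ?case using assms(3) by (auto intro: continuous_on_compose2)
next
  case (Suc k)
  obtain f' where f': "\<And>x. x \<in> U \<Longrightarrow> (f has_derivative f' x) (at x)"
    "\<And>i. i \<in> Basis \<Longrightarrow> Ck_on k U (\<lambda>x. f' x i)"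
    using Ck_on_SucE[OF assms(1) Suc.prems(1)] by metis
  obtain g' where g': "\<And>x. x \<in> V \<Longrightarrow> (g has_derivative g' x) (at x)"
    "\<And>i. i \<in> Basis \<Longrightarrow> Ck_on k V (\<lambda>x. g' x i)"
    using Ck_on_SucE[OF assms(2) Suc.prems(2)] by metis
  have fk: "Ck_on k U f" using Suc.prems(1) assms(1) Ck_on_SucD by blast
  have lin: "linear (g' (f x))" if "x \<in> U" for x
    using g'(1) that assms(3) has_derivative_linear by blast
  have "Ck_on k U (\<lambda>x. g' (f x) (f' x i))" if i: "i \<in> Basis" for i
  proof (rule Ck_on_cong[OF assms(1)])
    show "Ck_on k U (\<lambda>x. \<Sum>j\<in>Basis. (f' x i \<bullet> j) *\<^sub>R g' (f x) j)"
      by (intro Ck_on_sum assms(1) finite_Basis Ck_on_bilinear[OF bounded_bilinear_scaleR]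
          Ck_on_bilinear[OF bounded_bilinear_inner] f'(2) i Ck_on_const Suc.IH fk g'(2))
    show "(\<Sum>j\<in>Basis. (f' x i \<bullet> j) *\<^sub>R g' (f x) j) = g' (f x) (f' x i)" if "x \<in> U" for x
      by (rule linear_Basis_expansion[OF lin[OF that]])
  qed
  moreover have "((\<lambda>x. g (f x)) has_derivative (\<lambda>h. g' (f x) (f' x h))) (at x)" if "x \<in> U" for x
    using diff_chain_at[OF f'(1)[OF that] g'(1)[of "f x"]] assms(3) that by (auto simp: o_def)
  ultimately show ?case by (rule_tac Ck_on_SucI[OF assms(1)])
qed

lemma Ck_on_Pair:
  assumes "open U" "Ck_on k U f" "Ck_on k U g" shows "Ck_on k U (\<lambda>x. (f x, g x))"
proof -
  have "bounded_linear (\<lambda>y. (y, 0))" "bounded_linear (\<lambda>y. (0, y))"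
    by (auto intro!: bounded_linear_Pair bounded_linear_ident bounded_linear_zero)
  then have "Ck_on k U (\<lambda>x. (f x, 0) + (0, g x))"
    by (intro Ck_on_add assms(1) Ck_on_compose[OF assms(1) open_UNIV _ assms(2), where g="\<lambda>y. (y, 0)"]
        Ck_on_compose[OF assms(1) open_UNIV _ assms(3), where g="\<lambda>y. (0, y)"] Ck_on_bounded_linear) auto
  then show ?thesis by simp
qed

text \<open>Smoothness on some neighbourhood of the point. Since the domain is hidden, the rules
  collected in \<open>smooth_intros\<close> compose without domain bookkeeping.\<close>

definition smooth_at :: "('a::euclidean_space \<Rightarrow> 'b::euclidean_space) \<Rightarrow> 'a \<Rightarrow> bool" where
  "smooth_at f x \<longleftrightarrow> (\<exists>U. x \<in> U \<and> smooth_on_open U f)"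

named_theorems smooth_intros

lemma smooth_atE:
  assumes "smooth_at f x"
  obtains U where "open U" "x \<in> U" "\<And>k. Ck_on k U f"
  using assms by (auto simp: smooth_at_def smooth_on_open_def)

lemma smooth_atI: "open U \<Longrightarrow> x \<in> U \<Longrightarrow> (\<And>k. Ck_on k U f) \<Longrightarrow> smooth_at f x"
  by (auto simp: smooth_at_def smooth_on_open_def)

lemma smooth_at_eventually:
  assumes "smooth_at f x" shows "\<exists>U. open U \<and> x \<in> U \<and> (\<forall>y\<in>U. smooth_at f y)"
  using assms by (auto simp: smooth_at_def smooth_on_open_def)

lemma smooth_at_cong_open:
  assumes "smooth_at f x" "open U" "x \<in> U" "\<And>y. y \<in> U \<Longrightarrow> f y = g y"
  shows "smooth_at g x"
proof -
  obtain V where V: "open V" "x \<in> V" "\<And>k. Ck_on k V f" using assms(1) smooth_atE by metis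
  have "Ck_on k (U \<inter> V) g" for k
    using Ck_on_cong[of "U \<inter> V" f g k] Ck_on_subset[of V "U \<inter> V" k f] V assms by auto
  then show ?thesis using assms V by (intro smooth_atI[of "U \<inter> V"]) auto
qed

lemma smooth_at_binary:
  assumes "smooth_at f x" "smooth_at g x"
    "\<And>k U. open U \<Longrightarrow> Ck_on k U f \<Longrightarrow> Ck_on k U g \<Longrightarrow> Ck_on k U h"
  shows "smooth_at h x"
proof -
  obtain U V where "open U" "x \<in> U" "\<And>k. Ck_on k U f" "open V" "x \<in> V" "\<And>k. Ck_on k V g"
    using assms smooth_atE by metis
  then show ?thesis
    by (intro smooth_atI[of "U \<inter> V"] assms(3)) (auto intro: Ck_on_subset)
qed

lemma smooth_at_const [smooth_intros, simp]: "smooth_at (\<lambda>x. c) x"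
  by (rule smooth_atI[of UNIV]) (auto intro: Ck_on_const)

lemma smooth_at_bounded_linear: "bounded_linear f \<Longrightarrow> smooth_at f x"
  by (rule smooth_atI[of UNIV]) (auto intro: Ck_on_bounded_linear)

lemma smooth_at_linear: "linear f \<Longrightarrow> smooth_at f x"
  by (simp add: linear_conv_bounded_linear smooth_at_bounded_linear)

lemma smooth_at_ident [smooth_intros, simp]: "smooth_at (\<lambda>x. x) x"
  by (simp add: smooth_at_bounded_linear bounded_linear_ident)

lemma smooth_at_Pair [smooth_intros]: "smooth_at f x \<Longrightarrow> smooth_at g x \<Longrightarrow> smooth_at (\<lambda>x. (f x, g x)) x"
  by (erule (1) smooth_at_binary) (rule Ck_on_Pair)

lemma smooth_at_add [smooth_intros]: "smooth_at f x \<Longrightarrow> smooth_at g x \<Longrightarrow> smooth_at (\<lambda>x. f x + g x) x"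
  by (erule (1) smooth_at_binary) (rule Ck_on_add)

lemma smooth_at_bilinear:
  "bounded_bilinear pr \<Longrightarrow> smooth_at f x \<Longrightarrow> smooth_at g x \<Longrightarrow> smooth_at (\<lambda>x. pr (f x) (g x)) x"
  by (erule (1) smooth_at_binary) (rule Ck_on_bilinear)

lemmas smooth_at_scaleR [smooth_intros] = smooth_at_bilinear[OF bounded_bilinear_scaleR]
lemmas smooth_at_inner [smooth_intros] = smooth_at_bilinear[OF bounded_bilinear_inner]

lemma smooth_at_mult [smooth_intros]:
  fixes f g :: "'a::euclidean_space \<Rightarrow> real"
  shows "smooth_at f x \<Longrightarrow> smooth_at g x \<Longrightarrow> smooth_at (\<lambda>x. f x * g x) x"
  by (rule smooth_at_bilinear[OF bounded_bilinear_mult])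

lemma smooth_at_isCont: "smooth_at f x \<Longrightarrow> isCont f x"
  by (metis Ck_on_continuous continuous_on_eq_continuous_at smooth_atE)

lemma smooth_at_compose:
  assumes "smooth_at f x" "smooth_at g (f x)" shows "smooth_at (\<lambda>x. g (f x)) x"
proof -
  obtain U V where *: "open U" "x \<in> U" "\<And>k. Ck_on k U f" "open V" "f x \<in> V" "\<And>k. Ck_on k V g"
    using assms smooth_atE by metis
  define W where "W = U \<inter> f -` V"
  have "open W" unfolding W_def 
    by (rule continuous_open_preimage[OF Ck_on_continuous[OF *(1) *(3)[of 0]] *(1) *(4)])
  have "Ck_on k W (\<lambda>x. g (f x))" for k
    by (rule Ck_on_compose[OF \<open>open W\<close> *(4) _ Ck_on_subset[OF *(1) \<open>open W\<close> _ *(3)] *(6)])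
      (auto simp: W_def)
  moreover have "x \<in> W" using * by (simp add: W_def)
  ultimately show ?thesis using \<open>open W\<close> by (intro smooth_atI[of W])
qed

lemma smooth_at_fst [smooth_intros]: "smooth_at f x \<Longrightarrow> smooth_at (\<lambda>x. fst (f x)) x"
  by (rule smooth_at_compose) (auto intro: smooth_at_bounded_linear bounded_linear_fst)

lemma smooth_at_snd [smooth_intros]: "smooth_at f x \<Longrightarrow> smooth_at (\<lambda>x. snd (f x)) x"
  by (rule smooth_at_compose) (auto intro: smooth_at_bounded_linear bounded_linear_snd)

lemma smooth_at_minus [smooth_intros]: "smooth_at f x \<Longrightarrow> smooth_at (\<lambda>x. - f x) x"
  using smooth_at_bounded_linear[OF bounded_linear_minus[OF bounded_linear_ident]] smooth_at_compose by blast

lemma smooth_at_diff [smooth_intros]: "smooth_at f x \<Longrightarrow> smooth_at g x \<Longrightarrow> smooth_at (\<lambda>x. f x - g x) x"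
  using smooth_at_add[OF _ smooth_at_minus, of f x g] by simp

lemma smooth_at_sum [smooth_intros]:
  "(\<And>i. i \<in> I \<Longrightarrow> smooth_at (f i) x) \<Longrightarrow> smooth_at (\<lambda>x. \<Sum>i\<in>I. f i x) x"
  by (induction I rule: infinite_finite_induct) (auto intro!: smooth_intros)

lemma smooth_at_power [smooth_intros]:
  fixes f :: "'a::euclidean_space \<Rightarrow> real"
  shows "smooth_at f x \<Longrightarrow> smooth_at (\<lambda>x. f x ^ n) x"
  by (induction n) (auto intro!: smooth_intros)

lemma smooth_at_prod [smooth_intros]:
  fixes f :: "'i \<Rightarrow> 'a::euclidean_space \<Rightarrow> real"
  shows "(\<And>i. i \<in> I \<Longrightarrow> smooth_at (f i) x) \<Longrightarrow> smooth_at (\<lambda>x. \<Prod>i\<in>I. f i x) x"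
  by (induction I rule: infinite_finite_induct) (auto intro!: smooth_intros)

lemma Ck_on_realI:
  fixes f :: "real \<Rightarrow> real"
  assumes "open U" "\<And>x. x \<in> U \<Longrightarrow> (f has_real_derivative f' x) (at x)" "Ck_on k U f'"
  shows "Ck_on (Suc k) U f"
  using assms by (intro Ck_on_SucI[where f'="\<lambda>x h. f' x * h"]) (auto simp: has_field_derivative_def)

lemma Ck_on_exp: "Ck_on k (UNIV::real set) exp"
proof (induction k)
  case 0
  show ?case by (auto intro!: continuous_intros)
next
  case (Suc k)
  show ?case by (rule Ck_on_realI[OF open_UNIV _ Suc]) (rule DERIV_exp)
qed

lemma smooth_at_exp [smooth_intros]: "smooth_at f x \<Longrightarrow> smooth_at (\<lambda>x. exp (f x :: real)) x"
  by (erule smooth_at_compose) (auto intro: smooth_atI[of UNIV] Ck_on_exp)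

text \<open>The derivative is a polynomial in \<open>inverse\<close> itself, so the induction closes
  on the same function.\<close>

lemma Ck_on_inverse: "Ck_on k (- {0::real}) inverse"
proof (induction k)
  case 0
  show ?case by (auto intro!: continuous_intros)
next
  case (Suc k)
  have "Ck_on k (- {0::real}) (\<lambda>x. (-1) * (inverse x * inverse x))"
    by (intro Ck_on_bilinear[OF bounded_bilinear_mult] Ck_on_const Suc) auto
  then show ?case
    by (intro Ck_on_realI[where f'="\<lambda>x. (-1) * (inverse x * inverse x)"])
      (auto intro!: derivative_eq_intros simp: power2_eq_square)
qed

lemma smooth_at_inverse [smooth_intros]: "smooth_at f x \<Longrightarrow> f x \<noteq> 0 \<Longrightarrow> smooth_at (\<lambda>x. inverse (f x :: real)) x"
  by (erule smooth_at_compose) (auto intro!: smooth_atI[of "-{0}"] Ck_on_inverse)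

lemma smooth_at_divide [smooth_intros]:
  "smooth_at f x \<Longrightarrow> smooth_at g x \<Longrightarrow> g x \<noteq> 0 \<Longrightarrow> smooth_at (\<lambda>x. f x / g x :: real) x"
  unfolding divide_inverse by (intro smooth_intros)

lemma Ck_on_sqrt: "Ck_on k {0::real<..} sqrt"
proof (induction k)
  case 0
  show ?case by (auto intro!: continuous_intros)
next
  case (Suc k)
  have 1: "Ck_on k {0::real<..} (\<lambda>x. inverse (sqrt x))"
    by (rule Ck_on_compose[where V="-{0}"]) (auto intro: Suc Ck_on_inverse)
  have "Ck_on k {0::real<..} (\<lambda>x. (1/2) * inverse (sqrt x))"
    by (intro Ck_on_bilinear[OF bounded_bilinear_mult] Ck_on_const 1) auto
  then show ?case
    by (intro Ck_on_realI[where f'="\<lambda>x. (1/2) * inverse (sqrt x)"])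
      (auto intro!: derivative_eq_intros simp: field_simps)
qed

lemma smooth_at_sqrt [smooth_intros]: "smooth_at f x \<Longrightarrow> f x > 0 \<Longrightarrow> smooth_at (\<lambda>x. sqrt (f x)) x"
  by (erule smooth_at_compose) (auto intro!: smooth_atI[of "{0<..}"] Ck_on_sqrt)

lemma smooth_at_norm [smooth_intros]:
  "smooth_at f x \<Longrightarrow> f x \<noteq> 0 \<Longrightarrow> smooth_at (\<lambda>x. norm (f x)) x"
  unfolding norm_eq_sqrt_inner by (intro smooth_intros) auto

lemma Ck_on_ln: "Ck_on k {0::real<..} ln"
proof (cases k)
  case 0
  then show ?thesis by (auto intro!: continuous_intros)
next
  case (Suc j)
  have "Ck_on j {0::real<..} inverse" by (rule Ck_on_subset[OF _ _ _ Ck_on_inverse]) auto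
  then show ?thesis unfolding Suc
    by (intro Ck_on_realI[where f'=inverse]) (auto intro!: derivative_eq_intros simp: divide_inverse)
qed

lemma smooth_at_ln [smooth_intros]: "smooth_at f x \<Longrightarrow> f x > 0 \<Longrightarrow> smooth_at (\<lambda>x. ln (f x :: real)) x"
  by (erule smooth_at_compose) (auto intro!: smooth_atI[of "{0<..}"] Ck_on_ln)

lemma smooth_at_has_derivative:
  assumes "smooth_at f x" shows "(f has_derivative frechet_derivative f (at x)) (at x)"
proof -
  obtain U where "open U" "x \<in> U" "Ck_on (Suc 0) U f" using assms smooth_atE by metis
  then show ?thesis by (auto simp: differentiable_on_eq_differentiable_at frechet_derivative_works)
qed

text \<open>The direction may vary smoothly with the point; expanding it in the basis reduces the
  claim to partial derivatives.\<close>

lemma smooth_at_frechet_derivative [smooth_intros]: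
  assumes "smooth_at f x" "smooth_at h x"
  shows "smooth_at (\<lambda>x. frechet_derivative f (at x) (h x)) x"
proof -
  obtain U where U: "open U" "x \<in> U" "\<And>k. Ck_on (Suc k) U f" using assms(1) smooth_atE by metis
  have *: "smooth_at (\<lambda>x. frechet_derivative f (at x) i) x" if "i \<in> Basis" for i
    using U that by (intro smooth_atI[of U]) auto
  have "smooth_at (\<lambda>x. \<Sum>i\<in>Basis. (h x \<bullet> i) *\<^sub>R frechet_derivative f (at x) i) x"
    by (intro smooth_intros assms * )
  moreover have "(\<Sum>i\<in>Basis. (h y \<bullet> i) *\<^sub>R frechet_derivative f (at y) i) = frechet_derivative f (at y) (h y)"
    if "y \<in> U" for y
  proof -
    have "smooth_at f y" by (rule smooth_atI[OF U(1) that Ck_on_SucD[OF U(1) U(3)]])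
    then have "linear (frechet_derivative f (at y))" using smooth_at_has_derivative has_derivative_linear by blast
    then show ?thesis by (rule linear_Basis_expansion)
  qed
  ultimately show ?thesis by (rule smooth_at_cong_open[OF _ U(1,2), of "\<lambda>x. \<Sum>i\<in>Basis. (h x \<bullet> i) *\<^sub>R frechet_derivative f (at x) i"])
qed

section \<open>The inverse and implicit function theorems with smooth conclusions\<close>

section \<open>The smooth inverse function theorem\<close>

text \<open>A product rule in which one factor is merely continuous: the term that would need its
  derivative is multiplied by \<open>\<psi> x = 0\<close>.\<close>

lemma has_derivative_mult_vanishing:
  fixes \<phi> :: "'a::euclidean_space \<Rightarrow> real" and \<psi> :: "'a \<Rightarrow> 'b::euclidean_space"
  assumes c: "isCont \<phi> x" and d: "(\<psi> has_derivative \<psi>') (at x)" and z: "\<psi> x = 0"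
  shows "((\<lambda>y. \<phi> y *\<^sub>R \<psi> y) has_derivative (\<lambda>h. \<phi> x *\<^sub>R \<psi>' h)) (at x)"
proof -
  have bl: "bounded_linear \<psi>'" using d has_derivative_bounded_linear by blast
  have lim: "((\<lambda>y. norm (\<psi> y - \<psi> x - \<psi>' (y - x)) / norm (y - x)) \<longlongrightarrow> 0) (at x)"
    using d by (simp add: has_derivative_iff_norm)
  obtain B where B: "\<And>h. norm (\<psi>' h) \<le> norm h * B" "B > 0" using bounded_linear.pos_bounded[OF bl] by blast
  have l\<phi>: "(\<phi> \<longlongrightarrow> \<phi> x) (at x)" using c by (simp add: isCont_def)
  have l1: "((\<lambda>y. \<bar>\<phi> y\<bar> * (norm (\<psi> y - \<psi> x - \<psi>' (y - x)) / norm (y - x)) + \<bar>\<phi> y - \<phi> x\<bar> * B) \<longlongrightarrow> \<bar>\<phi> x\<bar> * 0 + \<bar>\<phi> x - \<phi> x\<bar> * B) (at x)"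
    by (intro tendsto_intros lim l\<phi>)
  have "((\<lambda>y. norm (\<phi> y *\<^sub>R \<psi> y - \<phi> x *\<^sub>R \<psi> x - \<phi> x *\<^sub>R \<psi>' (y - x)) / norm (y - x)) \<longlongrightarrow> 0) (at x)"
  proof (rule Lim_null_comparison)
    show "\<forall>\<^sub>F y in at x. norm (norm (\<phi> y *\<^sub>R \<psi> y - \<phi> x *\<^sub>R \<psi> x - \<phi> x *\<^sub>R \<psi>' (y - x)) / norm (y - x))
        \<le> \<bar>\<phi> y\<bar> * (norm (\<psi> y - \<psi> x - \<psi>' (y - x)) / norm (y - x)) + \<bar>\<phi> y - \<phi> x\<bar> * B"
    proof (rule eventually_at_filter[THEN iffD2], rule always_eventually, intro allI impI)
      fix y assume y: "y \<noteq> x"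
      have "\<phi> y *\<^sub>R \<psi> y - \<phi> x *\<^sub>R \<psi> x - \<phi> x *\<^sub>R \<psi>' (y - x)
          = \<phi> y *\<^sub>R (\<psi> y - \<psi> x - \<psi>' (y - x)) + (\<phi> y - \<phi> x) *\<^sub>R \<psi>' (y - x)"
        using z by (simp add: algebra_simps)
      then have "norm (\<phi> y *\<^sub>R \<psi> y - \<phi> x *\<^sub>R \<psi> x - \<phi> x *\<^sub>R \<psi>' (y - x))
          \<le> \<bar>\<phi> y\<bar> * norm (\<psi> y - \<psi> x - \<psi>' (y - x)) + \<bar>\<phi> y - \<phi> x\<bar> * norm (\<psi>' (y - x))"
        by (metis norm_scaleR norm_triangle_ineq)
      also have "\<dots> \<le> \<bar>\<phi> y\<bar> * norm (\<psi> y - \<psi> x - \<psi>' (y - x)) + \<bar>\<phi> y - \<phi> x\<bar> * (norm (y - x) * B)"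
        using B(1) by (simp add: mult_left_mono)
      finally show "norm (norm (\<phi> y *\<^sub>R \<psi> y - \<phi> x *\<^sub>R \<psi> x - \<phi> x *\<^sub>R \<psi>' (y - x)) / norm (y - x))
        \<le> \<bar>\<phi> y\<bar> * (norm (\<psi> y - \<psi> x - \<psi>' (y - x)) / norm (y - x)) + \<bar>\<phi> y - \<phi> x\<bar> * B"
        using y by (simp add: field_simps)
    qed
  qed (use l1 in simp)
  then show ?thesis
    using bl by (simp add: has_derivative_iff_norm bounded_linear_scaleR_right bounded_linear_const_scaleR)
qed

text \<open>Writing \<open>v y = inv (A y) i\<close>, the identity
  \<open>v y = v y\<^sub>0 - inv (A y\<^sub>0) ((A y - A y\<^sub>0) (v y))\<close> yields continuity first and differentiability next.\<close>

lemma inverse_linear_family: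
  fixes A :: "'x::euclidean_space \<Rightarrow> 'a::euclidean_space \<Rightarrow> 'a"
  assumes V: "open V" "y0 \<in> V" and lin: "\<And>y. y \<in> V \<Longrightarrow> linear (A y)" "\<And>y. y \<in> V \<Longrightarrow> bij (A y)"
  shows inverse_linear_isCont: "(\<And>j. j \<in> Basis \<Longrightarrow> isCont (\<lambda>y. A y j) y0) \<Longrightarrow> isCont (\<lambda>y. inv (A y) i) y0"
    and inverse_linear_has_derivative: "(\<And>j. j \<in> Basis \<Longrightarrow> ((\<lambda>y. A y j) has_derivative A' j) (at y0)) \<Longrightarrow>
      ((\<lambda>y. inv (A y) i) has_derivative
        (\<lambda>h. - (\<Sum>j\<in>Basis. (inv (A y0) i \<bullet> j) *\<^sub>R inv (A y0) (A' j h)))) (at y0)"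
proof -
  define B0 where "B0 = inv (A y0)"
  define v where "v y = inv (A y) i" for y
  have linB: "linear B0" unfolding B0_def using lin V
    by (metis bij_is_inj bij_is_surj linear_injective_left_inverse inv_unique_comp linear_inverse_left)
  have blB: "bounded_linear B0" using linB linear_conv_bounded_linear by blast
  have Av: "A y (v y) = i" if "y \<in> V" for y using lin(2)[OF that] by (simp add: v_def bij_is_surj surj_f_inv_f)
  have BA: "B0 (A y0 w) = w" for w using lin(2)[OF V(2)] by (simp add: B0_def bij_is_inj)
  have eq: "v y = v y0 - (\<Sum>j\<in>Basis. (v y \<bullet> j) *\<^sub>R B0 (A y j - A y0 j))" if y: "y \<in> V" for y
  proof -
    have "(\<Sum>j\<in>Basis. (v y \<bullet> j) *\<^sub>R B0 (A y j - A y0 j)) = B0 (\<Sum>j\<in>Basis. (v y \<bullet> j) *\<^sub>R (A y j - A y0 j))"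
      using linB by (simp add: linear_sum linear_scale)
    also have "(\<Sum>j\<in>Basis. (v y \<bullet> j) *\<^sub>R (A y j - A y0 j)) = A y (v y) - A y0 (v y)"
      using linear_Basis_expansion[OF lin(1)[OF y], of "v y"] linear_Basis_expansion[OF lin(1)[OF V(2)], of "v y"]
      by (simp add: scaleR_right_diff_distrib sum_subtractf)
    also have "B0 \<dots> = v y0 - v y"
      using Av[OF y] Av[OF V(2)] BA linB by (metis linear_diff)
    finally show ?thesis by simp
  qed
  have Vev: "\<forall>\<^sub>F y in at y0. y \<in> V" using V eventually_at_topological by blast
  show cont: "isCont (\<lambda>y. inv (A y) i) y0" if cA: "\<And>j. j \<in> Basis \<Longrightarrow> isCont (\<lambda>y. A y j) y0"
  proof -
    define S where "S y = (\<Sum>j\<in>Basis. norm (B0 (A y j - A y0 j)))" for y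
    have "(S \<longlongrightarrow> (\<Sum>j\<in>Basis. norm (B0 (A y0 j - A y0 j)))) (at y0)" unfolding S_def
      by (intro tendsto_intros bounded_linear.tendsto[OF blB] cA[unfolded isCont_def])
    then have S0: "(S \<longlongrightarrow> 0) (at y0)" using linear_0[OF linB] by simp
    have bd: "norm (v y - v y0) \<le> norm (v y) * S y" if "y \<in> V" for y
    proof -
      have "norm (v y - v y0) = norm (\<Sum>j\<in>Basis. (v y \<bullet> j) *\<^sub>R B0 (A y j - A y0 j))"
        using eq[OF that] by (metis add_diff_cancel_left' diff_add_cancel norm_minus_commute)
      also have "\<dots> \<le> (\<Sum>j\<in>Basis. norm ((v y \<bullet> j) *\<^sub>R B0 (A y j - A y0 j)))" by (rule norm_sum)
      also have "\<dots> \<le> (\<Sum>j\<in>Basis. norm (v y) * norm (B0 (A y j - A y0 j)))"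
        by (intro sum_mono) (auto simp: Basis_le_norm mult_right_mono)
      finally show ?thesis by (simp add: S_def sum_distrib_left)
    qed
    have "\<forall>\<^sub>F y in at y0. S y < 1/2" using S0 order_tendstoD(2)[of S 0 "at y0" "1/2"] by simp
    then have "\<forall>\<^sub>F y in at y0. norm (v y - v y0) \<le> 2 * norm (v y0) * S y"
      using Vev
    proof eventually_elim
      case (elim y)
      have S1: "0 \<le> S y" by (simp add: S_def sum_nonneg)
      have "norm (v y) \<le> norm (v y0) + norm (v y - v y0)" by (metis add.commute norm_triangle_sub)
      also have "\<dots> \<le> norm (v y0) + norm (v y) * (1/2)"
        using bd[OF elim(2)] elim(1) by (smt (verit) mult_left_mono norm_ge_zero)
      finally have "norm (v y) \<le> 2 * norm (v y0)" by simp
      then have "norm (v y) * S y \<le> 2 * norm (v y0) * S y" using S1 mult_right_mono by blast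
      then show ?case using bd[OF elim(2)] by linarith
    qed
    moreover have "((\<lambda>y. 2 * norm (v y0) * S y) \<longlongrightarrow> 0) (at y0)" using tendsto_mult_right_zero[OF S0] by simp
    ultimately have "((\<lambda>y. v y - v y0) \<longlongrightarrow> 0) (at y0)" by (rule Lim_null_comparison)
    then show ?thesis unfolding isCont_def v_def[symmetric] using LIM_zero_cancel by blast
  qed
  show "((\<lambda>y. inv (A y) i) has_derivative
        (\<lambda>h. - (\<Sum>j\<in>Basis. (inv (A y0) i \<bullet> j) *\<^sub>R inv (A y0) (A' j h)))) (at y0)"
    if dA: "\<And>j. j \<in> Basis \<Longrightarrow> ((\<lambda>y. A y j) has_derivative A' j) (at y0)"
  proof -
    have "isCont (\<lambda>y. A y j) y0" if "j \<in> Basis" for j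
      using has_derivative_continuous[OF dA[OF that]] by simp
    then have cv: "isCont v y0" using cont unfolding v_def by blast
    have 1: "((\<lambda>y. B0 (A y j - A y0 j)) has_derivative (\<lambda>h. B0 (A' j h))) (at y0)" if "j \<in> Basis" for j
      using bounded_linear.has_derivative[OF blB has_derivative_diff[OF dA[OF that] has_derivative_const]] by simp
    \<comment> \<open>Only continuity of \<open>v\<close> is known at this stage; the other factor
      vanishes at \<open>y0\<close>.\<close>
    have 2: "((\<lambda>y. (v y \<bullet> j) *\<^sub>R B0 (A y j - A y0 j)) has_derivative (\<lambda>h. (v y0 \<bullet> j) *\<^sub>R B0 (A' j h))) (at y0)"
      if "j \<in> Basis" for j
      by (rule has_derivative_mult_vanishing[OF _ 1[OF that]])
        (use cv linear_0[OF linB] in \<open>auto intro: continuous_intros\<close>)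
    have "((\<lambda>y. v y0 - (\<Sum>j\<in>Basis. (v y \<bullet> j) *\<^sub>R B0 (A y j - A y0 j))) has_derivative
        (\<lambda>h. 0 - (\<Sum>j\<in>Basis. (v y0 \<bullet> j) *\<^sub>R B0 (A' j h)))) (at y0)"
      by (intro has_derivative_diff has_derivative_const has_derivative_sum 2)
    then have "(v has_derivative (\<lambda>h. 0 - (\<Sum>j\<in>Basis. (v y0 \<bullet> j) *\<^sub>R B0 (A' j h)))) (at y0)"
      by (rule has_derivative_transform_within_open[OF _ V]) (use eq in auto)
    then show ?thesis by (simp add: v_def[abs_def] B0_def)
  qed
qed

text \<open>The derivative of the inverse, - B A' B with B the inverse, consists of entries of B and
  of the derivative of \<open>A\<close>. So differentiability of B bootstraps from one order to the
  next.\<close>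

lemma Ck_on_inverse_linear:
  fixes A :: "'x::euclidean_space \<Rightarrow> 'a::euclidean_space \<Rightarrow> 'a"
  assumes V: "open V" and lin: "\<And>y. y \<in> V \<Longrightarrow> linear (A y)" "\<And>y. y \<in> V \<Longrightarrow> bij (A y)"
    and A: "\<And>j. j \<in> Basis \<Longrightarrow> Ck_on k V (\<lambda>y. A y j)"
  shows "Ck_on k V (\<lambda>y. inv (A y) i)"
  using A
proof (induction k arbitrary: i)
  case 0
  have "isCont (\<lambda>y. inv (A y) i) y" if "y \<in> V" for y
    using inverse_linear_isCont[OF V that lin] 0 V that by (simp add: continuous_on_eq_continuous_at)
  then show ?case by (simp add: continuous_at_imp_continuous_on)
next
  case (Suc k)
  have "\<forall>j\<in>Basis. \<exists>A'. (\<forall>y\<in>V. ((\<lambda>y. A y j) has_derivative A' y) (at y)) \<and> (\<forall>b\<in>Basis. Ck_on k V (\<lambda>y. A' y b))"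
  proof
    fix j :: 'a assume j: "j \<in> Basis"
    show "\<exists>A'. (\<forall>y\<in>V. ((\<lambda>y. A y j) has_derivative A' y) (at y)) \<and> (\<forall>b\<in>Basis. Ck_on k V (\<lambda>y. A' y b))"
      by (rule Ck_on_SucE[OF V Suc.prems[OF j]]) blast
  qed
  from bchoice[OF this] obtain A' where A': "\<And>j y. j \<in> Basis \<Longrightarrow> y \<in> V \<Longrightarrow> ((\<lambda>y. A y j) has_derivative A' j y) (at y)"
    "\<And>j b. j \<in> Basis \<Longrightarrow> b \<in> Basis \<Longrightarrow> Ck_on k V (\<lambda>y. A' j y b)"
    by blast
  have v: "Ck_on k V (\<lambda>y. inv (A y) l)" for l
    by (rule Suc.IH) (rule Ck_on_SucD[OF V Suc.prems])
  have linI: "linear (inv (A y))" if "y \<in> V" for y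
    using lin[OF that] by (metis bij_is_inj bij_is_surj linear_injective_left_inverse inv_unique_comp linear_inverse_left)
  have "Ck_on k V (\<lambda>y. - (\<Sum>j\<in>Basis. (inv (A y) i \<bullet> j) *\<^sub>R inv (A y) (A' j y b)))" if b: "b \<in> Basis" for b
  proof (rule Ck_on_cong[OF V])
    show "Ck_on k V (\<lambda>y. (-1) *\<^sub>R (\<Sum>j\<in>Basis. (inv (A y) i \<bullet> j) *\<^sub>R (\<Sum>l\<in>Basis. (A' j y b \<bullet> l) *\<^sub>R inv (A y) l)))"
      by (intro Ck_on_sum V finite_Basis Ck_on_bilinear[OF bounded_bilinear_scaleR]
          Ck_on_bilinear[OF bounded_bilinear_inner] v A'(2) b Ck_on_const)
    show "(-1) *\<^sub>R (\<Sum>j\<in>Basis. (inv (A y) i \<bullet> j) *\<^sub>R (\<Sum>l\<in>Basis. (A' j y b \<bullet> l) *\<^sub>R inv (A y) l))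
        = - (\<Sum>j\<in>Basis. (inv (A y) i \<bullet> j) *\<^sub>R inv (A y) (A' j y b))" if "y \<in> V" for y
      by (simp add: linear_Basis_expansion[OF linI[OF that]])
  qed
  then show ?case
    using inverse_linear_has_derivative[OF V _ lin A'(1)]
    by (rule_tac Ck_on_SucI[OF V, where f'="\<lambda>y h. - (\<Sum>j\<in>Basis. (inv (A y) i \<bullet> j) *\<^sub>R inv (A y) (A' j y h))"]) auto
qed

text \<open>The library theorem gives an inverse \<open>g\<close> whose derivative is the inverse
  matrix of \<open>D (g y)\<close>. If \<open>g\<close> is of class k, so is this derivative by
  \<open>Ck_on_inverse_linear\<close>, hence \<open>g\<close> is of class k + 1.\<close>

theorem smooth_inverse_function:
  fixes f :: "'a::euclidean_space \<Rightarrow> 'a"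
  assumes f: "smooth_at f x0" and inj: "\<And>h. frechet_derivative f (at x0) h = 0 \<Longrightarrow> h = 0"
  obtains U V g where "open U" "x0 \<in> U" "open V" "f x0 \<in> V" "homeomorphism U V f g"
    "\<And>y. y \<in> V \<Longrightarrow> smooth_at g y" "\<And>x. x \<in> U \<Longrightarrow> smooth_at f x"
proof -
  obtain W where W: "open W" "x0 \<in> W" "\<And>k. Ck_on k W f" using smooth_atE[OF f] by blast
  have sf: "smooth_at f x" if "x \<in> W" for x by (rule smooth_atI[OF W(1) that W(3)])
  define D where "D x = frechet_derivative f (at x)" for x
  have D: "(f has_derivative D x) (at x)" if "x \<in> W" for x
    using smooth_at_has_derivative[OF sf[OF that]] by (simp add: D_def)
  have DC: "Ck_on k W (\<lambda>x. D x i)" if "i \<in> Basis" for k i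
    using W(3)[of "Suc k"] that by (simp add: D_def)
  define f' where "f' x = Blinfun (D x)" for x
  have f': "blinfun_apply (f' x) = D x" if "x \<in> W" for x
    using has_derivative_bounded_linear[OF D[OF that]] by (simp add: f'_def bounded_linear_Blinfun_apply)
  have cf': "continuous_on W f'"
  proof (rule continuous_on_blinfun_componentwise)
    fix i :: 'a assume i: "i \<in> Basis"
    show "continuous_on W (\<lambda>x. blinfun_apply (f' x) i)"
      using Ck_on_continuous[OF W(1) DC[OF i]] f' continuous_on_cong by (metis (no_types, lifting))
  qed
  obtain L where L: "linear L" "L \<circ> D x0 = id"
    using linear_injective_left_inverse[OF has_derivative_linear[OF D[OF W(2)]]] inj
    by (metis D_def has_derivative_linear[OF D[OF W(2)]] linear_injective_0)
  have inv: "Blinfun L o\<^sub>L f' x0 = id_blinfun"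
    using L f'[OF W(2)] by (intro blinfun_eqI)
      (simp add: bounded_linear_Blinfun_apply linear_conv_bounded_linear[symmetric] fun_eq_iff)
  obtain U V g g' where *: "open U" "U \<subseteq> W" "x0 \<in> U" "open V" "f x0 \<in> V" "homeomorphism U V f g"
    "\<And>y. y \<in> V \<Longrightarrow> (g has_derivative (g' y)) (at y)"
    "\<And>y. y \<in> V \<Longrightarrow> g' y = inv (blinfun_apply (f'(g y)))"
    "\<And>y. y \<in> V \<Longrightarrow> bij (blinfun_apply (f'(g y)))"
    using inverse_function_theorem[OF W(1) _ cf' W(2) inv] D f' by metis
  have gW: "g y \<in> W" if "y \<in> V" for y using *(2,6) that by (auto simp: homeomorphism_def)
  have Ckg: "Ck_on k V g" for k
  proof (induction k)
    case 0
    then show ?case using *(6) by (simp add: homeomorphism_def)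
  next
    case (Suc k)
    have "Ck_on k V (\<lambda>y. inv (D (g y)) i)" for i
    proof (rule Ck_on_inverse_linear[OF *(4)])
      show "linear (D (g y))" if "y \<in> V" for y using D gW has_derivative_linear that by blast
      show "bij (D (g y))" if "y \<in> V" for y using *(9)[OF that] f'[OF gW[OF that]] by simp
      show "Ck_on k V (\<lambda>y. D (g y) j)" if "j \<in> Basis" for j
        by (rule Ck_on_compose[OF *(4) W(1) _ Suc DC[OF that]]) (use gW in auto)
    qed
    moreover have "(g has_derivative inv (D (g y))) (at y)" if "y \<in> V" for y
      using *(7,8)[OF that] f'[OF gW[OF that]] by simp
    ultimately show ?case by (rule_tac Ck_on_SucI[OF *(4)])
  qed
  show ?thesis
    by (rule that[OF *(1,3,4,5,6)]) (use *(2,4) Ckg sf in \<open>auto intro: smooth_atI\<close>)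
qed

text \<open>The inverse function theorem is applied to (x, t) |-> (x, F (x, t)); the solution
  \<open>S\<close> is the second component of the local inverse at constant height
  \<open>F (x0, t0)\<close>.\<close>

lemma smooth_implicit_function:
  fixes F :: "'a::euclidean_space \<times> real \<Rightarrow> real"
  assumes F: "smooth_at F (x0, t0)" and nz: "frechet_derivative F (at (x0, t0)) (0, 1) \<noteq> 0"
  obtains U S where "open U" "x0 \<in> U" "S x0 = t0" "\<And>x. x \<in> U \<Longrightarrow> F (x, S x) = F (x0, t0)"
    "\<And>x. x \<in> U \<Longrightarrow> smooth_at S x"
proof -
  define \<Gamma> where "\<Gamma> = (\<lambda>p. (fst p, F p))"
  define D where "D = frechet_derivative F (at (x0, t0))"
  have D: "(F has_derivative D) (at (x0, t0))" unfolding D_def by (rule smooth_at_has_derivative[OF F])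
  have s: "smooth_at \<Gamma> (x0, t0)" unfolding \<Gamma>_def by (intro smooth_intros F)
  have d: "frechet_derivative \<Gamma> (at (x0, t0)) = (\<lambda>p. (fst p, D p))"
    unfolding \<Gamma>_def by (rule frechet_derivative_at[symmetric]) (intro derivative_intros D)
  have inj: "h = 0" if h: "frechet_derivative \<Gamma> (at (x0, t0)) h = 0" for h
  proof -
    from h have 1: "fst h = 0" "D h = 0" by (auto simp: d zero_prod_def)
    then have "h = snd h *\<^sub>R (0, 1)" by (cases h) auto
    then have "D h = snd h *\<^sub>R D (0, 1)" using D has_derivative_linear linear_scale by metis
    then have "snd h = 0" using 1 nz by (simp add: D_def)
    then show ?thesis using 1 by (cases h) (auto simp: zero_prod_def)
  qed
  obtain U V g where *: "open U" "(x0, t0) \<in> U" "open V" "\<Gamma> (x0, t0) \<in> V" "homeomorphism U V \<Gamma> g"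
    "\<And>y. y \<in> V \<Longrightarrow> smooth_at g y"
    using smooth_inverse_function[OF s inj] by metis
  define c where "c = F (x0, t0)"
  have g\<Gamma>: "\<And>p. p \<in> U \<Longrightarrow> g (\<Gamma> p) = p" "\<And>p. p \<in> V \<Longrightarrow> \<Gamma> (g p) = p" using *(5) by (auto simp: homeomorphism_def)
  have "open {x. (x, c) \<in> V}"
  proof -
    have "{x. (x, c) \<in> V} = (\<lambda>x. (x, c)) -` V" by auto
    moreover have "open ((\<lambda>x. (x, c)) -` V)" by (intro open_vimage *(3) continuous_intros)
    ultimately show ?thesis by simp
  qed
  moreover have "x0 \<in> {x. (x, c) \<in> V}" using *(4) by (simp add: \<Gamma>_def c_def)
  moreover have "snd (g (x0, c)) = t0" using g\<Gamma>(1)[OF *(2)] by (simp add: \<Gamma>_def c_def)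
  moreover have "F (x, snd (g (x, c))) = F (x0, t0)" if "x \<in> {x. (x, c) \<in> V}" for x
  proof -
    have "\<Gamma> (g (x, c)) = (x, c)" using g\<Gamma>(2) that by simp
    then have "fst (g (x, c)) = x" "F (g (x, c)) = c" by (auto simp: \<Gamma>_def)
    then show ?thesis by (metis c_def prod.collapse)
  qed
  moreover have "smooth_at (\<lambda>x. snd (g (x, c))) x" if "x \<in> {x. (x, c) \<in> V}" for x
    by (intro smooth_intros smooth_at_compose[of "\<lambda>x. (x, c)" x g]) (use *(6) that in auto)
  ultimately show ?thesis by (rule that)
qed

section \<open>Diffeomorphisms between subsets: composition, restriction, recognition,
  gluing\<close>

section \<open>Diffeomorphisms between subsets\<close>

lemma smooth_on_open_iff: "smooth_on_open U f \<longleftrightarrow> open U \<and> (\<forall>x\<in>U. smooth_at f x)"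
proof
  assume R: "open U \<and> (\<forall>x\<in>U. smooth_at f x)"
  have "Ck_on k U f" for k
    using R
  proof (induction k arbitrary: f)
    case 0
    then show ?case using smooth_at_isCont by (auto intro: continuous_at_imp_continuous_on)
  next
    case (Suc k)
    have "smooth_at (\<lambda>x. frechet_derivative f (at x) i) x" if "x \<in> U" for i x
      using smooth_at_frechet_derivative[OF _ smooth_at_const] Suc.prems that by blast
    then have "Ck_on k U (\<lambda>x. frechet_derivative f (at x) i)" for i
      using Suc by blast
    moreover have "(f has_derivative frechet_derivative f (at x)) (at x)" if "x \<in> U" for x
      using Suc.prems that smooth_at_has_derivative by blast
    ultimately show ?case using Suc.prems by (intro Ck_on_SucI) auto
  qed
  then show "smooth_on_open U f" using R by (simp add: smooth_on_open_def)
qed (auto simp: smooth_on_open_def smooth_at_def)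

lemma smooth_map_onI:
  assumes "\<And>x. x \<in> S \<Longrightarrow> \<exists>g U. open U \<and> x \<in> U \<and> smooth_at g x \<and> (\<forall>y\<in>S \<inter> U. g y = f y)"
  shows "smooth_map_on S f"
  unfolding smooth_map_on_def
proof
  fix x assume "x \<in> S"
  then obtain g U where *: "open U" "x \<in> U" "smooth_at g x" "\<forall>y\<in>S \<inter> U. g y = f y" using assms by blast
  obtain V where V: "open V" "x \<in> V" "\<forall>y\<in>V. smooth_at g y" using smooth_at_eventually[OF *(3)] by blast
  show "\<exists>U g. open U \<and> x \<in> U \<and> smooth_on_open U g \<and> (\<forall>y\<in>S \<inter> U. g y = f y)"
    by (rule exI[of _ "U \<inter> V"], rule exI[of _ g]) (use * V in \<open>auto simp: smooth_on_open_iff\<close>)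
qed

lemma smooth_map_onD:
  assumes "smooth_map_on S f" "x \<in> S"
  shows "\<exists>g U. open U \<and> x \<in> U \<and> smooth_at g x \<and> (\<forall>y\<in>S \<inter> U. g y = f y)"
proof -
  from assms obtain U g where "open U \<and> x \<in> U \<and> smooth_on_open U g \<and> (\<forall>y\<in>S \<inter> U. g y = f y)"
    unfolding smooth_map_on_def by meson
  then show ?thesis by (intro exI[of _ g] exI[of _ U]) (auto simp: smooth_on_open_iff)
qed

lemma smooth_map_on_smooth_at: "(\<And>x. x \<in> S \<Longrightarrow> smooth_at f x) \<Longrightarrow> smooth_map_on S f"
  by (rule smooth_map_onI) (use open_UNIV in blast)

lemma smooth_map_on_subset_cong:
  assumes f: "smooth_map_on S f" and T: "T \<subseteq> S" and eq: "\<And>x. x \<in> T \<Longrightarrow> f x = g x"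
  shows "smooth_map_on T g"
proof (rule smooth_map_onI)
  fix x assume "x \<in> T"
  then have "x \<in> S" using T by blast
  from smooth_map_onD[OF f this] obtain g' U
    where "open U" "x \<in> U" "smooth_at g' x" "\<forall>y\<in>S \<inter> U. g' y = f y" by blast
  then show "\<exists>g' U. open U \<and> x \<in> U \<and> smooth_at g' x \<and> (\<forall>y\<in>T \<inter> U. g' y = g y)"
    using T eq by (intro exI[of _ g'] exI[of _ U]) auto
qed

lemmas smooth_map_on_subset = smooth_map_on_subset_cong[OF _ _ refl]
lemmas smooth_map_on_cong = smooth_map_on_subset_cong[OF _ subset_refl]

lemma smooth_at_continuous_on: "(\<And>x. x \<in> S \<Longrightarrow> smooth_at f x) \<Longrightarrow> continuous_on S f"
  by (rule continuous_at_imp_continuous_on) (blast intro: smooth_at_isCont)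

lemma smooth_map_on_local:
  assumes "\<And>x. x \<in> S \<Longrightarrow> \<exists>U. open U \<and> x \<in> U \<and> smooth_map_on (S \<inter> U) f"
  shows "smooth_map_on S f"
proof (rule smooth_map_onI)
  fix x assume x: "x \<in> S"
  then obtain U where U: "open U" "x \<in> U" "smooth_map_on (S \<inter> U) f" using assms by blast
  then obtain g V where "open V" "x \<in> V" "smooth_at g x" "\<forall>y\<in>S \<inter> U \<inter> V. g y = f y"
    using smooth_map_onD[OF U(3), of x] x by blast
  then show "\<exists>g U. open U \<and> x \<in> U \<and> smooth_at g x \<and> (\<forall>y\<in>S \<inter> U. g y = f y)"
    using U by (intro exI[of _ g] exI[of _ "U \<inter> V"]) auto
qed

lemma smooth_map_on_continuous: "smooth_map_on S f \<Longrightarrow> continuous_on S f"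
proof (rule continuous_on_eq_continuous_within[THEN iffD2], rule ballI)
  fix x assume f: "smooth_map_on S f" and x: "x \<in> S"
  obtain g U where *: "open U" "x \<in> U" "smooth_at g x" "\<forall>y\<in>S \<inter> U. g y = f y"
    using smooth_map_onD[OF f x] by blast
  have "continuous (at x within S) g" using smooth_at_isCont[OF *(3)] continuous_at_imp_continuous_within by blast
  moreover obtain d where "d > 0" "ball x d \<subseteq> U" using * openE by blast
  ultimately show "continuous (at x within S) f"
    using * x by (intro continuous_transform_within[of x S g d f]) (auto simp: dist_commute mem_ball subset_iff)
qed

lemma smooth_map_on_compose:
  assumes f: "smooth_map_on S f" and "f ` S \<subseteq> T" and g: "smooth_map_on T g"
  shows "smooth_map_on S (\<lambda>x. g (f x))"
proof (rule smooth_map_onI)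
  fix x assume x: "x \<in> S"
  obtain f' U where 1: "open U" "x \<in> U" "smooth_at f' x" "\<forall>y\<in>S \<inter> U. f' y = f y"
    using smooth_map_onD[OF f x] by blast
  have fx: "f x \<in> T" using assms(2) x by blast
  obtain g' V where 2: "open V" "f x \<in> V" "smooth_at g' (f x)" "\<forall>y\<in>T \<inter> V. g' y = g y"
    using smooth_map_onD[OF g fx] by blast
  have eq: "f' x = f x" using 1 x by blast
  obtain W where W: "open W" "x \<in> W" "\<forall>y\<in>W. smooth_at f' y" using smooth_at_eventually[OF 1(3)] by blast
  have "continuous_on W f'" using W by (intro smooth_at_continuous_on) auto
  then have o: "open (W \<inter> f' -` V)" using W 2(1) continuous_open_preimage by blast
  show "\<exists>h U. open U \<and> x \<in> U \<and> smooth_at h x \<and> (\<forall>y\<in>S \<inter> U. h y = g (f y))"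
  proof (intro exI conjI)
    show "open (U \<inter> (W \<inter> f' -` V))" using 1 o by blast
    show "x \<in> U \<inter> (W \<inter> f' -` V)" using 1 2 W eq by auto
    show "smooth_at (\<lambda>x. g' (f' x)) x" using smooth_at_compose[OF 1(3)] 2(3) eq by simp
    show "\<forall>y\<in>S \<inter> (U \<inter> (W \<inter> f' -` V)). g' (f' y) = g (f y)"
      using 1(4) 2(4) assms(2) by auto
  qed
qed

text \<open>\<open>diffeomorphic_sets\<close> with both maps named, so that they can be composed,
  restricted and glued.\<close>

definition diffeo where
  "diffeo S T h k \<longleftrightarrow> h ` S = T \<and> k ` T = S \<and> (\<forall>x\<in>S. k (h x) = x) \<and> (\<forall>y\<in>T. h (k y) = y) \<and>
     smooth_map_on S h \<and> smooth_map_on T k"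

lemma diffeomorphic_sets_iff: "diffeomorphic_sets S T \<longleftrightarrow> (\<exists>h k. diffeo S T h k)"
  by (simp add: diffeomorphic_sets_def diffeo_def)

lemma diffeoI:
  assumes "\<And>x. x \<in> S \<Longrightarrow> h x \<in> T" "\<And>y. y \<in> T \<Longrightarrow> k y \<in> S" "\<And>x. x \<in> S \<Longrightarrow> k (h x) = x"
    "\<And>y. y \<in> T \<Longrightarrow> h (k y) = y" "smooth_map_on S h" "smooth_map_on T k"
  shows "diffeo S T h k"
proof -
  have "h ` S = T" "k ` T = S" using assms(1-4) by (auto, metis imageI, metis imageI)
  then show ?thesis using assms by (auto simp: diffeo_def)
qed

lemma diffeoD:
  assumes "diffeo S T h k"
  shows "\<And>x. x \<in> S \<Longrightarrow> h x \<in> T" "\<And>y. y \<in> T \<Longrightarrow> k y \<in> S" "\<And>x. x \<in> S \<Longrightarrow> k (h x) = x"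
    "\<And>y. y \<in> T \<Longrightarrow> h (k y) = y" "smooth_map_on S h" "smooth_map_on T k"
  using assms unfolding diffeo_def by blast+

lemma diffeo_sym: "diffeo S T h k \<Longrightarrow> diffeo T S k h"
  by (auto simp: diffeo_def)

lemma diffeo_id: "diffeo S S (\<lambda>x. x) (\<lambda>x. x)"
  by (auto intro!: diffeoI smooth_map_on_smooth_at)

lemma diffeo_trans:
  assumes "diffeo S T h k" "diffeo T U h' k'"
  shows "diffeo S U (\<lambda>x. h' (h x)) (\<lambda>x. k (k' x))"
proof (rule diffeoI)
  show "smooth_map_on S (\<lambda>x. h' (h x))" "smooth_map_on U (\<lambda>x. k (k' x))"
    using smooth_map_on_compose[of S h T h'] smooth_map_on_compose[of U k' T k] diffeoD[OF assms(1)] diffeoD[OF assms(2)] by blast+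
qed (use diffeoD[OF assms(1)] diffeoD[OF assms(2)] in auto)

lemma diffeo_subset:
  assumes "diffeo S T h k" "S' \<subseteq> S" "T' \<subseteq> T" "\<And>x. x \<in> S' \<Longrightarrow> h x \<in> T'" "\<And>y. y \<in> T' \<Longrightarrow> k y \<in> S'"
  shows "diffeo S' T' h k"
proof (rule diffeoI)
  show "smooth_map_on S' h" using diffeoD(5)[OF assms(1)] assms(2) by (rule smooth_map_on_subset)
  show "smooth_map_on T' k" using diffeoD(6)[OF assms(1)] assms(3) by (rule smooth_map_on_subset)
qed (use diffeoD[OF assms(1)] assms(2-5) in auto)

lemma diffeo_image:
  assumes "diffeo S T h k" "S' \<subseteq> S"
  shows "diffeo S' (h ` S') h k"
  using diffeoD[OF assms(1)] assms by (intro diffeo_subset[OF assms(1)]) (auto simp: subset_iff)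

lemma diffeo_homeomorphism: "diffeo S T h k \<Longrightarrow> homeomorphism S T h k"
  unfolding diffeo_def homeomorphism_def by (auto dest: smooth_map_on_continuous)

lemma diffeomorphic_sets_refl: "diffeomorphic_sets S S"
  using diffeo_id diffeomorphic_sets_iff by blast

lemma diffeomorphic_sets_sym: "diffeomorphic_sets S T \<Longrightarrow> diffeomorphic_sets T S"
  unfolding diffeomorphic_sets_iff by (blast dest: diffeo_sym)

lemma diffeomorphic_sets_trans: "diffeomorphic_sets S T \<Longrightarrow> diffeomorphic_sets T U \<Longrightarrow> diffeomorphic_sets S U"
  unfolding diffeomorphic_sets_iff by (blast dest: diffeo_trans)

lemma diffeomorphic_sets_compact: "diffeomorphic_sets S T \<Longrightarrow> compact S \<Longrightarrow> compact T"
  using diffeo_homeomorphism diffeomorphic_sets_iff homeomorphic_compactness homeomorphic_def by metis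

lemma diffeomorphic_sets_connected: "diffeomorphic_sets S T \<Longrightarrow> connected S \<Longrightarrow> connected T"
  using diffeo_homeomorphism diffeomorphic_sets_iff homeomorphic_connectedness homeomorphic_def by metis

lemma diffeo_linear:
  fixes L :: "'a::euclidean_space \<Rightarrow> 'b::euclidean_space"
  assumes "linear L" "linear L'" "\<And>x. L' (L x) = x" "\<And>x. L (L' x) = x"
  shows "diffeo UNIV UNIV (\<lambda>x. s + L x) (\<lambda>x. L' (x - s))"
proof (rule diffeoI)
  show "smooth_map_on UNIV (\<lambda>x. s + L x)"
    by (intro smooth_map_on_smooth_at smooth_intros smooth_at_linear assms)
  show "smooth_map_on UNIV (\<lambda>x. L' (x - s))"
    by (intro smooth_map_on_smooth_at smooth_at_compose[of "\<lambda>x. x - s" _ L'] smooth_intros smooth_at_linear assms)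
qed (use assms in auto)

text \<open>The components of diffeomorphic sets correspond to each other.\<close>

lemma diffeo_components:
  assumes "diffeo S T h k" "C \<in> components S" shows "h ` C \<in> components T"
proof -
  have hom: "homeomorphism S T h k" using assms diffeo_homeomorphism by blast
  obtain x where x: "x \<in> S" "C = connected_component_set S x" using assms(2) components_iff by metis
  have CS: "C \<subseteq> S" using x(2) connected_component_subset by metis
  have "h ` C = connected_component_set T (h x)"
  proof
    show "h ` C \<subseteq> connected_component_set T (h x)"
    proof (rule connected_component_maximal)
      show "h x \<in> h ` C" using x by simp
      show "connected (h ` C)" using x CS hom
        by (metis connected_connected_component connected_continuous_image continuous_on_subset homeomorphism_cont1)
      show "h ` C \<subseteq> T" using CS hom homeomorphism_image1 by blast
    qed
    have sub: "k ` connected_component_set T (h x) \<subseteq> connected_component_set S x"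
    proof (rule connected_component_maximal)
      show "x \<in> k ` connected_component_set T (h x)"
        using x hom by (metis connected_component_refl homeomorphism_def image_eqI imageI mem_Collect_eq)
      show "connected (k ` connected_component_set T (h x))"
        using hom by (metis connected_connected_component connected_continuous_image connected_component_subset continuous_on_subset homeomorphism_cont2)
      show "k ` connected_component_set T (h x) \<subseteq> S"
        using hom by (metis connected_component_subset homeomorphism_image2 image_mono)
    qed
    show "connected_component_set T (h x) \<subseteq> h ` C"
    proof
      fix y assume y: "y \<in> connected_component_set T (h x)"
      then have "y \<in> T" using connected_component_in by fastforce
      then have "h (k y) = y" using hom by (simp add: homeomorphism_def)
      moreover have "k y \<in> C" using sub y x(2) by blast
      ultimately show "y \<in> h ` C" by (metis imageI)
    qed
  qed
  then show ?thesis using x hom by (metis components_iff homeomorphism_image1 imageI)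
qed

text \<open>Smoothness of \<open>k\<close> at a point of \<open>T\<close> means a smooth extension
  to an ambient neighbourhood. The local inverse of \<open>h\<close> in the ambient space is such an
  extension.\<close>

lemma diffeo_homeomorphismI:
  fixes h :: "'a::euclidean_space \<Rightarrow> 'a"
  assumes hom: "homeomorphism S T h k" and s: "\<And>x. x \<in> S \<Longrightarrow> smooth_at h x"
    and inj: "\<And>x v. x \<in> S \<Longrightarrow> frechet_derivative h (at x) v = 0 \<Longrightarrow> v = 0"
  shows "diffeo S T h k"
proof (rule diffeoI)
  show "smooth_map_on T k"
  proof (rule smooth_map_onI)
    fix y assume y: "y \<in> T"
    define x where "x = k y"
    have x: "x \<in> S" "h x = y" using hom y by (auto simp: x_def homeomorphism_def)
    obtain U V g where *: "open U" "x \<in> U" "open V" "h x \<in> V" "homeomorphism U V h g"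
      "\<And>y. y \<in> V \<Longrightarrow> smooth_at g y"
      using smooth_inverse_function[OF s[OF x(1)]] inj[OF x(1)] by metis
    have "continuous_on T k" using hom by (simp add: homeomorphism_def)
    \<comment> \<open>Continuity of \<open>k\<close> keeps \<open>k z\<close> in \<open>U\<close>,
      where \<open>h\<close> is injective, so that \<open>g\<close> and \<open>k\<close> agree near
      \<open>y\<close>.\<close>
    then obtain O' where O': "open O'" "O' \<inter> T = k -` U \<inter> T" using *(1) continuous_on_open_invariant by metis
    have "y \<in> O'" using O' y *(2) x_def by blast
    then show "\<exists>g U. open U \<and> y \<in> U \<and> smooth_at g y \<and> (\<forall>z\<in>T \<inter> U. g z = k z)"
    proof (intro exI[of _ g] exI[of _ "O' \<inter> V"] conjI ballI)
      fix z assume z: "z \<in> T \<inter> (O' \<inter> V)"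
      then have "k z \<in> U" "h (k z) = z" using O' hom by (auto simp: homeomorphism_def)
      then show "g z = k z" using *(5) by (metis homeomorphism_apply1)
    qed (use * x O' in auto)
  qed
qed (use hom s smooth_map_on_smooth_at in \<open>auto simp: homeomorphism_def\<close>)

lemma diffeo_compactI:
  fixes h :: "'a::euclidean_space \<Rightarrow> 'a"
  assumes "compact S" "inj_on h S" "\<And>x. x \<in> S \<Longrightarrow> smooth_at h x"
    "\<And>x v. x \<in> S \<Longrightarrow> frechet_derivative h (at x) v = 0 \<Longrightarrow> v = 0"
  shows "\<exists>k. diffeo S (h ` S) h k"
proof -
  have "continuous_on S h" using assms(3) by (rule smooth_at_continuous_on)
  then obtain k where "homeomorphism S (h ` S) h k" using homeomorphism_compact[OF assms(1) _ refl assms(2)] by blast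
  then show ?thesis using diffeo_homeomorphismI assms(3,4) by blast
qed

lemma diffeo_openI:
  fixes h :: "'a::euclidean_space \<Rightarrow> 'a"
  assumes S: "open S" and inj: "inj_on h S" and s: "\<And>x. x \<in> S \<Longrightarrow> smooth_at h x"
    and d: "\<And>x v. x \<in> S \<Longrightarrow> frechet_derivative h (at x) v = 0 \<Longrightarrow> v = 0"
  shows "diffeo S (h ` S) h (inv_into S h)" "open (h ` S)"
proof -
  have *: "\<exists>V g. open V \<and> h x \<in> V \<and> V \<subseteq> h ` S \<and> smooth_at g (h x) \<and> (\<forall>y\<in>V. g y = inv_into S h y)"
    if x: "x \<in> S" for x
  proof -
    obtain U V g where *: "open U" "x \<in> U" "open V" "h x \<in> V" "homeomorphism U V h g"
      "\<And>y. y \<in> V \<Longrightarrow> smooth_at g y"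
      using smooth_inverse_function[OF s[OF x]] d[OF x] by metis
    have o: "open (V \<inter> g -` S)"
      using *(3,5) S continuous_open_preimage by (metis homeomorphism_def)
    have "g (h x) = x" using * by (metis homeomorphism_apply1)
    then have "h x \<in> V \<inter> g -` S" using * x by simp
    moreover have "g y = inv_into S h y \<and> y \<in> h ` S" if "y \<in> V \<inter> g -` S" for y
    proof -
      have "h (g y) = y" "g y \<in> S" using that *(5) by (auto simp: homeomorphism_def)
      then show ?thesis using inj by (metis imageI inv_into_f_f)
    qed
    ultimately show ?thesis using o *(4,6) by (intro exI[of _ "V \<inter> g -` S"] exI[of _ g]) auto
  qed
  show "open (h ` S)"
  proof (subst open_subopen, rule ballI)
    fix y assume "y \<in> h ` S"
    then obtain x where "x \<in> S" "y = h x" by blast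
    with *[of x] show "\<exists>T. open T \<and> y \<in> T \<and> T \<subseteq> h ` S" by metis
  qed
  show "diffeo S (h ` S) h (inv_into S h)"
  proof (rule diffeoI)
    show "smooth_map_on (h ` S) (inv_into S h)"
    proof (rule smooth_map_onI)
      fix y assume "y \<in> h ` S"
      then obtain x where x: "x \<in> S" "y = h x" by blast
      from *[OF x(1)] obtain V g where "open V" "h x \<in> V" "smooth_at g (h x)" "\<forall>y\<in>V. g y = inv_into S h y" by blast
      then show "\<exists>g U. open U \<and> y \<in> U \<and> smooth_at g y \<and> (\<forall>z\<in>h ` S \<inter> U. g z = inv_into S h z)"
        using x(2) by (intro exI[of _ g] exI[of _ V]) auto
    qed
  qed (use inj s smooth_map_on_smooth_at in \<open>auto simp: inv_into_into f_inv_into_f\<close>)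
qed

text \<open>Condition \<open>e\<close> does two things at once: on overlaps it makes the local maps
  agree, and across pieces it makes the glued map injective.\<close>

lemma diffeomorphic_sets_glue:
  fixes S :: "'a::euclidean_space set" and T :: "'b::euclidean_space set"
  assumes d: "\<And>i. i \<in> I \<Longrightarrow> diffeo (V i) (W i) (h i) (k i)"
    and o: "\<And>i. i \<in> I \<Longrightarrow> openin (top_of_set S) (V i)" "\<And>i. i \<in> I \<Longrightarrow> openin (top_of_set T) (W i)"
    and c: "S \<subseteq> (\<Union>i\<in>I. V i)" "T \<subseteq> (\<Union>i\<in>I. W i)"
    and e: "\<And>i j x y. i \<in> I \<Longrightarrow> j \<in> I \<Longrightarrow> x \<in> V i \<Longrightarrow> y \<in> V j \<Longrightarrow> h i x = h j y \<longleftrightarrow> x = y"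
  obtains H K where "diffeo S T H K" "\<And>i x. i \<in> I \<Longrightarrow> x \<in> V i \<Longrightarrow> H x = h i x"
    "\<And>i y. i \<in> I \<Longrightarrow> y \<in> W i \<Longrightarrow> K y = k i y"
proof -
  define H where "H x = h (SOME i. i \<in> I \<and> x \<in> V i) x" for x
  define K where "K y = k (SOME i. i \<in> I \<and> y \<in> W i) y" for y
  have H: "H x = h i x" if "i \<in> I" "x \<in> V i" for i x
  proof -
    have "(SOME i. i \<in> I \<and> x \<in> V i) \<in> I \<and> x \<in> V (SOME i. i \<in> I \<and> x \<in> V i)"
      by (rule someI[of _ i]) (use that in auto)
    then show ?thesis unfolding H_def using e that by blast
  qed
  have kk: "k i y = k j y" if "i \<in> I" "j \<in> I" "y \<in> W i" "y \<in> W j" for i j y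
    using e[of i j "k i y" "k j y"] diffeoD(2,4)[OF d] that by metis
  have K: "K y = k i y" if "i \<in> I" "y \<in> W i" for i y
  proof -
    have "(SOME i. i \<in> I \<and> y \<in> W i) \<in> I \<and> y \<in> W (SOME i. i \<in> I \<and> y \<in> W i)"
      by (rule someI[of _ i]) (use that in auto)
    then show ?thesis unfolding K_def using kk that by blast
  qed
  have sub: "V i \<subseteq> S" "W i \<subseteq> T" if "i \<in> I" for i using o that openin_imp_subset by metis+
  have "diffeo S T H K"
  proof (rule diffeoI)
    fix x assume "x \<in> S"
    then obtain i where i: "i \<in> I" "x \<in> V i" using c by blast
    then have *: "H x = h i x" "h i x \<in> W i" using H diffeoD(1)[OF d] by auto
    then show "H x \<in> T" using sub i by auto
    show "K (H x) = x" using * K i diffeoD(3)[OF d] by metis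
  next
    fix y assume "y \<in> T"
    then obtain i where i: "i \<in> I" "y \<in> W i" using c by blast
    then have *: "K y = k i y" "k i y \<in> V i" using K diffeoD(2)[OF d] by auto
    then show "K y \<in> S" using sub i by auto
    show "H (K y) = y" using * H i diffeoD(4)[OF d] by metis
  next
    show "smooth_map_on S H"
    proof (rule smooth_map_on_local)
      fix x assume "x \<in> S"
      then obtain i where i: "i \<in> I" "x \<in> V i" using c by blast
      obtain U where U: "open U" "V i = S \<inter> U" using o(1)[OF i(1)] openin_open by metis
      have "smooth_map_on (V i) H" using smooth_map_on_cong[OF diffeoD(5)[OF d[OF i(1)]]] H i by metis
      then show "\<exists>U. open U \<and> x \<in> U \<and> smooth_map_on (S \<inter> U) H" using U i by auto
    qed
    show "smooth_map_on T K"
    proof (rule smooth_map_on_local)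
      fix y assume "y \<in> T"
      then obtain i where i: "i \<in> I" "y \<in> W i" using c by blast
      obtain U where U: "open U" "W i = T \<inter> U" using o(2)[OF i(1)] openin_open by metis
      have "smooth_map_on (W i) K" using smooth_map_on_cong[OF diffeoD(6)[OF d[OF i(1)]]] K i by metis
      then show "\<exists>U. open U \<and> y \<in> U \<and> smooth_map_on (T \<inter> U) K" using U i by auto
    qed
  qed
  then show ?thesis using H K that by blast
qed

section \<open>Persistence of regular compact level sets under small perturbations\<close>

section \<open>Stability of regular level sets\<close>

definition grad :: "('a::euclidean_space \<Rightarrow> real) \<Rightarrow> 'a \<Rightarrow> 'a" where
  "grad g x = (\<Sum>b\<in>Basis. frechet_derivative g (at x) b *\<^sub>R b)"

lemma has_derivative_grad:
  assumes "smooth_at g x" shows "(g has_derivative (\<lambda>v. grad g x \<bullet> v)) (at x)"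
proof -
  have d: "(g has_derivative frechet_derivative g (at x)) (at x)" by (rule smooth_at_has_derivative[OF assms])
  have "frechet_derivative g (at x) v = grad g x \<bullet> v" for v
    using linear_Basis_expansion[OF has_derivative_linear[OF d], of v]
    by (simp add: grad_def inner_sum_left inner_sum_right inner_commute[of v] mult.commute)
  then show ?thesis using d by (metis (no_types, lifting) ext)
qed

lemma grad_unique:
  assumes "smooth_at g x" "(g has_derivative (\<lambda>v. w \<bullet> v)) (at x)" shows "grad g x = w"
  using has_derivative_unique[OF has_derivative_grad[OF assms(1)] assms(2)]
  by (metis (no_types, lifting) vector_eq_rdot inner_commute)

lemma smooth_at_grad [smooth_intros]: "smooth_at g x \<Longrightarrow> smooth_at (grad g) x"
  unfolding grad_def[abs_def] by (intro smooth_intros)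

lemma smooth_derivative_bounded:
  fixes f :: "'a::euclidean_space \<Rightarrow> 'b::euclidean_space"
  assumes K: "compact K" and f: "\<And>x. x \<in> K \<Longrightarrow> smooth_at f x"
  shows "\<exists>B>0. \<forall>x\<in>K. \<forall>v. norm (frechet_derivative f (at x) v) \<le> B * norm v"
proof -
  define D where "D x i = frechet_derivative f (at x) i" for x i
  have "continuous_on K (\<lambda>x. \<Sum>i\<in>Basis. norm (D x i))" unfolding D_def
    by (intro continuous_intros smooth_at_continuous_on smooth_intros f)
  then have "bounded ((\<lambda>x. \<Sum>i\<in>Basis. norm (D x i)) ` K)" using K compact_continuous_image compact_imp_bounded by blast
  then obtain B where B: "B > 0" "\<And>x. x \<in> K \<Longrightarrow> norm (\<Sum>i\<in>Basis. norm (D x i)) \<le> B"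
    unfolding bounded_pos by blast
  have "norm (frechet_derivative f (at x) v) \<le> B * norm v" if x: "x \<in> K" for x v
  proof -
    have lin: "linear (frechet_derivative f (at x))" using smooth_at_has_derivative[OF f[OF x]] has_derivative_linear by blast
    have "norm (frechet_derivative f (at x) v) = norm (\<Sum>j\<in>Basis. (v \<bullet> j) *\<^sub>R D x j)"
      using linear_Basis_expansion[OF lin] by (simp add: D_def)
    also have "\<dots> \<le> (\<Sum>j\<in>Basis. norm ((v \<bullet> j) *\<^sub>R D x j))" by (rule norm_sum)
    also have "\<dots> \<le> (\<Sum>j\<in>Basis. norm v * norm (D x j))"
      by (intro sum_mono) (auto simp: Basis_le_norm mult_right_mono)
    also have "\<dots> = norm v * norm (\<Sum>i\<in>Basis. norm (D x i))" by (simp add: sum_distrib_left sum_nonneg)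
    also have "\<dots> \<le> norm v * B" using B(2)[OF x] mult_left_mono norm_ge_zero by blast
    finally show ?thesis by (simp add: mult.commute)
  qed
  then show ?thesis using B(1) by blast
qed

text \<open>The map x |-> y - \<psi> x contracts the ball into itself, and its fixed point solves
  the equation.\<close>

lemma perturbed_identity_surj:
  fixes \<psi> :: "'a::euclidean_space \<Rightarrow> 'a"
  assumes r: "r \<ge> 0" and b: "\<And>x. x \<in> cball y r \<Longrightarrow> norm (\<psi> x) \<le> r"
    and l: "\<And>x z. x \<in> cball y r \<Longrightarrow> z \<in> cball y r \<Longrightarrow> norm (\<psi> x - \<psi> z) \<le> 1/2 * norm (x - z)"
  shows "\<exists>x\<in>cball y r. x + \<psi> x = y"
proof -
  have "\<exists>!x. x \<in> cball y r \<and> y - \<psi> x = x"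
  proof (rule Banach_fix[of "cball y r" "1/2" "\<lambda>x. y - \<psi> x"])
    show "complete (cball y r)" by (simp add: complete_eq_closed)
    show "cball y r \<noteq> {}" using r by simp
    show "(\<lambda>x. y - \<psi> x) ` cball y r \<subseteq> cball y r" using b by (auto simp: dist_norm)
    show "dist (y - \<psi> x) (y - \<psi> z) \<le> 1/2 * dist x z" if "x \<in> cball y r" "z \<in> cball y r" for x z
      using l[OF that] by (simp add: dist_norm norm_minus_commute)
  qed auto
  then obtain x where "x \<in> cball y r" "y - \<psi> x = x" by auto
  then show ?thesis by (intro bexI[of _ x]) (auto simp: algebra_simps)
qed

text \<open>The diffeomorphism moves \<open>x\<close> along \<open>N = grad g0\<close> by the time \<open>t x\<close> solving
  \<open>g0 (x + t x * N x) = g0 x + h x\<close>; for \<open>C\<^sup>1\<close>-small \<open>h\<close> this is a Lipschitz perturbation of the identity.\<close>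

theorem level_set_stability:
  fixes g0 :: "'a::euclidean_space \<Rightarrow> real"
  assumes U: "open U" "\<And>x. x \<in> U \<Longrightarrow> smooth_at g0 x"
    and C: "compact C" "C = {x\<in>U. g0 x = 0}" and reg: "\<And>x. x \<in> C \<Longrightarrow> grad g0 x \<noteq> 0"
    and V: "open V" "C \<subseteq> V"
  shows "\<exists>K \<epsilon>. compact K \<and> C \<subseteq> interior K \<and> K \<subseteq> U \<and> K \<subseteq> V \<and> \<epsilon> > 0 \<and>
    (\<forall>h. (\<forall>x\<in>K. smooth_at h x \<and> \<bar>h x\<bar> < \<epsilon> \<and> norm (grad h x) \<le> \<epsilon>) \<longrightarrow>
      {x\<in>K. g0 x + h x = 0} \<subseteq> interior K \<and> diffeomorphic_sets {x\<in>K. g0 x + h x = 0} C)"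
proof (cases "C = {}")
  case True
  show ?thesis by (intro exI[of _ "{}"] exI[of _ 1]) (use True diffeomorphic_sets_refl in auto)
next
  case ne: False
  define N where "N = grad g0"
  have sN: "smooth_at N x" if "x \<in> U" for x unfolding N_def by (intro smooth_intros U that)
  have dg: "(g0 has_derivative (\<lambda>v. N x \<bullet> v)) (at x)" if "x \<in> U" for x
    unfolding N_def by (rule has_derivative_grad[OF U(2)[OF that]])
  define W where "W = (U \<inter> N -` (-{0})) \<inter> V"
  have cN: "continuous_on U N" by (rule smooth_at_continuous_on[OF sN])
  have oW: "open W" unfolding W_def using V continuous_open_preimage[OF cN U(1), of "-{0}"] by auto
  have "C \<subseteq> W" using reg V C by (auto simp: W_def N_def)
  then obtain r0 where r0: "r0 > 0" "{x. infdist x C \<le> r0} \<subseteq> W"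
    using compact_in_open_separated[OF ne C(1) oW] by blast
  define K0 where "K0 = {x. infdist x C \<le> r0}"
  have cK0: "compact K0" unfolding K0_def by (rule compact_infdist_le[OF ne C(1) r0(1)])
  have K0W: "K0 \<subseteq> W" using r0 by (simp add: K0_def)
  then have K0U: "K0 \<subseteq> U" "K0 \<subseteq> V" by (auto simp: W_def)
  obtain c0 where "c0 \<in> C" using ne by blast
  then have "c0 \<in> K0" using r0 by (simp add: K0_def)
  then have K0ne: "K0 \<noteq> {}" by blast
  have cN0: "continuous_on K0 N" using cN K0U continuous_on_subset by blast
  obtain a where a: "a \<in> K0" "\<And>x. x \<in> K0 \<Longrightarrow> norm (N a) \<le> norm (N x)"
    using continuous_attains_inf[OF cK0 K0ne continuous_on_norm[OF cN0]] by blast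
  define n0 where "n0 = norm (N a)"
  have n0: "n0 > 0" using a(1) K0W by (auto simp: n0_def W_def)
  have n0': "\<And>x. x \<in> K0 \<Longrightarrow> n0 \<le> norm (N x)" using a(2) by (simp add: n0_def)
  obtain n1 where n1: "n1 > 0" "\<And>x. x \<in> K0 \<Longrightarrow> norm (N x) \<le> n1"
    using compact_imp_bounded[OF compact_continuous_image[OF cN0 cK0]] unfolding bounded_pos by blast
  obtain n2 where n2: "n2 > 0" "\<And>x v. x \<in> K0 \<Longrightarrow> norm (frechet_derivative N (at x) v) \<le> n2 * norm v"
    using smooth_derivative_bounded[OF cK0, of N] sN K0U by blast
  define k where "k = n0\<^sup>2 / 2"
  have k: "k > 0" using n0 by (simp add: k_def)
  \<comment> \<open>Allowed variation of \<open>N\<close> along a move. The bound by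
    \<open>k\<close> makes the slope along \<open>N\<close> at least \<open>k\<close>; the bound by
    \<open>k / 8\<close> pays for one quarter of the Lipschitz constant 1/2 in
    \<open>D12\<close>.\<close>
  define \<omega> where "\<omega> = min (k / n1) (k / (8 * n1))"
  have \<omega>: "\<omega> > 0" "\<omega> * n1 \<le> k" "\<omega> * n1 \<le> k / 8" using k n1 by (auto simp: \<omega>_def min_def field_simps)
  obtain \<rho> where \<rho>: "\<rho> > 0" "\<And>x z. x \<in> K0 \<Longrightarrow> z \<in> K0 \<Longrightarrow> dist z x < \<rho> \<Longrightarrow> dist (N z) (N x) < \<omega>"
    using compact_uniformly_continuous[OF cN0 cK0] \<omega>(1) unfolding uniformly_continuous_on_def by metis
  define r1 where "r1 = r0 / 2"
  \<comment> \<open>The longest time considered: the displacement is then at most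
    \<open>s0 * n1\<close>, which is below both \<open>r1\<close> and \<open>\<rho>\<close>.\<close>
  define s0 where "s0 = min r1 \<rho> / (2 * n1)"
  have s0: "s0 > 0" using r0 \<rho> n1 by (simp add: s0_def r1_def)
  have s0n: "s0 * n1 < r1" "s0 * n1 < \<rho>" using r0 \<rho> n1 by (auto simp: s0_def r1_def min_def field_simps)
  have r1: "r1 > 0" using r0 by (simp add: r1_def)
  define K where "K = {x. infdist x C \<le> r1}"
  define I where "I = {x. infdist x C < r1}"
  have oI: "open I" unfolding I_def by (intro open_Collect_less continuous_intros)
  have IK: "I \<subseteq> K" by (auto simp: I_def K_def)
  have KK0: "K \<subseteq> K0" using r0 by (auto simp: K_def K0_def r1_def)
  have CI: "C \<subseteq> I" using r1 by (auto simp: I_def)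
  have IiK: "I \<subseteq> interior K" using oI IK by (simp add: interior_maximal)
  have cK: "compact K" unfolding K_def by (rule compact_infdist_le[OF ne C(1) r1])
  have z: "x + s *\<^sub>R N x \<in> K0" "dist (x + s *\<^sub>R N x) x < \<rho>" "norm (s *\<^sub>R N x) \<le> s0 * n1"
    if "x \<in> K" "\<bar>s\<bar> \<le> s0" for x s
  proof -
    show 1: "norm (s *\<^sub>R N x) \<le> s0 * n1" using that KK0 n1(2)[of x] by (auto intro!: mult_mono)
    then show "dist (x + s *\<^sub>R N x) x < \<rho>" using s0n by (simp add: dist_norm)
    have "infdist (x + s *\<^sub>R N x) C \<le> infdist x C + dist (x + s *\<^sub>R N x) x" by (rule infdist_triangle)
    also have "\<dots> \<le> r1 + r1" using that 1 s0n by (intro add_mono) (auto simp: K_def dist_norm)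
    finally show "x + s *\<^sub>R N x \<in> K0" by (simp add: K0_def r1_def)
  qed
  have slope: "k \<le> N (x + s *\<^sub>R N x) \<bullet> N x" if "x \<in> K" "\<bar>s\<bar> \<le> s0" for x s
  proof -
    have x: "x \<in> K0" using that KK0 by blast
    have "norm (N x - N (x + s *\<^sub>R N x)) \<le> \<omega>"
      using \<rho>(2)[OF x z(1)[OF that] z(2)[OF that]] by (simp add: dist_norm norm_minus_commute)
    then have "(N x - N (x + s *\<^sub>R N x)) \<bullet> N x \<le> \<omega> * n1"
      using n1(2)[OF x] \<omega>(1) by (intro order_trans[OF norm_cauchy_schwarz] mult_mono) auto
    moreover have "n0\<^sup>2 \<le> N x \<bullet> N x" using n0'[OF x] n0 by (simp add: power2_norm_eq_inner[symmetric] power_mono)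
    ultimately show ?thesis using \<omega>(2) unfolding k_def by (simp add: inner_diff_left)
  qed
  have dF: "((\<lambda>s. g0 (x + s *\<^sub>R N x)) has_real_derivative (N (x + s *\<^sub>R N x) \<bullet> N x)) (at s)"
    if "x \<in> K" "\<bar>s\<bar> \<le> s0" for x s
  proof -
    have "((\<lambda>s. g0 (x + s *\<^sub>R N x)) has_derivative (\<lambda>h. N (x + s *\<^sub>R N x) \<bullet> (h *\<^sub>R N x))) (at s)"
      by (rule has_derivative_compose[OF _ dg, of "\<lambda>s. x + s *\<^sub>R N x" "\<lambda>h. h *\<^sub>R N x"])
        (use z(1)[OF that] K0U in \<open>auto intro!: derivative_eq_intros\<close>)
    then show ?thesis unfolding has_field_derivative_def by (rule has_derivative_eq_rhs) (auto simp: fun_eq_iff)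
  qed
  have mono: "k * (s' - s) \<le> g0 (x + s' *\<^sub>R N x) - g0 (x + s *\<^sub>R N x)"
    if m: "x \<in> K" "-s0 \<le> s" "s \<le> s'" "s' \<le> s0" for x s s'
  proof (cases "s = s'")
    case False
    then have "s < s'" using m by simp
    then obtain \<xi> where "s < \<xi>" "\<xi> < s'" and
      eq: "g0 (x + s' *\<^sub>R N x) - g0 (x + s *\<^sub>R N x) = (s' - s) * (N (x + \<xi> *\<^sub>R N x) \<bullet> N x)"
      using MVT2[OF \<open>s < s'\<close>, of "\<lambda>s. g0 (x + s *\<^sub>R N x)" "\<lambda>s. N (x + s *\<^sub>R N x) \<bullet> N x"] dF[OF m(1)] m by auto
    then have "k \<le> N (x + \<xi> *\<^sub>R N x) \<bullet> N x" using slope[OF m(1)] m by auto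
    then show ?thesis unfolding eq using \<open>s < s'\<close> by (simp add: mult.commute)
  qed auto
  have uniq: "s = s'" if "x \<in> K" "\<bar>s\<bar> \<le> s0" "\<bar>s'\<bar> \<le> s0" "g0 (x + s *\<^sub>R N x) = g0 (x + s' *\<^sub>R N x)" for x s s'
  proof (rule ccontr)
    assume "s \<noteq> s'"
    then consider "s < s'" | "s' < s" by linarith
    then show False
    proof cases
      case 1
      then have "k * (s' - s) > 0" using k by simp
      then show False using mono[OF that(1), of s s'] that 1 by (simp add: abs_le_iff)
    next
      case 2
      then have "k * (s - s') > 0" using k by simp
      then show False using mono[OF that(1), of s' s] that 2 by (simp add: abs_le_iff)
    qed
  qed
  \<comment> \<open>The first bound makes the time equation solvable within \<open>s0\<close>. Each
    of the other three bounds one summand of the derivative estimate in \<open>D12\<close> by 1/8;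
    the fourth eighth comes from \<open>\<omega>\<close>.\<close>
  define \<epsilon> where "\<epsilon> = min (k * s0 / 2) (min (k / (8 * n1)) (min (k * k / (8 * n1 * n1 * n2)) (k / (8 * n2))))"
  have \<epsilon>: "\<epsilon> > 0" using k s0 n1 n2 by (simp add: \<epsilon>_def)
  have \<epsilon>1: "\<epsilon> < k * s0"
  proof -
    have "\<epsilon> \<le> k * s0 / 2" by (simp add: \<epsilon>_def)
    also have "\<dots> < k * s0" using mult_pos_pos[OF k s0] by simp
    finally show ?thesis .
  qed
  have \<epsilon>2: "\<epsilon> * n1 \<le> k / 8"
    using mult_right_mono[of \<epsilon> "k / (8 * n1)" n1] n1 by (simp add: \<epsilon>_def)
  have \<epsilon>3: "\<epsilon> * n1 * n1 * n2 \<le> k * k / 8"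
  proof -
    have "\<epsilon> \<le> k * k / (8 * n1 * n1 * n2)" by (simp add: \<epsilon>_def)
    then show ?thesis using n1 n2 by (simp add: field_simps)
  qed
  have \<epsilon>4: "\<epsilon> * n2 \<le> k / 8"
    using mult_right_mono[of \<epsilon> "k / (8 * n2)" n2] n2 by (simp add: \<epsilon>_def)
  show ?thesis
  proof (rule exI[of _ K], rule exI[of _ \<epsilon>], intro conjI allI impI)
    show "compact K" by (rule cK)
    show "C \<subseteq> interior K" using CI IiK by blast
    show "K \<subseteq> U" "K \<subseteq> V" using KK0 K0U by auto
    show "\<epsilon> > 0" by (rule \<epsilon>)
    fix h :: "'a \<Rightarrow> real"
    assume hK: "\<forall>x\<in>K. smooth_at h x \<and> \<bar>h x\<bar> < \<epsilon> \<and> norm (grad h x) \<le> \<epsilon>"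
    have h: "\<And>x. x \<in> K \<Longrightarrow> smooth_at h x" and h\<epsilon>: "\<And>x. x \<in> K \<Longrightarrow> \<bar>h x\<bar> < \<epsilon>"
      and dh\<epsilon>: "\<And>x. x \<in> K \<Longrightarrow> norm (grad h x) \<le> \<epsilon>" using hK by auto
    have ex: "\<exists>s. \<bar>s\<bar> \<le> s0 \<and> g0 (x + s *\<^sub>R N x) = g0 x + h x" if x: "x \<in> K" for x
    proof -
      have cont: "continuous_on {-s0..s0} (\<lambda>s. g0 (x + s *\<^sub>R N x))"
      proof (rule continuous_at_imp_continuous_on, rule ballI)
        fix s assume "s \<in> {-s0..s0}"
        then have "\<bar>s\<bar> \<le> s0" by (simp add: abs_le_iff)
        then show "isCont (\<lambda>s. g0 (x + s *\<^sub>R N x)) s" using DERIV_isCont[OF dF[OF x]] by blast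
      qed
      have "g0 (x + (-s0) *\<^sub>R N x) \<le> g0 x + h x" "g0 x + h x \<le> g0 (x + s0 *\<^sub>R N x)"
        using mono[OF x, of "-s0" 0] mono[OF x, of 0 s0] h\<epsilon>[OF x] \<epsilon>1 s0 by auto
      then have "\<exists>s. -s0 \<le> s \<and> s \<le> s0 \<and> g0 (x + s *\<^sub>R N x) = g0 x + h x"
        using IVT'[of "\<lambda>s. g0 (x + s *\<^sub>R N x)" "-s0" "g0 x + h x" s0] cont s0 by auto
      then show ?thesis by (auto simp: abs_le_iff)
    qed
    define t where "t x = (SOME s. \<bar>s\<bar> \<le> s0 \<and> g0 (x + s *\<^sub>R N x) = g0 x + h x)" for x
    have t: "\<bar>t x\<bar> \<le> s0" "g0 (x + t x *\<^sub>R N x) = g0 x + h x" if "x \<in> K" for x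
      using someI_ex[OF ex[OF that]] by (auto simp: t_def)
    have tk: "k * \<bar>t x\<bar> \<le> \<epsilon>" if x: "x \<in> K" for x
      using mono[OF x, of "t x" 0] mono[OF x, of 0 "t x"] t[OF x] h\<epsilon>[OF x] s0 by (cases "t x \<ge> 0") auto
    have ts: "\<bar>t x\<bar> < s0" if x: "x \<in> K" for x
      using tk[OF x] \<epsilon>1 k by (smt (verit) mult_less_cancel_left_pos)
    have st: "smooth_at t x" if x: "x \<in> I" for x
    proof -
      have xK: "x \<in> K" using x IK by blast
      \<comment> \<open>\<open>t x\<close> was picked by choice. The implicit function theorem
        solves G (y, s) = 0 smoothly near \<open>x\<close>, and \<open>uniq\<close> identifies that
        solution with \<open>t\<close>.\<close>
      define G where "G = (\<lambda>p. g0 (fst p + snd p *\<^sub>R N (fst p)) - g0 (fst p) - h (fst p))"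
      have zU: "x + t x *\<^sub>R N x \<in> U" using z(1)[OF xK t(1)[OF xK]] K0U by blast
      have xU: "x \<in> U" using xK KK0 K0U by blast
      have sN': "smooth_at (\<lambda>p. N (fst p)) (x, t x)"
        by (rule smooth_at_compose[of fst _ N]) (auto intro!: smooth_intros sN xU)
      have s1: "smooth_at (\<lambda>p. fst p + snd p *\<^sub>R N (fst p)) (x, t x)"
        by (intro smooth_intros sN')
      have s2: "smooth_at (\<lambda>p. g0 (fst p + snd p *\<^sub>R N (fst p))) (x, t x)"
        by (rule smooth_at_compose[OF s1]) (use zU U(2) in simp)
      have s3: "smooth_at (\<lambda>p. g0 (fst p)) (x, t x)" "smooth_at (\<lambda>p. h (fst p)) (x, t x)"
        by (rule smooth_at_compose[of fst], auto intro!: smooth_intros U(2) xU h xK)+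
      have sG: "smooth_at G (x, t x)" unfolding G_def by (intro smooth_intros s2 s3)
      have "((\<lambda>s. G (x, s)) has_derivative (\<lambda>\<tau>. frechet_derivative G (at (x, t x)) (0, \<tau>))) (at (t x))"
      proof -
        have "((\<lambda>s. (x, s)) has_derivative (\<lambda>\<tau>. (0, \<tau>))) (at (t x))" by (auto intro!: derivative_eq_intros)
        then show ?thesis
          using has_derivative_compose[of "\<lambda>s. (x, s)" "\<lambda>\<tau>. (0, \<tau>)" "t x" UNIV G "frechet_derivative G (at (x, t x))"]
            smooth_at_has_derivative[OF sG] by simp
      qed
      moreover have "((\<lambda>s. G (x, s)) has_derivative (\<lambda>\<tau>. (N (x + t x *\<^sub>R N x) \<bullet> N x) * \<tau>)) (at (t x))"
        using dF[OF xK t(1)[OF xK]] unfolding G_def has_field_derivative_def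
        by (auto intro!: derivative_eq_intros)
      ultimately have "frechet_derivative G (at (x, t x)) (0, 1) = (N (x + t x *\<^sub>R N x) \<bullet> N x) * 1"
        using has_derivative_unique by metis
      then have nz: "frechet_derivative G (at (x, t x)) (0, 1) \<noteq> 0"
        using slope[OF xK t(1)[OF xK]] k by simp
      obtain O' S where O': "open O'" "x \<in> O'" "S x = t x" "\<And>y. y \<in> O' \<Longrightarrow> G (y, S y) = G (x, t x)"
        "\<And>y. y \<in> O' \<Longrightarrow> smooth_at S y"
        using smooth_implicit_function[OF sG nz] by metis
      have "continuous_on O' S" by (rule smooth_at_continuous_on[OF O'(5)])
      then have o: "open (O' \<inter> S -` {-s0<..<s0})" by (rule continuous_open_preimage) (use O' in auto)
      have "S y = t y" if y: "y \<in> (O' \<inter> S -` {-s0<..<s0}) \<inter> I" for y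
      proof -
        have yK: "y \<in> K" using y IK by blast
        have "G (y, S y) = 0" using O'(4)[of y] y t(2)[OF xK] by (simp add: G_def)
        then have "g0 (y + S y *\<^sub>R N y) = g0 (y + t y *\<^sub>R N y)" using t(2)[OF yK] by (simp add: G_def)
        then show ?thesis using uniq[OF yK _ t(1)[OF yK]] y by auto
      qed
      moreover have "x \<in> (O' \<inter> S -` {-s0<..<s0}) \<inter> I" using x O' ts[OF xK] by auto
      ultimately show ?thesis
        using smooth_at_cong_open[OF O'(5)[OF O'(2)] open_Int[OF o oI]] by blast
    qed
    define \<psi> where "\<psi> x = t x *\<^sub>R N x" for x
    define D\<psi> where "D\<psi> x v = t x *\<^sub>R frechet_derivative N (at x) v + (grad t x \<bullet> v) *\<^sub>R N x" for x v
    have IU: "I \<subseteq> U" using IK KK0 K0U by blast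
    have d\<psi>: "(\<psi> has_derivative D\<psi> x) (at x)" if x: "x \<in> I" for x
      unfolding \<psi>_def[abs_def] D\<psi>_def[abs_def]
      by (rule has_derivative_scaleR[OF has_derivative_grad[OF st[OF x]] smooth_at_has_derivative[OF sN]])
        (use x IU in blast)
    have gt: "\<bar>grad t x \<bullet> v\<bar> \<le> (\<omega> + \<epsilon> + \<epsilon> * n1 * n2 / k) / k * norm v" if x: "x \<in> I" for x v
    proof -
      have xK: "x \<in> K" using x IK by blast
      have x0: "x \<in> K0" using xK KK0 by blast
      define y where "y = x + t x *\<^sub>R N x"
      have y: "y \<in> K0" "dist y x < \<rho>" using z[OF xK t(1)[OF xK]] by (auto simp: y_def)
      have "((\<lambda>x. x + t x *\<^sub>R N x) has_derivative (\<lambda>v. v + D\<psi> x v)) (at x)"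
        using d\<psi>[OF x] unfolding \<psi>_def[abs_def] by (intro derivative_intros)
      from has_derivative_compose[OF this dg[of "x + t x *\<^sub>R N x"]]
      have "((\<lambda>x. g0 (x + t x *\<^sub>R N x)) has_derivative (\<lambda>v. N y \<bullet> (v + D\<psi> x v))) (at x)"
        using y(1) K0U by (auto simp: y_def)
      moreover have "((\<lambda>x. g0 (x + t x *\<^sub>R N x)) has_derivative (\<lambda>v. N x \<bullet> v + grad h x \<bullet> v)) (at x)"
        by (rule has_derivative_transform_within_open[OF has_derivative_add[OF dg has_derivative_grad[OF h[OF xK]]] oI x])
          (use x0 K0U t(2) IK in auto)
      \<comment> \<open>The equation defining \<open>t\<close> is differentiated in two ways. The
        coefficient of \<open>grad t x\<close> in the result is the slope, which is at least
        \<open>k\<close>, so the gradient of \<open>t\<close> can be estimated.\<close>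
      ultimately have eq: "N y \<bullet> (v + D\<psi> x v) = N x \<bullet> v + grad h x \<bullet> v"
        using has_derivative_unique by metis
      define E where "E = (N x - N y) \<bullet> v + grad h x \<bullet> v - t x * (N y \<bullet> frechet_derivative N (at x) v)"
      have E: "(N y \<bullet> N x) * (grad t x \<bullet> v) = E"
        using eq by (simp add: E_def D\<psi>_def inner_add_right inner_diff_left algebra_simps)
      have sl: "k \<le> N y \<bullet> N x" using slope[OF xK t(1)[OF xK]] by (simp add: y_def)
      have "norm (N x - N y) \<le> \<omega>" using \<rho>(2)[OF x0 y] by (simp add: dist_norm norm_minus_commute)
      then have b1: "\<bar>(N x - N y) \<bullet> v\<bar> \<le> \<omega> * norm v"
        by (meson Cauchy_Schwarz_ineq2 mult_right_mono norm_ge_zero order_trans)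
      have b2: "\<bar>grad h x \<bullet> v\<bar> \<le> \<epsilon> * norm v"
        using dh\<epsilon>[OF xK] by (meson Cauchy_Schwarz_ineq2 mult_right_mono norm_ge_zero order_trans)
      have "\<bar>N y \<bullet> frechet_derivative N (at x) v\<bar> \<le> n1 * (n2 * norm v)"
        using n1(2)[OF y(1)] n2(2)[OF x0, of v] n1(1) by (intro order_trans[OF Cauchy_Schwarz_ineq2] mult_mono) auto
      moreover have "\<bar>t x\<bar> \<le> \<epsilon> / k" using tk[OF xK] k by (simp add: field_simps)
      ultimately have b3: "\<bar>t x * (N y \<bullet> frechet_derivative N (at x) v)\<bar> \<le> \<epsilon> / k * (n1 * (n2 * norm v))"
        unfolding abs_mult using k \<epsilon> by (intro mult_mono) auto
      have "k * \<bar>grad t x \<bullet> v\<bar> \<le> \<bar>(N y \<bullet> N x) * (grad t x \<bullet> v)\<bar>"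
        unfolding abs_mult using sl k by (intro mult_right_mono) auto
      also have "\<dots> \<le> \<omega> * norm v + \<epsilon> * norm v + \<epsilon> / k * (n1 * (n2 * norm v))"
        unfolding E unfolding E_def using b1 b2 b3 by linarith
      also have "\<dots> = (\<omega> + \<epsilon> + \<epsilon> * n1 * n2 / k) * norm v" by (simp add: algebra_simps)
      finally show ?thesis using k by (simp add: field_simps)
    qed
    have D12: "norm (D\<psi> x v) \<le> 1/2 * norm v" if x: "x \<in> I" for x v
    proof -
      have xK: "x \<in> K" using x IK by blast
      have x0: "x \<in> K0" using xK KK0 by blast
      have tb: "\<bar>t x\<bar> \<le> \<epsilon> / k" using tk[OF xK] k by (simp add: field_simps)
      have "norm (D\<psi> x v) \<le> \<bar>t x\<bar> * norm (frechet_derivative N (at x) v) + \<bar>grad t x \<bullet> v\<bar> * norm (N x)"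
        unfolding D\<psi>_def by (rule order_trans[OF norm_triangle_ineq]) simp
      also have "\<dots> \<le> \<epsilon> / k * (n2 * norm v) + (\<omega> + \<epsilon> + \<epsilon> * n1 * n2 / k) / k * norm v * n1"
        using tb n2(2)[OF x0, of v] gt[OF x, of v] n1(2)[OF x0] k \<epsilon> \<omega> n1 n2
        by (intro add_mono mult_mono) auto
      also have "\<dots> = (\<epsilon> * n2 / k + \<omega> * n1 / k + \<epsilon> * n1 / k + \<epsilon> * n1 * n1 * n2 / (k * k)) * norm v"
        using k by (simp add: field_simps)
      also have "\<dots> \<le> 1/2 * norm v"
      proof (rule mult_right_mono)
        have "\<epsilon> * n2 / k \<le> 1/8" "\<omega> * n1 / k \<le> 1/8" "\<epsilon> * n1 / k \<le> 1/8"
          using \<epsilon>4 \<omega>(3) \<epsilon>2 k by (auto simp: field_simps)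
        moreover have "\<epsilon> * n1 * n1 * n2 / (k * k) \<le> 1/8" using \<epsilon>3 k by (simp add: field_simps)
        ultimately show "\<epsilon> * n2 / k + \<omega> * n1 / k + \<epsilon> * n1 / k + \<epsilon> * n1 * n1 * n2 / (k * k) \<le> 1 / 2" by linarith
      qed auto
      finally show ?thesis .
    qed
    have lip: "norm (\<psi> x - \<psi> x') \<le> 1/2 * norm (x - x')" if "convex B" "B \<subseteq> I" "x \<in> B" "x' \<in> B" for B x x'
    proof (rule differentiable_bound[OF that(1) _ _ that(3,4)])
      fix b assume "b \<in> B"
      then have b: "b \<in> I" using that by blast
      show "(\<psi> has_derivative D\<psi> b) (at b within B)" by (rule has_derivative_at_withinI[OF d\<psi>[OF b]])
      show "onorm (D\<psi> b) \<le> 1/2" by (rule onorm_le) (rule D12[OF b])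
    qed
    have \<psi>b: "norm (\<psi> x) \<le> s0 * n1" if "x \<in> K" for x
      using z(3)[OF that t(1)[OF that]] by (simp add: \<psi>_def)
    define \<Psi> where "\<Psi> x = x + \<psi> x" for x
    define C' where "C' = {x\<in>K. g0 x + h x = 0}"
    have \<Psi>C: "\<Psi> x \<in> C" if "x \<in> C'" for x
    proof -
      have "x \<in> K" "g0 x + h x = 0" using that by (auto simp: C'_def)
      then show ?thesis using z(1)[of x "t x"] t[of x] K0U C(2) by (auto simp: \<Psi>_def \<psi>_def)
    qed
    have near: "dist (\<Psi> x) x \<le> s0 * n1" if "x \<in> C'" for x
      using \<psi>b[of x] that by (auto simp: C'_def \<Psi>_def dist_norm)
    have C'I: "C' \<subseteq> I"
    proof
      fix x assume x: "x \<in> C'"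
      then have "infdist x C \<le> dist x (\<Psi> x)" using infdist_le[OF \<Psi>C] by blast
      then show "x \<in> I" using near[OF x] s0n by (auto simp: I_def dist_commute)
    qed
    have ballI: "cball y (s0 * n1) \<subseteq> I" if "y \<in> C" for y
    proof
      fix x assume "x \<in> cball y (s0 * n1)"
      then show "x \<in> I" using infdist_le[OF that, of x] s0n by (auto simp: I_def dist_commute)
    qed
    have inj: "inj_on \<Psi> C'"
    proof (rule inj_onI)
      fix x x' assume x: "x \<in> C'" "x' \<in> C'" and eq: "\<Psi> x = \<Psi> x'"
      \<comment> \<open>Both points lie within \<open>s0 * n1\<close> of their common image, hence
        in one ball contained in \<open>I\<close>; the Lipschitz bound needs such a convex
        set.\<close>
      have "norm (\<psi> x - \<psi> x') \<le> 1/2 * norm (x - x')"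
        by (rule lip[of "cball (\<Psi> x) (s0 * n1)"]) (use near[OF x(1)] near[OF x(2)] eq ballI \<Psi>C x in auto)
      moreover have "\<psi> x - \<psi> x' = x' - x" using eq by (simp add: \<Psi>_def algebra_simps)
      ultimately show "x = x'" by (simp add: norm_minus_commute)
    qed
    have "y \<in> \<Psi> ` C'" if y: "y \<in> C" for y
    proof -
      have "\<exists>x\<in>cball y (s0 * n1). x + \<psi> x = y"
      proof (rule perturbed_identity_surj)
        show "0 \<le> s0 * n1" using s0 n1 by simp
        show "norm (\<psi> x) \<le> s0 * n1" if "x \<in> cball y (s0 * n1)" for x
          using \<psi>b ballI[OF y] IK that by blast
        show "norm (\<psi> x - \<psi> z) \<le> 1/2 * norm (x - z)" if "x \<in> cball y (s0 * n1)" "z \<in> cball y (s0 * n1)" for x z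
          by (rule lip[OF convex_cball ballI[OF y] that])
      qed
      then obtain x where x: "x \<in> I" "x + \<psi> x = y" using ballI[OF y] by blast
      then have "x \<in> K" using IK by blast
      then have "g0 x + h x = g0 y" using t(2)[of x] x by (simp add: \<psi>_def)
      also have "\<dots> = 0" using y C by simp
      finally show ?thesis using x \<open>x \<in> K\<close> by (auto simp: C'_def \<Psi>_def)
    qed
    then have im: "\<Psi> ` C' = C" using \<Psi>C by blast
    have cC': "compact C'"
    proof -
      have "continuous_on K (\<lambda>x. g0 x + h x)"
        by (intro smooth_at_continuous_on smooth_intros h) (use KK0 K0U U in auto)
      then have "closed (K \<inter> (\<lambda>x. g0 x + h x) -` {0})"
        by (rule continuous_closed_preimage) (auto simp: compact_imp_closed cK)
      moreover have "C' = K \<inter> (K \<inter> (\<lambda>x. g0 x + h x) -` {0})" by (auto simp: C'_def)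
      ultimately show ?thesis using cK compact_Int_closed by metis
    qed
    have s\<Psi>: "smooth_at \<Psi> x" if "x \<in> C'" for x
      unfolding \<Psi>_def[abs_def] \<psi>_def[abs_def] by (intro smooth_intros st sN) (use that C'I IU in auto)
    have d\<Psi>: "v = 0" if x: "x \<in> C'" and v: "frechet_derivative \<Psi> (at x) v = 0" for x v
    proof -
      have "(\<Psi> has_derivative (\<lambda>v. v + D\<psi> x v)) (at x)"
        unfolding \<Psi>_def[abs_def] by (intro derivative_intros d\<psi>) (use x C'I in auto)
      then have "frechet_derivative \<Psi> (at x) v = v + D\<psi> x v" by (metis frechet_derivative_at)
      then have "norm v = norm (D\<psi> x v)" using v by (metis add_eq_0_iff norm_minus_cancel)
      then have "norm v \<le> 1/2 * norm v" using D12[of x v] x C'I by auto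
      then show "v = 0" by simp
    qed
    have "\<exists>k. diffeo C' (\<Psi> ` C') \<Psi> k"
    proof (rule diffeo_compactI[OF cC' inj s\<Psi>])
      show "v = 0" if "x \<in> C'" "frechet_derivative \<Psi> (at x) v = 0" for x v by (rule d\<Psi>[OF that])
    qed
    then have "diffeomorphic_sets C' C" unfolding im diffeomorphic_sets_iff by blast
    then show "{x\<in>K. g0 x + h x = 0} \<subseteq> interior K" "diffeomorphic_sets {x\<in>K. g0 x + h x = 0} C"
      using C'I IiK unfolding C'_def by blast+
  qed
qed

text \<open>No flow is integrated: by \<open>level_set_stability\<close> the diffeomorphism type of
  the zero set is locally constant in the parameter t, and [0, 1] is connected.\<close>

theorem level_set_isotopy:
  fixes u v :: "'a::euclidean_space \<Rightarrow> real"
  assumes u: "\<And>x. smooth_at u x" and v: "\<And>x. smooth_at v x" and K: "compact K"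
    and sub: "\<And>t x. 0 \<le> t \<Longrightarrow> t \<le> 1 \<Longrightarrow> u x + t * v x = 0 \<Longrightarrow> x \<in> K"
    and reg: "\<And>t x. 0 \<le> t \<Longrightarrow> t \<le> 1 \<Longrightarrow> u x + t * v x = 0 \<Longrightarrow> grad u x + t *\<^sub>R grad v x \<noteq> 0"
  shows "diffeomorphic_sets {x. u x = 0} {x. u x + v x = 0}"
proof -
  define Z where "Z t = {x. u x + t * v x = 0}" for t
  have "diffeomorphic_sets (Z 0) (Z 1)"
  proof (rule connected_equivalence_relation[of "{0..1::real}" 0 1 "\<lambda>a b. diffeomorphic_sets (Z a) (Z b)"])
    fix a :: real assume a: "a \<in> {0..1}"
    define g0 where "g0 x = u x + a * v x" for x
    have sg: "smooth_at g0 x" for x unfolding g0_def[abs_def] by (intro smooth_intros u v)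
    have gg: "grad g0 x = grad u x + a *\<^sub>R grad v x" for x
    proof (rule grad_unique[OF sg])
      show "(g0 has_derivative (\<lambda>w. (grad u x + a *\<^sub>R grad v x) \<bullet> w)) (at x)" unfolding g0_def[abs_def]
        by (rule has_derivative_eq_rhs[OF has_derivative_add[OF has_derivative_grad[OF u]
              has_derivative_mult_right[OF has_derivative_grad[OF v]]]])
          (auto simp: fun_eq_iff inner_add_left)
    qed
    have cg: "continuous_on UNIV g0" by (rule smooth_at_continuous_on[OF sg])
    have ZK: "Z t \<subseteq> K" if "t \<in> {0..1}" for t using sub that by (auto simp: Z_def)
    have Za: "Z a = {x\<in>UNIV. g0 x = 0}" by (auto simp: Z_def g0_def)
    have "closed (Z a)" unfolding Za using continuous_closed_preimage_constant[OF cg closed_UNIV] by simp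
    then have cZ: "compact (Z a)" using compact_Int_closed[OF K, of "Z a"] ZK[OF a] by (simp add: Int_absorb1)
    have rZ: "grad g0 x \<noteq> 0" if "x \<in> Z a" for x using reg[of a x] that a by (simp add: gg Z_def)
    obtain K1 \<epsilon> where K1: "compact K1" "Z a \<subseteq> interior K1" "\<epsilon> > 0"
      "\<And>h. (\<forall>x\<in>K1. smooth_at h x \<and> \<bar>h x\<bar> < \<epsilon> \<and> norm (grad h x) \<le> \<epsilon>) \<Longrightarrow>
        diffeomorphic_sets {x\<in>K1. g0 x + h x = 0} (Z a)"
      using level_set_stability[OF open_UNIV sg cZ Za rZ open_UNIV subset_UNIV] by blast
    have "bounded (v ` (K \<union> K1))" "bounded (grad v ` (K \<union> K1))"
      by (intro compact_imp_bounded compact_continuous_image smooth_at_continuous_on smooth_intros v compact_Un K K1)+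
    then obtain B1 B2 where B12: "B1 > 0" "B2 > 0" "\<And>x. x \<in> K \<union> K1 \<Longrightarrow> norm (v x) \<le> B1" "\<And>x. x \<in> K \<union> K1 \<Longrightarrow> norm (grad v x) \<le> B2"
      unfolding bounded_pos by blast
    define B where "B = max B1 B2"
    have B: "B > 0" "\<And>x. x \<in> K \<union> K1 \<Longrightarrow> \<bar>v x\<bar> \<le> B" "\<And>x. x \<in> K \<union> K1 \<Longrightarrow> norm (grad v x) \<le> B"
      using B12 by (fastforce simp: B_def max_def)+
    \<comment> \<open>All zero sets lie in \<open>K\<close>, but stability only controls them inside
      \<open>K1\<close>. The lower bound \<open>m\<close> for |g0| in between excludes further zeros
      for nearby parameters.\<close>
    obtain m where m: "m > 0" "\<And>x. x \<in> K - interior K1 \<Longrightarrow> m \<le> \<bar>g0 x\<bar>"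
    proof (cases "K - interior K1 = {}")
      case False
      have "compact (K - interior K1)" by (intro compact_diff K open_interior)
      moreover have "continuous_on (K - interior K1) (\<lambda>x. \<bar>g0 x\<bar>)"
        by (intro continuous_intros continuous_on_subset[OF cg]) auto
      ultimately obtain x0 where x0: "x0 \<in> K - interior K1" "\<And>x. x \<in> K - interior K1 \<Longrightarrow> \<bar>g0 x0\<bar> \<le> \<bar>g0 x\<bar>"
        using continuous_attains_inf[OF _ False] by meson
      have "g0 x0 \<noteq> 0" using x0(1) K1(2) Za by blast
      then show ?thesis using that[of "\<bar>g0 x0\<bar>"] x0 by auto
    qed (use that[of 1] in auto)
    define \<delta> where "\<delta> = min \<epsilon> m / B"
    have \<delta>: "\<delta> > 0" "\<delta> * B \<le> \<epsilon>" "\<delta> * B \<le> m" using K1 m B by (auto simp: \<delta>_def)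
    have R: "diffeomorphic_sets (Z a) (Z t)" if t: "t \<in> {0..1}" "\<bar>t - a\<bar> < \<delta>" for t
    proof -
      define h where "h x = (t - a) * v x" for x
      have sh: "smooth_at h x" for x unfolding h_def[abs_def] by (intro smooth_intros v)
      have gh: "grad h x = (t - a) *\<^sub>R grad v x" for x
      proof (rule grad_unique[OF sh])
        show "(h has_derivative (\<lambda>w. ((t - a) *\<^sub>R grad v x) \<bullet> w)) (at x)" unfolding h_def[abs_def]
          by (rule has_derivative_eq_rhs[OF has_derivative_mult_right[OF has_derivative_grad[OF v]]])
            (auto simp: fun_eq_iff)
      qed
      have hb: "\<bar>h x\<bar> < \<delta> * B" if "x \<in> K \<union> K1" for x
      proof -
        have "\<bar>h x\<bar> \<le> \<bar>t - a\<bar> * B" unfolding h_def abs_mult using B(2)[OF that] by (simp add: mult_left_mono)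
        also have "\<dots> < \<delta> * B" using t B by simp
        finally show ?thesis .
      qed
      have "norm (grad h x) \<le> \<epsilon>" if "x \<in> K1" for x
      proof -
        have "norm (grad h x) \<le> \<delta> * B" unfolding gh norm_scaleR using t B(3)[of x] that \<delta> by (intro mult_mono) auto
        then show ?thesis using \<delta> by linarith
      qed
      then have d: "diffeomorphic_sets {x\<in>K1. g0 x + h x = 0} (Z a)"
        using hb \<delta>(2) sh by (intro K1(4)) fastforce
      have "{x\<in>K1. g0 x + h x = 0} = Z t"
      proof -
        have eq: "g0 x + h x = u x + t * v x" for x by (simp add: g0_def h_def algebra_simps)
        have "x \<in> K1" if "x \<in> Z t" for x
        proof (rule ccontr)
          assume "x \<notin> K1"
          then have "x \<in> K - interior K1" using ZK[OF t(1)] that interior_subset by blast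
          then have "m \<le> \<bar>g0 x\<bar>" "\<bar>h x\<bar> < \<delta> * B" using m hb by auto
          moreover have "g0 x + h x = 0" using eq that by (simp add: Z_def)
          ultimately show False using \<delta>(3) by linarith
        qed
        then show ?thesis unfolding eq by (auto simp: Z_def)
      qed
      then show ?thesis using d diffeomorphic_sets_sym by simp
    qed
    show "\<exists>T. openin (top_of_set {0..1}) T \<and> a \<in> T \<and> (\<forall>x\<in>T. diffeomorphic_sets (Z a) (Z x))"
    proof (intro exI conjI)
      show "openin (top_of_set {0..1}) ({0..1} \<inter> ball a \<delta>)" by (simp add: openin_open_Int)
      show "a \<in> {0..1} \<inter> ball a \<delta>" using a \<delta> by simp
      show "\<forall>x\<in>{0..1} \<inter> ball a \<delta>. diffeomorphic_sets (Z a) (Z x)" using R by (auto simp: dist_real_def abs_minus_commute)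
    qed
  qed (auto intro: diffeomorphic_sets_sym diffeomorphic_sets_trans)
  then show ?thesis by (simp add: Z_def)
qed

section \<open>Smooth cut-offs, and diffeomorphisms of the whole space that are the identity far
  out\<close>

section \<open>Cut-off functions and compactly supported diffeomorphisms\<close>

text \<open>The powers are included because the derivative of a member of the family is a
  combination of two others, so that smoothness of all members follows by one induction.\<close>

definition flat_exp :: "nat \<Rightarrow> real \<Rightarrow> real" where
  "flat_exp j t = (if t > 0 then inverse t ^ j * exp (- inverse t) else 0)"

lemma flat_exp_tendsto_0: "((flat_exp j) \<longlongrightarrow> 0) (at 0)"
proof -
  have "((\<lambda>x::real. x ^ j / exp x) \<longlongrightarrow> 0) at_top" by (rule tendsto_power_div_exp_0)
  then have "((\<lambda>t::real. inverse t ^ j / exp (inverse t)) \<longlongrightarrow> 0) (at_right 0)"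
    by (rule filterlim_compose[OF _ filterlim_inverse_at_top_right])
  moreover have "\<forall>\<^sub>F t::real in at_right 0. inverse t ^ j / exp (inverse t) = flat_exp j t"
    by (rule eventually_at_rightI[of 0 1]) (auto simp: flat_exp_def exp_minus divide_inverse)
  ultimately have r: "(flat_exp j \<longlongrightarrow> 0) (at_right 0)" using Lim_transform_eventually by blast
  have "\<forall>\<^sub>F t::real in at_left 0. 0 = flat_exp j t"
    by (rule eventually_at_leftI[of "-1"]) (auto simp: flat_exp_def)
  then have "(flat_exp j \<longlongrightarrow> 0) (at_left 0)" using Lim_transform_eventually[OF tendsto_const] by blast
  then show ?thesis using r by (simp add: filterlim_split_at)
qed

lemma flat_exp_has_derivative:
  "(flat_exp j has_real_derivative (flat_exp (j + 2) t - real j * flat_exp (j + 1) t)) (at t)"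
proof -
  consider "t > 0" | "t < 0" | "t = 0" by linarith
  then show ?thesis
  proof cases
    case 1
    have "((\<lambda>t. inverse t ^ j * exp (- inverse t)) has_real_derivative
        (flat_exp (j + 2) t - real j * flat_exp (j + 1) t)) (at t)"
      by (rule DERIV_cong[OF DERIV_mult[OF DERIV_power[OF DERIV_inverse] DERIV_fun_exp[OF DERIV_minus[OF DERIV_inverse]]]])
        (use 1 in \<open>cases j; simp add: flat_exp_def algebra_simps\<close>)+
    then show ?thesis
      by (rule has_field_derivative_transform_within_open[of _ _ _ "{0<..}"]) (use 1 in \<open>auto simp: flat_exp_def\<close>)
  next
    case 2
    have "((\<lambda>t::real. 0) has_real_derivative (flat_exp (j + 2) t - real j * flat_exp (j + 1) t)) (at t)"
      using 2 by (simp add: flat_exp_def)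
    then show ?thesis
      by (rule has_field_derivative_transform_within_open[of _ _ _ "{..<0}"]) (use 2 in \<open>auto simp: flat_exp_def\<close>)
  next
    case 3
    have "(flat_exp j t - flat_exp j 0) / (t - 0) = flat_exp (j + 1) t" for t
      by (simp add: flat_exp_def divide_inverse)
    then have "((\<lambda>t. (flat_exp j t - flat_exp j 0) / (t - 0)) \<longlongrightarrow> 0) (at 0)"
      using flat_exp_tendsto_0[of "j + 1"] by simp
    then show ?thesis unfolding has_field_derivative_iff 3 by (simp add: flat_exp_def)
  qed
qed

lemma Ck_on_flat_exp: "Ck_on k UNIV (flat_exp j)"
proof (induction k arbitrary: j)
  case 0
  show ?case using DERIV_isCont[OF flat_exp_has_derivative] by (simp add: continuous_at_imp_continuous_on)
next
  case (Suc k)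
  have "Ck_on k UNIV (\<lambda>t. flat_exp (j + 2) t + (- real j) * flat_exp (j + 1) t)"
    by (intro Ck_on_add open_UNIV Ck_on_bilinear[OF bounded_bilinear_mult] Suc Ck_on_const)
  then have "Ck_on k UNIV (\<lambda>t. flat_exp (j + 2) t - real j * flat_exp (j + 1) t)" by simp
  then show ?case by (rule Ck_on_realI[OF open_UNIV flat_exp_has_derivative])
qed

lemma smooth_at_flat_exp [smooth_intros]: "smooth_at f x \<Longrightarrow> smooth_at (\<lambda>x. flat_exp j (f x)) x"
  by (erule smooth_at_compose) (rule smooth_atI[OF open_UNIV UNIV_I Ck_on_flat_exp])

lemma flat_exp_nonneg: "0 \<le> flat_exp j t" and flat_exp_pos: "t > 0 \<Longrightarrow> 0 < flat_exp j t"
  and flat_exp_zero: "t \<le> 0 \<Longrightarrow> flat_exp j t = 0"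
  by (auto simp: flat_exp_def)

definition smooth_step :: "real \<Rightarrow> real" where
  "smooth_step t = flat_exp 0 t / (flat_exp 0 t + flat_exp 0 (1 - t))"

lemma smooth_step_denom: "flat_exp 0 t + flat_exp 0 (1 - t) > 0"
  using flat_exp_nonneg[of 0 t] flat_exp_nonneg[of 0 "1 - t"] flat_exp_pos[of t 0] flat_exp_pos[of "1 - t" 0]
  by (cases "t > 0") auto

lemma smooth_at_smooth_step [smooth_intros]: "smooth_at f x \<Longrightarrow> smooth_at (\<lambda>x. smooth_step (f x)) x"
  unfolding smooth_step_def using smooth_step_denom by (intro smooth_intros) (auto simp: less_imp_neq[symmetric])

lemma smooth_step_le_0: "t \<le> 0 \<Longrightarrow> smooth_step t = 0"
  by (simp add: smooth_step_def flat_exp_zero)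

lemma smooth_step_ge_1: "t \<ge> 1 \<Longrightarrow> smooth_step t = 1"
  using flat_exp_pos[of t 0] by (simp add: smooth_step_def flat_exp_zero)

lemma smooth_step_bounds: "0 \<le> smooth_step t" "smooth_step t \<le> 1"
  using flat_exp_nonneg[of 0 t] flat_exp_nonneg[of 0 "1 - t"] smooth_step_denom[of t]
  by (auto simp: smooth_step_def divide_le_eq)

lemma DERIV_const_minus: "((-) c has_real_derivative - 1) (at (t::real))"
  using DERIV_diff[OF DERIV_const[of c] DERIV_ident, of t UNIV] by simp

definition smooth_step' :: "real \<Rightarrow> real" where
  "smooth_step' t = (flat_exp 2 t * flat_exp 0 (1 - t) + flat_exp 0 t * flat_exp 2 (1 - t)) /
     (flat_exp 0 t + flat_exp 0 (1 - t))\<^sup>2"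

lemma smooth_step_has_derivative: "(smooth_step has_real_derivative smooth_step' t) (at t)"
proof -
  have 1: "(flat_exp 0 has_real_derivative flat_exp 2 t) (at t)" for t
    using flat_exp_has_derivative[of 0 t] by (simp add: numeral_2_eq_2)
  have 2: "((\<lambda>t. flat_exp 0 (1 - t)) has_real_derivative - flat_exp 2 (1 - t)) (at t)" for t
    using DERIV_chain2[where f="flat_exp 0" and g="\<lambda>t. 1 - t" and x=t and s=UNIV, OF 1, of "-1"]
      DERIV_const_minus by simp
  show ?thesis unfolding smooth_step_def[abs_def] smooth_step'_def
    by (rule derivative_eq_intros 1 2 refl)+
      (use smooth_step_denom[of t] in \<open>auto simp: algebra_simps power2_eq_square\<close>)
qed

lemma smooth_step'_nonneg: "0 \<le> smooth_step' t"
  unfolding smooth_step'_def by (intro divide_nonneg_nonneg add_nonneg_nonneg mult_nonneg_nonneg flat_exp_nonneg) simp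

lemma smooth_step'_pos: "0 < t \<Longrightarrow> t < 1 \<Longrightarrow> 0 < smooth_step' t"
  unfolding smooth_step'_def using smooth_step_denom[of t]
  by (intro divide_pos_pos add_pos_pos mult_pos_pos flat_exp_pos) auto

lemma smooth_step'_bounded: "\<exists>B>0. \<forall>t. \<bar>smooth_step' t\<bar> \<le> B"
proof -
  have "continuous_on UNIV (flat_exp j)" for j using Ck_on_flat_exp[of 0 j] by simp
  then have c: "continuous_on {0..1} (\<lambda>t. flat_exp j (f t))" if "continuous_on {0..1} f" for j and f :: "real \<Rightarrow> real"
    using that continuous_on_compose2[of UNIV "flat_exp j" "{0..1}" f] by blast
  have "continuous_on {0..1} smooth_step'" unfolding smooth_step'_def[abs_def]
    using smooth_step_denom by (intro continuous_intros c) (auto simp: less_imp_neq[symmetric])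
  then have "bounded (smooth_step' ` {0..1})" by (intro compact_imp_bounded compact_continuous_image) auto
  then obtain B where B: "B > 0" "\<And>t. t \<in> {0..1} \<Longrightarrow> \<bar>smooth_step' t\<bar> \<le> B" unfolding bounded_pos by auto
  have "smooth_step' t = 0" if "t \<notin> {0..1}" for t
    using that by (auto simp: smooth_step'_def flat_exp_zero)
  then show ?thesis using B by (metis abs_zero less_imp_le)
qed

definition cutoff :: "real \<Rightarrow> real \<Rightarrow> real \<Rightarrow> real" where
  "cutoff a b t = smooth_step ((b - t) / (b - a))"

definition cutoff' :: "real \<Rightarrow> real \<Rightarrow> real \<Rightarrow> real" where
  "cutoff' a b t = - smooth_step' ((b - t) / (b - a)) / (b - a)"

lemma smooth_at_cutoff [smooth_intros]:
  "a < b \<Longrightarrow> smooth_at f x \<Longrightarrow> smooth_at (\<lambda>x. cutoff a b (f x)) x"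
  unfolding cutoff_def by (intro smooth_intros) auto

lemma cutoff_eq_1: "a < b \<Longrightarrow> t \<le> a \<Longrightarrow> cutoff a b t = 1"
  unfolding cutoff_def by (rule smooth_step_ge_1) (simp add: field_simps)

lemma cutoff_eq_0: "a < b \<Longrightarrow> t \<ge> b \<Longrightarrow> cutoff a b t = 0"
  unfolding cutoff_def by (rule smooth_step_le_0) (simp add: field_simps)

lemma cutoff_bounds: "0 \<le> cutoff a b t" "cutoff a b t \<le> 1"
  unfolding cutoff_def by (rule smooth_step_bounds)+

lemma cutoff_has_derivative: "a < b \<Longrightarrow> (cutoff a b has_real_derivative cutoff' a b t) (at t)"
  using DERIV_chain2[OF smooth_step_has_derivative DERIV_cdivide[of "\<lambda>t. b - t" "-1" t UNIV "b - a"]]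
  unfolding cutoff_def[abs_def] cutoff'_def by (simp add: DERIV_const_minus)

lemma cutoff'_nonpos: "a < b \<Longrightarrow> cutoff' a b t \<le> 0"
  by (simp add: cutoff'_def smooth_step'_nonneg divide_le_0_iff)

lemma cutoff'_bounded: "\<exists>B>0. \<forall>t. \<bar>cutoff' a b t\<bar> \<le> B"
proof (cases "a = b")
  case True
  then show ?thesis by (auto simp: cutoff'_def intro!: exI[of _ 1])
next
  case False
  obtain B where B: "B > 0" "\<And>t. \<bar>smooth_step' t\<bar> \<le> B" using smooth_step'_bounded by blast
  show ?thesis using B False
    by (intro exI[of _ "B / \<bar>b - a\<bar>"]) (auto simp: cutoff'_def abs_divide divide_right_mono)
qed

text \<open>Written with the squared norm, which is smooth at 0. The thresholds 1 and 4 correspond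
  to the radii \<delta> and 2 \<delta>.\<close>

definition bump :: "real \<Rightarrow> 'a::euclidean_space \<Rightarrow> real" where
  "bump \<delta> x = cutoff 1 4 ((x \<bullet> x) / \<delta>\<^sup>2)"

lemma bump_bounds: "0 \<le> bump \<delta> x" "bump \<delta> x \<le> 1"
  by (auto simp: bump_def cutoff_bounds)

lemma bump_eq_1: "\<delta> > 0 \<Longrightarrow> norm x \<le> \<delta> \<Longrightarrow> bump \<delta> x = 1"
  unfolding bump_def by (rule cutoff_eq_1) (auto simp: power2_norm_eq_inner[symmetric] divide_le_eq power_mono)

lemma bump_eq_0: "\<delta> > 0 \<Longrightarrow> norm x \<ge> 2 * \<delta> \<Longrightarrow> bump \<delta> x = 0"
proof -
  assume d: "\<delta> > 0" "norm x \<ge> 2 * \<delta>"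
  then have "(2 * \<delta>)\<^sup>2 \<le> (norm x)\<^sup>2" by (intro power_mono) auto
  then show ?thesis unfolding bump_def using d
    by (intro cutoff_eq_0) (auto simp: power2_norm_eq_inner[symmetric] le_divide_eq power_mult_distrib)
qed

lemma smooth_at_bump [smooth_intros]: "\<delta> > 0 \<Longrightarrow> smooth_at f x \<Longrightarrow> smooth_at (\<lambda>x. bump \<delta> (f x)) x"
  unfolding bump_def by (intro smooth_intros) auto

lemma bump_has_derivative:
  assumes "\<delta> > 0"
  shows "(bump \<delta> has_derivative (\<lambda>v. cutoff' 1 4 ((x \<bullet> x) / \<delta>\<^sup>2) * (2 * (x \<bullet> v) / \<delta>\<^sup>2))) (at x)"
proof -
  have "((\<lambda>x. (x \<bullet> x) / \<delta>\<^sup>2) has_derivative (\<lambda>v. 2 * (x \<bullet> v) / \<delta>\<^sup>2)) (at x)"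
    using assms by (auto intro!: derivative_eq_intros simp: inner_commute field_simps)
  from has_derivative_compose[OF this cutoff_has_derivative[of 1 4, unfolded has_field_derivative_def]]
  show ?thesis unfolding bump_def[abs_def] by simp
qed

lemma grad_bump: "\<delta> > 0 \<Longrightarrow> grad (bump \<delta>) x = (2 * cutoff' 1 4 ((x \<bullet> x) / \<delta>\<^sup>2) / \<delta>\<^sup>2) *\<^sub>R x"
  by (rule grad_unique[OF smooth_at_bump[OF _ smooth_at_ident]])
    (auto intro!: has_derivative_eq_rhs[OF bump_has_derivative])

text \<open>The constant \<open>B\<close> is independent of \<delta>. Hence cutting off a function
  that vanishes at the centre to order two costs only a gradient proportional to \<delta>.\<close>

lemma grad_bump_bound: "\<exists>B>0. \<forall>\<delta>>0. \<forall>x::'a::euclidean_space. norm (grad (bump \<delta>) x) \<le> B / \<delta>"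
proof -
  obtain B where B: "B > 0" "\<And>t. \<bar>cutoff' 1 4 t\<bar> \<le> B" using cutoff'_bounded by blast
  have "norm (grad (bump \<delta>) x) \<le> (4 * B) / \<delta>" if d: "\<delta> > 0" for \<delta> and x :: 'a
  proof (cases "norm x \<le> 2 * \<delta>")
    case True
    have "norm (grad (bump \<delta>) x) = 2 * \<bar>cutoff' 1 4 ((x \<bullet> x) / \<delta>\<^sup>2)\<bar> / \<delta>\<^sup>2 * norm x"
      unfolding grad_bump[OF d] by (simp add: abs_mult)
    also have "\<dots> \<le> 2 * B / \<delta>\<^sup>2 * (2 * \<delta>)"
      using B True d by (intro mult_mono divide_right_mono) auto
    also have "\<dots> = 4 * B / \<delta>" using d by (simp add: power2_eq_square)
    finally show ?thesis .
  next
    case False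
    have "(bump \<delta> has_derivative (\<lambda>v. 0)) (at x)"
    proof (rule has_derivative_transform_within_open[OF has_derivative_const[of 0]])
      show "open {x::'a. norm x > 2 * \<delta>}" by (intro open_Collect_less continuous_intros)
    qed (use False in \<open>auto simp: bump_eq_0[OF d]\<close>)
    then have "grad (bump \<delta>) x = 0" using grad_unique[OF smooth_at_bump[OF d smooth_at_ident], where w=0] by simp
    then show ?thesis using B d by simp
  qed
  then show ?thesis using B by (intro exI[of _ "4 * B"]) auto
qed

text \<open>The factor \<beta> is a nondecreasing function of |x|^2, so the radius is mapped by a
  strictly increasing function. This gives bijectivity, and an injective derivative.\<close>

lemma radial_diffeo:
  assumes \<mu>: "0 < \<mu>" "\<mu> < 1" and r: "0 < \<rho>" "\<rho> < r"
  obtains R R' :: "'a::euclidean_space \<Rightarrow> 'a" and \<beta> :: "'a \<Rightarrow> real" where "diffeo UNIV UNIV R R'"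
    "\<And>x. R x = \<beta> x *\<^sub>R x" "\<And>x. \<beta> x > 0" "\<And>x. norm x \<le> \<rho> \<Longrightarrow> \<beta> x = \<mu>" "\<And>x. norm x \<ge> r \<Longrightarrow> \<beta> x = 1"
proof -
  have ab: "\<rho>\<^sup>2 < r\<^sup>2" using r by (simp add: power_strict_mono)
  define b where "b s = 1 - (1 - \<mu>) * cutoff (\<rho>\<^sup>2) (r\<^sup>2) s" for s
  define b' where "b' s = (\<mu> - 1) * cutoff' (\<rho>\<^sup>2) (r\<^sup>2) s" for s
  have db: "(b has_real_derivative b' s) (at s)" for s unfolding b_def[abs_def] b'_def
    by (rule DERIV_cong[OF DERIV_diff[OF DERIV_const DERIV_cmult[OF cutoff_has_derivative[OF ab]]]]) (simp add: algebra_simps)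
  have b'0: "b' s \<ge> 0" for s using cutoff'_nonpos[OF ab, of s] \<mu> by (simp add: b'_def mult_nonpos_nonpos del: mult_minus_left)
  have b\<mu>: "b s \<ge> \<mu>" for s
  proof -
    have "(1 - \<mu>) * cutoff (\<rho>\<^sup>2) (r\<^sup>2) s \<le> (1 - \<mu>) * 1" by (intro mult_left_mono cutoff_bounds) (use \<mu> in simp)
    then show ?thesis by (simp add: b_def)
  qed
  have bpos: "b s > 0" for s using b\<mu>[of s] \<mu> by linarith
  define \<beta> where "\<beta> x = b (x \<bullet> x)" for x :: 'a
  define R where "R x = \<beta> x *\<^sub>R x" for x :: 'a
  have s\<beta>: "smooth_at \<beta> x" for x unfolding \<beta>_def[abs_def] b_def by (intro smooth_intros ab)
  have sR: "smooth_at R x" for x unfolding R_def[abs_def] by (intro smooth_intros s\<beta>)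
  have d\<beta>: "(\<beta> has_derivative (\<lambda>v. b' (x \<bullet> x) * (2 * (x \<bullet> v)))) (at x)" for x
  proof -
    have "((\<lambda>x::'a. x \<bullet> x) has_derivative (\<lambda>v. 2 * (x \<bullet> v))) (at x)"
      by (auto intro!: derivative_eq_intros simp: inner_commute)
    from has_derivative_compose[OF this db[unfolded has_field_derivative_def]]
    show ?thesis unfolding \<beta>_def[abs_def] by simp
  qed
  have dR: "(R has_derivative (\<lambda>v. \<beta> x *\<^sub>R v + (b' (x \<bullet> x) * (2 * (x \<bullet> v))) *\<^sub>R x)) (at x)" for x
    unfolding R_def[abs_def] by (rule has_derivative_scaleR[OF d\<beta> has_derivative_ident])
  have inj': "v = 0" if "frechet_derivative R (at x) v = 0" for x v
  proof -
    have 0: "\<beta> x *\<^sub>R v + (b' (x \<bullet> x) * (2 * (x \<bullet> v))) *\<^sub>R x = 0"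
      using that by (simp add: frechet_derivative_at[OF dR, symmetric])
    \<comment> \<open>Pairing with \<open>x\<close> isolates the radial part of \<open>v\<close>,
      whose coefficient is positive.\<close>
    then have "(\<beta> x *\<^sub>R v + (b' (x \<bullet> x) * (2 * (x \<bullet> v))) *\<^sub>R x) \<bullet> x = 0" by simp
    then have "(x \<bullet> v) * (\<beta> x + 2 * b' (x \<bullet> x) * (x \<bullet> x)) = 0"
      by (simp add: inner_add_left inner_commute algebra_simps)
    moreover have "\<beta> x + 2 * b' (x \<bullet> x) * (x \<bullet> x) > 0"
      using bpos[of "x \<bullet> x"] b'0[of "x \<bullet> x"] by (simp add: \<beta>_def add_pos_nonneg)
    ultimately have "x \<bullet> v = 0" by auto
    then show "v = 0" using 0 bpos by (simp add: \<beta>_def less_imp_neq[symmetric])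
  qed
  define \<phi> where "\<phi> s = s * b (s\<^sup>2)" for s
  have nR: "norm (R x) = \<phi> (norm x)" for x
    using bpos[of "x \<bullet> x"] by (simp add: R_def \<beta>_def \<phi>_def power2_norm_eq_inner)
  have d\<phi>: "(\<phi> has_real_derivative (b (s\<^sup>2) + 2 * s\<^sup>2 * b' (s\<^sup>2))) (at s)" for s
    unfolding \<phi>_def[abs_def]
    by (rule derivative_eq_intros DERIV_chain2[OF db] refl)+ (auto simp: power2_eq_square algebra_simps)
  have \<phi>mono: "\<phi> s < \<phi> s'" if "s < s'" for s s'
    by (rule DERIV_pos_imp_increasing[OF that]) (use d\<phi> bpos b'0 in \<open>blast intro: add_pos_nonneg mult_nonneg_nonneg zero_le_power2 zero_le_numeral\<close>)
  have inj: "inj R"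
  proof (rule injI)
    fix x y assume eq: "R x = R y"
    then have "norm x = norm y" using \<phi>mono[of "norm x" "norm y"] \<phi>mono[of "norm y" "norm x"] nR[of x] nR[of y]
      by (metis less_irrefl linorder_neqE_linordered_idom)
    then have "\<beta> x = \<beta> y" by (simp add: \<beta>_def power2_norm_eq_inner[symmetric])
    then show "x = y" using eq bpos[of "y \<bullet> y"] by (simp add: R_def \<beta>_def)
  qed
  have "y \<in> range R" for y
  proof -
    have c: "isCont \<phi> s" for s using d\<phi> DERIV_isCont by blast
    have "\<mu> * (norm y / \<mu>) \<le> \<phi> (norm y / \<mu>)"
    proof -
      have "\<mu> * (norm y / \<mu>) \<le> b ((norm y / \<mu>)\<^sup>2) * (norm y / \<mu>)" by (intro mult_right_mono b\<mu>) (use \<mu> in simp)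
      then show ?thesis by (simp add: \<phi>_def mult.commute)
    qed
    then have "\<exists>s\<ge>0. s \<le> norm y / \<mu> \<and> \<phi> s = norm y"
      using IVT[of \<phi> 0 "norm y" "norm y / \<mu>"] c \<mu> by (auto simp: \<phi>_def)
    then obtain s where s: "s \<ge> 0" "\<phi> s = norm y" by blast
    show ?thesis
    proof (cases "y = 0")
      case True
      then show ?thesis by (intro range_eqI[of _ _ 0]) (simp add: R_def)
    next
      case False
      define x where "x = (s / norm y) *\<^sub>R y"
      have "norm x = s" using s False by (simp add: x_def)
      then have "\<beta> x = b (s\<^sup>2)" by (simp add: \<beta>_def power2_norm_eq_inner[symmetric])
      then have "R x = (\<phi> s / norm y) *\<^sub>R y" by (simp add: R_def x_def \<phi>_def mult.commute)
      then show ?thesis using s False by (intro range_eqI[of _ _ x]) simp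
    qed
  qed
  then have im: "R ` UNIV = UNIV" by blast
  have "diffeo UNIV (R ` UNIV) R (inv_into UNIV R)"
    by (rule diffeo_openI(1)[OF open_UNIV inj]) (use sR inj' in auto)
  then have dR: "diffeo UNIV UNIV R (inv_into UNIV R)" unfolding im .
  show ?thesis
  proof (rule that[OF dR])
    show "R x = \<beta> x *\<^sub>R x" for x by (simp add: R_def)
    show "\<beta> x > 0" for x by (simp add: \<beta>_def bpos)
    show "\<beta> x = \<mu>" if "norm x \<le> \<rho>" for x
      using power_mono[OF that norm_ge_zero, of 2] ab by (simp add: \<beta>_def b_def cutoff_eq_1 power2_norm_eq_inner)
    show "\<beta> x = 1" if "norm x \<ge> r" for x
      using power_mono[OF that, of 2] ab r by (simp add: \<beta>_def b_def cutoff_eq_0 power2_norm_eq_inner)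
  qed
qed

text \<open>W - id has derivative 0 at the origin, so cut off at a small radius it has Lipschitz
  constant 1/2, and the identity plus such a map is a diffeomorphism. The explicit form with
  \<open>cf\<close> shows which linear functionals \<open>f\<close> preserves.\<close>

lemma germ_diffeo:
  fixes W :: "'a::euclidean_space \<Rightarrow> 'a"
  assumes W: "smooth_at W 0" "W 0 = 0" "(W has_derivative (\<lambda>v. v)) (at 0)" and r: "r > 0"
  obtains f f' cf \<epsilon> where "diffeo UNIV UNIV f f'" "\<And>x. f x = x + cf x *\<^sub>R (W x - x)" "\<epsilon> > 0"
    "\<And>x. norm x \<le> \<epsilon> \<Longrightarrow> f x = W x" "\<And>x. norm x \<ge> r \<Longrightarrow> f x = x"
proof -
  obtain O' where O': "open O'" "0 \<in> O'" "\<forall>y\<in>O'. smooth_at W y" using smooth_at_eventually[OF W(1)] by blast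
  define V where "V x = W x - x" for x
  have sV: "smooth_at V x" if "x \<in> O'" for x unfolding V_def[abs_def] using O' that by (intro smooth_intros) auto
  define DV where "DV x = frechet_derivative V (at x)" for x
  have dV: "(V has_derivative DV x) (at x)" if "x \<in> O'" for x unfolding DV_def by (rule smooth_at_has_derivative[OF sV[OF that]])
  have "(V has_derivative (\<lambda>v. v - v)) (at 0)" unfolding V_def[abs_def] by (intro derivative_intros W(3))
  from has_derivative_unique[OF dV[OF O'(2)] this] have DV0: "DV 0 = (\<lambda>v. 0)" by simp
  obtain B where B: "B > 0" "\<And>\<delta> x. \<delta> > 0 \<Longrightarrow> norm (grad (bump \<delta>) (x::'a)) \<le> B / \<delta>" using grad_bump_bound by blast
  \<comment> \<open>Chosen so that \<omega> (2 B + 1) = 1/2: the term \<omega> comes from the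
    derivative of \<open>V\<close>, the term 2 B \<omega> from the gradient of the bump.\<close>
  define \<omega> where "\<omega> = 1 / (2 * (2 * B + 1))"
  have \<omega>: "\<omega> > 0" using B by (simp add: \<omega>_def)
  define S where "S x = (\<Sum>i\<in>Basis. norm (DV x i))" for x
  have "continuous_on O' S" unfolding S_def DV_def
    by (intro continuous_intros smooth_at_continuous_on smooth_intros sV)
  then have oS: "open (O' \<inter> S -` {..< \<omega>})" by (rule continuous_open_preimage) (use O' in auto)
  have "0 \<in> O' \<inter> S -` {..< \<omega>}" using O' \<omega> by (simp add: S_def DV0)
  then obtain d where d: "d > 0" "ball 0 d \<subseteq> O' \<inter> S -` {..< \<omega>}" using oS openE by blast
  have DVb: "norm (DV x v) \<le> \<omega> * norm v" if x: "x \<in> ball 0 d" for x v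
  proof -
    have xO: "x \<in> O'" "S x < \<omega>" using x d by auto
    have "norm (DV x v) = norm (\<Sum>j\<in>Basis. (v \<bullet> j) *\<^sub>R DV x j)"
      using linear_Basis_expansion[OF has_derivative_linear[OF dV[OF xO(1)]]] by simp
    also have "\<dots> \<le> (\<Sum>j\<in>Basis. norm ((v \<bullet> j) *\<^sub>R DV x j))" by (rule norm_sum)
    also have "\<dots> \<le> (\<Sum>j\<in>Basis. norm v * norm (DV x j))"
      by (intro sum_mono) (auto simp: Basis_le_norm mult_right_mono)
    also have "\<dots> = norm v * S x" by (simp add: S_def sum_distrib_left)
    also have "\<dots> \<le> norm v * \<omega>" using xO by (intro mult_left_mono) auto
    finally show ?thesis by (simp add: mult.commute)
  qed
  have V0: "V 0 = 0" using W by (simp add: V_def)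
  have Vb: "norm (V x) \<le> \<omega> * norm x" if x: "x \<in> ball 0 d" for x
  proof -
    have "norm (V x - V 0) \<le> \<omega> * norm (x - 0)"
    proof (rule differentiable_bound[of "ball 0 d" V DV])
      show "(V has_derivative DV y) (at y within ball 0 d)" if "y \<in> ball 0 d" for y
        using dV that d by (blast intro: has_derivative_at_withinI)
      show "onorm (DV y) \<le> \<omega>" if "y \<in> ball 0 d" for y by (rule onorm_le) (rule DVb[OF that])
    qed (use x d in auto)
    then show ?thesis using V0 by simp
  qed
  define \<delta> where "\<delta> = min d r / 4"
  have \<delta>: "\<delta> > 0" "2 * \<delta> < d" "2 * \<delta> < r" using d r by (auto simp: \<delta>_def)
  define \<psi> where "\<psi> x = bump \<delta> x *\<^sub>R V x" for x
  have \<psi>0: "\<psi> x = 0" if "norm x \<ge> 2 * \<delta>" for x using bump_eq_0[OF \<delta>(1) that] by (simp add: \<psi>_def)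
  have ext: "open {x::'a. norm x > 2 * \<delta>}" by (intro open_Collect_less continuous_intros)
  have s\<psi>: "smooth_at \<psi> x" for x
  proof (cases "norm x < d")
    case True
    then show ?thesis unfolding \<psi>_def[abs_def] using d by (intro smooth_intros \<delta> sV) auto
  next
    case False
    show ?thesis
      by (rule smooth_at_cong_open[OF smooth_at_const[of 0] ext]) (use False \<delta> \<psi>0 in auto)
  qed
  have \<psi>D: "\<exists>D. (\<psi> has_derivative D) (at x) \<and> (\<forall>v. norm (D v) \<le> 1/2 * norm v)" for x
  proof (cases "norm x \<le> 2 * \<delta>")
    case True
    then have x: "x \<in> ball 0 d" using \<delta> by simp
    define D where "D v = bump \<delta> x *\<^sub>R DV x v + (grad (bump \<delta>) x \<bullet> v) *\<^sub>R V x" for v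
    have "(\<psi> has_derivative D) (at x)" unfolding \<psi>_def[abs_def] D_def[abs_def]
      by (rule has_derivative_scaleR[OF has_derivative_grad[OF smooth_at_bump[OF \<delta>(1) smooth_at_ident]] dV]) (use x d in blast)
    moreover have "norm (D v) \<le> 1/2 * norm v" for v
    proof -
      have "norm (D v) \<le> \<bar>bump \<delta> x\<bar> * norm (DV x v) + \<bar>grad (bump \<delta>) x \<bullet> v\<bar> * norm (V x)"
        unfolding D_def by (rule order_trans[OF norm_triangle_ineq]) simp
      also have "\<dots> \<le> 1 * (\<omega> * norm v) + (B / \<delta> * norm v) * (\<omega> * (2 * \<delta>))"
      proof (intro add_mono mult_mono)
        show "\<bar>grad (bump \<delta>) x \<bullet> v\<bar> \<le> B / \<delta> * norm v"
          using B(2)[OF \<delta>(1), of x] by (meson Cauchy_Schwarz_ineq2 mult_right_mono norm_ge_zero order_trans)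
        show "norm (V x) \<le> \<omega> * (2 * \<delta>)" using Vb[OF x] True \<omega> by (meson less_imp_le mult_left_mono order_trans)
      qed (use bump_bounds[of \<delta> x] DVb[OF x] \<omega> B \<delta> in auto)
      also have "\<dots> = \<omega> * (2 * B + 1) * norm v" using \<delta> by (simp add: field_simps)
      also have "\<omega> * (2 * B + 1) = 1/2" using B(1) by (simp add: \<omega>_def field_simps)
      finally show ?thesis .
    qed
    ultimately show ?thesis by blast
  next
    case False
    have "(\<psi> has_derivative (\<lambda>v. 0)) (at x)"
      by (rule has_derivative_transform_within_open[OF has_derivative_const[of 0] ext]) (use False \<psi>0 in auto)
    then show ?thesis by (intro exI[of _ "\<lambda>v. 0"]) auto
  qed
  then obtain D where D: "\<And>x. (\<psi> has_derivative D x) (at x)" "\<And>x v. norm (D x v) \<le> 1/2 * norm v" by metis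
  have lip: "norm (\<psi> x - \<psi> y) \<le> 1/2 * norm (x - y)" for x y
  proof (rule differentiable_bound[of UNIV \<psi> D])
    show "onorm (D x) \<le> 1/2" for x by (rule onorm_le) (rule D(2))
  qed (use D(1) in auto)
  define f where "f x = x + \<psi> x" for x
  have sf: "smooth_at f x" for x unfolding f_def[abs_def] by (intro smooth_intros s\<psi>)
  have inj: "inj f"
  proof (rule injI)
    fix x y assume "f x = f y"
    then have "\<psi> x - \<psi> y = y - x" by (simp add: f_def algebra_simps)
    then show "x = y" using lip[of x y] by (simp add: norm_minus_commute)
  qed
  have dinj: "v = 0" if v: "frechet_derivative f (at x) v = 0" for x v
  proof -
    have "(f has_derivative (\<lambda>v. v + D x v)) (at x)" unfolding f_def[abs_def] by (intro derivative_intros D)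
    then have "frechet_derivative f (at x) v = v + D x v" by (metis frechet_derivative_at)
    then have "norm v = norm (D x v)" using v by (metis add_eq_0_iff norm_minus_cancel)
    then show "v = 0" using D(2)[of x v] by simp
  qed
  have "y \<in> range f" for y
  proof -
    \<comment> \<open>A point on the sphere where \<psi> vanishes; the Lipschitz bound relative to
      it controls \<psi> inside that sphere.\<close>
    define z where "z = (SOME z::'a. norm z = 2 * \<delta>)"
    have z: "norm z = 2 * \<delta>" unfolding z_def using vector_choose_size[of "2 * \<delta>"] \<delta> by (metis (mono_tags) less_imp_le mult_pos_pos someI_ex zero_less_numeral)
    have "\<exists>x\<in>cball y (norm y + 2 * \<delta>). x + \<psi> x = y"
    proof (rule perturbed_identity_surj)
      fix x assume "x \<in> cball y (norm y + 2 * \<delta>)"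
      have "norm (\<psi> x) \<le> 2 * \<delta>"
      proof (cases "norm x \<ge> 2 * \<delta>")
        case False
        then have "norm (x - z) \<le> 4 * \<delta>" using norm_triangle_ineq4[of x z] z by linarith
        then show ?thesis using lip[of x z] \<psi>0[of z] z by simp
      qed (use \<psi>0 \<delta> in auto)
      then show "norm (\<psi> x) \<le> norm y + 2 * \<delta>" using norm_ge_zero[of y] by linarith
    qed (use lip \<delta> in auto)
    then show ?thesis by (auto simp: f_def)
  qed
  then have im: "f ` UNIV = UNIV" by blast
  have "diffeo UNIV (f ` UNIV) f (inv_into UNIV f)"
    by (rule diffeo_openI(1)[OF open_UNIV inj]) (use sf dinj in auto)
  then have df: "diffeo UNIV UNIV f (inv_into UNIV f)" unfolding im .
  show ?thesis
  proof (rule that[OF df])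
    show "f x = x + bump \<delta> x *\<^sub>R (W x - x)" for x by (simp add: f_def \<psi>_def V_def)
    show "\<delta> > 0" by (rule \<delta>)
    show "f x = W x" if "norm x \<le> \<delta>" for x using bump_eq_1[OF \<delta>(1) that] by (simp add: f_def \<psi>_def V_def)
    show "f x = x" if "norm x \<ge> r" for x using \<psi>0[of x] that \<delta> by (simp add: f_def)
  qed
qed

section \<open>Identifying a punctured sphere with a hyperplane, with prescribed behaviour at the
  puncture\<close>

section \<open>Charts of a punctured sphere\<close>

definition proj :: "'a::euclidean_space \<Rightarrow> 'a \<Rightarrow> 'a" where
  "proj e x = x - (x \<bullet> e) *\<^sub>R e"

text \<open>The model of a space of one dimension less, kept inside the ambient type so that no
  second type is involved.\<close>

definition hyp :: "'a::euclidean_space \<Rightarrow> 'a set" where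
  "hyp e = {y. y \<bullet> e = 0}"

lemma linear_proj: "linear (proj e)"
  by (rule linearI) (auto simp: proj_def algebra_simps inner_add_left)

lemma smooth_at_proj [smooth_intros]: "smooth_at f x \<Longrightarrow> smooth_at (\<lambda>x. proj e (f x)) x"
  unfolding proj_def by (intro smooth_intros)

lemma proj_hyp: "y \<in> hyp e \<Longrightarrow> proj e y = y"
  by (simp add: proj_def hyp_def)

lemma proj_in_hyp: "norm e = 1 \<Longrightarrow> proj e x \<in> hyp e"
  by (simp add: proj_def hyp_def inner_diff_left power2_norm_eq_inner[symmetric])

lemma proj_decomp: "proj e x + (x \<bullet> e) *\<^sub>R e = x"
  by (simp add: proj_def)

lemma closed_hyp: "closed (hyp e)"
  unfolding hyp_def by (intro closed_Collect_eq continuous_intros)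

lemma continuous_on_proj: "continuous_on A (proj e)"
  unfolding proj_def[abs_def] by (intro continuous_intros)

text \<open>A map defined only on a piece of the hyperplane becomes an ambient map after projecting
  first. Derivatives can then be taken in the ambient space.\<close>

lemma smooth_at_slice:
  assumes e: "norm e = 1" and f: "smooth_map_on (hyp e \<inter> U) f" "open U" "proj e x \<in> U"
  shows "smooth_at (\<lambda>x. f (proj e x)) x"
proof -
  obtain g V where g: "open V" "proj e x \<in> V" "smooth_at g (proj e x)" "\<forall>y\<in>hyp e \<inter> U \<inter> V. g y = f y"
    using smooth_map_onD[OF f(1), of "proj e x"] proj_in_hyp[OF e] f(3) by blast
  have o: "open (proj e -` (U \<inter> V))"
    using continuous_on_proj[of UNIV e] f(2) g(1) open_vimage by blast
  show ?thesis
    by (rule smooth_at_cong_open[OF smooth_at_compose[of "proj e" x g] o])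
      (use g f(3) proj_in_hyp[OF e] in \<open>auto intro!: smooth_intros\<close>)
qed

lemma diffeo_remove:
  assumes "diffeo S T h k" "x \<in> S" shows "diffeo (S - {x}) (T - {h x}) h k"
  using diffeoD(1-4)[OF assms(1)] assms(2) by (intro diffeo_subset[OF assms(1)]) (auto, metis+)

text \<open>By homogeneity, normalising after a linear isomorphism is undone by normalising after
  its inverse.\<close>

lemma diffeo_linear_sphere:
  fixes B :: "'a::euclidean_space \<Rightarrow> 'a"
  assumes B: "linear B" "linear B'" "\<And>x. B' (B x) = x" "\<And>x. B (B' x) = x"
  shows "diffeo (sphere 0 1) (sphere 0 1) (\<lambda>x. B x /\<^sub>R norm (B x)) (\<lambda>x. B' x /\<^sub>R norm (B' x))"
proof -
  have *: "A x /\<^sub>R norm (A x) \<in> sphere 0 1" "A' (A x /\<^sub>R norm (A x)) /\<^sub>R norm (A' (A x /\<^sub>R norm (A x))) = x"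
    "smooth_at (\<lambda>x. A x /\<^sub>R norm (A x)) x"
    if A: "linear A" "linear A'" "\<And>x. A' (A x) = x" "x \<in> sphere 0 1" for A A' :: "'a \<Rightarrow> 'a" and x
  proof -
    have nz: "A x \<noteq> 0" using A(3)[of x] A(4) linear_0[OF A(2)] by auto
    show "A x /\<^sub>R norm (A x) \<in> sphere 0 1" using nz by simp
    show "smooth_at (\<lambda>x. A x /\<^sub>R norm (A x)) x" using nz
      by (intro smooth_intros smooth_at_linear A) auto
    have "A' (A x /\<^sub>R norm (A x)) = x /\<^sub>R norm (A x)" using A by (simp add: linear_scale)
    then show "A' (A x /\<^sub>R norm (A x)) /\<^sub>R norm (A' (A x /\<^sub>R norm (A x))) = x" using nz A(4) by simp
  qed
  show ?thesis
  proof (rule diffeoI)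
    show "smooth_map_on (sphere 0 1) (\<lambda>x. B x /\<^sub>R norm (B x))"
      by (rule smooth_map_on_smooth_at) (rule *(3)[OF B(1,2,3)])
    show "smooth_map_on (sphere 0 1) (\<lambda>x. B' x /\<^sub>R norm (B' x))"
      by (rule smooth_map_on_smooth_at) (rule *(3)[OF B(2,1,4)])
  qed (use *(1,2)[OF B(1,2,3)] *(1,2)[OF B(2,1,4)] in blast)+
qed

definition stereo :: "'a::euclidean_space \<Rightarrow> 'a \<Rightarrow> 'a" where
  "stereo e x = proj e x /\<^sub>R (1 - x \<bullet> e)"

definition stereo_inv :: "'a::euclidean_space \<Rightarrow> 'a \<Rightarrow> 'a" where
  "stereo_inv e z = (2 *\<^sub>R z + (z \<bullet> z - 1) *\<^sub>R e) /\<^sub>R (1 + z \<bullet> z)"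

lemma norm_eq_1_inner: "norm x = 1 \<longleftrightarrow> x \<bullet> x = (1::real)"
  by (simp add: norm_eq_sqrt_inner)

lemma diffeo_stereo:
  assumes e: "norm e = 1" shows "diffeo (sphere 0 1 - {e}) (hyp e) (stereo e) (stereo_inv e)"
proof -
  have ee: "e \<bullet> e = 1" using e by (simp add: norm_eq_1_inner)
  have lt: "x \<bullet> e < 1" if "x \<in> sphere 0 1 - {e}" for x
  proof -
    have "(x - e) \<bullet> (x - e) > 0" using that by simp
    moreover have "x \<bullet> x = 1" using that by (simp add: norm_eq_1_inner)
    ultimately show ?thesis using ee by (simp add: inner_diff_left inner_diff_right inner_commute)
  qed
  have zz: "1 + z \<bullet> z \<noteq> 0" "1 + z \<bullet> z > 0" for z :: 'a using inner_ge_zero[of z] by linarith+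
  have inve: "stereo_inv e z \<bullet> e = (z \<bullet> z - 1) / (1 + z \<bullet> z)" if "z \<in> hyp e" for z
    using that ee by (simp add: stereo_inv_def hyp_def inner_add_left divide_inverse mult.commute)
  have invp: "proj e (stereo_inv e z) = (2 / (1 + z \<bullet> z)) *\<^sub>R z" if "z \<in> hyp e" for z
    unfolding proj_def inve[OF that] by (simp add: stereo_inv_def divide_inverse algebra_simps)
  show ?thesis
  proof (rule diffeoI)
    show "stereo e x \<in> hyp e" for x using proj_in_hyp[OF e, of x] by (simp add: stereo_def hyp_def)
    show "stereo_inv e z \<in> sphere 0 1 - {e}" if z: "z \<in> hyp e" for z
    proof -
      have "(2 *\<^sub>R z + (z \<bullet> z - 1) *\<^sub>R e) \<bullet> (2 *\<^sub>R z + (z \<bullet> z - 1) *\<^sub>R e) = (1 + z \<bullet> z)\<^sup>2"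
        using z ee by (simp add: hyp_def inner_add_left inner_add_right inner_commute power2_eq_square algebra_simps)
      then have "norm (2 *\<^sub>R z + (z \<bullet> z - 1) *\<^sub>R e) = 1 + z \<bullet> z"
        using zz(2)[of z] by (simp add: norm_eq_sqrt_inner)
      then have "norm (stereo_inv e z) = 1" using zz[of z] by (simp add: stereo_inv_def)
      moreover have "stereo_inv e z \<bullet> e < 1" using inve[OF z] zz(2)[of z] by simp
      ultimately show ?thesis using ee by auto
    qed
    show "stereo e (stereo_inv e z) = z" if z: "z \<in> hyp e" for z
    proof -
      have "1 - stereo_inv e z \<bullet> e = 2 / (1 + z \<bullet> z)" using inve[OF z] zz[of z] by (simp add: field_simps)
      moreover have "inverse (2 / (1 + z \<bullet> z)) * (2 / (1 + z \<bullet> z)) = 1" using zz[of z] by simp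
      ultimately show ?thesis unfolding stereo_def invp[OF z] by (metis scaleR_one scaleR_scaleR)
    qed
    show "stereo_inv e (stereo e x) = x" if x: "x \<in> sphere 0 1 - {e}" for x
    proof -
      define t where "t = x \<bullet> e"
      have t: "t < 1" using lt[OF x] by (simp add: t_def)
      have "proj e x \<bullet> proj e x = 1 - t\<^sup>2"
        using x ee by (simp add: proj_def inner_diff_left inner_diff_right norm_eq_1_inner inner_commute t_def power2_eq_square)
      then have "stereo e x \<bullet> stereo e x = (1 - t\<^sup>2) / (1 - t)\<^sup>2"
        by (simp add: stereo_def t_def[symmetric] divide_inverse power2_eq_square)
      also have "\<dots> = (1 + t) / (1 - t)" 
      proof -
        have "1 - t\<^sup>2 = (1 - t) * (1 + t)" by (simp add: power2_eq_square algebra_simps)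
        then show ?thesis using t by (simp add: power2_eq_square)
      qed
      finally have s: "stereo e x \<bullet> stereo e x = (1 + t) / (1 - t)" .
      have 1: "1 + (1 + t) / (1 - t) = 2 / (1 - t)" "(1 + t) / (1 - t) - 1 = 2 * t / (1 - t)"
        using t by (auto simp: field_simps)
      have st: "stereo e x = (1 / (1 - t)) *\<^sub>R proj e x" by (simp add: stereo_def t_def divide_inverse)
      have "stereo_inv e (stereo e x) = inverse (2 / (1 - t)) *\<^sub>R (2 *\<^sub>R stereo e x + (2 * t / (1 - t)) *\<^sub>R e)"
        unfolding stereo_inv_def s 1 ..
      also have "\<dots> = inverse (2 / (1 - t)) *\<^sub>R (2 / (1 - t)) *\<^sub>R (proj e x + t *\<^sub>R e)"
        unfolding st by (simp only: scaleR_add_right scaleR_scaleR) simp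
      also have "\<dots> = (inverse (2 / (1 - t)) * (2 / (1 - t))) *\<^sub>R (proj e x + t *\<^sub>R e)" by (simp only: scaleR_scaleR)
      also have "inverse (2 / (1 - t)) * (2 / (1 - t)) = 1" using t by simp
      also have "1 *\<^sub>R (proj e x + t *\<^sub>R e) = proj e x + t *\<^sub>R e" by simp
      finally show ?thesis by (simp add: t_def proj_decomp)
    qed
    show "smooth_map_on (sphere 0 1 - {e}) (stereo e)" unfolding stereo_def[abs_def]
      by (intro smooth_map_on_smooth_at smooth_intros) (use lt in force)
    show "smooth_map_on (hyp e) (stereo_inv e)" unfolding stereo_inv_def[abs_def]
      by (intro smooth_map_on_smooth_at smooth_intros) (rule zz)
  qed
qed

lemma exists_reflection:
  fixes p e :: "'a::euclidean_space"
  assumes "norm p = 1" "norm e = 1"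
  obtains Q where "linear Q" "\<And>x. norm (Q x) = norm x" "\<And>x. Q (Q x) = x" "Q p = e"
proof -
  define w where "w = p - e"
  \<comment> \<open>The Householder reflection exchanging p and e. For p = e, division by zero gives
    0, and \<open>Q\<close> is the identity.\<close>
  define Q where "Q x = x - (2 * (x \<bullet> w) / (w \<bullet> w)) *\<^sub>R w" for x
  have lin: "linear Q" unfolding Q_def
    by (rule linearI) (auto simp: inner_add_left algebra_simps add_divide_distrib)
  have QQ: "Q (Q x) = x" for x
    by (cases "w = 0") (auto simp: Q_def inner_diff_left algebra_simps)
  have "Q x \<bullet> Q x = x \<bullet> x" for x
    by (cases "w = 0") (auto simp: Q_def inner_diff_left inner_diff_right inner_commute algebra_simps power2_eq_square)
  then have n: "norm (Q x) = norm x" for x by (simp add: norm_eq_sqrt_inner)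
  have "Q p = e"
  proof (cases "w = 0")
    case False
    have "w \<bullet> w = 2 * (p \<bullet> w)"
      using assms by (simp add: w_def inner_diff_left inner_diff_right inner_commute norm_eq_1_inner)
    moreover from this have "p \<bullet> w \<noteq> 0" using False by (metis inner_eq_zero_iff mult_zero_right)
    ultimately have "Q p = p - w" by (simp add: Q_def)
    then show ?thesis by (simp add: w_def)
  qed (auto simp: Q_def w_def)
  then show ?thesis using that lin QQ n by blast
qed

text \<open>A point of the ball cannot leave it: its image would be fixed by \<open>f\<close>, and
  injectivity would make the point equal to its image.\<close>

lemma diffeo_ball_hyp:
  assumes f: "diffeo UNIV UNIV f f'" and id: "\<And>x. norm x \<ge> r1 \<Longrightarrow> f x = x" and r: "r1 < r"
    and h: "\<And>x. f x \<bullet> e = 0 \<longleftrightarrow> x \<bullet> e = 0"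
  shows "diffeo (hyp e \<inter> ball 0 r) (hyp e \<inter> ball 0 r) f f'"
proof (rule diffeo_subset[OF f])
  note f1 = diffeoD(3,4)[OF f]
  show "f x \<in> hyp e \<inter> ball 0 r" if x: "x \<in> hyp e \<inter> ball 0 r" for x
  proof -
    have "norm (f x) < r"
    proof (rule ccontr)
      assume a: "\<not> norm (f x) < r"
      then have "f (f x) = f x" using id r by simp
      then have "f x = x" using f1(1) by (metis UNIV_I)
      then show False using a x by simp
    qed
    then show ?thesis using x h by (simp add: hyp_def)
  qed
  show "f' y \<in> hyp e \<inter> ball 0 r" if y: "y \<in> hyp e \<inter> ball 0 r" for y
  proof -
    have fy: "f (f' y) = y" using f1 by simp
    have "norm (f' y) < r"
    proof (rule ccontr)
      assume a: "\<not> norm (f' y) < r"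
      then have "f (f' y) = f' y" using id r by simp
      then show False using fy a y by simp
    qed
    then show ?thesis using y h[of "f' y"] fy by (simp add: hyp_def)
  qed
qed auto

text \<open>The conjugate of \<open>g\<close> by the chart is glued to the identity on
  \<open>C - K\<close>, where the compact set \<open>K\<close> is the part of \<open>C\<close> on
  which the conjugate may move points.\<close>

lemma diffeo_extend_by_identity:
  assumes c: "diffeo (hyp e \<inter> ball 0 r) D c c'" and D: "openin (top_of_set C) D"
    and g: "diffeo (hyp e \<inter> ball 0 r) (hyp e \<inter> ball 0 r) g g'" and r1: "r1 < r"
    and id: "\<And>x. norm x \<ge> r1 \<Longrightarrow> g x = x"
  obtains G G' where "diffeo C C G G'" "\<And>y. y \<in> hyp e \<Longrightarrow> norm y < r \<Longrightarrow> G (c y) = c (g y)"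
proof -
  define B where "B = hyp e \<inter> ball 0 r"
  define K where "K = c ` (hyp e \<inter> cball 0 r1)"
  have sub: "hyp e \<inter> cball 0 r1 \<subseteq> B" using r1 by (auto simp: B_def)
  have "compact (hyp e \<inter> cball 0 r1)" using compact_Int_closed[OF compact_cball closed_hyp] by (simp add: Int_commute)
  moreover have "continuous_on (hyp e \<inter> cball 0 r1) c"
    using smooth_map_on_continuous[OF diffeoD(5)[OF c]] sub continuous_on_subset B_def by blast
  ultimately have cK: "compact K" unfolding K_def using compact_continuous_image by blast
  have oK: "openin (top_of_set C) (C - K)"
    using compact_imp_closed[OF cK] by (metis Diff_eq open_Compl openin_open_Int)
  have KD: "K \<subseteq> D" using diffeoD(1)[OF c] sub by (auto simp: K_def B_def)
  have DC: "D \<subseteq> C" using D openin_imp_subset by blast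
  note c1 = diffeoD(1-4)[OF c, folded B_def] and g1 = diffeoD(1-4)[OF g, folded B_def]
  have dG: "diffeo D D (\<lambda>x. c (g (c' x))) (\<lambda>x. c (g' (c' x)))"
    using diffeo_trans[OF diffeo_trans[OF diffeo_sym[OF c] g] c] by simp
  have fx: "c (g (c' x)) = x" if x: "x \<in> D" "x \<notin> K" for x
  proof -
    have "c' x \<in> B" "c (c' x) = x" using c1 x by auto
    have "norm (c' x) \<ge> r1"
    proof (rule ccontr)
      assume "\<not> norm (c' x) \<ge> r1"
      then have "c' x \<in> hyp e \<inter> cball 0 r1" using \<open>c' x \<in> B\<close> by (auto simp: B_def)
      then have "c (c' x) \<in> K" unfolding K_def by (rule imageI)
      then show False using x(2) \<open>c (c' x) = x\<close> by simp
    qed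
    then show ?thesis using id \<open>c (c' x) = x\<close> by simp
  qed
  have injG: "x = y" if "x \<in> D" "y \<in> D" "c (g (c' x)) = c (g (c' y))" for x y
    using diffeoD(3)[OF dG] that by metis
  obtain G G' where G: "diffeo C C G G'"
    "\<And>i x. i \<in> UNIV \<Longrightarrow> x \<in> (if i then D else C - K) \<Longrightarrow> G x = (if i then c (g (c' x)) else x)"
  proof (rule diffeomorphic_sets_glue[of "UNIV::bool set" "\<lambda>i. if i then D else C - K" "\<lambda>i. if i then D else C - K"
        "\<lambda>i x. if i then c (g (c' x)) else x" "\<lambda>i x. if i then c (g' (c' x)) else x" C C])
    show "diffeo (if i then D else C - K) (if i then D else C - K)
        (\<lambda>x. if i then c (g (c' x)) else x) (\<lambda>x. if i then c (g' (c' x)) else x)" for i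
      using dG diffeo_id by (cases i) auto
    show "openin (top_of_set C) (if i then D else C - K)" for i using D oK by simp
    then show "openin (top_of_set C) (if i then D else C - K)" for i .
    show "C \<subseteq> (\<Union>i\<in>UNIV. if i then D else C - K)" using KD by (auto simp: UNIV_bool)
    then show "C \<subseteq> (\<Union>i\<in>UNIV. if i then D else C - K)" .
    fix i j x y
    assume xy: "x \<in> (if i then D else C - K)" "y \<in> (if j then D else C - K)"
    have mixed: "c (g (c' x)) = y \<longleftrightarrow> x = y" if "x \<in> D" "y \<in> C - K" for x y
    proof
      assume eq: "c (g (c' x)) = y"
      then have "y \<in> D" using that dG diffeoD(1) by blast
      then have "c (g (c' y)) = y" using fx that by blast
      then show "x = y" using injG eq that \<open>y \<in> D\<close> by metis
    qed (use fx that in auto)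
    show "((if i then c (g (c' x)) else x) = (if j then c (g (c' y)) else y)) = (x = y)"
      using xy mixed[of x y] mixed[of y x] injG[of x y] by (cases i; cases j) auto
  qed blast
  have "G (c y) = c (g y)" if "y \<in> hyp e" "norm y < r" for y
    using G(2)[of True "c y"] c1(1,3)[of y] that by (simp add: B_def)
  then show ?thesis using G(1) that by blast
qed

text \<open>The chart \<open>c\<close> of \<open>C\<close> at \<open>c 0\<close> and the stereographic chart of the sphere differ by the germ of a
  diffeomorphism, which is made linear near \<open>0\<close>. A diffeomorphism of \<open>C\<close> supported in the chart
  expands this neighbourhood to the given radius \<open>\<rho>\<close>.\<close>

theorem punctured_sphere_chart:
  fixes e :: "'a::euclidean_space" and \<theta> c :: "'a \<Rightarrow> 'a"
  assumes e: "norm e = 1" and C: "diffeo C (sphere 0 1) \<theta> \<theta>'"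
    and c: "diffeo (hyp e \<inter> ball 0 r) D c c'" and D: "openin (top_of_set C) D"
    and \<rho>: "0 < \<rho>" "\<rho> < r"
  obtains \<kappa> \<kappa>' where "diffeo (C - {c 0}) (hyp e) \<kappa> \<kappa>'"
    "\<And>y. y \<in> hyp e \<Longrightarrow> y \<noteq> 0 \<Longrightarrow> norm y \<le> \<rho> \<Longrightarrow> \<kappa> (c y) = y /\<^sub>R (y \<bullet> y)"
proof -
  define B where "B = hyp e \<inter> ball 0 r"
  have ee: "e \<bullet> e = 1" using e by (simp add: norm_eq_1_inner)
  have B0: "0 \<in> B" using \<rho> by (simp add: B_def hyp_def)
  have BH: "B \<subseteq> hyp e" by (simp add: B_def)
  note cB = diffeoD[OF c, folded B_def]
  have DC: "D \<subseteq> C" using D openin_imp_subset by blast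
  have c0: "c 0 \<in> D" "c 0 \<in> C" using cB(1) B0 DC by auto
  have "\<theta> (c 0) \<in> sphere 0 1" using diffeoD(1)[OF C c0(2)] .
  then have p: "norm (\<theta> (c 0)) = 1" by simp
  obtain Q where Q: "linear Q" "\<And>x. norm (Q x) = norm x" "\<And>x. Q (Q x) = x" "Q (\<theta> (c 0)) = e"
    using exists_reflection[OF p e] by metis
  have dQ: "diffeo (sphere 0 1) (sphere 0 1) Q Q"
    by (rule diffeoI) (use Q in \<open>auto intro: smooth_map_on_smooth_at smooth_at_linear\<close>)
  define \<theta>1 where "\<theta>1 x = Q (\<theta> x)" for x
  define \<theta>1' where "\<theta>1' x = \<theta>' (Q x)" for x
  have d1: "diffeo C (sphere 0 1) \<theta>1 \<theta>1'" unfolding \<theta>1_def[abs_def] \<theta>1'_def[abs_def] by (rule diffeo_trans[OF C dQ])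
  have \<theta>1c0: "\<theta>1 (c 0) = e" by (simp add: \<theta>1_def Q)
  have nz: "e + y \<noteq> 0" if "y \<in> hyp e" for y
  proof
    assume "e + y = 0"
    then have "(e + y) \<bullet> e = 0" by simp
    then show False using that ee by (simp add: hyp_def inner_add_left)
  qed
  \<comment> \<open>The gnomonic parametrisation of the sphere near e: central projection of the
    tangent plane.\<close>
  define v where "v y = (e + y) /\<^sub>R norm (e + y)" for y
  have vS: "v y \<in> sphere 0 1" if "y \<in> hyp e" for y using nz[OF that] by (simp add: v_def)
  have v0: "v 0 = e" using e by (simp add: v_def)
  have "openin (top_of_set (sphere 0 1)) (\<theta>1 ` D)"
    by (rule homeomorphism_imp_open_map[OF diffeo_homeomorphism[OF d1] D])
  then obtain V where V: "open V" "\<theta>1 ` D = sphere 0 1 \<inter> V" using openin_open by metis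
  define Z where "Z = - {- e}"
  have sv: "smooth_at v x" if "x \<in> Z" for x
  proof -
    have "e + x \<noteq> 0" using that by (auto simp: Z_def add_eq_0_iff)
    then show ?thesis unfolding v_def[abs_def] by (intro smooth_intros) auto
  qed
  define U0 where "U0 = Z \<inter> v -` V"
  have oU0: "open U0" unfolding U0_def
    by (rule continuous_open_preimage[OF smooth_at_continuous_on[OF sv]]) (auto simp: Z_def V open_Compl)
  have "e \<in> V" using V(2) c0(1) \<theta>1c0 by blast
  then have U00: "0 \<in> U0" using v0 e by (auto simp: U0_def Z_def)
  have vD: "v y \<in> \<theta>1 ` D" if "y \<in> hyp e \<inter> U0" for y using that vS V by (auto simp: U0_def)
  have \<theta>1'D: "\<theta>1' (v y) \<in> D" "\<theta>1 (\<theta>1' (v y)) = v y" if y: "y \<in> hyp e \<inter> U0" for y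
  proof -
    obtain d where "d \<in> D" "v y = \<theta>1 d" using vD[OF y] by blast
    then show "\<theta>1' (v y) \<in> D" using diffeoD(3)[OF d1] DC by auto
    show "\<theta>1 (\<theta>1' (v y)) = v y" using diffeoD(4)[OF d1] vS y by blast
  qed
  \<comment> \<open>The transition map from gnomonic coordinates to the chart
    \<open>c\<close>.\<close>
  define T where "T y = c' (\<theta>1' (v y))" for y
  have sT: "smooth_map_on (hyp e \<inter> U0) T"
  proof -
    have 1: "smooth_map_on (hyp e \<inter> U0) v" by (rule smooth_map_on_smooth_at) (use sv in \<open>auto simp: U0_def\<close>)
    have 2: "smooth_map_on (hyp e \<inter> U0) (\<lambda>y. \<theta>1' (v y))"
      by (rule smooth_map_on_compose[OF 1 _ diffeoD(6)[OF d1]]) (use vS in blast)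
    show ?thesis unfolding T_def[abs_def]
      by (rule smooth_map_on_compose[OF 2 _ cB(6)]) (use \<theta>1'D in blast)
  qed
  have TB: "T y \<in> B" "\<theta>1 (c (T y)) = v y" if "y \<in> hyp e \<inter> U0" for y
    using \<theta>1'D[OF that] cB(2,4) by (auto simp: T_def)
  have T0: "T 0 = 0" using diffeoD(3)[OF d1 c0(2)] cB(3)[OF B0] by (simp add: T_def v0 \<theta>1c0)
  have p0: "proj e 0 = 0" by (simp add: proj_def)
  have pH: "proj e x \<bullet> e = 0" for x using proj_in_hyp[OF e, of x] by (simp add: hyp_def)
  have padd: "proj e (h + a *\<^sub>R e) = h" "(h + a *\<^sub>R e) \<bullet> e = a" if "h \<in> hyp e" for h a
    using that ee by (auto simp: proj_def hyp_def inner_add_left)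
  \<comment> \<open>\<open>T\<close> lives on the hyperplane only. Adding the identity along e gives
    a germ of an ambient map, whose derivative at 0 can be inverted.\<close>
  define Th where "Th x = proj e (T (proj e x)) + (x \<bullet> e) *\<^sub>R e" for x
  have sTh: "smooth_at Th 0" unfolding Th_def[abs_def]
    by (intro smooth_intros smooth_at_slice[OF e sT oU0]) (simp add: p0 U00)
  have Th0: "Th 0 = 0" by (simp add: Th_def p0 T0)
  define G1 where "G1 y = \<theta>1 (c y)" for y
  have sG1: "smooth_map_on (hyp e \<inter> ball 0 r) G1" unfolding G1_def[abs_def]
    by (rule smooth_map_on_compose[OF diffeoD(5)[OF c] _ diffeoD(5)[OF d1]]) (use cB(1) DC in \<open>auto simp: B_def\<close>)
  have sG: "smooth_at (\<lambda>x. G1 (proj e x)) 0"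
    by (rule smooth_at_slice[OF e sG1 open_ball]) (use \<rho> p0 in simp)
  \<comment> \<open>The opposite transition: dividing by the e-component inverts the central
    projection. \<open>EhTh\<close> then shows that the derivatives \<open>L\<close> and
    \<open>M\<close> at 0 are inverse to each other.\<close>
  define Eh where "Eh x = inverse (G1 (proj e x) \<bullet> e) *\<^sub>R proj e (G1 (proj e x)) + (x \<bullet> e) *\<^sub>R e" for x
  have sEh: "smooth_at Eh 0" unfolding Eh_def[abs_def]
    by (intro smooth_intros sG) (simp add: p0 G1_def \<theta>1c0 ee)
  define P where "P = proj e -` U0"
  have oP: "open P" "0 \<in> P" unfolding P_def using continuous_on_proj[of UNIV e] oU0 open_vimage U00 p0 by auto
  have EhTh: "Eh (Th x) = x" if "x \<in> P" for x
  proof -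
    define y where "y = proj e x"
    have y: "y \<in> hyp e \<inter> U0" using that proj_in_hyp[OF e] by (auto simp: y_def P_def)
    have Ty: "T y \<in> hyp e" using TB(1)[OF y] BH by blast
    then have Thx: "Th x = T y + (x \<bullet> e) *\<^sub>R e" by (simp add: Th_def y_def[symmetric] proj_hyp)
    have "G1 (proj e (Th x)) = v y" unfolding Thx padd(1)[OF Ty] G1_def by (rule TB(2)[OF y])
    moreover have "v y \<bullet> e = inverse (norm (e + y))" "proj e (v y) = y /\<^sub>R norm (e + y)"
      using y ee by (auto simp: v_def hyp_def proj_def inner_add_left algebra_simps)
    moreover have "norm (e + y) \<noteq> 0" using nz y by auto
    ultimately have "Eh (Th x) = y + (Th x \<bullet> e) *\<^sub>R e" by (simp add: Eh_def)
    also have "Th x \<bullet> e = x \<bullet> e" unfolding Thx by (rule padd(2)[OF Ty])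
    finally show ?thesis by (simp add: y_def proj_decomp)
  qed
  define L where "L = frechet_derivative Th (at 0)"
  define M where "M = frechet_derivative Eh (at 0)"
  have dTh: "(Th has_derivative L) (at 0)" unfolding L_def by (rule smooth_at_has_derivative[OF sTh])
  have dEh: "(Eh has_derivative M) (at (Th 0))" unfolding M_def Th0 by (rule smooth_at_has_derivative[OF sEh])
  have lin: "linear L" "linear M" using dTh dEh has_derivative_linear by blast+
  have "((\<lambda>x. Eh (Th x)) has_derivative (\<lambda>u. M (L u))) (at 0)" by (rule has_derivative_compose[OF dTh dEh])
  moreover have "((\<lambda>x. Eh (Th x)) has_derivative (\<lambda>u. u)) (at 0)"
    by (rule has_derivative_transform_within_open[OF has_derivative_ident oP]) (simp add: EhTh)
  ultimately have LinvM: "M (L u) = u" for u using has_derivative_unique[of "\<lambda>x. Eh (Th x)" _ 0] by metis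
  then have "M \<circ> L = id" by (simp add: fun_eq_iff)
  then have "L \<circ> M = id" using linear_inverse_left[OF lin] by simp
  then have LM: "L (M u) = u" for u by (metis comp_apply id_apply)
  have Le: "L u \<bullet> e = u \<bullet> e" for u
  proof -
    have "((\<lambda>x. Th x \<bullet> e) has_derivative (\<lambda>u. L u \<bullet> e)) (at 0)" by (rule has_derivative_inner_left[OF dTh])
    moreover have "(\<lambda>x. Th x \<bullet> e) = (\<lambda>x. x \<bullet> e)" using ee pH by (simp add: Th_def fun_eq_iff inner_add_left)
    moreover have "((\<lambda>x. x \<bullet> e) has_derivative (\<lambda>u. u \<bullet> e)) (at 0)" by (rule has_derivative_inner_left[OF has_derivative_ident])
    ultimately show ?thesis using has_derivative_unique by metis
  qed
  have Me: "M u \<bullet> e = u \<bullet> e" for u using Le[of "M u"] LM by simp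
  \<comment> \<open>Found backwards: for z in the hyperplane, \<open>Bs\<close> below sends e + m z
    to a multiple of 2 z + (1 - |z|^2) e, and the point of the sphere in that direction has
    stereographic image z / |z|^2.\<close>
  define m where "m x = inverse (1 - proj e x \<bullet> proj e x) *\<^sub>R M (proj e x)" for x
  have mH: "m x \<in> hyp e" for x using Me pH by (simp add: m_def hyp_def)
  have m0: "m 0 = 0" using linear_0[OF lin(2)] by (simp add: m_def p0)
  have sMp: "smooth_at (\<lambda>x. M (proj e x)) x" for x
    by (rule smooth_at_linear) (use linear_compose[OF linear_proj lin(2)] in \<open>simp add: o_def\<close>)
  have smm: "smooth_at m 0" unfolding m_def[abs_def] by (intro smooth_intros sMp) (simp add: p0)
  have dm: "(m has_derivative (\<lambda>u. M (proj e u))) (at 0)"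
  proof -
    have s: "smooth_at (\<lambda>x. inverse (1 - proj e x \<bullet> proj e x)) 0" by (intro smooth_intros) (simp add: p0)
    have "((\<lambda>x. M (proj e x)) has_derivative (\<lambda>u. M (proj e u))) (at 0)"
      by (rule bounded_linear_imp_has_derivative)
        (use linear_compose[OF linear_proj lin(2)] in \<open>simp add: o_def linear_conv_bounded_linear\<close>)
    from has_derivative_scaleR[OF has_derivative_grad[OF s] this]
    show ?thesis unfolding m_def[abs_def] by (simp add: p0 linear_0[OF lin(2)])
  qed
  \<comment> \<open>On the hyperplane this is \<open>T\<close> after \<open>m\<close>. Since
    \<open>m\<close> has derivative \<open>M\<close> there, the derivative of \<open>W\<close> at 0
    is the identity and \<open>germ_diffeo\<close> applies.\<close>
  define W where "W x = proj e (T (m x)) + (x \<bullet> e) *\<^sub>R e" for x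
  have W_eq: "W x = Th (m x) + (x \<bullet> e) *\<^sub>R e" for x
    using mH[of x] by (simp add: W_def Th_def proj_hyp) (simp add: hyp_def)
  have sW: "smooth_at W 0" unfolding W_eq[abs_def]
    by (intro smooth_intros smooth_at_compose[OF smm]) (simp add: m0 sTh)
  have W0: "W 0 = 0" by (simp add: W_def m0 T0 p0)
  have dW: "(W has_derivative (\<lambda>u. u)) (at 0)"
  proof -
    have "((\<lambda>x. Th (m x)) has_derivative (\<lambda>u. L (M (proj e u)))) (at 0)"
      by (rule has_derivative_compose[OF dm]) (simp add: m0 dTh)
    moreover have "((\<lambda>x. (x \<bullet> e) *\<^sub>R e) has_derivative (\<lambda>u. (u \<bullet> e) *\<^sub>R e)) (at 0)"
      by (auto intro!: derivative_eq_intros)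
    ultimately have "((\<lambda>x. Th (m x) + (x \<bullet> e) *\<^sub>R e) has_derivative (\<lambda>u. L (M (proj e u)) + (u \<bullet> e) *\<^sub>R e)) (at 0)"
      by (rule has_derivative_add)
    then show ?thesis unfolding W_eq[abs_def] by (simp add: LM proj_decomp)
  qed
  define r1 where "r1 = (\<rho> + r) / 2"
  have r1: "r1 > 0" "\<rho> < r1" "r1 < r" using \<rho> by (auto simp: r1_def)
  obtain f f' cf \<epsilon> where f: "diffeo UNIV UNIV f f'" "\<And>x. f x = x + cf x *\<^sub>R (W x - x)" "\<epsilon> > 0"
    "\<And>x. norm x \<le> \<epsilon> \<Longrightarrow> f x = W x" "\<And>x. norm x \<ge> r1 \<Longrightarrow> f x = x"
    using germ_diffeo[OF sW W0 dW r1(1)] by metis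
  have We: "W x \<bullet> e = x \<bullet> e" for x using ee pH by (simp add: W_def inner_add_left)
  have fe: "f x \<bullet> e = x \<bullet> e" for x by (simp add: f(2) inner_add_left inner_diff_left We)
  have "(m \<longlongrightarrow> m 0) (nhds 0)" using smooth_at_isCont[OF smm] by (simp add: isCont_def tendsto_at_iff_tendsto_nhds)
  then have "\<forall>\<^sub>F z in nhds 0. m z \<in> U0" by (rule topological_tendstoD) (use oU0 m0 U00 in auto)
  then obtain d where d: "d > 0" "\<And>z. dist z 0 < d \<Longrightarrow> m z \<in> U0" unfolding eventually_nhds_metric by blast
  define \<epsilon>1 where "\<epsilon>1 = min (d / 2) (min \<epsilon> (1/2))"
  have \<epsilon>1: "\<epsilon>1 > 0" "\<epsilon>1 < d" "\<epsilon>1 \<le> \<epsilon>" "\<epsilon>1 < 1" using d f(3) by (auto simp: \<epsilon>1_def)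
  \<comment> \<open>Shrinking by \<mu> moves the ball of radius \<rho> into the ball of radius
    \<open>\<epsilon>1\<close>, where \<open>f\<close> equals \<open>W\<close> and \<open>m\<close>
    takes values in \<open>U0\<close>.\<close>
  define \<mu> where "\<mu> = min (1/2) (\<epsilon>1 / \<rho>)"
  have \<mu>: "0 < \<mu>" "\<mu> < 1" using \<epsilon>1 \<rho> by (auto simp: \<mu>_def)
  have \<mu>\<rho>: "\<mu> * \<rho> \<le> \<epsilon>1" using mult_right_mono[of \<mu> "\<epsilon>1 / \<rho>" \<rho>] \<rho> by (simp add: \<mu>_def)
  obtain R R' :: "'a \<Rightarrow> 'a" and \<beta> where R: "diffeo UNIV UNIV R R'" "\<And>x. R x = \<beta> x *\<^sub>R x" "\<And>x. \<beta> x > 0"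
    "\<And>x. norm x \<le> \<rho> \<Longrightarrow> \<beta> x = \<mu>" "\<And>x. norm x \<ge> r1 \<Longrightarrow> \<beta> x = 1"
    using radial_diffeo[OF \<mu> \<rho>(1) r1(2)] by metis
  define g where "g x = f (R x)" for x
  have dg: "diffeo UNIV UNIV g (\<lambda>x. R' (f' x))" unfolding g_def[abs_def] by (rule diffeo_trans[OF R(1) f(1)])
  have gid: "g x = x" if "norm x \<ge> r1" for x using that by (simp add: g_def R(2,5) f(5))
  have "g x \<bullet> e = 0 \<longleftrightarrow> x \<bullet> e = 0" for x using R(3)[of x] by (simp add: g_def fe R(2) less_imp_neq[symmetric])
  from diffeo_ball_hyp[OF dg gid r1(3) this]
  have dgB: "diffeo (hyp e \<inter> ball 0 r) (hyp e \<inter> ball 0 r) g (\<lambda>x. R' (f' x))" by simp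
  obtain G G' where G: "diffeo C C G G'" "\<And>y. y \<in> hyp e \<Longrightarrow> norm y < r \<Longrightarrow> G (c y) = c (g y)"
    using diffeo_extend_by_identity[OF c D dgB r1(3) gid] by metis
  \<comment> \<open>\<open>L\<close> cancels the \<open>M\<close> contained in \<open>m\<close>; the
    factor 2 is the one in the formula for inverse stereographic projection.\<close>
  define Bs where "Bs x = L (2 *\<^sub>R proj e x) + (x \<bullet> e) *\<^sub>R e" for x
  define Bs' where "Bs' x = (1/2) *\<^sub>R M (proj e x) + (x \<bullet> e) *\<^sub>R e" for x
  have LH: "L (a *\<^sub>R proj e x) \<in> hyp e" "a *\<^sub>R M (proj e x) \<in> hyp e" for a x using Le Me pH by (auto simp: hyp_def)
  have linB: "linear Bs" "linear Bs'" unfolding Bs_def[abs_def] Bs'_def[abs_def]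
    by (rule linearI; simp add: linear_add[OF linear_proj] linear_scale[OF linear_proj] linear_add[OF lin(1)] linear_add[OF lin(2)]
        linear_scale[OF lin(1)] linear_scale[OF lin(2)] algebra_simps inner_add_left)+
  have BsB: "Bs' (Bs x) = x" for x
  proof -
    have "proj e (Bs x) = L (2 *\<^sub>R proj e x)" "Bs x \<bullet> e = x \<bullet> e" unfolding Bs_def using padd[OF LH(1)] by auto
    then show ?thesis by (simp add: Bs'_def LinvM linear_scale[OF lin(1)] linear_scale[OF lin(2)] proj_decomp)
  qed
  have BBs: "Bs (Bs' x) = x" for x
  proof -
    have "proj e (Bs' x) = (1/2) *\<^sub>R M (proj e x)" "Bs' x \<bullet> e = x \<bullet> e" unfolding Bs'_def using padd[OF LH(2)] by auto
    then show ?thesis by (simp add: Bs_def LM proj_decomp)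
  qed
  define SB where "SB x = Bs x /\<^sub>R norm (Bs x)" for x
  have dSB: "diffeo (sphere 0 1) (sphere 0 1) SB (\<lambda>x. Bs' x /\<^sub>R norm (Bs' x))"
    unfolding SB_def[abs_def] by (rule diffeo_linear_sphere[OF linB BsB BBs])
  obtain k2 where d2: "diffeo C (sphere 0 1) (\<lambda>x. SB (\<theta>1 (G x))) k2"
    using diffeo_trans[OF diffeo_trans[OF G(1) d1] dSB] by blast
  have "Bs e = e" using ee linear_0[OF lin(1)] by (simp add: Bs_def proj_def)
  then have SBe: "SB e = e" using e by (simp add: SB_def)
  have g0: "g 0 = 0" using f(3) by (simp add: g_def R(2) f(4) W0)
  have "G (c 0) = c 0" using G(2)[of 0] \<rho> g0 by (simp add: hyp_def)
  then have S0: "SB (\<theta>1 (G (c 0))) = e" by (simp add: \<theta>1c0 SBe)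
  have d3: "diffeo (C - {c 0}) (sphere 0 1 - {e}) (\<lambda>x. SB (\<theta>1 (G x))) k2"
    using diffeo_remove[OF d2 c0(2)] unfolding S0 .
  have dsc: "diffeo (hyp e) (hyp e) (\<lambda>x. \<mu> *\<^sub>R x) (\<lambda>x. inverse \<mu> *\<^sub>R x)"
    by (rule diffeoI) (use \<mu> in \<open>auto simp: hyp_def intro!: smooth_map_on_smooth_at smooth_intros\<close>)
  \<comment> \<open>The stereographic image is z / |z|^2 with z = \<mu> y; multiplication by \<mu>
    turns it into y / |y|^2.\<close>
  define \<kappa> where "\<kappa> x = \<mu> *\<^sub>R stereo e (SB (\<theta>1 (G x)))" for x
  obtain \<kappa>' where d\<kappa>: "diffeo (C - {c 0}) (hyp e) \<kappa> \<kappa>'"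
    using diffeo_trans[OF diffeo_trans[OF d3 diffeo_stereo[OF e]] dsc] unfolding \<kappa>_def by blast
  have "\<kappa> (c y) = y /\<^sub>R (y \<bullet> y)" if y: "y \<in> hyp e" "y \<noteq> 0" "norm y \<le> \<rho>" for y
  proof -
    define z where "z = \<mu> *\<^sub>R y"
    define s where "s = z \<bullet> z"
    have zH: "z \<in> hyp e" using y by (simp add: z_def hyp_def)
    have nzb: "norm z \<le> \<epsilon>1" using y(3) \<mu> \<mu>\<rho> by (simp add: z_def) (meson less_imp_le mult_left_mono order_trans)
    have sp: "s > 0" using y \<mu> by (simp add: s_def z_def)
    have s1: "s < 1" using nzb \<epsilon>1 by (simp add: s_def power2_norm_eq_inner[symmetric] power_less_one_iff)
    have mU: "m z \<in> hyp e \<inter> U0" using d(2)[of z] nzb \<epsilon>1 mH by (simp add: dist_norm)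
    have "g y = W z" using nzb \<epsilon>1 y(3) by (simp add: g_def R(2,4) f(4) z_def)
    also have "W z = T (m z)" using TB(1)[OF mU] BH zH by (simp add: W_def proj_hyp subset_iff hyp_def)
    finally have "G (c y) = c (T (m z))" using G(2)[OF y(1)] y(3) \<rho> by simp
    then have \<theta>G: "\<theta>1 (G (c y)) = v (m z)" using TB(2)[OF mU] by simp
    have mz: "m z = inverse (1 - s) *\<^sub>R M z" using zH by (simp add: m_def proj_hyp s_def)
    have "Bs (e + m z) = inverse (1 - s) *\<^sub>R (2 *\<^sub>R z) + e"
    proof -
      have "e + m z = m z + 1 *\<^sub>R e" by simp
      then have "proj e (e + m z) = m z" "(e + m z) \<bullet> e = 1" using padd[OF mH, of z 1] by metis+
      then show ?thesis by (simp add: Bs_def mz linear_scale[OF lin(1)] LM)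
    qed
    also have "\<dots> = inverse (1 - s) *\<^sub>R (2 *\<^sub>R z + (1 - s) *\<^sub>R e)" using s1 by (simp add: scaleR_add_right)
    finally have Bse: "Bs (e + m z) = inverse (1 - s) *\<^sub>R (2 *\<^sub>R z + (1 - s) *\<^sub>R e)" .
    define q where "q = 2 *\<^sub>R z + (1 - s) *\<^sub>R e"
    have "q \<bullet> q = (1 + s)\<^sup>2" using zH ee
      by (simp add: q_def hyp_def inner_add_left inner_add_right inner_commute power2_eq_square s_def algebra_simps)
    then have nq: "norm q = 1 + s" using sp by (simp add: norm_eq_sqrt_inner)
    define a where "a = inverse (norm (e + m z)) * inverse (1 - s)"
    have a: "a > 0" using nz[of "m z"] mH s1 by (simp add: a_def)
    have "Bs (v (m z)) = a *\<^sub>R q" by (simp add: v_def linear_scale[OF linB(1)] Bse a_def q_def)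
    then have SBv: "SB (v (m z)) = q /\<^sub>R (1 + s)" using a nq by (simp add: SB_def)
    have qe: "(q /\<^sub>R (1 + s)) \<bullet> e = (1 - s) / (1 + s)"
      using zH ee by (simp add: q_def hyp_def inner_add_left divide_inverse mult.commute)
    have pq: "proj e (q /\<^sub>R (1 + s)) = (2 / (1 + s)) *\<^sub>R z"
      unfolding proj_def qe by (simp add: q_def divide_inverse algebra_simps)
    have "1 - (1 - s) / (1 + s) = 2 * s / (1 + s)" using sp by (simp add: field_simps)
    then have "stereo e (SB (v (m z))) = inverse (2 * s / (1 + s)) *\<^sub>R ((2 / (1 + s)) *\<^sub>R z)"
      by (simp only: SBv stereo_def qe pq)
    also have "\<dots> = inverse s *\<^sub>R z"
    proof -
      have "inverse (2 * s / u) * (2 / u) = inverse s" if "u \<noteq> 0" for u using sp that by (simp add: field_simps)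
      from this[of "1 + s"] have "inverse (2 * s / (1 + s)) * (2 / (1 + s)) = inverse s" using sp by simp
      then show ?thesis by (simp only: scaleR_scaleR)
    qed
    finally have "\<kappa> (c y) = \<mu> *\<^sub>R (inverse s *\<^sub>R z)" by (simp add: \<kappa>_def \<theta>G)
    also have "\<dots> = y /\<^sub>R (y \<bullet> y)" using \<mu> y(2) by (simp add: s_def z_def field_simps)
    finally show ?thesis .
  qed
  then show ?thesis using d\<kappa> that by blast
qed

section \<open>Replacing two caps by a tube deletes one sphere\<close>

section \<open>Removing a sphere summand\<close>

text \<open>\<open>neck \<eta> \<delta>\<close> bends the cone \<open>\<bar>y\<bar>\<^sup>2 = a\<^sup>2\<close> near its apex: \<open>\<bar>y\<bar>\<^sup>2 = neck \<eta> \<delta> (a\<^sup>2)\<close> is a tube and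
  \<open>a\<^sup>2 = neck \<eta> \<delta> (\<bar>y\<bar>\<^sup>2)\<close> is a pair of caps; both agree with the cone beyond radius \<open>\<delta>\<close>.\<close>

definition neck :: "real \<Rightarrow> real \<Rightarrow> real \<Rightarrow> real" where
  "neck \<eta> \<delta> t = t + \<eta> * cutoff (\<delta>\<^sup>2 / 4) (\<delta>\<^sup>2) t"

text \<open>The bound on the derivative of the cut-off makes \<open>neck\<close> strictly
  increasing; the bound on \<eta> keeps the bend well inside radius \<delta>.\<close>

definition neck_ok :: "real \<Rightarrow> real \<Rightarrow> bool" where
  "neck_ok \<eta> \<delta> \<longleftrightarrow> 0 < \<delta> \<and> 0 < \<eta> \<and> \<eta> \<le> \<delta>\<^sup>2 / 4 \<and> (\<forall>t. \<eta> * \<bar>cutoff' (\<delta>\<^sup>2 / 4) (\<delta>\<^sup>2) t\<bar> < 1)"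

lemma neck_ok_cutoff: "neck_ok \<eta> \<delta> \<Longrightarrow> \<delta>\<^sup>2 / 4 < \<delta>\<^sup>2"
  by (simp add: neck_ok_def)

lemma smooth_at_neck [smooth_intros]:
  "neck_ok \<eta> \<delta> \<Longrightarrow> smooth_at f x \<Longrightarrow> smooth_at (\<lambda>x. neck \<eta> \<delta> (f x)) x"
  unfolding neck_def by (intro smooth_intros neck_ok_cutoff)

lemma neck_has_derivative:
  assumes "neck_ok \<eta> \<delta>"
  shows "(neck \<eta> \<delta> has_real_derivative (1 + \<eta> * cutoff' (\<delta>\<^sup>2 / 4) (\<delta>\<^sup>2) t)) (at t)"
  unfolding neck_def[abs_def]
  by (intro DERIV_add DERIV_ident DERIV_cmult cutoff_has_derivative neck_ok_cutoff[OF assms])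

lemma neck_derivative_pos:
  assumes "neck_ok \<eta> \<delta>" shows "0 < 1 + \<eta> * cutoff' (\<delta>\<^sup>2 / 4) (\<delta>\<^sup>2) t"
proof -
  have "\<bar>\<eta> * cutoff' (\<delta>\<^sup>2 / 4) (\<delta>\<^sup>2) t\<bar> < 1" using assms by (simp add: neck_ok_def abs_mult)
  then show ?thesis by linarith
qed

lemma neck_mono: "neck_ok \<eta> \<delta> \<Longrightarrow> s < t \<Longrightarrow> neck \<eta> \<delta> s < neck \<eta> \<delta> t"
  by (rule DERIV_pos_imp_increasing) (use neck_has_derivative neck_derivative_pos in blast)+

lemma neck_mono_le: "neck_ok \<eta> \<delta> \<Longrightarrow> s \<le> t \<Longrightarrow> neck \<eta> \<delta> s \<le> neck \<eta> \<delta> t"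
  using neck_mono[of \<eta> \<delta> s t] by (cases "s = t") auto

lemma neck_eq: "neck_ok \<eta> \<delta> \<Longrightarrow> t \<ge> \<delta>\<^sup>2 \<Longrightarrow> neck \<eta> \<delta> t = t"
  by (simp add: neck_def cutoff_eq_0[OF neck_ok_cutoff])

lemma neck_0: "neck_ok \<eta> \<delta> \<Longrightarrow> neck \<eta> \<delta> 0 = \<eta>"
  by (simp add: neck_def cutoff_eq_1[OF neck_ok_cutoff])

lemma neck_ge: "neck_ok \<eta> \<delta> \<Longrightarrow> t \<ge> 0 \<Longrightarrow> neck \<eta> \<delta> t \<ge> \<eta>"
  using neck_mono_le[of \<eta> \<delta> 0 t] by (simp add: neck_0)

lemma neck_pos: "neck_ok \<eta> \<delta> \<Longrightarrow> t \<ge> 0 \<Longrightarrow> neck \<eta> \<delta> t > 0"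
  using neck_ge[of \<eta> \<delta> t] by (auto simp: neck_ok_def)

lemma smooth_step_half: "smooth_step (1/2) = 1/2"
  using smooth_step_denom[of "1/2"] by (simp add: smooth_step_def)

lemma smooth_step_mono: "s \<le> t \<Longrightarrow> smooth_step s \<le> smooth_step t"
  by (rule DERIV_nonneg_imp_nondecreasing) (use smooth_step_has_derivative smooth_step'_nonneg in blast)+

text \<open>Along the tube, with axial coordinate a, \<tau> a is the radius assigned in the target
  disc. At the left end it is the radius -a of the cone itself, at the right end the radius l / a
  with l = \<eta> / 2 after inversion. The parametrisation by \<tau> joins the two
  identifications.\<close>

lemma neck_profile:
  assumes ok: "neck_ok \<eta> \<delta>"
  obtains \<tau> \<sigma> where "\<And>a. \<tau> a > 0" "\<And>a b. a < b \<Longrightarrow> \<tau> b < \<tau> a" "\<And>a. a \<le> -\<delta> \<Longrightarrow> \<tau> a = - a"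
    "\<And>a. a \<ge> \<delta> \<Longrightarrow> \<tau> a = \<eta> / 2 / a" "diffeo {- (2 * \<delta>)<..<2 * \<delta>} {\<eta> / (4 * \<delta>)<..<2 * \<delta>} \<tau> \<sigma>"
proof -
  have \<delta>: "\<delta> > 0" and \<eta>: "\<eta> > 0" using ok by (auto simp: neck_ok_def)
  define l where "l = \<eta> / 2"
  have l: "l > 0" using \<eta> by (simp add: l_def)
  define q where "q a = ln (neck \<eta> \<delta> (a\<^sup>2)) / 2" for a
  define \<psi> where "\<psi> a = smooth_step ((a + \<delta>) / (2 * \<delta>))" for a
  \<comment> \<open>The interpolation is done for logarithms, from q to ln l - q. It decreases
    because the factor 1 - 2 \<psi> has the sign opposite to q', and because l lies below every
    value of \<open>neck\<close>, so ln l < 2 q.\<close>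
  define E where "E a = q a * (1 - 2 * \<psi> a) + \<psi> a * ln l" for a
  define \<tau> where "\<tau> a = exp (E a)" for a
  have npos: "neck \<eta> \<delta> (a\<^sup>2) > 0" for a using neck_pos[OF ok] by simp
  define q' where "q' a = a * (1 + \<eta> * cutoff' (\<delta>\<^sup>2 / 4) (\<delta>\<^sup>2) (a\<^sup>2)) / neck \<eta> \<delta> (a\<^sup>2)" for a
  define \<psi>' where "\<psi>' a = smooth_step' ((a + \<delta>) / (2 * \<delta>)) / (2 * \<delta>)" for a
  have dsq: "((\<lambda>a::real. a\<^sup>2) has_real_derivative 2 * a) (at a)" for a by (auto intro!: derivative_eq_intros)
  have dq: "(q has_real_derivative q' a) (at a)" for a
  proof -
    have 1: "((\<lambda>a. neck \<eta> \<delta> (a\<^sup>2)) has_real_derivative ((1 + \<eta> * cutoff' (\<delta>\<^sup>2 / 4) (\<delta>\<^sup>2) (a\<^sup>2)) * (2 * a))) (at a)"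
      by (rule DERIV_chain2[OF neck_has_derivative[OF ok] dsq])
    show ?thesis unfolding q_def[abs_def] q'_def
      by (rule DERIV_cong[OF DERIV_cdivide[OF DERIV_chain2[OF DERIV_ln_divide[OF npos] 1]]])
        (use npos[of a] in \<open>simp add: field_simps\<close>)
  qed
  have d\<psi>: "(\<psi> has_real_derivative \<psi>' a) (at a)" for a
  proof -
    have 1: "((\<lambda>a. (a + \<delta>) / (2 * \<delta>)) has_real_derivative (1 / (2 * \<delta>))) (at a)"
      using \<delta> by (auto intro!: derivative_eq_intros)
    show ?thesis unfolding \<psi>_def[abs_def] \<psi>'_def
      by (rule DERIV_cong[OF DERIV_chain2[OF smooth_step_has_derivative 1]]) simp
  qed
  have dE: "(E has_real_derivative (q' a * (1 - 2 * \<psi> a) + \<psi>' a * (ln l - 2 * q a))) (at a)" for a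
    unfolding E_def[abs_def] by (rule derivative_eq_intros dq d\<psi> refl)+ (simp add: algebra_simps)
  have E'neg: "q' a * (1 - 2 * \<psi> a) + \<psi>' a * (ln l - 2 * q a) < 0" for a
  proof -
    have qs: "a < 0 \<Longrightarrow> q' a < 0" "a > 0 \<Longrightarrow> q' a > 0" "a = 0 \<Longrightarrow> q' a = 0"
      using neck_derivative_pos[OF ok, of "a\<^sup>2"] npos[of a]
      by (auto simp: q'_def divide_neg_pos mult_neg_pos)
    have \<psi>h: "a \<le> 0 \<Longrightarrow> \<psi> a \<le> 1/2" "a \<ge> 0 \<Longrightarrow> \<psi> a \<ge> 1/2"
      using smooth_step_mono[of "(a + \<delta>) / (2 * \<delta>)" "1/2"] smooth_step_mono[of "1/2" "(a + \<delta>) / (2 * \<delta>)"] \<delta>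
      by (auto simp: \<psi>_def smooth_step_half field_simps)
    have 1: "q' a * (1 - 2 * \<psi> a) \<le> 0"
      using qs \<psi>h by (cases "a = 0"; cases "a < 0") (auto simp: mult_nonneg_nonpos mult_nonpos_nonneg)
    have "l < neck \<eta> \<delta> (a\<^sup>2)" using neck_ge[OF ok, of "a\<^sup>2"] \<eta> by (simp add: l_def)
    then have 2: "ln l - 2 * q a < 0" using l npos[of a] by (simp add: q_def)
    have \<psi>'0: "\<psi>' a \<ge> 0" using \<delta> by (simp add: \<psi>'_def smooth_step'_nonneg)
    then have 3: "\<psi>' a * (ln l - 2 * q a) \<le> 0" using 2 by (simp add: mult_nonneg_nonpos)
    consider "\<bar>a\<bar> < \<delta>" | "a \<le> -\<delta>" | "a \<ge> \<delta>" by linarith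
    then show ?thesis
    proof cases
      case 1
      then have "\<psi>' a > 0" using \<delta> by (auto simp: \<psi>'_def field_simps abs_less_iff intro!: divide_pos_pos smooth_step'_pos)
      then have "\<psi>' a * (ln l - 2 * q a) < 0" using 2 by (simp add: mult_pos_neg)
      then show ?thesis using \<open>q' a * (1 - 2 * \<psi> a) \<le> 0\<close> by linarith
    next
      case 2
      then have "\<psi> a = 0" using \<delta> by (auto simp: \<psi>_def field_simps intro!: smooth_step_le_0)
      then show ?thesis using 3 qs 2 \<delta> by auto
    next
      case 3
      then have "\<psi> a = 1" using \<delta> by (auto simp: \<psi>_def field_simps intro!: smooth_step_ge_1)
      then show ?thesis using \<open>\<psi>' a * (ln l - 2 * q a) \<le> 0\<close> qs 3 \<delta> by auto
    qed
  qed
  have Emono: "E b < E a" if "a < b" for a b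
    by (rule DERIV_neg_imp_decreasing[OF that]) (use dE E'neg in blast)
  have \<tau>mono: "\<tau> b < \<tau> a" if "a < b" for a b using Emono[OF that] by (simp add: \<tau>_def)
  have qA: "exp (q a) = \<bar>a\<bar>" if "\<bar>a\<bar> \<ge> \<delta>" for a
  proof -
    have "a\<^sup>2 \<ge> \<delta>\<^sup>2" using power_mono[OF that, of 2] \<delta> by simp
    then have "q a = ln (\<bar>a\<bar>\<^sup>2) / 2" by (simp only: q_def neck_eq[OF ok] power2_abs)
    also have "\<dots> = ln \<bar>a\<bar>" using that \<delta> by (subst ln_realpow) auto
    finally show ?thesis using that \<delta> by simp
  qed
  have \<tau>l: "\<tau> a = - a" if "a \<le> -\<delta>" for a
  proof -
    have "\<psi> a = 0" using that \<delta> by (auto simp: \<psi>_def field_simps intro!: smooth_step_le_0)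
    then show ?thesis using qA[of a] that \<delta> by (simp add: \<tau>_def E_def)
  qed
  have \<tau>r: "\<tau> a = l / a" if "a \<ge> \<delta>" for a
  proof -
    have "\<psi> a = 1" using that \<delta> by (auto simp: \<psi>_def field_simps intro!: smooth_step_ge_1)
    then have "\<tau> a = exp (ln l - q a)" by (simp add: \<tau>_def E_def)
    then show ?thesis using qA[of a] that \<delta> l by (simp add: exp_diff)
  qed
  have s\<tau>: "smooth_at \<tau> a" for a unfolding \<tau>_def[abs_def] E_def q_def \<psi>_def
    using \<delta> npos by (intro smooth_intros ok) auto
  have d\<tau>: "frechet_derivative \<tau> (at a) v = (\<tau> a * (q' a * (1 - 2 * \<psi> a) + \<psi>' a * (ln l - 2 * q a))) * v" for a v
  proof -
    have "(\<tau> has_real_derivative (\<tau> a * (q' a * (1 - 2 * \<psi> a) + \<psi>' a * (ln l - 2 * q a)))) (at a)"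
      unfolding \<tau>_def[abs_def] by (rule DERIV_fun_exp[OF dE])
    then show ?thesis unfolding has_field_derivative_def by (simp add: frechet_derivative_at[symmetric])
  qed
  define S where "S = {- (2 * \<delta>)<..<2 * \<delta>}"
  have inj: "inj_on \<tau> S"
    by (rule inj_onI) (metis \<tau>mono less_irrefl linorder_neqE_linordered_idom)
  have dS: "diffeo S (\<tau> ` S) \<tau> (inv_into S \<tau>)"
  proof (rule diffeo_openI(1)[OF _ inj s\<tau>])
    show "open S" by (simp add: S_def)
    show "v = 0" if "frechet_derivative \<tau> (at x) v = 0" for x v
      using that E'neg[of x] by (simp add: d\<tau>) (simp add: \<tau>_def)
  qed
  have im: "\<tau> ` S = {\<eta> / (4 * \<delta>)<..<2 * \<delta>}"
  proof
    have e: "\<tau> (- (2 * \<delta>)) = 2 * \<delta>" "\<tau> (2 * \<delta>) = \<eta> / (4 * \<delta>)" using \<tau>l[of "-(2*\<delta>)"] \<tau>r[of "2*\<delta>"] \<delta> by (auto simp: l_def)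
    show "\<tau> ` S \<subseteq> {\<eta> / (4 * \<delta>)<..<2 * \<delta>}"
      using \<tau>mono[of "-(2*\<delta>)"] \<tau>mono[of _ "2*\<delta>"] e by (auto simp: S_def)
    show "{\<eta> / (4 * \<delta>)<..<2 * \<delta>} \<subseteq> \<tau> ` S"
    proof
      fix t assume t: "t \<in> {\<eta> / (4 * \<delta>)<..<2 * \<delta>}"
      have "\<forall>x. - (2 * \<delta>) \<le> x \<and> x \<le> 2 * \<delta> \<longrightarrow> isCont \<tau> x" using s\<tau> smooth_at_isCont by blast
      then obtain x where x: "- (2 * \<delta>) \<le> x" "x \<le> 2 * \<delta>" "\<tau> x = t"
        using IVT2[of \<tau> "2 * \<delta>" t "- (2 * \<delta>)"] e t \<delta> by auto
      then have "x \<noteq> - (2 * \<delta>)" "x \<noteq> 2 * \<delta>" using e t by auto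
      then show "t \<in> \<tau> ` S" using x by (auto simp: S_def)
    qed
  qed
  show ?thesis
  proof (rule that[of \<tau> "inv_into S \<tau>"])
    show "\<tau> a > 0" for a by (simp add: \<tau>_def)
    show "diffeo {- (2 * \<delta>)<..<2 * \<delta>} {\<eta> / (4 * \<delta>)<..<2 * \<delta>} \<tau> (inv_into S \<tau>)"
      using dS unfolding im unfolding S_def[symmetric] .
  qed (use \<tau>mono \<tau>l \<tau>r in \<open>auto simp: l_def\<close>)
qed

lemma diffeo_graph:
  assumes e: "norm e = 1" and s: "\<And>x. x \<in> X \<Longrightarrow> smooth_at \<phi> x" and X: "X \<subseteq> hyp e"
  shows "diffeo X ((\<lambda>u. u + \<phi> u *\<^sub>R e) ` X) (\<lambda>u. u + \<phi> u *\<^sub>R e) (proj e)"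
proof -
  have p: "proj e (u + a *\<^sub>R e) = u" if "u \<in> X" for u a
    using that X e by (auto simp: proj_def hyp_def inner_add_left norm_eq_1_inner)
  show ?thesis
    by (rule diffeoI) (use p s in \<open>auto intro!: smooth_map_on_smooth_at smooth_intros\<close>)
qed

text \<open>\<open>C2\<close> without a point is a hyperplane, with the removed cap near infinity.
  So \<open>C2\<close> minus a cap is a disc, and tube plus disc fill exactly the hole left by the
  cap removed from \<open>Lm - C2\<close>. The three pieces of \<open>Lp\<close> (left part, tube,
  rest of \<open>C2\<close>) are mapped by the identity, by the neck profile and by the chart
  \<kappa>, and then glued.\<close>

theorem remove_sphere_summand:
  fixes e :: "'a::euclidean_space"
  assumes e: "norm e = 1" and ok: "neck_ok \<eta> \<delta>"
    and Lp: "\<And>x. \<bar>x \<bullet> e\<bar> < 3 * \<delta> \<Longrightarrow> norm (proj e x) < 3 * \<delta> \<Longrightarrow>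
      x \<in> Lp \<longleftrightarrow> (norm (proj e x))\<^sup>2 = neck \<eta> \<delta> ((x \<bullet> e)\<^sup>2)"
    and Lm: "\<And>x. \<bar>x \<bullet> e\<bar> < 3 * \<delta> \<Longrightarrow> norm (proj e x) < 3 * \<delta> \<Longrightarrow>
      x \<in> Lm \<longleftrightarrow> (x \<bullet> e)\<^sup>2 = neck \<eta> \<delta> ((norm (proj e x))\<^sup>2)"
    and out: "\<And>x. \<not> (\<bar>x \<bullet> e\<bar> < 2 * \<delta> \<and> norm (proj e x) < 2 * \<delta>) \<Longrightarrow> x \<in> Lp \<longleftrightarrow> x \<in> Lm"
    and cL: "closed Lm" and C2: "openin (top_of_set Lm) C2" "closed C2"
    and right: "\<And>x. x \<in> Lm \<Longrightarrow> 0 < x \<bullet> e \<Longrightarrow> x \<bullet> e < 3 * \<delta> \<Longrightarrow> norm (proj e x) < 3 * \<delta> \<Longrightarrow> x \<in> C2"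
    and left: "\<And>x. x \<in> Lm \<Longrightarrow> x \<bullet> e < 0 \<Longrightarrow> - (3 * \<delta>) < x \<bullet> e \<Longrightarrow> norm (proj e x) < 3 * \<delta> \<Longrightarrow> x \<notin> C2"
    and sph: "diffeomorphic_sets C2 (sphere (0::'a) 1)"
  shows "diffeomorphic_sets Lp (Lm - C2)"
proof -
  have \<delta>: "\<delta> > 0" and \<eta>: "\<eta> > 0" "\<eta> \<le> \<delta>\<^sup>2 / 4" using ok by (auto simp: neck_ok_def)
  have ee: "e \<bullet> e = 1" using e by (simp add: norm_eq_1_inner)
  define l where "l = \<eta> / 2"
  have l: "l > 0" "l < \<delta>\<^sup>2" using \<eta> by (auto simp: l_def)
  have l\<delta>: "l / \<delta> < \<delta>" using l \<delta> by (simp add: field_simps power2_eq_square)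
  \<comment> \<open>Height of the caps over the hyperplane; \<open>c\<close> and \<open>e1\<close>
    below parametrise the right and left cap as graphs of \<open>al\<close> and -
    \<open>al\<close>.\<close>
  define al where "al u = sqrt (neck \<eta> \<delta> (u \<bullet> u))" for u :: 'a
  have sal: "smooth_at al u" for u unfolding al_def[abs_def] by (intro smooth_intros ok neck_pos) auto
  have al0: "al u > 0" for u using neck_pos[OF ok] by (simp add: al_def)
  have al2: "(al u)\<^sup>2 = neck \<eta> \<delta> ((norm u)\<^sup>2)" for u
    using neck_pos[OF ok, of "u \<bullet> u"] by (simp add: al_def power2_norm_eq_inner)
  have aln: "al u = norm u" if "norm u \<ge> \<delta>" for u
  proof -
    have "(norm u)\<^sup>2 \<ge> \<delta>\<^sup>2" using that \<delta> by (simp add: power_mono)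
    then have "(al u)\<^sup>2 = (norm u)\<^sup>2" using al2 neck_eq[OF ok] by simp
    then show ?thesis using al0[of u] by (simp add: power2_eq_iff_nonneg)
  qed
  have neck_lt: "neck \<eta> \<delta> (t\<^sup>2) < b\<^sup>2" if "\<bar>t\<bar> < b" "\<delta> < b" for t b
  proof -
    have "\<bar>t\<bar>\<^sup>2 < b\<^sup>2" using that(1) by (intro power_strict_mono) auto
    then have "t\<^sup>2 < b\<^sup>2" by simp
    then have "neck \<eta> \<delta> (t\<^sup>2) < neck \<eta> \<delta> (b\<^sup>2)" by (rule neck_mono[OF ok])
    then show ?thesis using that \<delta> neck_eq[OF ok, of "b\<^sup>2"] by (simp add: power_mono)
  qed
  have allt: "al u < b" if "norm u < b" "\<delta> < b" for u b
  proof -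
    have "(al u)\<^sup>2 < b\<^sup>2" using neck_lt[of "norm u" b] that al2[of u] by simp
    then show ?thesis by (rule power_less_imp_less_base) (use that \<delta> in simp)
  qed
  define c where "c u = u + al u *\<^sub>R e" for u
  define e1 where "e1 u = u + (- al u) *\<^sub>R e" for u
  have pc: "proj e (c u) = u" "c u \<bullet> e = al u" "proj e (e1 u) = u" "e1 u \<bullet> e = - al u" if "u \<in> hyp e" for u
    using that ee by (auto simp: c_def e1_def proj_def hyp_def inner_add_left inner_diff_left)
  have in3: "c u \<in> C2" "e1 u \<in> Lm - C2" if u: "u \<in> hyp e" "norm u < 3 * \<delta>" for u
  proof -
    have a: "al u < 3 * \<delta>" using allt[OF u(2)] \<delta> by simp
    have "c u \<in> Lm" "e1 u \<in> Lm" using Lm[of "c u"] Lm[of "e1 u"] pc[OF u(1)] a al0[of u] u(2) al2 by auto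
    then show "c u \<in> C2" "e1 u \<in> Lm - C2" using right[of "c u"] left[of "e1 u"] pc[OF u(1)] a al0[of u] u(2) by auto
  qed
  have Lm3: "x = c (proj e x) \<or> x = e1 (proj e x)" if "x \<in> Lm" "\<bar>x \<bullet> e\<bar> < 3 * \<delta>" "norm (proj e x) < 3 * \<delta>" for x
  proof -
    have "(x \<bullet> e)\<^sup>2 = (al (proj e x))\<^sup>2" using Lm[OF that(2,3)] that(1) al2 by simp
    then have "x \<bullet> e = al (proj e x) \<or> x \<bullet> e = - al (proj e x)" by (simp add: power2_eq_iff)
    then show ?thesis using proj_decomp[of e x] unfolding c_def e1_def by metis
  qed
  have C2L: "C2 \<subseteq> Lm" using C2(1) openin_imp_subset by blast
  define B where "B = hyp e \<inter> ball 0 (3 * \<delta>)"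
  have dc: "diffeo B (c ` B) c (proj e)" unfolding c_def[abs_def]
    by (rule diffeo_graph[OF e sal]) (auto simp: B_def)
  have opB: "openin (top_of_set C2) (c ` B)"
  proof -
    define O' where "O' = {x. 0 < x \<bullet> e \<and> x \<bullet> e < 3 * \<delta> \<and> norm (proj e x) < 3 * \<delta>}"
    have "open O'" unfolding O'_def
      by (intro open_Collect_conj open_Collect_less continuous_intros continuous_on_proj)
    moreover have "c ` B = C2 \<inter> O'"
    proof
      show "c ` B \<subseteq> C2 \<inter> O'" using in3 pc al0 allt \<delta> by (auto simp: B_def O'_def)
      show "C2 \<inter> O' \<subseteq> c ` B"
      proof
        fix x assume x: "x \<in> C2 \<inter> O'"
        then have "x = c (proj e x) \<or> x = e1 (proj e x)" using Lm3[of x] C2L by (auto simp: O'_def)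
        moreover have "x \<noteq> e1 (proj e x)" using pc(4)[OF proj_in_hyp[OF e], of x] al0[of "proj e x"] x by (auto simp: O'_def)
        ultimately show "x \<in> c ` B" using x proj_in_hyp[OF e, of x] by (auto simp: O'_def B_def)
      qed
    qed
    ultimately show ?thesis by (auto simp: openin_open)
  qed
  obtain \<theta> \<theta>' where \<theta>: "diffeo C2 (sphere (0::'a) 1) \<theta> \<theta>'" using sph diffeomorphic_sets_iff by blast
  obtain \<kappa>0 \<kappa>0' where \<kappa>0: "diffeo (C2 - {c 0}) (hyp e) \<kappa>0 \<kappa>0'"
    "\<And>y. y \<in> hyp e \<Longrightarrow> y \<noteq> 0 \<Longrightarrow> norm y \<le> 2 * \<delta> \<Longrightarrow> \<kappa>0 (c y) = y /\<^sub>R (y \<bullet> y)"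
    using punctured_sphere_chart[OF e \<theta> dc[unfolded B_def] opB[unfolded B_def], of "2 * \<delta>"] \<delta> by auto
  \<comment> \<open>After scaling by l, the cap is inverted by y |-> l y / |y|^2. The resulting
    radius l / |y| matches the right end of the profile \<tau>.\<close>
  define \<kappa> where "\<kappa> x = l *\<^sub>R \<kappa>0 x" for x
  define \<kappa>' where "\<kappa>' u = \<kappa>0' (inverse l *\<^sub>R u)" for u
  have dsc: "diffeo (hyp e) (hyp e) (\<lambda>x. l *\<^sub>R x) (\<lambda>x. inverse l *\<^sub>R x)"
    by (rule diffeoI) (use l in \<open>auto simp: hyp_def intro!: smooth_map_on_smooth_at smooth_intros\<close>)
  have d\<kappa>: "diffeo (C2 - {c 0}) (hyp e) \<kappa> \<kappa>'" unfolding \<kappa>_def[abs_def] \<kappa>'_def[abs_def]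
    by (rule diffeo_trans[OF \<kappa>0(1) dsc])
  have \<kappa>c: "\<kappa> (c y) = (l / (norm y)\<^sup>2) *\<^sub>R y" if "y \<in> hyp e" "y \<noteq> 0" "norm y \<le> 2 * \<delta>" for y
    using \<kappa>0(2)[OF that] by (simp add: \<kappa>_def power2_norm_eq_inner divide_inverse)
  have n\<kappa>c: "norm (\<kappa> (c y)) = l / norm y" if "y \<in> hyp e" "y \<noteq> 0" "norm y \<le> 2 * \<delta>" for y
    using \<kappa>c[OF that] l that(2) by (simp add: power2_eq_square)
  define Q where "Q = {x. \<bar>x \<bullet> e\<bar> < 2 * \<delta> \<and> norm (proj e x) < 2 * \<delta>}"
  have oQ: "open Q" unfolding Q_def by (intro open_Collect_conj open_Collect_less continuous_intros continuous_on_proj)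
  have ph: "proj e x \<in> hyp e" for x by (rule proj_in_hyp[OF e])
  \<comment> \<open>\<open>F1\<close> and \<open>F2\<close> are the closed discs of radius \<delta>
    cut out of the left and the right cap. The sources \<open>V1\<close>, \<open>VT\<close>,
    \<open>V2\<close> cover \<open>Lp\<close>; the targets \<open>V1\<close>, the annulus
    \<open>WT\<close> and the disc \<open>W2\<close> cover \<open>Lm - C2\<close>.\<close>
  define F1 where "F1 = e1 ` (hyp e \<inter> cball 0 \<delta>)"
  define F2 where "F2 = c ` (hyp e \<inter> cball 0 \<delta>)"
  define V1 where "V1 = (Lm - C2) - F1"
  define V2 where "V2 = C2 - F2"
  define VT where "VT = Lp \<inter> Q"
  define W2 where "W2 = e1 ` (hyp e \<inter> ball 0 (l / \<delta>))"
  define WT where "WT = e1 ` {u \<in> hyp e. l / (2 * \<delta>) < norm u \<and> norm u < 2 * \<delta>}"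
  have F2B: "F2 \<subseteq> c ` B" using \<delta> by (auto simp: F2_def B_def)
  obtain \<tau> \<sigma> where \<tau>: "\<And>a. \<tau> a > 0" "\<And>a b. a < b \<Longrightarrow> \<tau> b < \<tau> a" "\<And>a. a \<le> -\<delta> \<Longrightarrow> \<tau> a = - a"
    "\<And>a. a \<ge> \<delta> \<Longrightarrow> \<tau> a = l / a" "diffeo {- (2 * \<delta>)<..<2 * \<delta>} {l / (2 * \<delta>)<..<2 * \<delta>} \<tau> \<sigma>"
    using neck_profile[OF ok] by (auto simp: l_def)
  define A where "A a = sqrt (neck \<eta> \<delta> (a\<^sup>2))" for a
  have sA: "smooth_at A a" for a unfolding A_def[abs_def] by (intro smooth_intros ok neck_pos) auto
  have A0: "A a > 0" for a using neck_pos[OF ok] by (simp add: A_def)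
  have An: "A a = \<bar>a\<bar>" if "\<bar>a\<bar> \<ge> \<delta>" for a
    using power_mono[OF that, of 2] \<delta> by (simp add: A_def neck_eq[OF ok])
  have Alt: "A a < b" if "\<bar>a\<bar> < b" "\<delta> < b" for a b
    using neck_lt[OF that] \<delta> that by (simp add: A_def real_less_lsqrt)
  have VTn: "norm (proj e x) = A (x \<bullet> e)" if "x \<in> VT" for x
  proof -
    have "(norm (proj e x))\<^sup>2 = neck \<eta> \<delta> ((x \<bullet> e)\<^sup>2)" using that Lp[of x] \<delta> by (auto simp: VT_def Q_def)
    then show ?thesis using real_sqrt_unique[of "norm (proj e x)"] by (simp add: A_def)
  qed
  have VTI: "x \<in> VT" if "\<bar>x \<bullet> e\<bar> < 2 * \<delta>" "norm (proj e x) = A (x \<bullet> e)" for x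
  proof -
    have n: "norm (proj e x) < 2 * \<delta>" using Alt[OF that(1)] \<delta> that(2) by simp
    have "(norm (proj e x))\<^sup>2 = neck \<eta> \<delta> ((x \<bullet> e)\<^sup>2)"
      unfolding that(2) A_def using neck_pos[OF ok, of "(x \<bullet> e)\<^sup>2"] by simp
    then show ?thesis using Lp[of x] that(1) n \<delta> by (auto simp: VT_def Q_def)
  qed
  \<comment> \<open>The transverse direction is kept, and the axial coordinate is turned into a
    radius on the left cap by \<tau>.\<close>
  define hT where "hT x = e1 ((\<tau> (x \<bullet> e) / norm (proj e x)) *\<^sub>R proj e x)" for x
  define kT where "kT w = (A (\<sigma> (norm (proj e w))) / norm (proj e w)) *\<^sub>R proj e w + \<sigma> (norm (proj e w)) *\<^sub>R e" for w
  have se1: "smooth_at e1 u" for u unfolding e1_def[abs_def] by (intro smooth_intros sal)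
  note \<tau>d = diffeoD[OF \<tau>(5)]
  have hyps: "a *\<^sub>R proj e x \<in> hyp e" for a x using ph[of x] by (simp add: hyp_def)
  have nhT: "proj e (hT x) = (\<tau> (x \<bullet> e) / norm (proj e x)) *\<^sub>R proj e x" for x unfolding hT_def by (rule pc(3)[OF hyps])
  have dT: "diffeo VT WT hT kT"
  proof (rule diffeoI)
    fix x assume x: "x \<in> VT"
    have a: "x \<bullet> e \<in> {- (2 * \<delta>)<..<2 * \<delta>}" using x by (auto simp: VT_def Q_def)
    have n: "norm (proj e x) > 0" using VTn[OF x] A0 by simp
    have nn: "norm ((\<tau> (x \<bullet> e) / norm (proj e x)) *\<^sub>R proj e x) = \<tau> (x \<bullet> e)" using n \<tau>(1)[of "x \<bullet> e"] by simp
    then show "hT x \<in> WT" unfolding hT_def WT_def using \<tau>d(1)[OF a] hyps by (intro imageI) simp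
    have "\<sigma> (norm (proj e (hT x))) = x \<bullet> e" unfolding nhT nn by (rule \<tau>d(3)[OF a])
    then have "kT (hT x) = (A (x \<bullet> e) / \<tau> (x \<bullet> e)) *\<^sub>R ((\<tau> (x \<bullet> e) / norm (proj e x)) *\<^sub>R proj e x) + (x \<bullet> e) *\<^sub>R e"
      unfolding kT_def nhT nn by simp
    also have "\<dots> = proj e x + (x \<bullet> e) *\<^sub>R e" using VTn[OF x] A0[of "x \<bullet> e"] \<tau>(1)[of "x \<bullet> e"] by simp
    finally show "kT (hT x) = x" by (simp add: proj_decomp)
  next
    fix w assume "w \<in> WT"
    then obtain u where u: "u \<in> hyp e" "l / (2 * \<delta>) < norm u" "norm u < 2 * \<delta>" "w = e1 u" by (auto simp: WT_def)
    have un: "norm u > 0" using u(2) l \<delta> by (meson divide_pos_pos less_trans mult_pos_pos zero_less_numeral)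
    have pw: "proj e w = u" using pc(3) u by simp
    define a where "a = \<sigma> (norm u)"
    have a: "a \<in> {- (2 * \<delta>)<..<2 * \<delta>}" "\<tau> a = norm u" using \<tau>d(2,4)[of "norm u"] u by (auto simp: a_def)
    have kw: "kT w = (A a / norm u) *\<^sub>R u + a *\<^sub>R e" by (simp add: kT_def pw a_def)
    have h: "(A a / norm u) *\<^sub>R u \<in> hyp e" using u by (simp add: hyp_def)
    have k: "proj e (kT w) = (A a / norm u) *\<^sub>R u" "kT w \<bullet> e = a"
      unfolding kw using h ee by (auto simp: proj_def hyp_def inner_add_left)
    have nk: "norm (proj e (kT w)) = A a" unfolding k using un A0[of a] by simp
    show "kT w \<in> VT" by (rule VTI) (use a nk k in auto)
    show "hT (kT w) = w" unfolding hT_def nk unfolding k using a un A0[of a] u by simp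
  next
    have n0: "proj e x \<noteq> 0" if "x \<in> VT" for x using VTn[OF that] A0[of "x \<bullet> e"] by auto
    have sT: "smooth_map_on VT (\<lambda>x. \<tau> (x \<bullet> e))"
      by (rule smooth_map_on_compose[OF _ _ \<tau>d(5)])
        (auto simp: VT_def Q_def intro!: smooth_map_on_smooth_at smooth_intros)
    \<comment> \<open>Smoothness of \<tau> is available only as a map of its interval. Pairing its
      value with x reduces \<open>hT\<close> to a formula that is smooth in the ambient
      space.\<close>
    have "smooth_map_on VT (\<lambda>x. (\<tau> (x \<bullet> e), x))"
    proof (rule smooth_map_onI)
      fix x assume "x \<in> VT"
      then obtain g U where g: "open U" "x \<in> U" "smooth_at g x" "\<forall>y\<in>VT \<inter> U. g y = \<tau> (y \<bullet> e)" using smooth_map_onD[OF sT] by blast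
      then show "\<exists>g U. open U \<and> x \<in> U \<and> smooth_at g x \<and> (\<forall>y\<in>VT \<inter> U. g y = (\<tau> (y \<bullet> e), y))"
        by (intro exI[of _ "\<lambda>x. (g x, x)"] exI[of _ U]) (auto intro!: smooth_intros)
    qed
    moreover have "smooth_map_on (UNIV \<times> VT) (\<lambda>p. e1 ((fst p / norm (proj e (snd p))) *\<^sub>R proj e (snd p)))"
    proof (rule smooth_map_on_smooth_at)
      fix p :: "real \<times> 'a" assume "p \<in> UNIV \<times> VT"
      then have "proj e (snd p) \<noteq> 0" using n0 by auto
      then show "smooth_at (\<lambda>p. e1 ((fst p / norm (proj e (snd p))) *\<^sub>R proj e (snd p))) p"
        by (intro smooth_at_compose[of _ p e1] se1 smooth_intros) auto
    qed
    ultimately show "smooth_map_on VT hT" unfolding hT_def[abs_def]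
      using smooth_map_on_compose[of VT "\<lambda>x. (\<tau> (x \<bullet> e), x)" "UNIV \<times> VT"] by force
  next
    have W: "l / (2 * \<delta>) < norm (proj e w)" "norm (proj e w) < 2 * \<delta>" "proj e w \<noteq> 0" if w: "w \<in> WT" for w
    proof -
      show 1: "l / (2 * \<delta>) < norm (proj e w)" "norm (proj e w) < 2 * \<delta>" using w pc(3) by (auto simp: WT_def)
      have "0 < l / (2 * \<delta>)" using l \<delta> by simp
      then show "proj e w \<noteq> 0" using 1 by auto
    qed
    have "smooth_map_on WT (\<lambda>w. norm (proj e w))"
      by (rule smooth_map_on_smooth_at) (use W in \<open>auto intro!: smooth_intros\<close>)
    then have sS: "smooth_map_on WT (\<lambda>w. \<sigma> (norm (proj e w)))"
      by (rule smooth_map_on_compose[OF _ _ \<tau>d(6)]) (use W in auto)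
    have "smooth_map_on WT (\<lambda>x. (\<sigma> (norm (proj e x)), x))"
    proof (rule smooth_map_onI)
      fix x assume "x \<in> WT"
      then obtain g U where g: "open U" "x \<in> U" "smooth_at g x" "\<forall>y\<in>WT \<inter> U. g y = \<sigma> (norm (proj e y))" using smooth_map_onD[OF sS] by blast
      then show "\<exists>g U. open U \<and> x \<in> U \<and> smooth_at g x \<and> (\<forall>y\<in>WT \<inter> U. g y = (\<sigma> (norm (proj e y)), y))"
        by (intro exI[of _ "\<lambda>x. (g x, x)"] exI[of _ U]) (auto intro!: smooth_intros)
    qed
    moreover have "smooth_map_on (UNIV \<times> WT) (\<lambda>p. (A (fst p) / norm (proj e (snd p))) *\<^sub>R proj e (snd p) + fst p *\<^sub>R e)"
    proof (rule smooth_map_on_smooth_at)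
      fix p :: "real \<times> 'a" assume "p \<in> UNIV \<times> WT"
      then have "proj e (snd p) \<noteq> 0" using W by auto
      moreover have "smooth_at (\<lambda>p::real \<times> 'a. A (fst p)) p" by (intro smooth_at_compose[of fst p A] sA smooth_intros)
      ultimately show "smooth_at (\<lambda>p. (A (fst p) / norm (proj e (snd p))) *\<^sub>R proj e (snd p) + fst p *\<^sub>R e) p"
        by (intro smooth_intros) auto
    qed
    ultimately show "smooth_map_on WT kT" unfolding kT_def[abs_def]
      using smooth_map_on_compose[of WT "\<lambda>x. (\<sigma> (norm (proj e x)), x)" "UNIV \<times> WT"] by force
  qed
  have c0F2: "c 0 \<in> F2" using \<delta> by (auto simp: F2_def hyp_def)
  have \<kappa>V2: "norm (\<kappa> x) < l / \<delta>" if x: "x \<in> V2" for x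
  proof (rule ccontr)
    assume a: "\<not> norm (\<kappa> x) < l / \<delta>"
    have xC: "x \<in> C2 - {c 0}" using x c0F2 by (auto simp: V2_def)
    define u where "u = \<kappa> x"
    have uh: "u \<in> hyp e" using diffeoD(1)[OF d\<kappa> xC] by (simp add: u_def)
    have "0 < l / \<delta>" using l \<delta> by simp
    then have nu: "norm u \<ge> l / \<delta>" "norm u > 0" using a unfolding u_def[symmetric] by linarith+
    \<comment> \<open>The inversion of \<open>u\<close>: if |u| is at least l / \<delta>, then
      \<open>c y\<close> lies in \<open>F2\<close> and has the same image as
      \<open>x\<close>.\<close>
    define y where "y = (l / (norm u)\<^sup>2) *\<^sub>R u"
    have ny: "norm y = l / norm u" using nu l by (simp add: y_def power2_eq_square)
    have yd: "norm y \<le> \<delta>" using nu l \<delta> by (simp add: ny field_simps)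
    have y: "y \<in> hyp e" "y \<noteq> 0" using uh nu l by (auto simp: y_def hyp_def)
    have "\<kappa> (c y) = (l / (l / norm u)\<^sup>2) *\<^sub>R ((l / (norm u)\<^sup>2) *\<^sub>R u)" using \<kappa>c[OF y] yd \<delta> unfolding ny by (simp add: y_def)
    also have "\<dots> = u" using nu l by (simp add: field_simps power2_eq_square)
    finally have "\<kappa> (c y) = \<kappa> x" by (simp add: u_def)
    moreover have "c y \<in> C2 - {c 0}" using in3(1)[OF y(1)] yd \<delta> y pc(1)[OF y(1)] pc(1)[of 0] by (auto simp: hyp_def)
    ultimately have "c y = x" using diffeoD(3)[OF d\<kappa>] xC by metis
    moreover have "c y \<in> F2" using y yd by (auto simp: F2_def)
    ultimately show False using x by (simp add: V2_def)
  qed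
  have \<kappa>W2: "\<kappa>' u \<in> V2" if u: "u \<in> hyp e" "norm u < l / \<delta>" for u
  proof -
    have k: "\<kappa>' u \<in> C2 - {c 0}" "\<kappa> (\<kappa>' u) = u" using diffeoD(2,4)[OF d\<kappa> u(1)] by auto
    have "\<kappa>' u \<notin> F2"
    proof
      assume "\<kappa>' u \<in> F2"
      then obtain y where y: "y \<in> hyp e" "norm y \<le> \<delta>" "\<kappa>' u = c y" by (auto simp: F2_def)
      then have y0: "y \<noteq> 0" using k by auto
      then have "norm u = l / norm y" using n\<kappa>c[OF y(1)] y k \<delta> by auto
      moreover have "l / \<delta> \<le> l / norm y" using y(2) y0 l \<delta> by (intro divide_left_mono) auto
      ultimately show False using u(2) by simp
    qed
    then show ?thesis using k by (simp add: V2_def)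
  qed
  have d2: "diffeo V2 W2 (\<lambda>x. e1 (\<kappa> x)) (\<lambda>w. \<kappa>' (proj e w))"
  proof -
    have 1: "diffeo V2 (hyp e \<inter> ball 0 (l / \<delta>)) \<kappa> \<kappa>'"
    proof (rule diffeo_subset[OF d\<kappa>])
      show "\<kappa> x \<in> hyp e \<inter> ball 0 (l / \<delta>)" if "x \<in> V2" for x
        using \<kappa>V2[OF that] diffeoD(1)[OF d\<kappa>, of x] that c0F2 by (auto simp: V2_def)
    qed (use \<kappa>W2 c0F2 in \<open>auto simp: V2_def\<close>)
    have 2: "diffeo (hyp e \<inter> ball 0 (l / \<delta>)) W2 e1 (proj e)"
      unfolding W2_def e1_def[abs_def] by (rule diffeo_graph[OF e]) (auto intro!: smooth_intros sal)
    show ?thesis by (rule diffeo_trans[OF 1 2])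
  qed
  have dcp: "closed (C2 \<union> X)" if "closed X" for X using C2(2) that by blast
  have cF1: "closed F1"
  proof -
    have "compact (hyp e \<inter> cball 0 \<delta>)" using compact_Int_closed[OF compact_cball closed_hyp] by (simp add: Int_commute)
    moreover have "continuous_on (hyp e \<inter> cball 0 \<delta>) e1" by (rule smooth_at_continuous_on[OF se1])
    ultimately show ?thesis unfolding F1_def using compact_continuous_image compact_imp_closed by blast
  qed
  \<comment> \<open>Closed slabs that serve to write \<open>V1\<close> and \<open>V2\<close> as
    \<open>Lp\<close> minus a closed set, which gives their relative openness.\<close>
  define Z1 where "Z1 = {x. - \<delta> \<le> x \<bullet> e \<and> x \<bullet> e \<le> 3/2 * \<delta> \<and> norm (proj e x) \<le> 3/2 * \<delta>}"
  define Z2 where "Z2 = {x. - (3/2 * \<delta>) \<le> x \<bullet> e \<and> x \<bullet> e \<le> \<delta> \<and> norm (proj e x) \<le> 3/2 * \<delta>}"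
  have cZ: "closed Z1" "closed Z2" unfolding Z1_def Z2_def
    by (intro closed_Collect_conj closed_Collect_le continuous_intros continuous_on_proj)+
  have inQ: "x \<in> VT \<longleftrightarrow> x \<in> Lp" if "x \<in> Q" for x using that by (simp add: VT_def)
  have outQ: "x \<in> Lp \<longleftrightarrow> x \<in> Lm" if "x \<notin> Q" for x using out[of x] that by (auto simp: Q_def)
  have "c u \<in> Q \<and> e1 u \<in> Q" if "u \<in> hyp e" "norm u \<le> \<delta>" for u
    using pc[OF that(1)] allt[of u "2*\<delta>"] al0[of u] that(2) \<delta> by (auto simp: Q_def)
  then have F1Q: "F1 \<subseteq> Q" "F2 \<subseteq> Q" by (auto simp: F1_def F2_def)
  have LmQ: "x = c (proj e x) \<or> x = e1 (proj e x)" if "x \<in> Lm" "x \<in> Q" for x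
    using Lm3[OF that(1)] that(2) \<delta> by (auto simp: Q_def)
  have cal: "c (proj e x) \<bullet> e = al (proj e x)" "e1 (proj e x) \<bullet> e = - al (proj e x)" for x using pc ph by auto
  have VTl: "x = e1 (proj e x)" "norm (proj e x) = - (x \<bullet> e)" if x: "x \<in> VT" "x \<bullet> e < - \<delta>" for x
  proof -
    show n: "norm (proj e x) = - (x \<bullet> e)" using VTn[OF x(1)] An[of "x \<bullet> e"] x(2) \<delta> by simp
    then have "al (proj e x) = - (x \<bullet> e)" using aln[of "proj e x"] x(2) by simp
    then show "x = e1 (proj e x)" using proj_decomp[of e x] by (simp add: e1_def)
  qed
  have VTr: "x = c (proj e x)" "norm (proj e x) = x \<bullet> e" if x: "x \<in> VT" "x \<bullet> e > \<delta>" for x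
  proof -
    show n: "norm (proj e x) = x \<bullet> e" using VTn[OF x(1)] An[of "x \<bullet> e"] x(2) \<delta> by simp
    then have "al (proj e x) = x \<bullet> e" using aln[of "proj e x"] x(2) by simp
    then show "x = c (proj e x)" using proj_decomp[of e x] by (simp add: c_def)
  qed
  have A32: "A a \<le> 3/2 * \<delta>" if "\<bar>a\<bar> \<le> 3/2 * \<delta>" for a
  proof (cases "\<bar>a\<bar> \<ge> \<delta>")
    case True then show ?thesis using An that by simp
  next
    case False then show ?thesis using Alt[of a "3/2 * \<delta>"] \<delta> by simp
  qed
  have e1I: "e1 (proj e x) \<in> Lm - C2" "c (proj e x) \<in> C2" if "x \<in> Q" for x using in3[OF ph, of x] that \<delta> by (auto simp: Q_def)
  have V1Q: "x \<in> V1 \<longleftrightarrow> x \<in> VT \<and> x \<bullet> e < - \<delta>" if x: "x \<in> Q" for x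
  proof
    assume a: "x \<in> V1"
    then have xe: "x = e1 (proj e x)" using LmQ[OF _ x] e1I(2)[OF x] by (auto simp: V1_def)
    have n: "norm (proj e x) > \<delta>" using a xe ph[of x] by (force simp: V1_def F1_def)
    have "al (proj e x) = norm (proj e x)" using aln n by simp
    then have xn: "x \<bullet> e = - norm (proj e x)" using xe cal(2)[of x] by simp
    have "x \<in> VT"
    proof (rule VTI)
      show "\<bar>x \<bullet> e\<bar> < 2 * \<delta>" using x by (simp add: Q_def)
      show "norm (proj e x) = A (x \<bullet> e)" using An[of "x \<bullet> e"] xn n by simp
    qed
    then show "x \<in> VT \<and> x \<bullet> e < - \<delta>" using n xn by simp
  next
    assume a: "x \<in> VT \<and> x \<bullet> e < - \<delta>"
    then have xe: "x = e1 (proj e x)" "norm (proj e x) = - (x \<bullet> e)" using VTl by auto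
    have "x \<notin> F1" using pc(3) xe(2) a by (auto simp: F1_def)
    then show "x \<in> V1" using e1I(1)[OF x] xe(1) by (simp add: V1_def)
  qed
  have V2Q: "x \<in> V2 \<longleftrightarrow> x \<in> VT \<and> x \<bullet> e > \<delta>" if x: "x \<in> Q" for x
  proof
    assume a: "x \<in> V2"
    then have "x \<in> C2" by (simp add: V2_def)
    then have xe: "x = c (proj e x)" using LmQ[OF _ x] e1I(1)[OF x] C2L by (metis DiffD2 subsetD)
    have n: "norm (proj e x) > \<delta>" using a xe ph[of x] by (force simp: V2_def F2_def)
    have "al (proj e x) = norm (proj e x)" using aln n by simp
    then have xn: "x \<bullet> e = norm (proj e x)" using xe cal(1)[of x] by simp
    have "x \<in> VT"
    proof (rule VTI)
      show "\<bar>x \<bullet> e\<bar> < 2 * \<delta>" using x by (simp add: Q_def)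
      show "norm (proj e x) = A (x \<bullet> e)" using An[of "x \<bullet> e"] xn n by simp
    qed
    then show "x \<in> VT \<and> x \<bullet> e > \<delta>" using n xn by simp
  next
    assume a: "x \<in> VT \<and> x \<bullet> e > \<delta>"
    then have xe: "x = c (proj e x)" "norm (proj e x) = x \<bullet> e" using VTr by auto
    have "x \<notin> F2" using pc(1) xe(2) a by (auto simp: F2_def)
    then show "x \<in> V2" using e1I(2)[OF x] xe(1) by (simp add: V2_def)
  qed
  have V1out: "x \<in> V1 \<longleftrightarrow> x \<in> Lp \<and> x \<notin> C2" if "x \<notin> Q" for x using that outQ[OF that] F1Q by (auto simp: V1_def)
  have V2out: "x \<in> V2 \<longleftrightarrow> x \<in> Lp \<and> x \<in> C2" if "x \<notin> Q" for x using that outQ[OF that] F1Q C2L by (auto simp: V2_def)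
  have ZQ: "Z1 \<subseteq> Q" "Z2 \<subseteq> Q" using \<delta> by (auto simp: Z1_def Z2_def Q_def)
  have opV1: "openin (top_of_set Lp) V1"
  proof -
    have "x \<in> V1 \<longleftrightarrow> x \<in> Lp \<and> x \<notin> C2 \<and> x \<notin> Z1" for x
    proof (cases "x \<in> Q")
      case False then show ?thesis using V1out ZQ by blast
    next
      case True
      have "x \<in> Z1" if "x \<in> VT" "- \<delta> \<le> x \<bullet> e" "x \<notin> C2"
      proof -
        have "\<not> x \<bullet> e > 3/2 * \<delta>" using VTr(1)[OF that(1)] e1I(2)[OF True] that(3) \<delta> by fastforce
        then show ?thesis using that VTn A32[of "x \<bullet> e"] \<delta> by (auto simp: Z1_def)
      qed
      moreover have "x \<notin> Z1" "x \<notin> C2" if "x \<in> V1" using V1Q[OF True] that by (auto simp: Z1_def V1_def)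
      ultimately show ?thesis using V1Q[OF True] inQ[OF True] by (auto simp: not_less)
    qed
    then have "V1 = Lp \<inter> - (C2 \<union> Z1)" by auto
    then show ?thesis using dcp[OF cZ(1)] openin_open open_Compl by blast
  qed
  have cLC: "closed (Lm - C2)"
  proof -
    obtain O' where "open O'" "C2 = Lm \<inter> O'" using C2(1) openin_open by metis
    then have "Lm - C2 = Lm \<inter> - O'" by auto
    then show ?thesis using cL \<open>open O'\<close> by auto
  qed
  have opV2: "openin (top_of_set Lp) V2"
  proof -
    have "x \<in> V2 \<longleftrightarrow> x \<in> Lp \<and> x \<notin> Lm - C2 \<and> x \<notin> Z2" for x
    proof (cases "x \<in> Q")
      case False then show ?thesis using V2out ZQ outQ by blast
    next
      case True
      have "x \<in> Z2" if "x \<in> VT" "x \<bullet> e \<le> \<delta>" "x \<notin> Lm - C2"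
      proof -
        have "\<not> x \<bullet> e < - (3/2 * \<delta>)" using VTl(1)[OF that(1)] e1I(1)[OF True] that(3) \<delta> by fastforce
        then show ?thesis using that VTn A32[of "x \<bullet> e"] \<delta> by (auto simp: Z2_def)
      qed
      moreover have "x \<notin> Z2" "x \<notin> Lm - C2" if "x \<in> V2" using V2Q[OF True] that by (auto simp: Z2_def V2_def)
      ultimately show ?thesis using V2Q[OF True] inQ[OF True] by (auto simp: not_less)
    qed
    then have "V2 = Lp \<inter> - ((Lm - C2) \<union> Z2)" by auto
    then show ?thesis using closed_Un[OF cLC cZ(2)] openin_open open_Compl by blast
  qed
  have opVT: "openin (top_of_set Lp) VT" unfolding VT_def using oQ by (simp add: openin_open_Int)
  have opW1: "openin (top_of_set (Lm - C2)) V1" unfolding V1_def using cF1 by (metis Diff_eq open_Compl openin_open_Int)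
  have leftQ: "x = e1 (proj e x)" if "x \<in> Lm - C2" "x \<in> Q" for x using LmQ[of x] e1I(2)[of x] that by (metis DiffD1 DiffD2)
  have e1Q: "e1 u \<in> Q \<inter> (Lm - C2)" if "u \<in> hyp e" "norm u < 2 * \<delta>" for u
    using in3(2)[OF that(1)] that pc(3,4)[OF that(1)] allt[OF that(2)] al0[of u] \<delta> by (auto simp: Q_def)
  have opWT: "openin (top_of_set (Lm - C2)) WT"
  proof -
    have "WT = (Lm - C2) \<inter> (Q \<inter> {x. l / (2 * \<delta>) < norm (proj e x)})"
      using e1Q pc(3) leftQ ph by (auto simp: WT_def Q_def intro!: image_eqI)
    moreover have "open (Q \<inter> {x. l / (2 * \<delta>) < norm (proj e x)})"
      by (intro open_Int oQ open_Collect_less continuous_intros continuous_on_proj)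
    ultimately show ?thesis by (simp add: openin_open_Int)
  qed
  have opW2: "openin (top_of_set (Lm - C2)) W2"
  proof -
    have "W2 = (Lm - C2) \<inter> (Q \<inter> {x. norm (proj e x) < l / \<delta>})"
      using e1Q pc(3) leftQ ph l\<delta> \<delta> by (fastforce simp: W2_def Q_def intro!: image_eqI)
    moreover have "open (Q \<inter> {x. norm (proj e x) < l / \<delta>})"
      by (intro open_Int oQ open_Collect_less continuous_intros continuous_on_proj)
    ultimately show ?thesis by (simp add: openin_open_Int)
  qed
  define V where "V i = (if i = (0::nat) then V1 else if i = 1 then VT else V2)" for i
  define W where "W i = (if i = (0::nat) then V1 else if i = 1 then WT else W2)" for i
  define h where "h i = (if i = (0::nat) then (\<lambda>x. x) else if i = 1 then hT else (\<lambda>x. e1 (\<kappa> x)))" for i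
  define k where "k i = (if i = (0::nat) then (\<lambda>x. x) else if i = 1 then kT else (\<lambda>w. \<kappa>' (proj e w)))" for i
  have e1inj: "u = u'" if "u \<in> hyp e" "u' \<in> hyp e" "e1 u = e1 u'" for u u' using that pc(3) by metis
  have \<tau>le: "a \<le> b \<Longrightarrow> \<tau> b \<le> \<tau> a" for a b using \<tau>(2)[of a b] by (cases "a = b") auto
  have nT: "hT y = e1 u \<and> u \<in> hyp e \<and> norm u = \<tau> (y \<bullet> e)" if "y \<in> VT" "u = (\<tau> (y \<bullet> e) / norm (proj e y)) *\<^sub>R proj e y" for y u
    using that VTn[OF that(1)] A0[of "y \<bullet> e"] \<tau>(1)[of "y \<bullet> e"] hyps by (auto simp: hT_def)
  have hTl: "hT y = y" if "y \<in> VT" "y \<bullet> e < - \<delta>" for y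
  proof -
    have "\<tau> (y \<bullet> e) = norm (proj e y)" using \<tau>(3)[of "y \<bullet> e"] that VTl(2) by simp
    then have "hT y = e1 (proj e y)" using VTn[OF that(1)] A0[of "y \<bullet> e"] by (simp add: hT_def)
    then show ?thesis using VTl(1)[OF that] by simp
  qed
  \<comment> \<open>Beyond axial coordinate \<delta> the tube is part of the right cap, and the
    radius l / a of the profile is that of the inversion.\<close>
  have hTr: "hT y = e1 (\<kappa> y)" if "y \<in> VT" "y \<bullet> e > \<delta>" for y
  proof -
    have n: "norm (proj e y) = y \<bullet> e" "y = c (proj e y)" using VTr[OF that] by auto
    have "norm (proj e y) \<le> 2 * \<delta>" "proj e y \<noteq> 0" using that n(1) \<delta> by (auto simp: VT_def Q_def)
    then have "\<kappa> y = (l / (norm (proj e y))\<^sup>2) *\<^sub>R proj e y" using \<kappa>c[OF ph[of y]] n(2) by metis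
    moreover have "\<tau> (y \<bullet> e) / norm (proj e y) = l / (norm (proj e y))\<^sup>2"
      using \<tau>(4)[of "y \<bullet> e"] that n(1) by (simp add: power2_eq_square)
    ultimately show ?thesis by (simp add: hT_def)
  qed
  \<comment> \<open>Tube points with axial coordinate at least -\<delta> land in the removed disc
    \<open>F1\<close>, so they cannot collide with \<open>V1\<close>.\<close>
  have e1T: "x = hT y \<longleftrightarrow> x = y" if x: "x \<in> V1" and y: "y \<in> VT" for x y
  proof (cases "y \<bullet> e < - \<delta>")
    case True then show ?thesis using hTl[OF y] by simp
  next
    case False
    obtain u where u: "hT y = e1 u" "u \<in> hyp e" "norm u = \<tau> (y \<bullet> e)" using nT[OF y] by blast
    have "\<tau> (y \<bullet> e) \<le> \<delta>" using \<tau>le[of "- \<delta>" "y \<bullet> e"] \<tau>(3)[of "- \<delta>"] False by simp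
    then have "hT y \<in> F1" using u by (auto simp: F1_def)
    moreover have "y \<notin> V1" using V1Q[of y] y False by (auto simp: VT_def)
    ultimately show ?thesis using x by (auto simp: V1_def)
  qed
  have e2T: "e1 (\<kappa> x) = hT y \<longleftrightarrow> x = y" if x: "x \<in> V2" and y: "y \<in> VT" for x y
  proof (cases "y \<bullet> e > \<delta>")
    case True
    then have "y \<in> V2" using V2Q[of y] y by (auto simp: VT_def)
    then show ?thesis using hTr[OF y True] diffeoD(3)[OF d2] x by metis
  next
    case False
    obtain u where u: "hT y = e1 u" "u \<in> hyp e" "norm u = \<tau> (y \<bullet> e)" using nT[OF y] by blast
    have "l / \<delta> \<le> norm u" using \<tau>le[of "y \<bullet> e" \<delta>] \<tau>(4)[of \<delta>] False u(3) by simp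
    moreover have "\<kappa> x \<in> hyp e" using diffeoD(1)[OF d\<kappa>, of x] x c0F2 by (auto simp: V2_def)
    ultimately have "e1 (\<kappa> x) \<noteq> hT y" using e1inj[of "\<kappa> x" u] u \<kappa>V2[OF x] by auto
    moreover have "y \<notin> V2" using V2Q[of y] y False by (auto simp: VT_def)
    ultimately show ?thesis using x by auto
  qed
  have e12: "x \<noteq> e1 (\<kappa> y)" "x \<noteq> y" if x: "x \<in> V1" and y: "y \<in> V2" for x y
  proof -
    have "\<kappa> y \<in> hyp e" using diffeoD(1)[OF d\<kappa>, of y] y c0F2 by (auto simp: V2_def)
    then have "e1 (\<kappa> y) \<in> F1" using \<kappa>V2[OF y] l\<delta> by (auto simp: F1_def)
    then show "x \<noteq> e1 (\<kappa> y)" using x by (auto simp: V1_def)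
    show "x \<noteq> y" using x y by (auto simp: V1_def V2_def)
  qed
  have injT: "hT x = hT y \<longleftrightarrow> x = y" if "x \<in> VT" "y \<in> VT" for x y using diffeoD(3)[OF dT] that by metis
  have inj2: "e1 (\<kappa> x) = e1 (\<kappa> y) \<longleftrightarrow> x = y" if "x \<in> V2" "y \<in> V2" for x y using diffeoD(3)[OF d2] that by metis
  obtain H K where "diffeo Lp (Lm - C2) H K"
  proof (rule diffeomorphic_sets_glue[of "{0, 1, 2::nat}" V W h k Lp "Lm - C2"])
    show "diffeo (V i) (W i) (h i) (k i)" if "i \<in> {0, 1, 2}" for i
      using dT d2 diffeo_id[of V1] by (simp add: V_def W_def h_def k_def)
    show "openin (top_of_set Lp) (V i)" for i using opV1 opV2 opVT by (simp add: V_def)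
    show "openin (top_of_set (Lm - C2)) (W i)" for i using opW1 opW2 opWT by (simp add: W_def)
    show "Lp \<subseteq> (\<Union>i\<in>{0, 1, 2}. V i)"
    proof
      fix x assume "x \<in> Lp"
      then have "x \<in> V1 \<or> x \<in> VT \<or> x \<in> V2" using V1out[of x] V2out[of x] by (auto simp: VT_def)
      then show "x \<in> (\<Union>i\<in>{0, 1, 2}. V i)" by (auto simp: V_def)
    qed
    show "Lm - C2 \<subseteq> (\<Union>i\<in>{0, 1, 2}. W i)"
    proof
      fix x assume x: "x \<in> Lm - C2"
      have "x \<in> WT \<or> x \<in> W2" if xF: "x \<in> F1"
      proof -
        obtain u where u: "u \<in> hyp e" "norm u \<le> \<delta>" "x = e1 u" using xF by (auto simp: F1_def)
        have "l / (2 * \<delta>) < l / \<delta>" using l \<delta> by (simp add: field_simps)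
        then have "norm u < l / \<delta> \<or> l / (2 * \<delta>) < norm u" by linarith
        then show ?thesis using u \<delta> by (auto simp: WT_def W2_def)
      qed
      then have "x \<in> V1 \<or> x \<in> WT \<or> x \<in> W2" using x by (auto simp: V1_def)
      then show "x \<in> (\<Union>i\<in>{0, 1, 2}. W i)" by (auto simp: W_def)
    qed
    fix i j x y assume ij: "i \<in> {0, 1, 2::nat}" "j \<in> {0, 1, 2::nat}" and xy: "x \<in> V i" "y \<in> V j"
    show "(h i x = h j y) = (x = y)"
      using ij xy e1T[of x y] e1T[of y x] e2T[of x y] e2T[of y x] e12[of x y] e12[of y x] injT[of x y] inj2[of x y]
      by (elim insertE emptyE) (auto simp: V_def h_def)
  qed blast
  then show ?thesis using diffeomorphic_sets_iff by blast
qed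

section \<open>The sublevel side: extending maps to the punctured plane across critical
  levels\<close>

section \<open>Index one critical points join different components\<close>

text \<open>One formula for both indices: \<open>a = 0\<close> is a minimum, a unit vector
  \<open>a\<close> is the descending direction of a saddle of index one.\<close>

definition normal_form :: "('a::euclidean_space \<Rightarrow> real) \<Rightarrow> 'a \<Rightarrow> ('a \<Rightarrow> 'a) \<Rightarrow> ('a \<Rightarrow> 'a) \<Rightarrow> 'a \<Rightarrow> real \<Rightarrow> bool" where
  "normal_form M s L L' a r \<longleftrightarrow> linear L \<and> linear L' \<and> (\<forall>x. L' (L x) = x) \<and> (\<forall>x. L (L' x) = x) \<and> 0 < r \<and>
     (a = 0 \<or> norm a = 1) \<and> (\<forall>x. norm x < r \<longrightarrow> M (s + L x) = M s + x \<bullet> x - 2 * (x \<bullet> a)\<^sup>2)"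

text \<open>A proper Morse function of indices 0 and 1, literally quadratic near its critical points
  and with distinct critical values. The last clause provides the one global topological input:
  contractible sublevel sets at arbitrarily high levels.\<close>

definition tame :: "('a::euclidean_space \<Rightarrow> real) \<Rightarrow> bool" where
  "tame M \<longleftrightarrow> (\<forall>x. smooth_at M x) \<and> finite {x. grad M x = 0} \<and> inj_on M {x. grad M x = 0} \<and>
     (\<forall>s. grad M s = 0 \<longrightarrow> (\<exists>L L' a r. normal_form M s L L' a r)) \<and>
     (\<forall>b. compact {x. M x \<le> b}) \<and> (\<forall>b. \<exists>b'\<ge>b. contractible {x. M x \<le> b'})"

lemma norm_proj: "norm a = 1 \<Longrightarrow> x \<bullet> x = (norm (proj a x))\<^sup>2 + (x \<bullet> a)\<^sup>2"
  unfolding power2_norm_eq_inner proj_def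
  by (simp add: inner_diff_left inner_diff_right inner_commute norm_eq_1_inner power2_eq_square)

text \<open>The square root is the norm of the pair \<open>(proj a x, \<delta>)\<close>, which is a
  convex function of x, and the right side is linear.\<close>

lemma convex_cone_part:
  assumes "norm a = 1" shows "convex {x. sqrt ((norm (proj a x))\<^sup>2 + \<delta>\<^sup>2) \<le> x \<bullet> a}"
proof (rule convexI)
  fix x y :: 'a and u v :: real
  assume x: "x \<in> {x. sqrt ((norm (proj a x))\<^sup>2 + \<delta>\<^sup>2) \<le> x \<bullet> a}" and y: "y \<in> {x. sqrt ((norm (proj a x))\<^sup>2 + \<delta>\<^sup>2) \<le> x \<bullet> a}"
    and uv: "0 \<le> u" "0 \<le> v" "u + v = 1"
  define n where "n z = norm (proj a z, \<delta>)" for z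
  have n: "n z = sqrt ((norm (proj a z))\<^sup>2 + \<delta>\<^sup>2)" for z by (simp add: n_def norm_Pair)
  have "(proj a (u *\<^sub>R x + v *\<^sub>R y), \<delta>) = u *\<^sub>R (proj a x, \<delta>) + v *\<^sub>R (proj a y, \<delta>)"
    using uv by (simp add: linear_add[OF linear_proj] linear_scale[OF linear_proj] flip: distrib_right)
  then have "n (u *\<^sub>R x + v *\<^sub>R y) \<le> norm (u *\<^sub>R (proj a x, \<delta>)) + norm (v *\<^sub>R (proj a y, \<delta>))"
    unfolding n_def by (metis norm_triangle_ineq)
  also have "\<dots> = u * n x + v * n y" unfolding norm_scaleR n_def using uv by simp
  also have "\<dots> \<le> u * (x \<bullet> a) + v * (y \<bullet> a)" using x y uv by (intro add_mono mult_left_mono) (auto simp: n)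
  finally show "u *\<^sub>R x + v *\<^sub>R y \<in> {x. sqrt ((norm (proj a x))\<^sup>2 + \<delta>\<^sup>2) \<le> x \<bullet> a}"
    by (simp add: n inner_add_left)
qed

text \<open>Below the critical level, a small box around the critical point meets the sublevel set in at most two convex
  pieces, so a nowhere vanishing function has a logarithm there; Tietze's theorem extends the logarithm to the box.\<close>

lemma extend_over_box:
  fixes M :: "'a::euclidean_space \<Rightarrow> real" and v :: "'a \<Rightarrow> complex"
  assumes nf: "normal_form M s L L' a r" and r1: "0 < r1" "r1 < r" and \<delta>: "\<delta> > 0"
    and cA: "closed {x. M x \<le> M s - \<delta>}" and v: "continuous_on {x. M x \<le> M s - \<delta>} v" "\<And>x. v x \<noteq> 0"
  defines "Bx \<equiv> (\<lambda>x. s + L x) ` cball 0 r1"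
  obtains v' where "continuous_on ({x. M x \<le> M s - \<delta>} \<union> Bx) v'" "\<And>x. v' x \<noteq> 0" "\<And>x. M x \<le> M s - \<delta> \<Longrightarrow> v' x = v x"
proof -
  define A where "A = {x. M x \<le> M s - \<delta>}"
  have lin: "linear L" "linear L'" and inv: "\<And>x. L' (L x) = x" "\<And>x. L (L' x) = x" and a: "a = 0 \<or> norm a = 1"
    and M: "\<And>x. norm x < r \<Longrightarrow> M (s + L x) = M s + x \<bullet> x - 2 * (x \<bullet> a)\<^sup>2"
    using nf by (auto simp: normal_form_def)
  have contL: "continuous_on X (\<lambda>x. s + L x)" for X
    by (intro continuous_intros linear_continuous_on_compose[OF _ lin(1)] continuous_on_id)
  have cB: "compact Bx" unfolding Bx_def by (intro compact_continuous_image contL compact_cball)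
  \<comment> \<open>The two nappes of the part of the box below level M s - \<delta>, for \<sigma> =
    1 and \<sigma> = -1.\<close>
  define P where "P \<sigma> = cball 0 r1 \<inter> {x. sqrt ((norm (proj a x))\<^sup>2 + (sqrt \<delta>)\<^sup>2) \<le> \<sigma> * (x \<bullet> a)}" for \<sigma> :: real
  have "\<exists>g. continuous_on (A \<inter> Bx) g \<and> (\<forall>x\<in>A \<inter> Bx. v x = exp (g x))"
  proof (cases "a = 0")
    case True
    have "A \<inter> Bx = {}"
    proof (rule ccontr)
      assume "A \<inter> Bx \<noteq> {}"
      then obtain x where x: "norm x \<le> r1" "M (s + L x) \<le> M s - \<delta>" by (auto simp: A_def Bx_def)
      then have "x \<bullet> x \<le> - \<delta>" using M[of x] r1 True by simp
      then show False using \<delta> inner_ge_zero[of x] by linarith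
    qed
    then show ?thesis by simp
  next
    case False
    then have a1: "norm a = 1" using a by blast
    have mem: "M (s + L x) \<le> M s - \<delta> \<longleftrightarrow> sqrt ((norm (proj a x))\<^sup>2 + (sqrt \<delta>)\<^sup>2) \<le> \<bar>x \<bullet> a\<bar>" if "norm x \<le> r1" for x
    proof -
      have "M (s + L x) = M s + (norm (proj a x))\<^sup>2 - (x \<bullet> a)\<^sup>2" using M[of x] that r1 norm_proj[OF a1, of x] by simp
      then have "M (s + L x) \<le> M s - \<delta> \<longleftrightarrow> (norm (proj a x))\<^sup>2 + \<delta> \<le> (x \<bullet> a)\<^sup>2" by linarith
      also have "\<dots> \<longleftrightarrow> sqrt ((norm (proj a x))\<^sup>2 + \<delta>) \<le> sqrt ((x \<bullet> a)\<^sup>2)" by (simp only: real_sqrt_le_iff)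
      finally show ?thesis using \<delta> by simp
    qed
    have pm: "proj (- a) x = proj a x" for x by (simp add: proj_def)
    have cP: "convex (P 1)" "convex (P (- 1))"
      using convex_cone_part[OF a1, of "sqrt \<delta>"] convex_cone_part[of "- a" "sqrt \<delta>"] a1
      by (auto simp: P_def pm intro!: convex_Int)
    have clP: "closed (P \<sigma>)" for \<sigma> unfolding P_def
      by (intro closed_Int closed_cball closed_Collect_le continuous_intros continuous_on_proj)
    define I where "I \<sigma> = (\<lambda>x. s + L x) ` P \<sigma>" for \<sigma>
    have clI: "closed (I \<sigma>)" for \<sigma>
    proof -
      have "compact (P \<sigma>)" unfolding compact_eq_bounded_closed using clP[of \<sigma>] by (auto simp: P_def intro: bounded_subset[OF bounded_cball])
      then show ?thesis unfolding I_def by (intro compact_imp_closed compact_continuous_image contL)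
    qed
    have cI: "convex (I \<sigma>)" if "convex (P \<sigma>)" for \<sigma>
    proof -
      have "I \<sigma> = (+) s ` L ` P \<sigma>" by (auto simp: I_def)
      then show ?thesis using convex_linear_image[OF lin(1) that] convex_translation by metis
    qed
    have IA: "I \<sigma> \<subseteq> A" if "\<sigma> = 1 \<or> \<sigma> = - 1" for \<sigma>
      using mem that by (auto simp: I_def P_def A_def)
    have AI: "A \<inter> Bx = I 1 \<union> I (- 1)"
    proof
      show "A \<inter> Bx \<subseteq> I 1 \<union> I (- 1)"
      proof
        fix p assume p: "p \<in> A \<inter> Bx"
        then obtain x where x: "norm x \<le> r1" "p = s + L x" by (auto simp: Bx_def)
        then have "sqrt ((norm (proj a x))\<^sup>2 + (sqrt \<delta>)\<^sup>2) \<le> \<bar>x \<bullet> a\<bar>" using mem[OF x(1)] p by (auto simp: A_def)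
        then have "x \<in> P 1 \<or> x \<in> P (- 1)" using x by (cases "x \<bullet> a \<ge> 0") (auto simp: P_def)
        then show "p \<in> I 1 \<union> I (- 1)" using x by (auto simp: I_def)
      qed
      have "I \<sigma> \<subseteq> Bx" for \<sigma> by (auto simp: I_def Bx_def P_def)
      then show "I 1 \<union> I (- 1) \<subseteq> A \<inter> Bx" using IA[of 1] IA[of "- 1"] by blast
    qed
    have disj: "I 1 \<inter> I (- 1) = {}"
    proof (rule ccontr)
      assume "I 1 \<inter> I (- 1) \<noteq> {}"
      then obtain x y where xy: "x \<in> P 1" "y \<in> P (- 1)" "s + L x = s + L y" by (auto simp: I_def)
      then have "x = y" using inv(1) by (metis add_left_cancel)
      then have "sqrt ((norm (proj a x))\<^sup>2 + (sqrt \<delta>)\<^sup>2) \<le> x \<bullet> a" "sqrt ((norm (proj a x))\<^sup>2 + (sqrt \<delta>)\<^sup>2) \<le> - (x \<bullet> a)"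
        using xy by (auto simp: P_def)
      moreover have "0 < sqrt ((norm (proj a x))\<^sup>2 + (sqrt \<delta>)\<^sup>2)" using \<delta> by (simp add: add_nonneg_pos)
      ultimately show False by linarith
    qed
    have "\<exists>g. continuous_on (I \<sigma>) g \<and> (\<forall>x\<in>I \<sigma>. v x = exp (g x))" if "\<sigma> = 1 \<or> \<sigma> = - 1" for \<sigma>
    proof -
      have "contractible (I \<sigma>)" using cI cP that by (auto intro: convex_imp_contractible)
      moreover have "continuous_on (I \<sigma>) v" using v(1) IA[OF that] continuous_on_subset A_def by blast
      ultimately show ?thesis using continuous_logarithm_on_contractible[of "I \<sigma>" v] v(2) by metis
    qed
    then obtain g1 g2 where g: "continuous_on (I 1) g1" "\<forall>x\<in>I 1. v x = exp (g1 x)"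
      "continuous_on (I (- 1)) g2" "\<forall>x\<in>I (- 1). v x = exp (g2 x)" by metis
    have "continuous_on (I 1 \<union> I (- 1)) (\<lambda>x. if x \<in> I 1 then g1 x else g2 x)"
      by (rule continuous_on_cases[OF clI clI g(1,3)]) (use disj in auto)
    then show ?thesis unfolding AI using g disj by (intro exI[of _ "\<lambda>x. if x \<in> I 1 then g1 x else g2 x"]) auto
  qed
  then obtain g where g: "continuous_on (A \<inter> Bx) g" "\<forall>x\<in>A \<inter> Bx. v x = exp (g x)" by blast
  have "closedin (top_of_set Bx) (A \<inter> Bx)" using cA by (simp add: A_def closedin_closed_Int Int_commute)
  then obtain G where G: "continuous_on Bx G" "\<And>x. x \<in> A \<inter> Bx \<Longrightarrow> G x = g x"
    using Tietze_unbounded[OF g(1)] by metis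
  define v' where "v' x = (if x \<in> A then v x else exp (G x))" for x
  have "continuous_on (A \<union> Bx) v'" unfolding v'_def
    by (rule continuous_on_cases) (use cA cB v(1) G g(2) in \<open>auto simp: A_def compact_imp_closed intro!: continuous_on_exp\<close>)
  then show ?thesis using v(2) by (intro that[of v']) (auto simp: v'_def A_def)
qed

text \<open>Pushing along \<open>- grad M\<close> deforms \<open>{M \<le> b0 + \<delta>}\<close> into \<open>{M \<le> b0 - \<delta>}\<close> together with a neighbourhood
  of the critical point at level \<open>b0\<close>.\<close>

lemma gradient_push:
  fixes M :: "'a::euclidean_space \<Rightarrow> real"
  assumes sm: "\<And>x. smooth_at M x" and K: "compact {x. M x \<le> b0 + d}" and d: "d > 0"
    and Bi: "open Bi" and ncr: "\<And>x. b0 - d \<le> M x \<Longrightarrow> M x \<le> b0 + d \<Longrightarrow> x \<notin> Bi \<Longrightarrow> grad M x \<noteq> 0"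
    and Bx: "\<epsilon> > 0" "\<And>x y. x \<in> Bi \<Longrightarrow> dist y x \<le> \<epsilon> \<Longrightarrow> y \<in> Bx"
  obtains \<delta> \<rho> where "\<delta> > 0" "2 * \<delta> \<le> d" "continuous_on UNIV \<rho>" "\<And>x. M x \<le> b0 - 2 * \<delta> \<Longrightarrow> \<rho> x = x"
    "\<And>x. M x \<le> b0 + \<delta> \<Longrightarrow> M (\<rho> x) \<le> b0 - \<delta> \<or> \<rho> x \<in> Bx"
proof -
  define K1 where "K1 = {x. M x \<le> b0 + d}"
  define K2 where "K2 = {x + y |x y. x \<in> K1 \<and> y \<in> cball 0 1}"
  have cK2: "compact K2" unfolding K2_def using compact_sums[of K1 "cball 0 1"] K by (simp add: K1_def)
  have K12: "x - y \<in> K2" if "x \<in> K1" "norm y \<le> 1" for x y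
    unfolding K2_def using that by (intro CollectI exI[of _ x] exI[of _ "- y"]) auto
  have cg: "continuous_on X (grad M)" for X by (intro smooth_at_continuous_on smooth_intros sm)
  have cM: "continuous_on X M" for X by (intro smooth_at_continuous_on sm)
  define Kp where "Kp = {x. b0 - d \<le> M x \<and> M x \<le> b0 + d} - Bi"
  have "closed {x. b0 - d \<le> M x}" by (intro closed_Collect_le continuous_intros cM)
  then have "compact (K1 \<inter> {x. b0 - d \<le> M x})" using K by (simp add: K1_def compact_Int_closed)
  moreover have "Kp = (K1 \<inter> {x. b0 - d \<le> M x}) - Bi" by (auto simp: Kp_def K1_def)
  ultimately have cKp: "compact Kp" using Bi by (simp add: compact_diff)
  have "\<exists>g>0. \<forall>x\<in>Kp. g \<le> norm (grad M x)"
  proof (cases "Kp = {}")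
    case False
    obtain z where z: "z \<in> Kp" "\<And>x. x \<in> Kp \<Longrightarrow> norm (grad M z) \<le> norm (grad M x)"
      using continuous_attains_inf[OF cKp False continuous_on_norm[OF cg]] by blast
    then show ?thesis using ncr[of z] by (intro exI[of _ "norm (grad M z)"]) (auto simp: Kp_def)
  qed (auto intro: exI[of _ 1])
  then obtain g where g: "g > 0" "\<And>x. x \<in> Kp \<Longrightarrow> g \<le> norm (grad M x)" by blast
  obtain g1 where g1: "g1 > 0" "\<And>x. x \<in> K1 \<Longrightarrow> norm (grad M x) \<le> g1"
    using compact_imp_bounded[OF compact_continuous_image[OF cg K]] unfolding bounded_pos K1_def by blast
  have "uniformly_continuous_on K2 (grad M)" by (rule compact_uniformly_continuous[OF cg cK2])
  moreover have "g / 2 > 0" using g by simp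
  ultimately obtain \<omega> where \<omega>: "\<omega> > 0" "\<And>x y. x \<in> K2 \<Longrightarrow> y \<in> K2 \<Longrightarrow> dist y x < \<omega> \<Longrightarrow> dist (grad M y) (grad M x) < g / 2"
    unfolding uniformly_continuous_on_def by metis
  \<comment> \<open>Step length: a step stays in \<open>K2\<close>, changes the gradient by less
    than g / 2, and takes \<open>Bi\<close> into \<open>Bx\<close>.\<close>
  define \<kappa> where "\<kappa> = min (min 1 (\<omega> / 2)) \<epsilon> / g1"
  have \<kappa>: "\<kappa> > 0" "\<kappa> * g1 \<le> 1" "\<kappa> * g1 < \<omega>" "\<kappa> * g1 \<le> \<epsilon>" using \<omega> Bx(1) g1 by (auto simp: \<kappa>_def)
  have desc: "M (x - t *\<^sub>R grad M x) \<le> M x - t * (g\<^sup>2 / 2)" if x: "x \<in> Kp" and t: "0 \<le> t" "t \<le> \<kappa>" for x t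
  proof -
    define G where "G = grad M x"
    have xK: "x \<in> K1" using x by (auto simp: Kp_def K1_def)
    have Gg: "g \<le> norm G" "norm G \<le> g1" using g(2)[OF x] g1(2)[OF xK] by (auto simp: G_def)
    have bd: "norm (\<tau> *\<^sub>R G) \<le> \<kappa> * g1" if "0 \<le> \<tau>" "\<tau> \<le> \<kappa>" for \<tau>
      using that Gg \<kappa> by (auto intro!: mult_mono)
    have dM: "((\<lambda>\<tau>. M (x - \<tau> *\<^sub>R G)) has_real_derivative - (grad M (x - \<tau> *\<^sub>R G) \<bullet> G)) (at \<tau>)" for \<tau>
    proof -
      have 1: "((\<lambda>\<tau>. x - \<tau> *\<^sub>R G) has_derivative (\<lambda>h. - (h *\<^sub>R G))) (at \<tau>)" by (auto intro!: derivative_eq_intros)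
      have "((\<lambda>\<tau>. M (x - \<tau> *\<^sub>R G)) has_derivative (\<lambda>h. grad M (x - \<tau> *\<^sub>R G) \<bullet> (- (h *\<^sub>R G)))) (at \<tau>)"
        by (rule has_derivative_compose[OF 1 has_derivative_grad[OF sm]])
      then show ?thesis unfolding has_field_derivative_def by (rule has_derivative_eq_rhs) (auto simp: fun_eq_iff)
    qed
    have sl: "- (grad M (x - \<tau> *\<^sub>R G) \<bullet> G) \<le> - (g\<^sup>2 / 2)" if \<tau>: "0 \<le> \<tau>" "\<tau> \<le> \<kappa>" for \<tau>
    proof -
      have "x \<in> K2" using K12[OF xK, of 0] by simp
      moreover have "x - \<tau> *\<^sub>R G \<in> K2" using K12[OF xK] bd[OF \<tau>] \<kappa>(2) by simp
      moreover have "dist (x - \<tau> *\<^sub>R G) x < \<omega>" using bd[OF \<tau>] \<kappa>(3) by (simp add: dist_norm)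
      ultimately have "norm (grad M (x - \<tau> *\<^sub>R G) - G) < g / 2" using \<omega>(2) by (simp add: dist_norm G_def)
      then have "norm (G - grad M (x - \<tau> *\<^sub>R G)) \<le> g / 2" by (simp add: norm_minus_commute)
      then have "(G - grad M (x - \<tau> *\<^sub>R G)) \<bullet> G \<le> g / 2 * norm G"
        by (intro order_trans[OF norm_cauchy_schwarz] mult_right_mono) auto
      moreover have "G \<bullet> G = norm G * norm G" by (simp add: power2_norm_eq_inner[symmetric] power2_eq_square)
      moreover have "g / 2 * norm G \<le> norm G * norm G / 2" using Gg g(1) by (simp add: mult_right_mono)
      moreover have "g\<^sup>2 \<le> norm G * norm G" unfolding power2_eq_square using Gg g(1) by (intro mult_mono) auto
      ultimately show ?thesis by (simp add: inner_diff_left)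
    qed
    show ?thesis
    proof (cases "t = 0")
      case False
      then have "0 < t" using t by simp
      obtain z where z: "0 < z" "z < t" "M (x - t *\<^sub>R G) - M (x - 0 *\<^sub>R G) = (t - 0) * - (grad M (x - z *\<^sub>R G) \<bullet> G)"
        using MVT2[OF \<open>0 < t\<close>, of "\<lambda>\<tau>. M (x - \<tau> *\<^sub>R G)" "\<lambda>\<tau>. - (grad M (x - \<tau> *\<^sub>R G) \<bullet> G)"] dM by blast
      have "t * - (grad M (x - z *\<^sub>R G) \<bullet> G) \<le> t * - (g\<^sup>2 / 2)" using sl[of z] z t by (intro mult_left_mono) auto
      then show ?thesis using z(3) by (simp add: G_def)
    qed simp
  qed
  \<comment> \<open>A full step lowers \<open>M\<close> by at least \<kappa> g^2 / 2, hence by 2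
    \<delta>: enough to get from b0 + \<delta> down to b0 - \<delta>.\<close>
  define \<delta> where "\<delta> = min (d / 2) (\<kappa> * g\<^sup>2 / 4)"
  have \<delta>: "\<delta> > 0" "2 * \<delta> \<le> d" "2 * \<delta> \<le> \<kappa> * (g\<^sup>2 / 2)" using d \<kappa> g by (auto simp: \<delta>_def)
  \<comment> \<open>Rises from 0 at level b0 - 2 \<delta> to 1 at level b0 - \<delta>, so that
    \<rho> is continuous and fixes everything lower down.\<close>
  define lam where "lam x = max 0 (min 1 ((M x - (b0 - 2 * \<delta>)) / \<delta>))" for x
  have lam: "0 \<le> lam x" "lam x \<le> 1" for x by (auto simp: lam_def)
  define \<rho> where "\<rho> x = x - (\<kappa> * lam x) *\<^sub>R grad M x" for x
  show ?thesis
  proof (rule that[OF \<delta>(1,2)])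
    show "continuous_on UNIV \<rho>" unfolding \<rho>_def lam_def by (intro continuous_intros cg cM) (use \<delta> in auto)
    show "\<rho> x = x" if "M x \<le> b0 - 2 * \<delta>" for x
    proof -
      have "(M x - (b0 - 2 * \<delta>)) / \<delta> \<le> 0" using that \<delta>(1) by (simp add: divide_le_0_iff)
      then show ?thesis by (simp add: \<rho>_def lam_def)
    qed
    show "M (\<rho> x) \<le> b0 - \<delta> \<or> \<rho> x \<in> Bx" if x: "M x \<le> b0 + \<delta>" for x
    proof (cases "x \<in> Bi")
      case True
      have "M x \<le> b0 + d" using x \<delta>(1,2) by linarith
      then have "norm (grad M x) \<le> g1" using g1(2)[of x] by (simp add: K1_def)
      then have "lam x * norm (grad M x) \<le> 1 * g1" using lam[of x] by (intro mult_mono) auto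
      then have "norm ((\<kappa> * lam x) *\<^sub>R grad M x) \<le> \<kappa> * g1"
        using \<kappa>(1) lam[of x] by (simp add: abs_mult mult.assoc)
      then have "dist (\<rho> x) x \<le> \<epsilon>" using \<kappa>(4) by (simp add: \<rho>_def dist_norm)
      then show ?thesis using Bx(2)[OF True] by blast
    next
      case False
      show ?thesis
      proof (cases "M x < b0 - 2 * \<delta>")
        case True
        then have "(M x - (b0 - 2 * \<delta>)) / \<delta> \<le> 0" using \<delta>(1) by (simp add: divide_le_0_iff)
        then have "\<rho> x = x" by (simp add: \<rho>_def lam_def)
        then show ?thesis using True \<delta>(1) by simp
      next
        case nl: False
        then have xKp: "x \<in> Kp" using False x \<delta> d by (auto simp: Kp_def)
        have de: "M (\<rho> x) \<le> M x - (\<kappa> * lam x) * (g\<^sup>2 / 2)" unfolding \<rho>_def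
          by (rule desc[OF xKp]) (use lam[of x] \<kappa>(1) in \<open>auto simp: mult_left_le\<close>)
        show ?thesis
        proof (cases "M x \<le> b0 - \<delta>")
          case True
          have "0 \<le> (\<kappa> * lam x) * (g\<^sup>2 / 2)" using lam[of x] \<kappa>(1) by simp
          then show ?thesis using de True by linarith
        next
          case False
          then have "(M x - (b0 - 2 * \<delta>)) / \<delta> \<ge> 1" using \<delta>(1) by (simp add: le_divide_eq)
          then have "lam x = 1" by (simp add: lam_def)
          then show ?thesis using de x \<delta>(3) by simp
        qed
      qed
    qed
  qed
qed

text \<open>A nowhere zero complex function stands for an integral class of degree one; the
  predicate says that the class given by \<open>u\<close> below level c extends to level b.
  \<open>v\<close> is total, and only its restriction to the sublevel set needs to be
  continuous.\<close>

definition extends_to :: "('a::euclidean_space \<Rightarrow> real) \<Rightarrow> real \<Rightarrow> ('a \<Rightarrow> complex) \<Rightarrow> real \<Rightarrow> bool" where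
  "extends_to M c u b \<longleftrightarrow> (\<exists>v. continuous_on {x. M x \<le> b} v \<and> (\<forall>x. v x \<noteq> 0) \<and> (\<forall>x. M x \<le> c \<longrightarrow> v x = u x))"

lemma extends_to_mono: "extends_to M c u b \<Longrightarrow> b' \<le> b \<Longrightarrow> extends_to M c u b'"
proof -
  assume e: "extends_to M c u b" and b: "b' \<le> b"
  obtain v where v: "continuous_on {x. M x \<le> b} v" "\<forall>x. v x \<noteq> 0" "\<forall>x. M x \<le> c \<longrightarrow> v x = u x"
    using e by (auto simp: extends_to_def)
  have "continuous_on {x. M x \<le> b'} v" by (rule continuous_on_subset[OF v(1)]) (use b in auto)
  then show ?thesis unfolding extends_to_def using v by blast
qed

lemma tame_isolated_value:
  assumes "tame M"
  obtains d where "d > 0" "\<And>x. grad M x = 0 \<Longrightarrow> \<bar>M x - b\<bar> \<le> d \<Longrightarrow> M x = b"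
proof -
  have f: "finite (M ` {x. grad M x = 0} - {b})" using assms by (simp add: tame_def)
  have "\<exists>d>0. \<forall>y\<in>M ` {x. grad M x = 0} - {b}. y \<noteq> b \<longrightarrow> d \<le> dist b y" using finite_set_avoid[OF f, of b] by blast
  then obtain d where d: "d > 0" "\<And>y. y \<in> M ` {x. grad M x = 0} - {b} \<Longrightarrow> d \<le> dist b y" by blast
  show ?thesis
  proof (rule that[of "d / 2"])
    show "d / 2 > 0" using d by simp
    fix x assume x: "grad M x = 0" "\<bar>M x - b\<bar> \<le> d / 2"
    show "M x = b"
    proof (rule ccontr)
      assume "M x \<noteq> b"
      then have "d \<le> dist b (M x)" using d(2)[of "M x"] x(1) by blast
      then show False using x(2) d(1) by (simp add: dist_real_def abs_minus_commute)
    qed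
  qed
qed

lemma tame_cont: "tame M \<Longrightarrow> continuous_on X M"
  by (rule smooth_at_continuous_on) (simp add: tame_def)

text \<open>Handles of index 0 and 1 do not obstruct the extension: the map is extended over the box
  around the critical point if there is one, and then pulled back along the gradient push.\<close>

lemma extends_to_step:
  assumes t: "tame M" and c: "c < b0"
  shows "\<exists>\<delta>>0. c \<le> b0 - \<delta> \<and> (extends_to M c u (b0 - \<delta>) \<longrightarrow> extends_to M c u (b0 + \<delta>))"
proof -
  have sm: "\<And>x. smooth_at M x" and cp: "\<And>b. compact {x. M x \<le> b}" using t by (auto simp: tame_def)
  obtain d0 where d0: "d0 > 0" "\<And>x. grad M x = 0 \<Longrightarrow> \<bar>M x - b0\<bar> \<le> d0 \<Longrightarrow> M x = b0" using tame_isolated_value[OF t] by blast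
  define d where "d = min d0 (b0 - c)"
  have d: "d > 0" "d \<le> d0" "c \<le> b0 - d" using d0 c by (auto simp: d_def)
  have cl: "closed {x. M x \<le> b}" for b using cp compact_imp_closed by blast
  show ?thesis
  proof (cases "\<exists>s. grad M s = 0 \<and> M s = b0")
    case False
    then have ncr: "b0 - d \<le> M x \<Longrightarrow> M x \<le> b0 + d \<Longrightarrow> x \<notin> {} \<Longrightarrow> grad M x \<noteq> 0" for x using d0(2)[of x] d by force
    obtain \<delta> \<rho> where *: "\<delta> > 0" "2 * \<delta> \<le> d" "continuous_on UNIV \<rho>" "\<And>x. M x \<le> b0 - 2 * \<delta> \<Longrightarrow> \<rho> x = x"
      "\<And>x. M x \<le> b0 + \<delta> \<Longrightarrow> M (\<rho> x) \<le> b0 - \<delta> \<or> \<rho> x \<in> {}"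
      using gradient_push[OF sm cp d(1) open_empty ncr, where \<epsilon>=1 and Bx="{}"] by auto
    have "extends_to M c u (b0 + \<delta>)" if ex: "extends_to M c u (b0 - \<delta>)"
    proof -
      obtain v where v: "continuous_on {x. M x \<le> b0 - \<delta>} v" "\<forall>x. v x \<noteq> 0" "\<forall>x. M x \<le> c \<longrightarrow> v x = u x" using ex by (auto simp: extends_to_def)
      have "continuous_on {x. M x \<le> b0 + \<delta>} (\<lambda>x. v (\<rho> x))"
        by (rule continuous_on_compose2[OF v(1) continuous_on_subset[OF *(3)]]) (use *(5) in auto)
      moreover have "v (\<rho> x) = u x" if "M x \<le> c" for x using that *(2) *(4)[of x] d v(3) by auto
      ultimately show ?thesis using v(2) unfolding extends_to_def by (intro exI[of _ "\<lambda>x. v (\<rho> x)"]) auto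
    qed
    then show ?thesis using *(1,2) d by (intro exI[of _ \<delta>]) auto
  next
    case True
    then obtain s where s: "grad M s = 0" "M s = b0" by blast
    then obtain L L' a r where nf: "normal_form M s L L' a r" using t unfolding tame_def by blast
    have r: "r > 0" and lin: "linear L" "linear L'" and inv: "\<And>x. L' (L x) = x" "\<And>x. L (L' x) = x" using nf by (auto simp: normal_form_def)
    have uniq: "x = s" if "grad M x = 0" "\<bar>M x - b0\<bar> \<le> d0" for x
      using d0(2)[OF that] t s that(1) unfolding tame_def inj_on_def by auto
    define r1 where "r1 = r / 2"
    define Bx where "Bx = (\<lambda>x. s + L x) ` cball 0 r1"
    have r1: "0 < r1" "r1 < r" using r by (auto simp: r1_def)
    obtain B where B: "B > 0" "\<And>x. norm (L' x) \<le> B * norm x" using linear_bounded_pos[OF lin(2)] by blast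
    define Bi where "Bi = ball s (r1 / 2 / B)"
    have inBx: "y \<in> Bx" if "norm (y - s) \<le> r1 / B" for y
    proof -
      have "norm (L' (y - s)) \<le> B * (r1 / B)" using B(2)[of "y - s"] that B(1) by (meson less_imp_le mult_left_mono order_trans)
      then have "L' (y - s) \<in> cball 0 r1" using B(1) by simp
      then have "s + L (L' (y - s)) \<in> Bx" unfolding Bx_def by blast
      then show ?thesis by (simp add: inv)
    qed
    have Bxi: "y \<in> Bx" if "x \<in> Bi" "dist y x \<le> r1 / 2 / B" for x y
    proof (rule inBx)
      have "dist y s \<le> dist y x + dist x s" by (rule dist_triangle)
      also have "\<dots> \<le> r1 / 2 / B + r1 / 2 / B" using that by (intro add_mono) (auto simp: Bi_def dist_commute)
      finally show "norm (y - s) \<le> r1 / B" by (simp add: dist_norm)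
    qed
    have sBi: "s \<in> Bi" using r1 B by (simp add: Bi_def)
    have ncr: "b0 - d \<le> M x \<Longrightarrow> M x \<le> b0 + d \<Longrightarrow> x \<notin> Bi \<Longrightarrow> grad M x \<noteq> 0" for x
    proof
      assume x: "b0 - d \<le> M x" "M x \<le> b0 + d" "x \<notin> Bi" "grad M x = 0"
      then have "\<bar>M x - b0\<bar> \<le> d0" using d(2) by linarith
      then show False using uniq[OF x(4)] x(3) sBi by blast
    qed
    have \<epsilon>: "0 < r1 / 2 / B" using r1 B by simp
    have oBi: "open Bi" by (simp add: Bi_def)
    obtain \<delta> \<rho> where *: "\<delta> > 0" "2 * \<delta> \<le> d" "continuous_on UNIV \<rho>" "\<And>x. M x \<le> b0 - 2 * \<delta> \<Longrightarrow> \<rho> x = x"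
      "\<And>x. M x \<le> b0 + \<delta> \<Longrightarrow> M (\<rho> x) \<le> b0 - \<delta> \<or> \<rho> x \<in> Bx"
      by (rule gradient_push[OF sm cp d(1) oBi ncr \<epsilon> Bxi]) (assumption | rule that)+
    have "extends_to M c u (b0 + \<delta>)" if ex: "extends_to M c u (b0 - \<delta>)"
    proof -
      obtain v where v: "continuous_on {x. M x \<le> M s - \<delta>} v" "\<forall>x. v x \<noteq> 0" "\<forall>x. M x \<le> c \<longrightarrow> v x = u x"
        using ex s by (auto simp: extends_to_def)
      obtain v' where v': "continuous_on ({x. M x \<le> M s - \<delta>} \<union> Bx) v'" "\<And>x. v' x \<noteq> 0" "\<And>x. M x \<le> M s - \<delta> \<Longrightarrow> v' x = v x"
        using extend_over_box[OF nf r1 *(1) cl v(1)] v(2) unfolding Bx_def by metis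
      have "continuous_on {x. M x \<le> b0 + \<delta>} (\<lambda>x. v' (\<rho> x))"
        by (rule continuous_on_compose2[OF v'(1) continuous_on_subset[OF *(3)]]) (use *(5) s in auto)
      moreover have "v' (\<rho> x) = u x" if "M x \<le> c" for x using that *(1,2) *(4)[of x] d v(3) v'(3)[of x] s by auto
      ultimately show ?thesis using v'(2) unfolding extends_to_def by (intro exI[of _ "\<lambda>x. v' (\<rho> x)"]) auto
    qed
    then show ?thesis using *(1,2) d by (intro exI[of _ \<delta>]) auto
  qed
qed

text \<open>At the supremum of the levels reached, \<open>extends_to_step\<close> would go
  further.\<close>

lemma extends_to_all:
  assumes t: "tame M" and c: "c < b1" and e: "extends_to M c u b1"
  shows "extends_to M c u b"
proof (rule ccontr)
  assume n: "\<not> extends_to M c u b"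
  define S where "S = {b. extends_to M c u b}"
  have bd: "bdd_above S" by (rule bdd_aboveI[of _ b]) (use n extends_to_mono S_def in \<open>force simp: not_le[symmetric]\<close>)
  have b1S: "b1 \<in> S" using e by (simp add: S_def)
  define B where "B = Sup S"
  have B1: "b1 \<le> B" unfolding B_def by (rule cSup_upper[OF b1S bd])
  obtain \<delta> where \<delta>: "\<delta> > 0" "extends_to M c u (B - \<delta>) \<longrightarrow> extends_to M c u (B + \<delta>)"
    using extends_to_step[OF t, of c B u] c B1 by auto
  have "\<exists>y\<in>S. B - \<delta> < y" using less_cSup_iff[of S "B - \<delta>"] bd b1S \<delta>(1) unfolding B_def by force
  then obtain y where "y \<in> S" "B - \<delta> < y" by blast
  then have "extends_to M c u (B - \<delta>)" using extends_to_mono[of M c u y] by (simp add: S_def)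
  then have "B + \<delta> \<in> S" using \<delta>(2) by (simp add: S_def)
  then have "B + \<delta> \<le> B" unfolding B_def by (rule cSup_upper[OF _ bd])
  then show False using \<delta>(1) by simp
qed

lemma exp_eq_1_discrete:
  fixes x y :: complex
  assumes that: "exp x = 1" "exp y = 1" "norm (x - y) < 1" shows "x = y"
  proof -
    have "exp (x - y) = 1" using that by (simp add: exp_diff)
    then obtain n where n: "Re (x - y) = 0" "Im (x - y) = of_int (2 * n) * pi" by (auto simp: exp_eq_1)
    have "\<bar>Im (x - y)\<bar> < 1" using that(3) abs_Im_le_cmod[of "x - y"] by linarith
    then have "n = 0"
    proof -
      have "\<bar>of_int (2 * n) * pi\<bar> < 1" using \<open>\<bar>Im (x - y)\<bar> < 1\<close> n by simp
      then have "\<bar>real_of_int n\<bar> * (2 * pi) < 1" by (simp add: abs_mult)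
      moreover have "1 * (2 * pi) \<le> \<bar>real_of_int n\<bar> * (2 * pi)" if "n \<noteq> 0"
        using that by (intro mult_right_mono) auto
      ultimately show ?thesis using pi_gt3 by fastforce
    qed
    then show ?thesis using n by (simp add: complex_eq_iff)
  qed

lemma exp_eq_1_constant:
  fixes f :: "'b::topological_space \<Rightarrow> complex"
  assumes that: "connected S" "continuous_on S f" "\<And>x. x \<in> S \<Longrightarrow> exp (f x) = 1"
  shows "\<exists>k. \<forall>x\<in>S. f x = k"
  proof -
    have "f constant_on S"
    proof (rule continuous_discrete_range_constant[OF that(1,2)])
      fix x assume "x \<in> S"
      then show "\<exists>e>0. \<forall>y. y \<in> S \<and> f y \<noteq> f x \<longrightarrow> e \<le> norm (f y - f x)"
        using exp_eq_1_discrete[of "f _" "f x"] that(3) by (intro exI[of _ 1]) (auto simp: not_less[symmetric])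
    qed
    then show ?thesis by (auto simp: constant_on_def)
  qed

text \<open>If the two sides of an index one critical point were joined below it, a loop through the critical point would
  have winding number one with respect to a map to the circle that extends to a contractible sublevel set.\<close>

theorem no_self_handle:
  fixes M :: "'a::euclidean_space \<Rightarrow> real"
  assumes tm: "tame M" and nf: "normal_form M s L L' a r" and a: "norm a = 1" and t: "0 < t" "3 * t < r"
    and K: "connected K" "\<And>p. p \<in> K \<Longrightarrow> M p \<le> M s"
    and far: "\<And>x. norm x < r \<Longrightarrow> s + L x \<in> K \<Longrightarrow> t \<le> \<bar>x \<bullet> a\<bar>"
    and ends: "s + L (t *\<^sub>R a) \<in> K" "s + L (- t *\<^sub>R a) \<in> K"
  shows False
proof -
  have lin: "linear L" "linear L'" and inv: "\<And>x. L' (L x) = x" "\<And>x. L (L' x) = x"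
    and nM: "\<And>x. norm x < r \<Longrightarrow> M (s + L x) = M s + x \<bullet> x - 2 * (x \<bullet> a)\<^sup>2"
    using nf by (auto simp: normal_form_def)
  have aa: "a \<bullet> a = 1" using a by (simp add: norm_eq_1_inner)
  define X where "X p = L' (p - s)" for p
  have XL: "X (s + L x) = x" "s + L (X p) = p" for x p by (simp_all add: X_def inv)
  have cX: "continuous_on S X" for S unfolding X_def
    by (intro linear_continuous_on_compose[OF _ lin(2)] continuous_intros)
  \<comment> \<open>Rises from 0 to 1 as the coordinate along \<open>a\<close> goes from -t to t, so
    that \<open>E\<close> below runs once around the circle.\<close>
  define \<theta> where "\<theta> p = max 0 (min 1 ((X p \<bullet> a + t) / (2 * t)))" for p
  have c\<theta>: "continuous_on S \<theta>" for S unfolding \<theta>_def by (intro continuous_intros cX) (use t in auto)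
  define E where "E p = exp (2 * complex_of_real pi * \<i> * complex_of_real (\<theta> p))" for p
  define \<epsilon> where "\<epsilon> = t\<^sup>2"
  have \<epsilon>: "\<epsilon> > 0" using t by (simp add: \<epsilon>_def)
  define A where "A = {p. M p \<le> M s + \<epsilon>}"
  define Bc where "Bc = {p. \<bar>X p \<bullet> a\<bar> \<le> t \<and> norm (proj a (X p)) \<le> 2 * t}"
  define Bo where "Bo = {p. \<bar>X p \<bullet> a\<bar> < t \<and> norm (proj a (X p)) < 2 * t}"
  have cproj: "continuous_on S (\<lambda>p. proj a (X p))" for S by (rule continuous_on_compose2[OF continuous_on_proj cX]) auto
  have clB: "closed Bc" unfolding Bc_def
    by (intro closed_Collect_conj closed_Collect_le continuous_intros cX cproj)
  have opB: "open Bo" unfolding Bo_def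
    by (intro open_Collect_conj open_Collect_less continuous_intros cX cproj)
  have clA: "closed A" unfolding A_def using tm compact_imp_closed by (auto simp: tame_def)
  have Xr: "norm (X p) < r" if "p \<in> Bc" for p
  proof -
    have "X p = proj a (X p) + (X p \<bullet> a) *\<^sub>R a" by (simp add: proj_decomp)
    then have "norm (X p) \<le> norm (proj a (X p)) + norm ((X p \<bullet> a) *\<^sub>R a)" by (metis norm_triangle_ineq)
    also have "\<dots> \<le> 2 * t + t" using that a by (intro add_mono) (auto simp: Bc_def)
    finally show ?thesis using t by simp
  qed
  \<comment> \<open>The sublevel set avoids the lateral faces of the box. It leaves the box only
    through the faces at distance t along \<open>a\<close>, where \<open>E = 1\<close>.\<close>
  have bound: "norm (proj a (X p)) < 2 * t" if "p \<in> A" "p \<in> Bc" for p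
  proof -
    have "M p = M s + (norm (proj a (X p)))\<^sup>2 - (X p \<bullet> a)\<^sup>2"
      using nM[OF Xr[OF that(2)]] norm_proj[OF a, of "X p"] by (simp add: XL)
    moreover have "(X p \<bullet> a)\<^sup>2 \<le> t\<^sup>2" using that(2) t by (simp add: Bc_def abs_le_square_iff[symmetric])
    ultimately have "(norm (proj a (X p)))\<^sup>2 \<le> 2 * t\<^sup>2" using that(1) by (simp add: A_def \<epsilon>_def)
    also have "\<dots> < (2 * t)\<^sup>2" using t by (simp add: power_mult_distrib)
    finally show ?thesis by (rule power_less_imp_less_base) (use t in simp)
  qed
  have \<theta>1: "\<theta> p = 1" if "X p \<bullet> a \<ge> t" for p using that t by (simp add: \<theta>_def min_def max_def le_divide_eq)
  have \<theta>0: "\<theta> p = 0" if "X p \<bullet> a \<le> - t" for p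
  proof -
    have "(X p \<bullet> a + t) / (2 * t) \<le> 0" using that t by (simp add: divide_le_0_iff)
    then show ?thesis by (simp add: \<theta>_def)
  qed
  have E1: "E p = 1" if tp: "t \<le> \<bar>X p \<bullet> a\<bar>" for p
  proof -
    consider "X p \<bullet> a \<ge> t" | "X p \<bullet> a \<le> - t" using tp by linarith
    then show ?thesis
    proof cases
      case 1 then show ?thesis using exp_two_pi_i by (simp add: E_def \<theta>1 mult.commute mult.left_commute)
    next
      case 2 then show ?thesis by (simp add: E_def \<theta>0)
    qed
  qed
  \<comment> \<open>The map of degree one across the handle: it winds inside the box and is constant
    elsewhere.\<close>
  define u where "u p = (if p \<in> Bc then E p else 1)" for p
  have cE: "continuous_on S E" for S unfolding E_def by (intro continuous_intros c\<theta>)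
  have cu: "continuous_on ((A \<inter> Bc) \<union> (A - Bo)) u" unfolding u_def
  proof (rule continuous_on_cases)
    show "closed (A \<inter> Bc)" using clA clB by blast
    show "closed (A - Bo)" using clA opB by blast
    show "\<forall>x. x \<in> A \<inter> Bc \<and> x \<notin> Bc \<or> x \<in> A - Bo \<and> x \<in> Bc \<longrightarrow> E x = 1"
    proof (intro allI impI)
      fix p assume "p \<in> A \<inter> Bc \<and> p \<notin> Bc \<or> p \<in> A - Bo \<and> p \<in> Bc"
      then have "p \<in> A" "p \<in> Bc" "p \<notin> Bo" by auto
      then show "E p = 1" using bound[of p] by (intro E1) (auto simp: Bo_def)
    qed
  qed (use cE in auto)
  have "(A \<inter> Bc) \<union> (A - Bo) = A" by (auto simp: Bo_def Bc_def)
  then have "extends_to M (M s) u (M s + \<epsilon>)" unfolding extends_to_def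
    using cu by (intro exI[of _ u]) (auto simp: u_def E_def A_def)
  then have ext: "extends_to M (M s) u b" for b using extends_to_all[OF tm, of "M s" "M s + \<epsilon>"] \<epsilon> by auto
  obtain b where b: "b \<ge> M s" "contractible {x. M x \<le> b}" using tm unfolding tame_def by blast
  obtain v where v: "continuous_on {x. M x \<le> b} v" "\<forall>x. v x \<noteq> 0" "\<forall>x. M x \<le> M s \<longrightarrow> v x = u x"
    using ext[of b] unfolding extends_to_def by blast
  obtain g where g: "continuous_on {x. M x \<le> b} g" "\<And>x. x \<in> {x. M x \<le> b} \<Longrightarrow> v x = exp (g x)"
    using continuous_logarithm_on_contractible[OF v(1) b(2)] v(2) by metis
  have gu: "exp (g p) = u p" if "M p \<le> M s" for p using g(2)[of p] v(3) that b(1) by auto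
  have cgs: "continuous_on S g" if "\<And>p. p \<in> S \<Longrightarrow> M p \<le> M s" for S
    by (rule continuous_on_subset[OF g(1)]) (use that b(1) in force)
  have uK: "u p = 1" if "p \<in> K" for p
    using far[of "X p"] that Xr[of p] E1[of p] by (auto simp: u_def XL)
  \<comment> \<open>On \<open>K\<close> the map \<open>u\<close> is 1, so the logarithm
    \<open>g\<close> takes discrete values there and is constant: both ends of the path
    \<open>P\<close> get the same value.\<close>
  obtain k where k: "\<And>p. p \<in> K \<Longrightarrow> g p = k"
    using exp_eq_1_constant[OF K(1) cgs[OF K(2)]] gu[OF K(2)] uK by metis
  define P where "P \<tau> = s + L (\<tau> *\<^sub>R a)" for \<tau> :: real
  have XP: "X (P \<tau>) = \<tau> *\<^sub>R a" for \<tau> by (simp add: P_def XL)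
  have MP: "M (P \<tau>) \<le> M s" if "\<tau> \<in> {-t..t}" for \<tau>
  proof -
    have "norm (\<tau> *\<^sub>R a) < r" using that t a by auto
    then show ?thesis using nM[of "\<tau> *\<^sub>R a"] aa by (simp add: P_def power2_eq_square)
  qed
  have pa: "proj a (\<tau> *\<^sub>R a) = 0" for \<tau> using aa by (simp add: proj_def)
  have uP: "u (P \<tau>) = exp (2 * complex_of_real pi * \<i> * complex_of_real (\<theta> (P \<tau>)))" if "\<tau> \<in> {-t..t}" for \<tau>
    using that t aa by (auto simp: u_def Bc_def XP pa E_def)
  \<comment> \<open>Along the straight path through the critical point the logarithm must follow 2
    \<pi> i \<theta>, hence it grows by 2 \<pi> i. This contradicts the equality of its end
    values.\<close>
  define f where "f \<tau> = g (P \<tau>) - 2 * complex_of_real pi * \<i> * complex_of_real (\<theta> (P \<tau>))" for \<tau>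
  have cP: "continuous_on S P" for S unfolding P_def
    by (intro continuous_intros linear_continuous_on_compose[OF _ lin(1)])
  have "continuous_on {-t..t} f" unfolding f_def
  proof -
    have 1: "continuous_on {-t..t} (\<lambda>\<tau>. g (P \<tau>))"
    proof (rule continuous_on_compose2[OF cgs cP])
      show "M p \<le> M s" if "p \<in> P ` {-t..t}" for p using that MP by blast
    qed auto
    have 2: "continuous_on {-t..t} (\<lambda>\<tau>. \<theta> (P \<tau>))" by (rule continuous_on_compose2[OF c\<theta>[of UNIV] cP]) auto
    show "continuous_on {-t..t} (\<lambda>\<tau>. g (P \<tau>) - 2 * complex_of_real pi * \<i> * complex_of_real (\<theta> (P \<tau>)))"
      by (intro continuous_intros 1 2)
  qed
  moreover have "exp (f \<tau>) = 1" if "\<tau> \<in> {-t..t}" for \<tau>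
    using gu[OF MP[OF that]] uP[OF that] by (simp add: f_def exp_diff)
  ultimately obtain k' where k': "\<And>\<tau>. \<tau> \<in> {-t..t} \<Longrightarrow> f \<tau> = k'"
    using exp_eq_1_constant[of "{-t..t}" f] connected_Icc by metis
  have "f t = f (- t)" using k' t by simp
  moreover have "g (P t) = g (P (- t))" using k[OF ends(1)] k[OF ends(2)] by (simp add: P_def)
  moreover have "\<theta> (P t) = 1" "\<theta> (P (- t)) = 0" using \<theta>1[of "P t"] \<theta>0[of "P (-t)"] aa by (auto simp: XP)
  ultimately show False by (simp add: f_def)
qed

section \<open>Morse theory of the levels: isotopies between critical values, crossing a saddle or a
  minimum\<close>

section \<open>Regular level sets of a tame function\<close>

definition all_spheres :: "'a::euclidean_space set \<Rightarrow> bool" where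
  "all_spheres S \<longleftrightarrow> (\<forall>C\<in>components S. diffeomorphic_sets C (sphere (0::'a) 1))"

lemma all_spheres_diffeo:
  fixes S T :: "'a::euclidean_space set"
  assumes "diffeomorphic_sets S T" "all_spheres T" shows "all_spheres S"
  unfolding all_spheres_def
proof
  fix C assume C: "C \<in> components S"
  obtain h k where d: "diffeo S T h k" using assms(1) diffeomorphic_sets_iff by blast
  have "h ` C \<in> components T" by (rule diffeo_components[OF d C])
  then have 1: "diffeomorphic_sets (h ` C) (sphere (0::'a) 1)" using assms(2) by (simp add: all_spheres_def)
  have "diffeomorphic_sets C (h ` C)"
    using diffeo_image[OF d in_components_subset[OF C]] diffeomorphic_sets_iff by blast
  then show "diffeomorphic_sets C (sphere (0::'a) 1)" using 1 diffeomorphic_sets_trans by blast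
qed

lemma grad_const: "grad (\<lambda>x. c) x = 0"
  by (rule grad_unique) auto

lemma grad_add: "smooth_at f x \<Longrightarrow> smooth_at g x \<Longrightarrow> grad (\<lambda>x. f x + g x) x = grad f x + grad g x"
  by (rule grad_unique) (auto intro!: smooth_intros has_derivative_eq_rhs[OF has_derivative_add[OF has_derivative_grad has_derivative_grad]] simp: inner_add_left)

lemma grad_cmult: "smooth_at f x \<Longrightarrow> grad (\<lambda>x. c * f x) x = c *\<^sub>R grad f x"
  by (rule grad_unique) (auto intro!: smooth_intros has_derivative_eq_rhs[OF has_derivative_mult_right[OF has_derivative_grad]])

lemma grad_add_const: "smooth_at f x \<Longrightarrow> grad (\<lambda>x. f x + c) x = grad f x"
  by (simp add: grad_add grad_const)

lemma level_change:
  fixes M :: "'a::euclidean_space \<Rightarrow> real"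
  assumes sm: "\<And>x. smooth_at M x" and K: "\<And>b. compact {x. M x \<le> b}"
    and reg: "\<And>x. a \<le> M x \<Longrightarrow> M x \<le> b \<Longrightarrow> grad M x \<noteq> 0" and ab: "a \<le> b"
  shows "diffeomorphic_sets {x. M x = a} {x. M x = b}"
proof -
  have eq: "M x + - a + t * - (b - a) = 0 \<longleftrightarrow> M x = a + t * (b - a)" for x t by (auto simp: algebra_simps)
  have bd: "a \<le> a + t * (b - a) \<and> a + t * (b - a) \<le> b" if "0 \<le> t" "t \<le> 1" for t
    using mult_right_mono[OF that(2), of "b - a"] that ab by auto
  have "diffeomorphic_sets {x. M x + - a = 0} {x. M x + - a + - (b - a) = 0}"
  proof (rule level_set_isotopy[OF _ _ K[of b]])
    show "smooth_at (\<lambda>x. M x + - a) x" for x by (intro smooth_intros sm)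
    fix t x assume t: "0 \<le> t" "t \<le> 1" "M x + - a + t * - (b - a) = 0"
    then have "M x = a + t * (b - a)" by (simp only: eq)
    then have "a \<le> M x" "M x \<le> b" using bd[OF t(1,2)] by auto
    then show "x \<in> {x. M x \<le> b}" "grad (\<lambda>x. M x + - a) x + t *\<^sub>R grad (\<lambda>x. - (b - a)) x \<noteq> 0"
      using reg[of x] unfolding grad_add_const[OF sm] grad_const by auto
  qed simp
  then show ?thesis by simp
qed

text \<open>Near a regular point a level set is a straightened hyperplane, hence locally connected,
  and components of locally connected sets are open.\<close>

lemma regular_level_component_open:
  fixes g :: "'a::euclidean_space \<Rightarrow> real"
  assumes sm: "\<And>x. smooth_at g x" and C: "C \<in> components {x. g x = 0}" and reg: "\<And>x. x \<in> C \<Longrightarrow> grad g x \<noteq> 0"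
  shows "openin (top_of_set {x. g x = 0}) C"
proof -
  define Z where "Z = {x. g x = 0}"
  have CZ: "C \<subseteq> Z" using C in_components_subset Z_def by blast
  have "\<exists>U. open U \<and> x \<in> U \<and> Z \<inter> U \<subseteq> C" if x: "x \<in> C" for x
  proof -
    define n where "n = sgn (grad g x)"
    have n1: "norm n = 1" using reg[OF x] by (simp add: n_def norm_sgn)
    have nn: "n \<bullet> n = 1" using n1 by (simp add: norm_eq_1_inner)
    \<comment> \<open>Straightening: the coordinate along the gradient direction is replaced by the
      value of \<open>g\<close>.\<close>
    define \<Gamma> where "\<Gamma> y = proj n y + g y *\<^sub>R n" for y
    have s\<Gamma>: "smooth_at \<Gamma> x" unfolding \<Gamma>_def[abs_def] by (intro smooth_intros sm)
    have d\<Gamma>: "(\<Gamma> has_derivative (\<lambda>v. proj n v + (grad g x \<bullet> v) *\<^sub>R n)) (at x)" unfolding \<Gamma>_def[abs_def]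
      by (intro has_derivative_add has_derivative_scaleR_left has_derivative_grad sm bounded_linear_imp_has_derivative)
        (simp add: linear_conv_bounded_linear[symmetric] linear_proj)
    have inj: "v = 0" if v: "frechet_derivative \<Gamma> (at x) v = 0" for v
    proof -
      have 0: "proj n v + (grad g x \<bullet> v) *\<^sub>R n = 0" using v by (simp add: frechet_derivative_at[OF d\<Gamma>, symmetric])
      then have "(proj n v + (grad g x \<bullet> v) *\<^sub>R n) \<bullet> n = 0" by simp
      then have gv: "grad g x \<bullet> v = 0" using proj_in_hyp[OF n1, of v] nn by (simp add: inner_add_left hyp_def)
      then have p: "proj n v = 0" using 0 by simp
      have "grad g x = norm (grad g x) *\<^sub>R n" using reg[OF x] by (simp add: n_def sgn_div_norm)
      then have "norm (grad g x) * (n \<bullet> v) = 0" using gv by (metis inner_scaleR_left)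
      then have "v \<bullet> n = 0" using reg[OF x] by (simp add: inner_commute)
      then show "v = 0" using p by (simp add: proj_def)
    qed
    obtain U V k where k: "open U" "x \<in> U" "open V" "\<Gamma> x \<in> V" "homeomorphism U V \<Gamma> k"
      using smooth_inverse_function[OF s\<Gamma> inj] by metis
    have gx: "g x = 0" using x CZ by (auto simp: Z_def)
    have gn: "\<Gamma> y \<bullet> n = g y" for y using proj_in_hyp[OF n1, of y] nn by (simp add: \<Gamma>_def inner_add_left hyp_def)
    obtain d where d: "d > 0" "ball (\<Gamma> x) d \<subseteq> V" using k openE by blast
    define W where "W = U \<inter> \<Gamma> -` ball (\<Gamma> x) d"
    have oW: "open W" unfolding W_def
      by (rule continuous_open_preimage) (use k in \<open>auto simp: homeomorphism_def\<close>)
    have eq: "Z \<inter> W = k ` (hyp n \<inter> ball (\<Gamma> x) d)"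
    proof
      show "Z \<inter> W \<subseteq> k ` (hyp n \<inter> ball (\<Gamma> x) d)"
      proof
        fix y assume y: "y \<in> Z \<inter> W"
        then have "\<Gamma> y \<in> hyp n \<inter> ball (\<Gamma> x) d" using gn[of y] by (auto simp: W_def Z_def hyp_def)
        moreover have "k (\<Gamma> y) = y" using y k(5) by (auto simp: W_def homeomorphism_def)
        ultimately show "y \<in> k ` (hyp n \<inter> ball (\<Gamma> x) d)" by (metis imageI)
      qed
      show "k ` (hyp n \<inter> ball (\<Gamma> x) d) \<subseteq> Z \<inter> W"
      proof
        fix y assume "y \<in> k ` (hyp n \<inter> ball (\<Gamma> x) d)"
        then obtain z where z: "z \<in> hyp n" "z \<in> ball (\<Gamma> x) d" "y = k z" by blast
        then have "\<Gamma> y = z" "y \<in> U" using k(5) d(2) by (auto simp: homeomorphism_def)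
        then show "y \<in> Z \<inter> W" using gn[of y] z by (auto simp: W_def Z_def hyp_def)
      qed
    qed
    have "convex (hyp n)" unfolding hyp_def using convex_hyperplane[of n 0] by (simp add: inner_commute)
    then have "connected (hyp n \<inter> ball (\<Gamma> x) d)" by (intro convex_connected convex_Int convex_ball)
    moreover have "continuous_on (hyp n \<inter> ball (\<Gamma> x) d) k"
      by (rule continuous_on_subset[OF homeomorphism_cont2[OF k(5)]]) (use d(2) in blast)
    ultimately have cn: "connected (Z \<inter> W)" unfolding eq by (rule connected_continuous_image[rotated])
    have xW: "x \<in> Z \<inter> W" using k d gx by (auto simp: W_def Z_def)
    have "Z \<inter> W \<subseteq> C" by (rule components_maximal[OF C cn]) (use xW x in \<open>auto simp: Z_def\<close>)
    then show ?thesis using oW xW by blast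
  qed
  then obtain U where U: "\<And>x. x \<in> C \<Longrightarrow> open (U x) \<and> x \<in> U x \<and> Z \<inter> U x \<subseteq> C" by metis
  have "C = Z \<inter> (\<Union>x\<in>C. U x)" using U CZ by blast
  moreover have "open (\<Union>x\<in>C. U x)" using U by blast
  ultimately show ?thesis unfolding Z_def[symmetric] openin_open by blast
qed

text \<open>The level at distance \<eta> from the critical one is moved to the critical level except
  where the bump \<open>B\<close> is nonzero. The levels just above and just below can therefore be
  compared outside a small box, where both become the critical level.\<close>

lemma bump_isotopy:
  fixes N :: "'a::euclidean_space \<Rightarrow> real"
  assumes sm: "\<And>x. smooth_at N x" and K: "\<And>b. compact {x. N x \<le> b}" and sB: "\<And>x. smooth_at B x"
    and B: "\<And>x. 0 \<le> B x" "\<And>x. B x \<le> 1" "B 0 = 1" and N0: "N 0 = c" and \<eta>: "\<eta> > 0" and \<sigma>: "\<sigma> = 1 \<or> \<sigma> = -1"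
    and cr: "\<And>x. grad N x = 0 \<Longrightarrow> \<bar>N x - c\<bar> \<le> \<eta> \<Longrightarrow> x = 0"
    and reg: "\<And>x t. x \<noteq> 0 \<Longrightarrow> grad N x \<noteq> 0 \<Longrightarrow> \<bar>t\<bar> \<le> \<eta> \<Longrightarrow> grad N x + t *\<^sub>R grad B x \<noteq> 0"
  shows "diffeomorphic_sets {x. N x = c + \<sigma> * \<eta>} {x. N x = c + \<sigma> * \<eta> * B x}"
proof -
  define u where "u x = N x + - (c + \<sigma> * \<eta>)" for x
  define v where "v x = (\<sigma> * \<eta>) + (- (\<sigma> * \<eta>)) * B x" for x
  have su: "smooth_at u x" "smooth_at v x" for x unfolding u_def v_def by (intro smooth_intros sm sB)+
  have gu: "grad u x = grad N x" for x unfolding u_def by (rule grad_add_const[OF sm])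
  have gv: "grad v x = (- (\<sigma> * \<eta>)) *\<^sub>R grad B x" for x
  proof -
    have "grad v x = grad (\<lambda>x. \<sigma> * \<eta>) x + grad (\<lambda>x. (- (\<sigma> * \<eta>)) * B x) x" unfolding v_def[abs_def]
      by (rule grad_add) (intro smooth_intros sB)+
    then show ?thesis unfolding grad_const grad_cmult[OF sB] by simp
  qed
  have "diffeomorphic_sets {x. u x = 0} {x. u x + v x = 0}"
  proof (rule level_set_isotopy[OF su K[of "c + \<eta>"]])
    fix t x assume t: "0 \<le> t" "t \<le> 1" "u x + t * v x = 0"
    define w where "w = (1 - t) + t * B x"
    have w: "0 \<le> w" "w \<le> 1" using t(1,2) B(1,2)[of x] by (auto simp: w_def mult_left_le)
    have Nw: "N x = c + \<sigma> * \<eta> * w" using t(3) by (simp add: u_def v_def w_def algebra_simps)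
    then have ab: "\<bar>N x - c\<bar> \<le> \<eta>" using w \<eta> \<sigma> by (auto simp: abs_mult mult_left_le)
    then show "x \<in> {x. N x \<le> c + \<eta>}" by auto
    have x0: "x \<noteq> 0"
    proof
      assume "x = 0"
      then have "w = 1" "N x = c" using B(3) N0 by (auto simp: w_def)
      then show False using Nw \<eta> \<sigma> by auto
    qed
    then have "grad N x \<noteq> 0" using cr ab by blast
    moreover have "\<bar>t * (- (\<sigma> * \<eta>))\<bar> \<le> \<eta>" using t \<sigma> \<eta> by (auto simp: abs_mult mult_left_le_one_le)
    ultimately have "grad N x + (t * (- (\<sigma> * \<eta>))) *\<^sub>R grad B x \<noteq> 0" using reg[OF x0] by blast
    then show "grad u x + t *\<^sub>R grad v x \<noteq> 0" by (simp add: gu gv)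
  qed
  then show ?thesis by (simp add: u_def v_def algebra_simps)
qed

text \<open>The thresholds p, p' apply to the axial square and q, q' to the transverse square. They
  are separate because the tube and the caps need opposite proportions.\<close>

definition box_bump where
  "box_bump a p p' q q' x = cutoff p p' ((x \<bullet> a)\<^sup>2) * cutoff q q' (proj a x \<bullet> proj a x)"

lemma smooth_box_bump: "p < p' \<Longrightarrow> q < q' \<Longrightarrow> smooth_at (box_bump a p p' q q') x"
  unfolding box_bump_def[abs_def] by (intro smooth_intros) auto

lemma grad_box_bump:
  assumes "p < p'" "q < q'" "norm a = 1"
  shows "grad (box_bump a p p' q q') x =
    (2 * (x \<bullet> a) * cutoff' p p' ((x \<bullet> a)\<^sup>2) * cutoff q q' (proj a x \<bullet> proj a x)) *\<^sub>R a +
    (2 * cutoff p p' ((x \<bullet> a)\<^sup>2) * cutoff' q q' (proj a x \<bullet> proj a x)) *\<^sub>R proj a x"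
proof (rule grad_unique[OF smooth_box_bump[OF assms(1,2)]])
  have pp: "proj a x \<bullet> proj a v = proj a x \<bullet> v" for v
  proof -
    have "proj a x \<bullet> (proj a v + (v \<bullet> a) *\<^sub>R a) = proj a x \<bullet> proj a v"
      using proj_in_hyp[OF assms(3), of x] by (simp add: inner_add_right hyp_def)
    then show ?thesis by (simp add: proj_decomp)
  qed
  have 1: "((\<lambda>x. (x \<bullet> a)\<^sup>2) has_derivative (\<lambda>v. 2 * (x \<bullet> a) * (v \<bullet> a))) (at x)"
    by (auto intro!: derivative_eq_intros)
  have dp: "(proj a has_derivative proj a) (at x)"
    by (rule bounded_linear_imp_has_derivative) (simp add: linear_conv_bounded_linear[symmetric] linear_proj)
  have 2: "((\<lambda>x. proj a x \<bullet> proj a x) has_derivative (\<lambda>v. 2 * (proj a x \<bullet> v))) (at x)"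
    by (rule has_derivative_eq_rhs[OF has_derivative_inner[OF dp dp]]) (auto simp: fun_eq_iff pp inner_commute[of "proj a _" "proj a x"])
  have c1: "((\<lambda>x. cutoff p p' ((x \<bullet> a)\<^sup>2)) has_derivative (\<lambda>v. cutoff' p p' ((x \<bullet> a)\<^sup>2) * (2 * (x \<bullet> a) * (v \<bullet> a)))) (at x)"
    by (rule has_derivative_compose[OF 1 cutoff_has_derivative[OF assms(1), unfolded has_field_derivative_def]])
  have c2: "((\<lambda>x. cutoff q q' (proj a x \<bullet> proj a x)) has_derivative (\<lambda>v. cutoff' q q' (proj a x \<bullet> proj a x) * (2 * (proj a x \<bullet> v)))) (at x)"
    by (rule has_derivative_compose[OF 2 cutoff_has_derivative[OF assms(2), unfolded has_field_derivative_def]])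
  show "(box_bump a p p' q q' has_derivative (\<lambda>v. ((2 * (x \<bullet> a) * cutoff' p p' ((x \<bullet> a)\<^sup>2) * cutoff q q' (proj a x \<bullet> proj a x)) *\<^sub>R a +
    (2 * cutoff p p' ((x \<bullet> a)\<^sup>2) * cutoff' q q' (proj a x \<bullet> proj a x)) *\<^sub>R proj a x) \<bullet> v)) (at x)"
    unfolding box_bump_def[abs_def]
    by (rule has_derivative_eq_rhs[OF has_derivative_mult[OF c1 c2]])
      (auto simp: fun_eq_iff inner_add_left inner_commute algebra_simps)
qed

lemma cutoff'_eq_0: "p < p' \<Longrightarrow> t \<ge> p' \<Longrightarrow> cutoff' p p' t = 0"
proof -
  assume "p < p'" "t \<ge> p'"
  then have "(p' - t) / (p' - p) \<le> 0" by (simp add: divide_le_0_iff)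
  then show ?thesis by (simp add: cutoff'_def smooth_step'_def flat_exp_zero)
qed

text \<open>In the normal form the gradient is twice the transverse part minus twice the axial part.
  The perturbation only multiplies these parts by the factors \<open>A2\<close> and
  \<open>A1\<close>, which stay positive as \<eta> times the cut-off slopes is below 1.\<close>

lemma box_bump_regular:
  fixes N :: "'a::euclidean_space \<Rightarrow> real"
  assumes sm: "\<And>x. smooth_at N x" and a: "norm a = 1"
    and N: "\<And>x. norm x < r \<Longrightarrow> N x = c + x \<bullet> x - 2 * (x \<bullet> a)\<^sup>2" and \<delta>: "0 < \<delta>" "6 * \<delta> < r"
    and pq: "p < p'" "q < q'" "p' \<le> (3 * \<delta>)\<^sup>2" "q' \<le> (3 * \<delta>)\<^sup>2"
    and small: "\<And>s. \<eta> * \<bar>cutoff' p p' s\<bar> < 1" "\<And>s. \<eta> * \<bar>cutoff' q q' s\<bar> < 1" and \<eta>: "\<eta> > 0"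
    and x: "x \<noteq> 0" "grad N x \<noteq> 0" "\<bar>t\<bar> \<le> \<eta>"
  shows "grad N x + t *\<^sub>R grad (box_bump a p p' q q') x \<noteq> 0"
proof (cases "(x \<bullet> a)\<^sup>2 < p' \<and> proj a x \<bullet> proj a x < q'")
  case False
  then have "grad (box_bump a p p' q q') x = 0" unfolding grad_box_bump[OF pq(1,2) a]
    using cutoff'_eq_0[OF pq(1)] cutoff'_eq_0[OF pq(2)] cutoff_eq_0[OF pq(1)] cutoff_eq_0[OF pq(2)] by (auto simp: not_less)
  then show ?thesis using x by simp
next
  case True
  have aa: "a \<bullet> a = 1" using a by (simp add: norm_eq_1_inner)
  have "\<bar>x \<bullet> a\<bar>\<^sup>2 < (3 * \<delta>)\<^sup>2" "(norm (proj a x))\<^sup>2 < (3 * \<delta>)\<^sup>2" using True pq by (auto simp: power2_norm_eq_inner)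
  then have "\<bar>x \<bullet> a\<bar> < 3 * \<delta>" "norm (proj a x) < 3 * \<delta>" using power_less_imp_less_base[of _ 2 "3 * \<delta>"] \<delta> by auto
  moreover have "norm x \<le> norm (proj a x) + norm ((x \<bullet> a) *\<^sub>R a)" by (metis norm_triangle_ineq proj_decomp)
  ultimately have xr: "norm x < r" using a \<delta> by simp
  have gN: "grad N x = 2 *\<^sub>R proj a x - (2 * (x \<bullet> a)) *\<^sub>R a"
  proof (rule grad_unique[OF sm])
    have "((\<lambda>x. c + x \<bullet> x - 2 * (x \<bullet> a)\<^sup>2) has_derivative (\<lambda>v. (2 *\<^sub>R proj a x - (2 * (x \<bullet> a)) *\<^sub>R a) \<bullet> v)) (at x)"
      by (auto intro!: derivative_eq_intros simp: fun_eq_iff inner_diff_left inner_diff_right proj_def inner_commute algebra_simps)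
    then show "(N has_derivative (\<lambda>v. (2 *\<^sub>R proj a x - (2 * (x \<bullet> a)) *\<^sub>R a) \<bullet> v)) (at x)"
      by (rule has_derivative_transform_within_open[of _ _ _ _ "ball 0 r"]) (use xr N in auto)
  qed
  define A1 where "A1 = 1 - t * (cutoff' p p' ((x \<bullet> a)\<^sup>2) * cutoff q q' (proj a x \<bullet> proj a x))"
  define A2 where "A2 = 1 + t * (cutoff p p' ((x \<bullet> a)\<^sup>2) * cutoff' q q' (proj a x \<bullet> proj a x))"
  have small1: "\<bar>t * (y * z)\<bar> < 1" if "\<eta> * \<bar>y\<bar> < 1" "0 \<le> z" "z \<le> 1" for y z
  proof -
    have "\<bar>t * (y * z)\<bar> = (\<bar>t\<bar> * \<bar>y\<bar>) * z" using that by (simp add: abs_mult)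
    also have "\<dots> \<le> (\<bar>t\<bar> * \<bar>y\<bar>) * 1" using that by (intro mult_left_mono) auto
    also have "\<dots> \<le> \<eta> * \<bar>y\<bar>" using x(3) by (simp add: mult_right_mono)
    finally show ?thesis using that by simp
  qed
  have "\<bar>t * (cutoff' p p' ((x \<bullet> a)\<^sup>2) * cutoff q q' (proj a x \<bullet> proj a x))\<bar> < 1"
    by (rule small1[OF small(1) cutoff_bounds])
  then have A1: "A1 > 0" by (simp add: A1_def abs_less_iff)
  have "\<bar>t * (cutoff' q q' (proj a x \<bullet> proj a x) * cutoff p p' ((x \<bullet> a)\<^sup>2))\<bar> < 1"
    by (rule small1[OF small(2) cutoff_bounds])
  then have A2: "A2 > 0" by (simp add: A2_def abs_less_iff mult.commute)
  show ?thesis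
  proof
    assume z: "grad N x + t *\<^sub>R grad (box_bump a p p' q q') x = 0"
    have eq: "grad N x + t *\<^sub>R grad (box_bump a p p' q q') x = (2 * A2) *\<^sub>R proj a x - (2 * (x \<bullet> a) * A1) *\<^sub>R a"
      unfolding gN grad_box_bump[OF pq(1,2) a] A1_def A2_def by (simp add: algebra_simps)
    have "proj a x \<bullet> a = 0" using proj_in_hyp[OF a, of x] by (simp add: hyp_def)
    then have "((2 * A2) *\<^sub>R proj a x - (2 * (x \<bullet> a) * A1) *\<^sub>R a) \<bullet> a = - (2 * (x \<bullet> a) * A1)" using aa by (simp add: inner_diff_left)
    then have xa: "x \<bullet> a = 0" using z eq A1 by auto
    then have "proj a x = 0" using z eq A2 by auto
    then show False using xa x(1) proj_decomp[of a x] by simp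
  qed
qed

text \<open>A connected set cannot cross the boundary of a relatively clopen \<open>D\<close>, so
  the component in S of a point outside \<open>D\<close> avoids \<open>D\<close> altogether.\<close>

lemma components_diff_clopen:
  assumes "openin (top_of_set S) D" "closed D" "C \<in> components (S - D)"
  shows "C \<in> components S"
proof -
  obtain x where x: "x \<in> S - D" "C = connected_component_set (S - D) x" using assms(3) components_iff by metis
  have cn: "connected (connected_component_set S x)" by simp
  obtain O' where O': "open O'" "D = S \<inter> O'" using assms(1) openin_open by metis
  have sub: "connected_component_set S x \<subseteq> S" by (rule connected_component_subset)
  have xm: "x \<in> connected_component_set S x" using x(1) by simp
  have "connected_component_set S x \<subseteq> S - D"
  proof (rule ccontr)
    assume "\<not> connected_component_set S x \<subseteq> S - D"
    then have "O' \<inter> connected_component_set S x \<noteq> {}" "- D \<inter> connected_component_set S x \<noteq> {}"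
      using sub O' xm x(1) by blast+
    moreover have "connected_component_set S x \<subseteq> O' \<union> - D" using O' sub by blast
    moreover have "O' \<inter> - D \<inter> connected_component_set S x = {}" using O' sub by blast
    ultimately show False using connectedD[OF cn O'(1), of "- D"] assms(2) by (simp add: open_Compl)
  qed
  then have "connected_component_set S x \<subseteq> C" unfolding x(2) by (rule connected_component_maximal[OF xm cn])
  moreover have "C \<subseteq> connected_component_set S x" unfolding x(2) by (rule connected_component_mono) blast
  ultimately show ?thesis using x(1) components_iff by blast
qed

lemma all_spheres_diff: "openin (top_of_set S) D \<Longrightarrow> closed D \<Longrightarrow> all_spheres S \<Longrightarrow> all_spheres (S - D)"
  using components_diff_clopen unfolding all_spheres_def by blast

lemma small_eta:
  assumes "(0::real) < \<delta>"
  obtains \<eta>0 where "\<eta>0 > 0" "\<And>\<eta>. 0 < \<eta> \<Longrightarrow> \<eta> \<le> \<eta>0 \<Longrightarrow> neck_ok \<eta> \<delta> \<and> (\<forall>s. \<eta> * \<bar>cutoff' (4 * \<delta>\<^sup>2) (9 * \<delta>\<^sup>2) s\<bar> < 1)"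
proof -
  obtain B1 where B1: "B1 > 0" "\<And>t. \<bar>cutoff' (\<delta>\<^sup>2 / 4) (\<delta>\<^sup>2) t\<bar> \<le> B1" using cutoff'_bounded by blast
  obtain B2 where B2: "B2 > 0" "\<And>t. \<bar>cutoff' (4 * \<delta>\<^sup>2) (9 * \<delta>\<^sup>2) t\<bar> \<le> B2" using cutoff'_bounded by blast
  define \<eta>0 where "\<eta>0 = min (\<delta>\<^sup>2 / 4) (1 / (2 * (B1 + B2)))"
  have lt: "\<eta> * \<bar>y\<bar> < 1" if "0 < \<eta>" "\<eta> \<le> \<eta>0" "\<bar>y\<bar> \<le> B1 + B2" for \<eta> y
  proof -
    have "\<eta> * \<bar>y\<bar> \<le> (1 / (2 * (B1 + B2))) * (B1 + B2)" using that B1(1) B2(1) by (intro mult_mono) (auto simp: \<eta>0_def)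
    also have "\<dots> < 1" using B1(1) B2(1) by (simp add: field_simps)
    finally show ?thesis .
  qed
  show ?thesis
  proof (rule that[of \<eta>0])
    show "\<eta>0 > 0" using assms B1 B2 by (simp add: \<eta>0_def)
    fix \<eta> assume \<eta>: "0 < \<eta>" "\<eta> \<le> \<eta>0"
    have "\<eta> * \<bar>cutoff' (\<delta>\<^sup>2 / 4) (\<delta>\<^sup>2) s\<bar> < 1" "\<eta> * \<bar>cutoff' (4 * \<delta>\<^sup>2) (9 * \<delta>\<^sup>2) s\<bar> < 1" for s
      using lt[OF \<eta>] B1(1) B1(2)[of s] B2(1) B2(2)[of s] by auto
    then show "neck_ok \<eta> \<delta> \<and> (\<forall>s. \<eta> * \<bar>cutoff' (4 * \<delta>\<^sup>2) (9 * \<delta>\<^sup>2) s\<bar> < 1)"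
      using \<eta> assms by (simp add: neck_ok_def \<eta>0_def)
  qed
qed

lemma affine_pullback:
  fixes M :: "'a::euclidean_space \<Rightarrow> real"
  assumes tm: "tame M" and nf: "normal_form M s L L' a r"
  shows "smooth_at (\<lambda>x. M (s + L x)) x" "compact {x. M (s + L x) \<le> b}"
    "grad (\<lambda>x. M (s + L x)) x = 0 \<Longrightarrow> grad M (s + L x) = 0"
    "diffeomorphic_sets {x. M (s + L x) = b} {p. M p = b}"
proof -
  have lin: "linear L" "linear L'" and inv: "\<And>x. L' (L x) = x" "\<And>x. L (L' x) = x"
    using nf by (auto simp: normal_form_def)
  define N where "N x = M (s + L x)" for x
  have sL: "smooth_at (\<lambda>x. s + L x) x" for x by (intro smooth_intros smooth_at_linear lin)
  have sM: "smooth_at M x" for x using tm by (simp add: tame_def)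
  have sN: "smooth_at N x" for x unfolding N_def[abs_def] by (rule smooth_at_compose[OF sL sM])
  have contLi: "continuous_on X (\<lambda>p. L' (p - s))" for X
    by (intro linear_continuous_on_compose[OF _ lin(2)] continuous_intros)
  have KN: "compact {x. N x \<le> b}" for b
  proof -
    have "{x. N x \<le> b} = (\<lambda>p. L' (p - s)) ` {p. M p \<le> b}"
    proof
      show "{x. N x \<le> b} \<subseteq> (\<lambda>p. L' (p - s)) ` {p. M p \<le> b}"
      proof
        fix x assume "x \<in> {x. N x \<le> b}"
        then have "s + L x \<in> {p. M p \<le> b}" "x = L' ((s + L x) - s)" by (simp_all add: N_def inv)
        then show "x \<in> (\<lambda>p. L' (p - s)) ` {p. M p \<le> b}" by blast
      qed
    qed (auto simp: N_def inv)
    then show ?thesis using tm compact_continuous_image[OF contLi, of "{p. M p \<le> b}"] by (simp add: tame_def)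
  qed
  have gN: "grad M (s + L x) = 0" if "grad N x = 0" for x
  proof -
    have "((\<lambda>x. s + L x) has_derivative L) (at x)"
      using bounded_linear_imp_has_derivative[of L "at x"] lin(1) by (auto intro!: derivative_eq_intros simp: linear_conv_bounded_linear)
    from has_derivative_compose[OF this has_derivative_grad[OF sM]]
    have "(N has_derivative (\<lambda>v. grad M (s + L x) \<bullet> L v)) (at x)" by (simp add: N_def[abs_def])
    then have "grad M (s + L x) \<bullet> L v = grad N x \<bullet> v" for v
      using has_derivative_unique[OF _ has_derivative_grad[OF sN]] by metis
    then have "grad M (s + L x) \<bullet> w = 0" for w using that inv(2)[of w] by (metis inner_zero_left)
    then show ?thesis by (metis inner_eq_zero_iff)
  qed
  show "smooth_at (\<lambda>x. M (s + L x)) x" using sN by (simp add: N_def[abs_def])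
  show "compact {x. M (s + L x) \<le> b}" using KN by (simp add: N_def)
  show "grad (\<lambda>x. M (s + L x)) x = 0 \<Longrightarrow> grad M (s + L x) = 0" using gN by (simp add: N_def[abs_def])
  have "diffeo {x. M (s + L x) = b} {p. M p = b} (\<lambda>x. s + L x) (\<lambda>x. L' (x - s))"
    by (rule diffeo_subset[OF diffeo_linear[OF lin inv]]) (auto simp: inv)
  then show "diffeomorphic_sets {x. M (s + L x) = b} {p. M p = b}" using diffeomorphic_sets_iff by blast
qed

text \<open>After isotopy the level above (\<open>Zp\<close>) is a tube and the level below
  (\<open>Zm\<close>) a pair of caps, equal outside a box. By \<open>no_self_handle\<close> the caps
  lie in different components, and the one of the right cap is a sphere by hypothesis; so
  \<open>Zp\<close> is \<open>Zm\<close> with that sphere deleted.\<close>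

lemma saddle_crossing:
  fixes M :: "'a::euclidean_space \<Rightarrow> real"
  assumes tm: "tame M" and nf: "normal_form M s L L' a r" and a: "norm a = 1"
  obtains \<eta>0 where "\<eta>0 > 0" "\<And>\<eta>. 0 < \<eta> \<Longrightarrow> \<eta> \<le> \<eta>0 \<Longrightarrow> (\<And>x. grad M x = 0 \<Longrightarrow> \<bar>M x - M s\<bar> \<le> \<eta> \<Longrightarrow> x = s) \<Longrightarrow>
    all_spheres {x. M (s + L x) = M s - \<eta>} \<Longrightarrow> all_spheres {x. M (s + L x) = M s + \<eta>}"
proof -
  have lin: "linear L" "linear L'" and inv: "\<And>x. L' (L x) = x" "\<And>x. L (L' x) = x" and r: "r > 0"
    and nM: "\<And>x. norm x < r \<Longrightarrow> M (s + L x) = M s + x \<bullet> x - 2 * (x \<bullet> a)\<^sup>2"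
    using nf by (auto simp: normal_form_def)
  have aa: "a \<bullet> a = 1" using a by (simp add: norm_eq_1_inner)
  define \<delta> where "\<delta> = r / 7"
  have \<delta>: "\<delta> > 0" "6 * \<delta> < r" using r by (auto simp: \<delta>_def)
  define N where "N x = M (s + L x)" for x
  define c where "c = M s"
  have NQ: "N x = c + x \<bullet> x - 2 * (x \<bullet> a)\<^sup>2" if "norm x < r" for x using nM[OF that] by (simp add: N_def c_def)
  have N0: "N 0 = c" using linear_0[OF lin(1)] by (simp add: N_def c_def)
  note pb = affine_pullback[OF tm nf, folded N_def]
  have sL: "smooth_at (\<lambda>x. s + L x) x" for x by (intro smooth_intros smooth_at_linear lin)
  have sN: "smooth_at N x" for x using pb(1) by (simp add: N_def[abs_def])
  note KN = pb(2) and gN = pb(3)[folded N_def[abs_def]]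
  obtain \<eta>0 where \<eta>0: "\<eta>0 > 0" "\<And>\<eta>. 0 < \<eta> \<Longrightarrow> \<eta> \<le> \<eta>0 \<Longrightarrow> neck_ok \<eta> \<delta> \<and> (\<forall>s. \<eta> * \<bar>cutoff' (4 * \<delta>\<^sup>2) (9 * \<delta>\<^sup>2) s\<bar> < 1)"
    using small_eta[OF \<delta>(1)] by metis
  show ?thesis
  proof (rule that[OF \<eta>0(1)])
    fix \<eta> assume \<eta>: "0 < \<eta>" "\<eta> \<le> \<eta>0" and cr: "\<And>x. grad M x = 0 \<Longrightarrow> \<bar>M x - M s\<bar> \<le> \<eta> \<Longrightarrow> x = s"
      and low: "all_spheres {x. M (s + L x) = M s - \<eta>}"
    have ok: "neck_ok \<eta> \<delta>" and ok2: "\<And>s. \<eta> * \<bar>cutoff' (4 * \<delta>\<^sup>2) (9 * \<delta>\<^sup>2) s\<bar> < 1" using \<eta>0(2)[OF \<eta>] by auto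
    have ok1: "\<And>s. \<eta> * \<bar>cutoff' (\<delta>\<^sup>2 / 4) (\<delta>\<^sup>2) s\<bar> < 1" and \<eta>\<delta>: "\<eta> \<le> \<delta>\<^sup>2 / 4" using ok by (auto simp: neck_ok_def)
    have \<delta>2: "\<delta>\<^sup>2 > 0" "\<delta>\<^sup>2 / 4 < \<delta>\<^sup>2" "4 * \<delta>\<^sup>2 < 9 * \<delta>\<^sup>2" "\<delta>\<^sup>2 \<le> (3 * \<delta>)\<^sup>2" "9 * \<delta>\<^sup>2 \<le> (3 * \<delta>)\<^sup>2" using \<delta> by (auto simp: power_mult_distrib)
    have crN: "x = 0" if "grad N x = 0" "\<bar>N x - c\<bar> \<le> \<eta>" for x
    proof -
      have "s + L x = s" using cr[OF gN[OF that(1)]] that(2) by (simp add: N_def c_def)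
      then have "L x = 0" by simp
      then show "x = 0" using inv(1)[of x] linear_0[OF lin(2)] by simp
    qed
    define z1 where "z1 = cutoff (\<delta>\<^sup>2 / 4) (\<delta>\<^sup>2)"
    define z2 where "z2 = cutoff (4 * \<delta>\<^sup>2) (9 * \<delta>\<^sup>2)"
    \<comment> \<open>The tube is bent only where the axial coordinate is small, the caps only where
      the transverse one is; the wide thresholds 4 \<delta>^2 and 9 \<delta>^2 merely give compact
      support.\<close>
    define Bp where "Bp = box_bump a (\<delta>\<^sup>2 / 4) (\<delta>\<^sup>2) (4 * \<delta>\<^sup>2) (9 * \<delta>\<^sup>2)"
    define Bm where "Bm = box_bump a (4 * \<delta>\<^sup>2) (9 * \<delta>\<^sup>2) (\<delta>\<^sup>2 / 4) (\<delta>\<^sup>2)"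
    have Bp: "Bp x = z1 ((x \<bullet> a)\<^sup>2) * z2 ((norm (proj a x))\<^sup>2)" and Bm: "Bm x = z2 ((x \<bullet> a)\<^sup>2) * z1 ((norm (proj a x))\<^sup>2)" for x
      by (auto simp: Bp_def Bm_def box_bump_def z1_def z2_def power2_norm_eq_inner)
    have zb: "0 \<le> z1 s" "z1 s \<le> 1" "0 \<le> z2 s" "z2 s \<le> 1" for s by (auto simp: z1_def z2_def cutoff_bounds)
    have z1e: "s \<ge> \<delta>\<^sup>2 \<Longrightarrow> z1 s = 0" "s \<le> \<delta>\<^sup>2 / 4 \<Longrightarrow> z1 s = 1" and z2e: "s \<ge> 9 * \<delta>\<^sup>2 \<Longrightarrow> z2 s = 0" "s \<le> 4 * \<delta>\<^sup>2 \<Longrightarrow> z2 s = 1" for s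
      using \<delta>2 by (auto simp: z1_def z2_def cutoff_eq_0 cutoff_eq_1)
    have sB: "smooth_at Bp x" "smooth_at Bm x" for x unfolding Bp_def Bm_def by (intro smooth_box_bump \<delta>2)+
    have B01: "0 \<le> Bp x" "Bp x \<le> 1" "0 \<le> Bm x" "Bm x \<le> 1" for x
      using zb by (auto simp: Bp Bm mult_le_one)
    have p0: "proj a 0 = 0" by (simp add: proj_def)
    have B0: "Bp 0 = 1" "Bm 0 = 1" using \<delta>2 z1e z2e by (auto simp: Bp Bm p0)
    have Lp: "diffeomorphic_sets {x. N x = c + 1 * \<eta>} {x. N x = c + 1 * \<eta> * Bp x}"
      by (rule bump_isotopy[OF sN KN sB(1) B01(1,2) B0(1) N0 \<eta>(1) _ crN])
        (use box_bump_regular[OF sN a NQ \<delta> \<delta>2(2,3,4,5) ok1 ok2 \<eta>(1)] in \<open>auto simp: Bp_def\<close>)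
    have Lm: "diffeomorphic_sets {x. N x = c + (-1) * \<eta>} {x. N x = c + (-1) * \<eta> * Bm x}"
      by (rule bump_isotopy[OF sN KN sB(2) B01(3,4) B0(2) N0 \<eta>(1) _ crN])
        (use box_bump_regular[OF sN a NQ \<delta> \<delta>2(3,2,5,4) ok2 ok1 \<eta>(1)] in \<open>auto simp: Bm_def\<close>)
    define Zp where "Zp = {x. N x = c + \<eta> * Bp x}"
    define Zm where "Zm = {x. N x = c - \<eta> * Bm x}"
    have NB: "N x = c + (norm (proj a x))\<^sup>2 - (x \<bullet> a)\<^sup>2" if "norm x < r" for x
      using NQ[OF that] norm_proj[OF a, of x] by simp
    have inr: "norm x < r" if "\<bar>x \<bullet> a\<bar> < 3 * \<delta>" "norm (proj a x) < 3 * \<delta>" for x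
    proof -
      have "norm x \<le> norm (proj a x) + norm ((x \<bullet> a) *\<^sub>R a)" by (metis norm_triangle_ineq proj_decomp)
      then show ?thesis using that a \<delta> by simp
    qed
    \<comment> \<open>The wide cut-off \<open>z2\<close> is invisible: where \<open>z1\<close> is
      nonzero, A is below \<delta>^2, and then neither equation has a solution with Y above 4
      \<delta>^2.\<close>
    have key: "(Y = A + \<eta> * (z1 A * z2 Y)) \<longleftrightarrow> Y = neck \<eta> \<delta> A" if "A \<ge> 0" "Y \<ge> 0" for A Y
    proof (cases "z1 A = 0 \<or> Y \<le> 4 * \<delta>\<^sup>2")
      case True then show ?thesis using z2e(2)[of Y] by (auto simp: neck_def z1_def[symmetric])
    next
      case False
      then have A: "A < \<delta>\<^sup>2" using z1e(1)[of A] by force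
      have b: "\<eta> * w \<le> \<delta>\<^sup>2 / 4" if "0 \<le> w" "w \<le> 1" for w
      proof -
        have "\<eta> * w \<le> \<eta> * 1" using that(2) \<eta>(1) by (intro mult_left_mono) auto
        then show ?thesis using \<eta>\<delta> by linarith
      qed
      have "\<eta> * (z1 A * z2 Y) \<le> \<delta>\<^sup>2 / 4" by (rule b) (auto simp: zb mult_le_one)
      moreover have "\<eta> * z1 A \<le> \<delta>\<^sup>2 / 4" by (rule b) (auto simp: zb)
      ultimately have "Y \<noteq> A + \<eta> * (z1 A * z2 Y)" "Y \<noteq> A + \<eta> * z1 A" using A False \<delta>2(1) by linarith+
      then show ?thesis by (simp add: neck_def z1_def[symmetric])
    qed
    have Zp3: "x \<in> Zp \<longleftrightarrow> (norm (proj a x))\<^sup>2 = neck \<eta> \<delta> ((x \<bullet> a)\<^sup>2)" if "\<bar>x \<bullet> a\<bar> < 3 * \<delta>" "norm (proj a x) < 3 * \<delta>" for x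
      using key[of "(x \<bullet> a)\<^sup>2" "(norm (proj a x))\<^sup>2"] NB[OF inr[OF that]] by (auto simp: Zp_def Bp)
    have Zm3: "x \<in> Zm \<longleftrightarrow> (x \<bullet> a)\<^sup>2 = neck \<eta> \<delta> ((norm (proj a x))\<^sup>2)" if "\<bar>x \<bullet> a\<bar> < 3 * \<delta>" "norm (proj a x) < 3 * \<delta>" for x
      using key[of "(norm (proj a x))\<^sup>2" "(x \<bullet> a)\<^sup>2"] NB[OF inr[OF that]] by (auto simp: Zm_def Bm mult.commute)
    have neckb: "neck \<eta> \<delta> s < 4 * \<delta>\<^sup>2" if "0 \<le> s" "s < \<delta>\<^sup>2" for s
      using neck_mono[OF ok that(2)] neck_eq[OF ok, of "\<delta>\<^sup>2"] \<delta>2(1) by linarith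
    have lt2: "\<bar>w\<bar> < 2 * \<delta>" if "w\<^sup>2 < 4 * \<delta>\<^sup>2" for w
    proof -
      have "\<bar>w\<bar>\<^sup>2 < (2 * \<delta>)\<^sup>2" using that by (simp add: power_mult_distrib)
      then show ?thesis by (rule power_less_imp_less_base) (use \<delta> in simp)
    qed
    have lt3: "\<bar>w\<bar> < 3 * \<delta>" if "w\<^sup>2 < 9 * \<delta>\<^sup>2" for w
    proof -
      have "\<bar>w\<bar>\<^sup>2 < (3 * \<delta>)\<^sup>2" using that by (simp add: power_mult_distrib)
      then show ?thesis by (rule power_less_imp_less_base) (use \<delta> in simp)
    qed
    have out: "x \<in> Zp \<longleftrightarrow> x \<in> Zm" if o: "\<not> (\<bar>x \<bullet> a\<bar> < 2 * \<delta> \<and> norm (proj a x) < 2 * \<delta>)" for x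
    proof -
      have ge: "4 * \<delta>\<^sup>2 \<le> (x \<bullet> a)\<^sup>2 \<or> 4 * \<delta>\<^sup>2 \<le> (norm (proj a x))\<^sup>2"
        using o lt2[of "x \<bullet> a"] lt2[of "norm (proj a x)"] by force
      show ?thesis
      proof (cases "(x \<bullet> a)\<^sup>2 < 9 * \<delta>\<^sup>2 \<and> (norm (proj a x))\<^sup>2 < 9 * \<delta>\<^sup>2")
        case True
        then have 3: "\<bar>x \<bullet> a\<bar> < 3 * \<delta>" "norm (proj a x) < 3 * \<delta>" using lt3[of "x \<bullet> a"] lt3[of "norm (proj a x)"] by auto
        \<comment> \<open>Once one of the two squares exceeds 4 \<delta>^2, any solution lies where
          \<open>neck\<close> is the identity; there the equations of tube and caps both say P =
          Q.\<close>
        have sw: "P = neck \<eta> \<delta> Q \<longleftrightarrow> Q = neck \<eta> \<delta> P" if "4 * \<delta>\<^sup>2 \<le> P \<or> 4 * \<delta>\<^sup>2 \<le> Q" "0 \<le> P" "0 \<le> Q" for P Q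
        proof (cases "P < \<delta>\<^sup>2 \<or> Q < \<delta>\<^sup>2")
          case True
          then have "P \<noteq> neck \<eta> \<delta> Q \<and> Q \<noteq> neck \<eta> \<delta> P"
            using neckb[of P] neckb[of Q] neck_eq[OF ok, of P] neck_eq[OF ok, of Q] that \<delta>2(1) by (cases "P < \<delta>\<^sup>2"; cases "Q < \<delta>\<^sup>2") auto
          then show ?thesis by simp
        next
          case False
          then show ?thesis using neck_eq[OF ok] by auto
        qed
        show ?thesis using Zp3[OF 3] Zm3[OF 3] sw[of "(norm (proj a x))\<^sup>2" "(x \<bullet> a)\<^sup>2"] ge by auto
      next
        case False
        then have "9 * \<delta>\<^sup>2 \<le> (x \<bullet> a)\<^sup>2 \<or> 9 * \<delta>\<^sup>2 \<le> (norm (proj a x))\<^sup>2" by linarith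
        moreover have "z1 s = 0" if "9 * \<delta>\<^sup>2 \<le> s" for s by (rule z1e(1)) (use that \<delta>2(1) in linarith)
        ultimately have "Bp x = 0" "Bm x = 0" using z2e(1) by (auto simp: Bp Bm)
        then show ?thesis by (simp add: Zp_def Zm_def)
      qed
    qed
    define g where "g x = N x + - c + \<eta> * Bm x" for x
    have sg: "smooth_at g x" for x unfolding g_def[abs_def] by (intro smooth_intros sN sB)
    have Zg: "Zm = {x. g x = 0}" by (auto simp: Zm_def g_def)
    have cZm: "closed Zm" unfolding Zg
      using continuous_closed_preimage_constant[OF smooth_at_continuous_on[OF sg] closed_UNIV] by simp
    have gg: "grad g x = grad N x + \<eta> *\<^sub>R grad Bm x" for x
    proof -
      have "grad g x = grad (\<lambda>x. N x + - c) x + grad (\<lambda>x. \<eta> * Bm x) x" unfolding g_def[abs_def]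
        by (rule grad_add) (intro smooth_intros sN sB)+
      then show ?thesis unfolding grad_add_const[OF sN] grad_cmult[OF sB(2)] .
    qed
    have rg: "grad g x \<noteq> 0" if "x \<in> Zm" for x
    proof -
      have "N x = c - \<eta> * Bm x" using that by (simp add: Zm_def)
      then have ab: "\<bar>N x - c\<bar> \<le> \<eta>" using B01(3,4)[of x] \<eta>(1) by (simp add: mult_left_le)
      have "x \<noteq> 0" using that N0 B0(2) \<eta>(1) by (auto simp: Zm_def)
      moreover have "grad N x \<noteq> 0" using crN ab \<open>x \<noteq> 0\<close> by blast
      ultimately show ?thesis unfolding gg Bm_def
        using box_bump_regular[OF sN a NQ \<delta> \<delta>2(3,2,5,4) ok2 ok1 \<eta>(1), of x \<eta>] \<eta>(1) by auto
    qed
    \<comment> \<open>The component of the tip of the right cap.\<close>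
    define C2 where "C2 = connected_component_set Zm (sqrt \<eta> *\<^sub>R a)"
    have sq: "(sqrt \<eta>)\<^sup>2 = \<eta>" "sqrt \<eta> > 0" using \<eta>(1) by auto
    have "sqrt \<eta> \<le> sqrt (\<delta>\<^sup>2 / 4)" using \<eta>\<delta> by simp
    also have "\<dots> = \<delta> / 2" using \<delta> by (simp add: real_sqrt_divide)
    finally have sq\<delta>: "sqrt \<eta> \<le> \<delta> / 2" .
    have tip: "\<tau> *\<^sub>R a \<in> Zm" if "\<bar>\<tau>\<bar> = sqrt \<eta>" for \<tau>
    proof -
      have "\<tau>\<^sup>2 = \<eta>" using that sq(1) by (metis power2_abs)
      moreover have "proj a (\<tau> *\<^sub>R a) = 0" using aa by (simp add: proj_def)
      ultimately show ?thesis using Zm3[of "\<tau> *\<^sub>R a"] that sq\<delta> \<delta> aa neck_0[OF ok] by simp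
    qed
    have C2c: "C2 \<in> components Zm" using tip[of "sqrt \<eta>"] sq by (auto simp: C2_def components_iff)
    have tipC: "sqrt \<eta> *\<^sub>R a \<in> C2"
      using tip[of "sqrt \<eta>"] sq unfolding C2_def by (simp add: connected_component_refl_eq)
    have C2op: "openin (top_of_set Zm) C2" unfolding Zg
      by (rule regular_level_component_open[OF sg]) (use C2c rg in_components_subset in \<open>auto simp: Zg\<close>)
    have C2cl: "closed C2" using closed_components[OF cZm C2c] .
    have C2Zm: "C2 \<subseteq> Zm" using C2c in_components_subset by blast
    \<comment> \<open>Each cap is a graph over a disc, hence connected, so it lies in a single
      component.\<close>
    define cap where "cap \<sigma> = (\<lambda>u. u + (\<sigma> * sqrt (neck \<eta> \<delta> (u \<bullet> u))) *\<^sub>R a) ` (hyp a \<inter> ball 0 (3 * \<delta>))" for \<sigma>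
    have ncap: "neck \<eta> \<delta> (u \<bullet> u) > 0" for u :: 'a by (rule neck_pos[OF ok]) simp
    have capcon: "connected (cap \<sigma>)" for \<sigma>
    proof -
      have "convex (hyp a)" unfolding hyp_def using convex_hyperplane[of a 0] by (simp add: inner_commute)
      then have "connected (hyp a \<inter> ball 0 (3 * \<delta>))" by (intro convex_connected convex_Int convex_ball)
      moreover have "smooth_at (\<lambda>u. u + (\<sigma> * sqrt (neck \<eta> \<delta> (u \<bullet> u))) *\<^sub>R a) u" for u by (intro smooth_intros ok ncap)
      ultimately show ?thesis unfolding cap_def using connected_continuous_image smooth_at_continuous_on by blast
    qed
    have capZ: "cap \<sigma> \<subseteq> Zm" if \<sigma>: "\<sigma> = 1 \<or> \<sigma> = -1" for \<sigma>
    proof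
      fix x assume "x \<in> cap \<sigma>"
      then obtain u where u: "u \<in> hyp a" "norm u < 3 * \<delta>" "x = u + (\<sigma> * sqrt (neck \<eta> \<delta> (u \<bullet> u))) *\<^sub>R a" by (auto simp: cap_def)
      have x: "proj a x = u" "x \<bullet> a = \<sigma> * sqrt (neck \<eta> \<delta> (u \<bullet> u))" using u aa by (auto simp: proj_def hyp_def inner_add_left)
      have xa2: "(x \<bullet> a)\<^sup>2 = neck \<eta> \<delta> ((norm u)\<^sup>2)" using x(2) \<sigma> ncap[of u] by (auto simp: power2_norm_eq_inner)
      have "(norm u)\<^sup>2 < 9 * \<delta>\<^sup>2" using power_strict_mono[OF u(2), of 2] by (simp add: power_mult_distrib)
      then have "neck \<eta> \<delta> ((norm u)\<^sup>2) < neck \<eta> \<delta> (9 * \<delta>\<^sup>2)" by (rule neck_mono[OF ok])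
      then have "(x \<bullet> a)\<^sup>2 < 9 * \<delta>\<^sup>2" using xa2 neck_eq[OF ok, of "9 * \<delta>\<^sup>2"] \<delta>2(1) by simp
      then show "x \<in> Zm" using Zm3[of x] lt3[of "x \<bullet> a"] u(2) x(1) xa2 by simp
    qed
    have capI: "x \<in> cap \<sigma>" if "x \<in> Zm" "\<bar>x \<bullet> a\<bar> < 3 * \<delta>" "norm (proj a x) < 3 * \<delta>" "x \<bullet> a = \<sigma> * \<bar>x \<bullet> a\<bar>" for x \<sigma>
    proof -
      have "(x \<bullet> a)\<^sup>2 = neck \<eta> \<delta> (proj a x \<bullet> proj a x)" using Zm3[OF that(2,3)] that(1) by (simp add: power2_norm_eq_inner)
      then have "\<bar>x \<bullet> a\<bar> = sqrt (neck \<eta> \<delta> (proj a x \<bullet> proj a x))" by (metis real_sqrt_abs)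
      then have "x = proj a x + (\<sigma> * sqrt (neck \<eta> \<delta> (proj a x \<bullet> proj a x))) *\<^sub>R a" using proj_decomp[of a x] that(4) by metis
      then show ?thesis unfolding cap_def using that(3) proj_in_hyp[OF a, of x] by (intro image_eqI[of _ _ "proj a x"]) auto
    qed
    have tipcap: "(\<sigma> * sqrt \<eta>) *\<^sub>R a \<in> cap \<sigma>" for \<sigma>
      unfolding cap_def by (rule image_eqI[of _ _ 0]) (use \<delta> neck_0[OF ok] in \<open>auto simp: hyp_def\<close>)
    have right: "x \<in> C2" if "x \<in> Zm" "0 < x \<bullet> a" "x \<bullet> a < 3 * \<delta>" "norm (proj a x) < 3 * \<delta>" for x
    proof -
      have "sqrt \<eta> *\<^sub>R a \<in> cap 1" using tipcap[of 1] by simp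
      then have "cap 1 \<subseteq> C2" using tipC by (intro components_maximal[OF C2c capcon capZ]) auto
      then show ?thesis using capI[of x 1] that by auto
    qed
    have left: "x \<notin> C2" if x: "x \<in> Zm" "x \<bullet> a < 0" "- (3 * \<delta>) < x \<bullet> a" "norm (proj a x) < 3 * \<delta>" for x
    proof
      assume xC: "x \<in> C2"
      have "x \<in> cap (-1)" using capI[of x "-1"] x by auto
      then have "cap (-1) \<subseteq> C2" using xC by (intro components_maximal[OF C2c capcon capZ]) auto
      then have ml: "(- sqrt \<eta>) *\<^sub>R a \<in> C2" using tipcap[of "-1"] by auto
      \<comment> \<open>With both tips in \<open>C2\<close>, its image below the critical level
        would join the two sides of the saddle.\<close>
      show False
      proof (rule no_self_handle[OF tm nf a sq(2), of "(\<lambda>x. s + L x) ` C2"])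
        show "3 * sqrt \<eta> < r" using sq\<delta> \<delta> by simp
        have "continuous_on C2 (\<lambda>x. s + L x)" by (rule smooth_at_continuous_on[OF sL])
        moreover have "connected C2" by (simp add: C2_def)
        ultimately show "connected ((\<lambda>x. s + L x) ` C2)" using connected_continuous_image by blast
        show "M p \<le> M s" if pC: "p \<in> (\<lambda>x. s + L x) ` C2" for p
        proof -
          obtain y where y: "y \<in> C2" "p = s + L y" using pC by blast
          then have "N y = c - \<eta> * Bm y" using C2Zm by (auto simp: Zm_def)
          then show ?thesis using y(2) B01(3)[of y] \<eta>(1) by (simp add: N_def c_def)
        qed
        show "s + L (sqrt \<eta> *\<^sub>R a) \<in> (\<lambda>x. s + L x) ` C2" using tipC by blast
        show "s + L (- sqrt \<eta> *\<^sub>R a) \<in> (\<lambda>x. s + L x) ` C2" using ml by simp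
        \<comment> \<open>On \<open>Zm\<close> the axial square is the transverse square plus \<eta>
          times the bump: either the bump is 1, or one of the squares alone is already larger than
          \<eta>.\<close>
        show "sqrt \<eta> \<le> \<bar>y \<bullet> a\<bar>" if yr: "norm y < r" and yC: "s + L y \<in> (\<lambda>x. s + L x) ` C2" for y
        proof -
          obtain y' where y': "y' \<in> C2" "s + L y = s + L y'" using yC by blast
          then have "y = y'" using inv(1) by (metis add_left_cancel)
          then have "y \<in> Zm" using y' C2Zm by blast
          then have e: "(y \<bullet> a)\<^sup>2 = (norm (proj a y))\<^sup>2 + \<eta> * Bm y" using NB[OF yr] by (simp add: Zm_def)
          have "\<eta> \<le> (y \<bullet> a)\<^sup>2"
          proof (cases "(norm (proj a y))\<^sup>2 \<le> \<delta>\<^sup>2 / 4 \<and> (y \<bullet> a)\<^sup>2 \<le> 4 * \<delta>\<^sup>2")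
            case True
            then have "Bm y = 1" using z1e(2) z2e(2) by (simp add: Bm)
            then show ?thesis using e by simp
          next
            case False
            then have "\<delta>\<^sup>2 / 4 < (norm (proj a y))\<^sup>2 \<or> 4 * \<delta>\<^sup>2 < (y \<bullet> a)\<^sup>2" by linarith
            moreover have "0 \<le> \<eta> * Bm y" using B01(3)[of y] \<eta>(1) by simp
            ultimately show ?thesis using e \<eta>\<delta> \<delta>2(1) by (elim disjE) linarith+
          qed
          then have "sqrt \<eta> \<le> sqrt ((y \<bullet> a)\<^sup>2)" by (simp only: real_sqrt_le_iff)
          then show ?thesis by simp
        qed
      qed
    qed
    have low': "all_spheres Zm"
    proof (rule all_spheres_diffeo[OF diffeomorphic_sets_sym])
      show "diffeomorphic_sets {x. N x = c - \<eta>} Zm" using Lm by (simp add: Zm_def)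
      show "all_spheres {x. N x = c - \<eta>}" using low by (simp add: N_def c_def)
    qed
    then have sph: "diffeomorphic_sets C2 (sphere (0::'a) 1)" using C2c by (simp add: all_spheres_def)
    have "diffeomorphic_sets Zp (Zm - C2)"
      by (rule remove_sphere_summand[OF a ok Zp3 Zm3 out cZm C2op C2cl right left sph])
    then have "all_spheres Zp" using all_spheres_diffeo all_spheres_diff[OF C2op C2cl low'] by blast
    moreover have "diffeomorphic_sets {x. N x = c + \<eta>} Zp" using Lp by (simp add: Zp_def)
    ultimately have "all_spheres {x. N x = c + \<eta>}" using all_spheres_diffeo by blast
    then show "all_spheres {x. M (s + L x) = M s + \<eta>}" by (simp add: N_def c_def)
  qed
qed

lemma connected_clopen_cases:
  assumes "connected C" "C \<subseteq> S" "openin (top_of_set S) D" "closed D"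
  shows "C \<subseteq> D \<or> C \<inter> D = {}"
proof (rule ccontr)
  assume n: "\<not> (C \<subseteq> D \<or> C \<inter> D = {})"
  obtain O' where O': "open O'" "D = S \<inter> O'" using assms(3) openin_open by metis
  have "O' \<inter> C \<noteq> {}" "- D \<inter> C \<noteq> {}" "C \<subseteq> O' \<union> - D" "O' \<inter> - D \<inter> C = {}" using n O' assms(2) by blast+
  then show False using connectedD[OF assms(1) O'(1), of "- D"] assms(4) by (simp add: open_Compl)
qed

text \<open>Above a nondegenerate minimum the level consists of the level below and a small round
  sphere \<open>D\<close>, which is connected since the dimension is at least 2.\<close>

lemma min_crossing:
  fixes M :: "'a::euclidean_space \<Rightarrow> real"
  assumes tm: "tame M" and nf: "normal_form M s L L' 0 r" and dim: "2 \<le> DIM('a)"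
  obtains \<eta>0 where "\<eta>0 > 0" "\<And>\<eta>. 0 < \<eta> \<Longrightarrow> \<eta> \<le> \<eta>0 \<Longrightarrow> (\<And>x. grad M x = 0 \<Longrightarrow> \<bar>M x - M s\<bar> \<le> \<eta> \<Longrightarrow> x = s) \<Longrightarrow>
    all_spheres {x. M (s + L x) = M s - \<eta>} \<Longrightarrow> all_spheres {x. M (s + L x) = M s + \<eta>}"
proof -
  have lin: "linear L" "linear L'" and inv: "\<And>x. L' (L x) = x" and r: "r > 0"
    and nM: "\<And>x. norm x < r \<Longrightarrow> M (s + L x) = M s + x \<bullet> x"
    using nf by (auto simp: normal_form_def)
  define \<rho> where "\<rho> = r / 3"
  have \<rho>: "\<rho> > 0" "2 * \<rho> < r" using r by (auto simp: \<rho>_def)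
  define N where "N x = M (s + L x)" for x
  define c where "c = M s"
  have NQ: "N x = c + x \<bullet> x" if "norm x < r" for x using nM[OF that] by (simp add: N_def c_def)
  have N0: "N 0 = c" using linear_0[OF lin(1)] by (simp add: N_def c_def)
  note pb = affine_pullback[OF tm nf, folded N_def]
  have sN: "smooth_at N x" for x using pb(1) by (simp add: N_def[abs_def])
  note KN = pb(2) and gN = pb(3)[folded N_def[abs_def]]
  obtain B1 where B1: "B1 > 0" "\<And>t. \<bar>cutoff' 1 4 t\<bar> \<le> B1" using cutoff'_bounded by blast
  \<comment> \<open>The first bound puts the new sphere where the bump is 1; the second lets the
    perturbation change the factor of the gradient 2 x by at most one half.\<close>
  define \<eta>0 where "\<eta>0 = min (\<rho>\<^sup>2) (\<rho>\<^sup>2 / (2 * B1))"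
  have \<eta>0: "\<eta>0 > 0" using \<rho> B1 by (simp add: \<eta>0_def)
  show ?thesis
  proof (rule that[OF \<eta>0])
    fix \<eta> assume \<eta>: "0 < \<eta>" "\<eta> \<le> \<eta>0" and cr: "\<And>x. grad M x = 0 \<Longrightarrow> \<bar>M x - M s\<bar> \<le> \<eta> \<Longrightarrow> x = s"
      and low: "all_spheres {x. M (s + L x) = M s - \<eta>}"
    have crN: "x = 0" if "grad N x = 0" "\<bar>N x - c\<bar> \<le> \<eta>" for x
    proof -
      have "s + L x = s" using cr[OF gN[OF that(1)]] that(2) by (simp add: N_def c_def)
      then have "L x = 0" by simp
      then show "x = 0" using inv(1)[of x] linear_0[OF lin(2)] by simp
    qed
    have reg: "grad N x + t *\<^sub>R grad (bump \<rho>) x \<noteq> 0" if x: "x \<noteq> 0" "grad N x \<noteq> 0" "\<bar>t\<bar> \<le> \<eta>" for x t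
    proof (cases "norm x < r")
      case True
      have "grad N x = 2 *\<^sub>R x"
      proof (rule grad_unique[OF sN])
        have "((\<lambda>x. c + x \<bullet> x) has_derivative (\<lambda>v. (2 *\<^sub>R x) \<bullet> v)) (at x)"
          by (auto intro!: derivative_eq_intros simp: fun_eq_iff inner_commute)
        then show "(N has_derivative (\<lambda>v. (2 *\<^sub>R x) \<bullet> v)) (at x)"
          by (rule has_derivative_transform_within_open[of _ _ _ _ "ball 0 r"]) (use True NQ in auto)
      qed
      define k where "k = cutoff' 1 4 ((x \<bullet> x) / \<rho>\<^sup>2) / \<rho>\<^sup>2"
      have "\<bar>t * k\<bar> \<le> (\<rho>\<^sup>2 / (2 * B1)) * (B1 / \<rho>\<^sup>2)"
        unfolding abs_mult using x(3) \<eta>(2) B1 by (intro mult_mono) (auto simp: k_def abs_divide \<eta>0_def intro!: divide_right_mono)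
      also have "\<dots> = 1/2" using B1(1) \<rho> by simp
      finally have "1 + t * k \<noteq> 0" by auto
      moreover have "grad N x + t *\<^sub>R grad (bump \<rho>) x = (2 * (1 + t * k)) *\<^sub>R x"
        unfolding \<open>grad N x = 2 *\<^sub>R x\<close> grad_bump[OF \<rho>(1)] k_def by (simp add: algebra_simps)
      ultimately show ?thesis using x(1) by simp
    next
      case False
      then have "(2 * \<rho>)\<^sup>2 \<le> (norm x)\<^sup>2" using \<rho> by (intro power_mono) auto
      then have "4 \<le> (x \<bullet> x) / \<rho>\<^sup>2" using \<rho> by (simp add: power2_norm_eq_inner power_mult_distrib le_divide_eq)
      then have "grad (bump \<rho>) x = 0" unfolding grad_bump[OF \<rho>(1)] by (simp add: cutoff'_eq_0)
      then show ?thesis using x by simp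
    qed
    have b0: "bump \<rho> (0::'a) = 1" using bump_eq_1[OF \<rho>(1), of "0::'a"] \<rho> by simp
    have iso: "diffeomorphic_sets {x. N x = c + \<sigma> * \<eta>} {x. N x = c + \<sigma> * \<eta> * bump \<rho> x}" if "\<sigma> = 1 \<or> \<sigma> = -1" for \<sigma>
      by (rule bump_isotopy[OF sN KN smooth_at_bump[OF \<rho>(1) smooth_at_ident] bump_bounds b0 N0 \<eta>(1) that crN reg])
    define Zp where "Zp = {x. N x = c + \<eta> * bump \<rho> x}"
    define Zm where "Zm = {x. N x = c - \<eta> * bump \<rho> x}"
    define D where "D = sphere (0::'a) (sqrt \<eta>)"
    have \<eta>\<rho>: "\<eta> \<le> \<rho>\<^sup>2" using \<eta> by (simp add: \<eta>0_def)
    have sq: "sqrt \<eta> \<le> \<rho>" using \<eta>\<rho> \<rho> by (simp add: real_le_lsqrt)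
    have inD: "x \<in> Zp \<longleftrightarrow> x \<in> D" if x: "norm x < r" for x
    proof (cases "norm x \<le> \<rho>")
      case True
      then have "bump \<rho> x = 1" by (rule bump_eq_1[OF \<rho>(1)])
      then have "x \<in> Zp \<longleftrightarrow> x \<bullet> x = \<eta>" using NQ[OF x] by (simp add: Zp_def)
      then show ?thesis using \<eta>(1) by (auto simp: D_def norm_eq_sqrt_inner)
    next
      case False
      then have "x \<notin> D" using sq by (simp add: D_def)
      moreover have "\<rho>\<^sup>2 < (norm x)\<^sup>2" using False \<rho> by (intro power_strict_mono) auto
      moreover have "\<eta> * bump \<rho> x \<le> \<eta>" using bump_bounds[of \<rho> x] \<eta>(1) by (simp add: mult_left_le)
      ultimately show ?thesis using NQ[OF x] \<eta>\<rho> by (simp add: Zp_def power2_norm_eq_inner)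
    qed
    have notm: "x \<notin> Zm" if x: "norm x < r" for x
    proof
      assume "x \<in> Zm"
      then have e: "x \<bullet> x = - (\<eta> * bump \<rho> x)" using NQ[OF x] by (simp add: Zm_def)
      moreover have "0 \<le> \<eta> * bump \<rho> x" using bump_bounds[of \<rho> x] \<eta>(1) by simp
      ultimately have "x \<bullet> x = 0" using inner_ge_zero[of x] by linarith
      then have "x = 0" by simp
      then show False using e b0 \<eta>(1) by simp
    qed
    have outr: "x \<in> Zp \<longleftrightarrow> x \<in> Zm" if "\<not> norm x < r" for x
      using bump_eq_0[OF \<rho>(1), of x] that \<rho>(2) by (simp add: Zp_def Zm_def)
    have Dr: "norm x < r" if "x \<in> D" for x using that sq \<rho> by (simp add: D_def)
    have Zpm: "Zp - D = Zm" using inD notm outr Dr by blast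
    have "D = Zp \<inter> ball 0 r" using inD Dr by auto
    then have Dop: "openin (top_of_set Zp) D" by (simp add: openin_open_Int)
    have DZ: "D \<subseteq> Zp" using inD Dr by blast
    have cD: "connected D" unfolding D_def by (rule connected_sphere[OF dim])
    have low': "all_spheres Zm"
    proof (rule all_spheres_diffeo[OF diffeomorphic_sets_sym])
      show "diffeomorphic_sets {x. N x = c - \<eta>} Zm" using iso[of "-1"] by (simp add: Zm_def)
      show "all_spheres {x. N x = c - \<eta>}" using low by (simp add: N_def c_def)
    qed
    have "all_spheres Zp" unfolding all_spheres_def
    proof
      fix C assume C: "C \<in> components Zp"
      have "C \<subseteq> D \<or> C \<inter> D = {}"
        by (rule connected_clopen_cases[OF in_components_connected[OF C] in_components_subset[OF C] Dop]) (simp add: D_def)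
      then show "diffeomorphic_sets C (sphere (0::'a) 1)"
      proof
        assume CD: "C \<subseteq> D"
        have "C \<inter> D \<noteq> {}" using CD in_components_nonempty[OF C] by blast
        then have "D \<subseteq> C" by (intro components_maximal[OF C cD DZ])
        then have CeD: "C = D" using CD by blast
        have s0: "sqrt \<eta> > 0" using \<eta>(1) by simp
        have "diffeo D (sphere (0::'a) 1) (\<lambda>x. inverse (sqrt \<eta>) *\<^sub>R x) (\<lambda>x. sqrt \<eta> *\<^sub>R x)"
          by (rule diffeoI) (use s0 \<eta>(1) in \<open>auto simp: D_def intro!: smooth_map_on_smooth_at smooth_intros\<close>)
        then show ?thesis unfolding CeD diffeomorphic_sets_iff by blast
      next
        assume "C \<inter> D = {}"
        then have "C \<subseteq> Zm" using Zpm in_components_subset[OF C] by blast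
        moreover have "Zm \<subseteq> Zp" using Zpm by blast
        ultimately have "C \<in> components Zm" using components_intermediate_subset[OF C] by blast
        then show ?thesis using low' by (simp add: all_spheres_def)
      qed
    qed
    moreover have "diffeomorphic_sets {x. N x = c + \<eta>} Zp" using iso[of 1] by (simp add: Zp_def)
    ultimately have "all_spheres {x. N x = c + \<eta>}" using all_spheres_diffeo by blast
    then show "all_spheres {x. M (s + L x) = M s + \<eta>}" by (simp add: N_def c_def)
  qed
qed

text \<open>Induction on the number of critical values below b. The level is pushed down to just
  above the highest of them, that value is crossed, and the induction hypothesis applies just below
  it.\<close>

theorem tame_level_spheres:
  fixes M :: "'a::euclidean_space \<Rightarrow> real"
  assumes tm: "tame M" and dim: "2 \<le> DIM('a)" and reg: "\<And>x. M x = b \<Longrightarrow> grad M x \<noteq> 0"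
  shows "all_spheres {x. M x = b}"
  using reg
proof (induction "card (M ` {x. grad M x = 0} \<inter> {..<b})" arbitrary: b rule: less_induct)
  case less
  define V where "V = M ` {x. grad M x = 0}"
  have sm: "smooth_at M x" and cp: "compact {x. M x \<le> b'}" and inj: "inj_on M {x. grad M x = 0}" for x b'
    using tm by (auto simp: tame_def)
  have fV: "finite V" using tm by (simp add: tame_def V_def)
  show ?case
  proof (cases "V \<inter> {..<b} = {}")
    case True
    \<comment> \<open>A nonempty sublevel set contains a global minimum, whose value would be a
      critical value below b.\<close>
    have "{x. M x = b} = {}"
    proof (rule ccontr)
      assume "{x. M x = b} \<noteq> {}"
      then have ne: "{x. M x \<le> b} \<noteq> {}" by force
      obtain z where z: "M z \<le> b" "\<And>x. M x \<le> b \<Longrightarrow> M z \<le> M x"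
        using continuous_attains_inf[OF cp ne tame_cont[OF tm]] by auto
      have zmin: "M z \<le> M x" for x using z(1) z(2)[of x] by (cases "M x \<le> b") auto
      have "(\<lambda>v. grad M z \<bullet> v) = (\<lambda>v. 0)"
        by (rule differential_zero_maxmin[OF UNIV_I open_UNIV has_derivative_grad[OF sm]]) (use zmin in blast)
      then have "grad M z = 0" by (metis inner_eq_zero_iff)
      then have "M z \<in> V" "M z \<noteq> b" using less.prems by (auto simp: V_def)
      then show False using True z(1) by auto
    qed
    then show ?thesis by (simp add: all_spheres_def)
  next
    case False
    define c0 where "c0 = Max (V \<inter> {..<b})"
    have c0: "c0 \<in> V" "c0 < b" using Max_in[of "V \<inter> {..<b}"] fV False by (auto simp: c0_def)
    have c0max: "v \<le> c0" if "v \<in> V" "v < b" for v using Max_ge[of "V \<inter> {..<b}" v] fV that by (auto simp: c0_def)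
    obtain s where s: "grad M s = 0" "M s = c0" using c0 by (auto simp: V_def)
    obtain L L' a r where nf: "normal_form M s L L' a r" using tm s unfolding tame_def by blast
    have "a = 0 \<or> norm a = 1" using nf by (simp add: normal_form_def)
    then have "\<exists>\<eta>0>0. \<forall>\<eta>. 0 < \<eta> \<longrightarrow> \<eta> \<le> \<eta>0 \<longrightarrow> (\<forall>x. grad M x = 0 \<longrightarrow> \<bar>M x - M s\<bar> \<le> \<eta> \<longrightarrow> x = s) \<longrightarrow>
      all_spheres {x. M (s + L x) = M s - \<eta>} \<longrightarrow> all_spheres {x. M (s + L x) = M s + \<eta>}"
    proof
      assume "a = 0"
      then have "normal_form M s L L' 0 r" using nf by simp
      from min_crossing[OF tm this dim] show ?thesis by metis
    next
      assume "norm a = 1"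
      from saddle_crossing[OF tm nf this] show ?thesis by metis
    qed
    then obtain \<eta>0 where \<eta>0: "\<eta>0 > 0" "\<And>\<eta>. 0 < \<eta> \<Longrightarrow> \<eta> \<le> \<eta>0 \<Longrightarrow> (\<forall>x. grad M x = 0 \<longrightarrow> \<bar>M x - M s\<bar> \<le> \<eta> \<longrightarrow> x = s) \<Longrightarrow>
      all_spheres {x. M (s + L x) = M s - \<eta>} \<Longrightarrow> all_spheres {x. M (s + L x) = M s + \<eta>}" by blast
    obtain d where d: "d > 0" "\<And>x. grad M x = 0 \<Longrightarrow> \<bar>M x - c0\<bar> \<le> d \<Longrightarrow> M x = c0" using tame_isolated_value[OF tm] by blast
    \<comment> \<open>Small enough for the crossing, for isolating the critical value c0, and for
      staying below b.\<close>
    define \<eta> where "\<eta> = min \<eta>0 (min d ((b - c0) / 2))"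
    have \<eta>: "0 < \<eta>" "\<eta> \<le> \<eta>0" "\<eta> \<le> d" "c0 + \<eta> < b" using \<eta>0 d c0 by (auto simp: \<eta>_def min_def field_simps)
    have cr: "x = s" if "grad M x = 0" "\<bar>M x - M s\<bar> \<le> \<eta>" for x
    proof -
      have "M x = M s" using d(2)[OF that(1)] that(2) \<eta>(3) s(2) by simp
      then show ?thesis using inj that(1) s(1) by (auto simp: inj_on_def)
    qed
    have "all_spheres {x. M x = c0 - \<eta>}"
    proof -
      have "c0 \<in> V \<inter> {..<b}" "c0 \<notin> V \<inter> {..<c0 - \<eta>}" using c0 \<eta>(1) by auto
      moreover have "{..<c0 - \<eta>} \<subseteq> {..<b}" using c0(2) \<eta>(1) by (intro lessThan_subset_iff[THEN iffD2]) linarith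
      then have "V \<inter> {..<c0 - \<eta>} \<subseteq> V \<inter> {..<b}" by (intro Int_mono order_refl)
      ultimately have "V \<inter> {..<c0 - \<eta>} \<subset> V \<inter> {..<b}" unfolding psubset_eq by metis
      then have "card (V \<inter> {..<c0 - \<eta>}) < card (V \<inter> {..<b})" using fV by (intro psubset_card_mono) auto
      moreover have "grad M x \<noteq> 0" if "M x = c0 - \<eta>" for x
      proof
        assume "grad M x = 0"
        then have "x = s" using cr[of x] that s(2) \<eta>(1) by simp
        then show False using that s(2) \<eta>(1) by simp
      qed
      ultimately show ?thesis using less.hyps[of "c0 - \<eta>"] unfolding V_def by blast
    qed
    then have "all_spheres {x. M (s + L x) = M s - \<eta>}"
      using all_spheres_diffeo[OF affine_pullback(4)[OF tm nf]] s(2) by simp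
    then have "all_spheres {x. M (s + L x) = M s + \<eta>}" using \<eta>0(2)[OF \<eta>(1,2)] cr by blast
    then have up: "all_spheres {x. M x = c0 + \<eta>}"
      using all_spheres_diffeo[OF diffeomorphic_sets_sym[OF affine_pullback(4)[OF tm nf]]] s(2) by simp
    have "diffeomorphic_sets {x. M x = c0 + \<eta>} {x. M x = b}"
    proof (rule level_change[OF sm cp])
      fix x assume x: "c0 + \<eta> \<le> M x" "M x \<le> b"
      show "grad M x \<noteq> 0"
      proof
        assume g: "grad M x = 0"
        then have "M x \<noteq> b" using less.prems by blast
        then have "M x \<le> c0" using c0max[of "M x"] x(2) g by (auto simp: V_def)
        then show False using x(1) \<eta>(1) by simp
      qed
    qed (use \<eta> in simp)
    then show ?thesis using all_spheres_diffeo[OF diffeomorphic_sets_sym up] by blast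
  qed
qed

section \<open>The plane subharmonicity of the logarithm and its consequence for the Hessian\<close>

section \<open>Products of squared distances\<close>

text \<open>\<open>G\<close> is the gradient and \<open>H\<close> the Hessian. Where P > 0, the
  quadratic inequality says that ln P is subharmonic on the plane spanned by u and v; it is
  multiplied out so as to make sense at the zeros too. The last clause is growth at
  infinity.\<close>

definition potential :: "('a::euclidean_space \<Rightarrow> real) \<Rightarrow> ('a \<Rightarrow> 'a) \<Rightarrow> ('a \<Rightarrow> 'a \<Rightarrow> 'a) \<Rightarrow> bool" where
  "potential P G H \<longleftrightarrow> (\<forall>x. smooth_at P x \<and> (P has_derivative (\<lambda>v. G x \<bullet> v)) (at x) \<and> (G has_derivative H x) (at x) \<and> 0 \<le> P x) \<and>
     (\<forall>x u v. u \<bullet> H x v = v \<bullet> H x u) \<and>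
     (\<forall>x u v. norm u = 1 \<longrightarrow> norm v = 1 \<longrightarrow> u \<bullet> v = 0 \<longrightarrow>
        (G x \<bullet> u)\<^sup>2 + (G x \<bullet> v)\<^sup>2 \<le> P x * (u \<bullet> H x u + v \<bullet> H x v) \<and> 0 \<le> u \<bullet> H x u + v \<bullet> H x v) \<and>
     (\<exists>R. \<forall>x. R \<le> norm x \<longrightarrow> 1 \<le> P x \<and> (norm x)\<^sup>2 \<le> G x \<bullet> x)"

lemma bessel2:
  fixes u v :: "'a::euclidean_space"
  assumes "norm u = 1" "norm v = 1" "u \<bullet> v = 0" shows "(y \<bullet> u)\<^sup>2 + (y \<bullet> v)\<^sup>2 \<le> y \<bullet> y"
proof -
  have "0 \<le> (y - (y \<bullet> u) *\<^sub>R u - (y \<bullet> v) *\<^sub>R v) \<bullet> (y - (y \<bullet> u) *\<^sub>R u - (y \<bullet> v) *\<^sub>R v)" by (rule inner_ge_zero)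
  also have "\<dots> = y \<bullet> y - (y \<bullet> u)\<^sup>2 - (y \<bullet> v)\<^sup>2"
    using assms by (simp add: inner_diff_left inner_diff_right norm_eq_1 inner_commute power2_eq_square)
  finally show ?thesis by linarith
qed

lemma potential_square_dist:
  fixes w :: "'a::euclidean_space"
  shows "potential (\<lambda>x. (x - w) \<bullet> (x - w)) (\<lambda>x. 2 *\<^sub>R (x - w)) (\<lambda>x v. 2 *\<^sub>R v)"
  unfolding potential_def
proof (intro conjI allI impI)
  fix x show "((\<lambda>x. (x - w) \<bullet> (x - w)) has_derivative (\<lambda>v. 2 *\<^sub>R (x - w) \<bullet> v)) (at x)"
    by (auto intro!: derivative_eq_intros simp: inner_commute)
  show "((\<lambda>x. 2 *\<^sub>R (x - w)) has_derivative (\<lambda>v. 2 *\<^sub>R v)) (at x)" by (auto intro!: derivative_eq_intros)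
  show "smooth_at (\<lambda>x. (x - w) \<bullet> (x - w)) x" by (intro smooth_intros)
next
  \<comment> \<open>For one squared distance the inequality is Bessel's inequality for the pair u,
    v.\<close>
  fix x u v :: 'a assume "norm u = 1" "norm v = 1" "u \<bullet> v = 0"
  then show "(2 *\<^sub>R (x - w) \<bullet> u)\<^sup>2 + (2 *\<^sub>R (x - w) \<bullet> v)\<^sup>2 \<le> (x - w) \<bullet> (x - w) * (u \<bullet> 2 *\<^sub>R u + v \<bullet> 2 *\<^sub>R v)"
    using bessel2[of u v "x - w"] by (simp add: norm_eq_1 power_mult_distrib)
next
  define R where "R = 2 * norm w + 1"
  have "1 \<le> (x - w) \<bullet> (x - w) \<and> (norm x)\<^sup>2 \<le> 2 *\<^sub>R (x - w) \<bullet> x" if "R \<le> norm x" for x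
  proof
    have "1 \<le> norm (x - w)" using norm_triangle_ineq2[of x w] that norm_ge_zero[of w] unfolding R_def by linarith
    then show "1 \<le> (x - w) \<bullet> (x - w)" unfolding power2_norm_eq_inner[symmetric] by (simp add: one_le_power)
    have "w \<bullet> x \<le> norm w * norm x" by (rule norm_cauchy_schwarz)
    moreover have "2 * (norm w * norm x) \<le> norm x * norm x"
      using mult_right_mono[of "2 * norm w" "norm x" "norm x"] that by (simp add: R_def)
    ultimately have "2 * (w \<bullet> x) \<le> norm x * norm x" by linarith
    then show "(norm x)\<^sup>2 \<le> 2 *\<^sub>R (x - w) \<bullet> x"
      by (simp add: inner_diff_left power2_norm_eq_inner[symmetric] power2_eq_square)
  qed
  then show "\<exists>R. \<forall>x. R \<le> norm x \<longrightarrow> 1 \<le> (x - w) \<bullet> (x - w) \<and> (norm x)\<^sup>2 \<le> 2 *\<^sub>R (x - w) \<bullet> x" by blast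
qed (auto simp: inner_commute)

text \<open>The logarithmic inequality for \<^term>\<open>P\<close> is preserved because the logarithm of a product is a sum; it forces the
  gradient to vanish at the zeros, which gives the sign of the partial traces there as well.\<close>

lemma potential_mult:
  assumes "potential P1 G1 H1" "potential P2 G2 H2"
  shows "potential (\<lambda>x. P1 x * P2 x) (\<lambda>x. P1 x *\<^sub>R G2 x + P2 x *\<^sub>R G1 x)
    (\<lambda>x v. P1 x *\<^sub>R H2 x v + P2 x *\<^sub>R H1 x v + (G1 x \<bullet> v) *\<^sub>R G2 x + (G2 x \<bullet> v) *\<^sub>R G1 x)"
proof -
  note d = assms[unfolded potential_def]
  have sm: "smooth_at P1 x" "smooth_at P2 x" and nn: "0 \<le> P1 x" "0 \<le> P2 x"
    and dP [derivative_intros]: "(P1 has_derivative (\<lambda>v. G1 x \<bullet> v)) (at x)" "(P2 has_derivative (\<lambda>v. G2 x \<bullet> v)) (at x)"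
    and dG: "(G1 has_derivative H1 x) (at x)" "(G2 has_derivative H2 x) (at x)"
    and sy: "u \<bullet> H1 x v = v \<bullet> H1 x u" "u \<bullet> H2 x v = v \<bullet> H2 x u" for x u v using d by blast+
  have tr: "(G1 x \<bullet> u)\<^sup>2 + (G1 x \<bullet> v)\<^sup>2 \<le> P1 x * (u \<bullet> H1 x u + v \<bullet> H1 x v)" "0 \<le> u \<bullet> H1 x u + v \<bullet> H1 x v"
    "(G2 x \<bullet> u)\<^sup>2 + (G2 x \<bullet> v)\<^sup>2 \<le> P2 x * (u \<bullet> H2 x u + v \<bullet> H2 x v)" "0 \<le> u \<bullet> H2 x u + v \<bullet> H2 x v"
    if "norm u = 1" "norm v = 1" "u \<bullet> v = 0" for x u v using d that by blast+
  obtain R1 where R1: "\<And>x. R1 \<le> norm x \<Longrightarrow> 1 \<le> P1 x \<and> (norm x)\<^sup>2 \<le> G1 x \<bullet> x" using d by blast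
  obtain R2 where R2: "\<And>x. R2 \<le> norm x \<Longrightarrow> 1 \<le> P2 x \<and> (norm x)\<^sup>2 \<le> G2 x \<bullet> x" using d by blast
  define G where "G x = P1 x *\<^sub>R G2 x + P2 x *\<^sub>R G1 x" for x
  define H where "H x v = P1 x *\<^sub>R H2 x v + P2 x *\<^sub>R H1 x v + (G1 x \<bullet> v) *\<^sub>R G2 x + (G2 x \<bullet> v) *\<^sub>R G1 x" for x v
  have "potential (\<lambda>x. P1 x * P2 x) G H" unfolding potential_def
  proof (intro conjI allI impI)
    fix x
    show "smooth_at (\<lambda>x. P1 x * P2 x) x" by (intro smooth_intros sm)
    show "((\<lambda>x. P1 x * P2 x) has_derivative (\<lambda>v. G x \<bullet> v)) (at x)"
      by (rule has_derivative_eq_rhs[OF has_derivative_mult[OF dP]]) (simp add: G_def inner_add_left mult.commute)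
    show "(G has_derivative H x) (at x)" unfolding G_def
      by (rule has_derivative_eq_rhs[OF has_derivative_add[OF has_derivative_scaleR[OF dP(1) dG(2)] has_derivative_scaleR[OF dP(2) dG(1)]]])
        (auto simp: H_def)
    show "0 \<le> P1 x * P2 x" using nn by simp
  next
    fix x u v
    show "u \<bullet> H x v = v \<bullet> H x u" using sy[of u x v]
      by (simp add: H_def inner_add_right inner_commute[of v] inner_commute[of u "G1 x"] inner_commute[of u "G2 x"] mult.commute)
  next
    fix x u v :: 'a assume uv: "norm u = 1" "norm v = 1" "u \<bullet> v = 0"
    define h1 h2 a b a' b' where "h1 = u \<bullet> H1 x u + v \<bullet> H1 x v" "h2 = u \<bullet> H2 x u + v \<bullet> H2 x v"
      "a = G1 x \<bullet> u" "b = G1 x \<bullet> v" "a' = G2 x \<bullet> u" "b' = G2 x \<bullet> v"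
    note t = tr[OF uv, of x, folded h1_h2_a_b_a'_b'_def]
    have T: "u \<bullet> H x u + v \<bullet> H x v = P1 x * h2 + P2 x * h1 + 2 * (a * a' + b * b')"
      by (simp add: H_def h1_h2_a_b_a'_b'_def inner_add_right inner_commute[of v] inner_commute[of u] algebra_simps)
    have g: "G x \<bullet> u = P1 x * a' + P2 x * a" "G x \<bullet> v = P1 x * b' + P2 x * b"
      by (auto simp: G_def h1_h2_a_b_a'_b'_def inner_add_left)
    \<comment> \<open>The two factor inequalities, weighted by the square of the other factor, add
      up to the claim; the mixed terms 2 P1 P2 (a a' + b b') are the same on both sides.\<close>
    have "(P2 x)\<^sup>2 * (a\<^sup>2 + b\<^sup>2) \<le> (P2 x)\<^sup>2 * (P1 x * h1)" "(P1 x)\<^sup>2 * (a'\<^sup>2 + b'\<^sup>2) \<le> (P1 x)\<^sup>2 * (P2 x * h2)"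
      by (intro mult_left_mono t zero_le_power2)+
    then show *: "(G x \<bullet> u)\<^sup>2 + (G x \<bullet> v)\<^sup>2 \<le> P1 x * P2 x * (u \<bullet> H x u + v \<bullet> H x v)"
      unfolding T g by (simp add: power2_eq_square algebra_simps)
    show "0 \<le> u \<bullet> H x u + v \<bullet> H x v"
    proof (cases "P1 x = 0 \<or> P2 x = 0")
      case True
      have z: "p = 0 \<and> q = 0" if "p\<^sup>2 + q\<^sup>2 \<le> 0" for p q :: real
        using that sum_power2_le_zero_iff by blast
      have "a * a' + b * b' = 0" using True t(1,3) z[of a b] z[of a' b'] by auto
      moreover have "0 \<le> P1 x * h2 + P2 x * h1" using nn t by simp
      ultimately show ?thesis unfolding T by simp
    next
      case False
      then have "0 < P1 x * P2 x" using nn[of x] by simp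
      moreover have "0 \<le> P1 x * P2 x * (u \<bullet> H x u + v \<bullet> H x v)" using * by (rule order_trans[rotated]) simp
      ultimately show ?thesis by (simp add: zero_le_mult_iff)
    qed
  next
    have "1 \<le> P1 x * P2 x \<and> (norm x)\<^sup>2 \<le> G x \<bullet> x" if "max R1 R2 \<le> norm x" for x
    proof
      have 1: "1 \<le> P1 x" "1 \<le> P2 x" "(norm x)\<^sup>2 \<le> G1 x \<bullet> x" "(norm x)\<^sup>2 \<le> G2 x \<bullet> x" using R1[of x] R2[of x] that by auto
      show "1 \<le> P1 x * P2 x" using mult_mono[OF 1(1,2)] 1 by simp
      have "1 * (norm x)\<^sup>2 \<le> P1 x * (G2 x \<bullet> x)" by (rule mult_mono[OF 1(1,4)]) (use 1 in auto)
      moreover have "0 \<le> P2 x * (G1 x \<bullet> x)" using 1 order_trans[OF zero_le_power2 1(3)] by simp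
      ultimately show "(norm x)\<^sup>2 \<le> G x \<bullet> x" by (simp add: G_def inner_add_left)
    qed
    then show "\<exists>R. \<forall>x. R \<le> norm x \<longrightarrow> 1 \<le> P1 x * P2 x \<and> (norm x)\<^sup>2 \<le> G x \<bullet> x" by blast
  qed
  then show ?thesis unfolding G_def[abs_def] H_def[abs_def] .
qed

lemma potential_prod:
  fixes w :: "nat \<Rightarrow> 'a::euclidean_space"
  assumes "1 \<le> r"
  shows "\<exists>G H. potential (\<lambda>x. \<Prod>i=1..r. (x - w i) \<bullet> (x - w i)) G H"
  using assms
proof (induction r rule: nat_induct_at_least)
  case base
  have "potential (\<lambda>x. \<Prod>i=1..1. (x - w i) \<bullet> (x - w i)) (\<lambda>x. 2 *\<^sub>R (x - w 1)) (\<lambda>x v. 2 *\<^sub>R v)"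
    using potential_square_dist[of "w 1"] by simp
  then show ?case by (intro exI)
next
  case (Suc r)
  then obtain G H where "potential (\<lambda>x. \<Prod>i=1..r. (x - w i) \<bullet> (x - w i)) G H" by blast
  note potential_mult[OF this potential_square_dist[of "w (Suc r)"]]
  moreover have "(\<lambda>x. \<Prod>i=1..Suc r. (x - w i) \<bullet> (x - w i)) =
      (\<lambda>x. (\<Prod>i=1..r. (x - w i) \<bullet> (x - w i)) * ((x - w (Suc r)) \<bullet> (x - w (Suc r))))" by simp
  ultimately show ?case by (simp only:) (intro exI)
qed

section \<open>Sard's theorem for the gradient map\<close>

section \<open>A dense set of regular values\<close>

text \<open>A linearly ordered copy of the index type: \<open>baby_Sard\<close> is stated for
  well-ordered finite index types, whereas \<open>'n\<close> is merely finite.\<close>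

typedef (overloaded) ('n::finite) fin_index = "{..<CARD('n)}"
  by (rule exI[of _ 0]) simp

instantiation fin_index :: (finite) linorder
begin
definition "i \<le> j \<longleftrightarrow> Rep_fin_index i \<le> Rep_fin_index j"
definition "i < j \<longleftrightarrow> Rep_fin_index i < Rep_fin_index j"
instance by standard (auto simp: less_eq_fin_index_def less_fin_index_def Rep_fin_index_inject)
end

instance fin_index :: (finite) wellorder
proof
  fix P :: "'a fin_index \<Rightarrow> bool" and i
  assume st: "\<And>x. (\<And>y. y < x \<Longrightarrow> P y) \<Longrightarrow> P x"
  show "P i"
    by (induction i rule: measure_induct_rule[of Rep_fin_index]) (rule st, simp add: less_fin_index_def)
qed

lemma UNIV_fin_index: "bij_betw Rep_fin_index (UNIV :: 'n::finite fin_index set) {..<CARD('n)}"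
  by (metis bij_betw_def inj_onI Rep_fin_index_inject type_definition.Rep_range type_definition_fin_index)

instance fin_index :: (finite) finite
  by standard (use bij_betw_finite[OF UNIV_fin_index] in simp)

lemma card_fin_index: "CARD('n::finite fin_index) = CARD('n)"
  using bij_betw_same_card[OF UNIV_fin_index] by simp

text \<open>The critical values form a null set and so contain no ball. With \<open>G\<close> a
  gradient, a regular value e is a linear perturbation that makes all critical points
  nondegenerate.\<close>

lemma regular_value_dense:
  fixes G :: "real^'n \<Rightarrow> real^'n"
  assumes dG: "\<And>x. (G has_derivative H x) (at x)" and "\<epsilon> > 0"
  obtains e where "norm e < \<epsilon>" "\<And>x. G x = e \<Longrightarrow> inj (H x)"
proof -
  obtain \<pi> :: "'n fin_index \<Rightarrow> 'n" where \<pi>: "bij \<pi>"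
    using finite_same_card_bij[of "UNIV :: 'n fin_index set" "UNIV :: 'n set"] card_fin_index by auto
  define T :: "real^'n \<Rightarrow> real^('n fin_index)" where "T x = (\<chi> i. x $ \<pi> i)" for x
  define T' :: "real^('n fin_index) \<Rightarrow> real^'n" where "T' y = (\<chi> j. y $ inv \<pi> j)" for y
  have T': "T' (T x) = x" "T (T' y) = y" for x y
    using \<pi> by (auto simp: T_def T'_def vec_eq_iff bij_is_surj surj_f_inv_f bij_is_inj)
  have lin: "linear T" "linear T'" by (auto intro!: linearI simp: T_def T'_def vec_eq_iff)
  have bl: "bounded_linear T" "bounded_linear T'" using lin linear_conv_bounded_linear by blast+
  define f where "f y = T (G (T' y))" for y
  define f' where "f' y v = T (H (T' y) (T' v))" for y v
  define S where "S = {y. \<not> inj (H (T' y))}"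
  have df: "(f has_derivative f' y) (at y within S)" for y
  proof -
    have "((\<lambda>y. G (T' y)) has_derivative (\<lambda>v. H (T' y) (T' v))) (at y)"
      by (rule has_derivative_compose[OF bounded_linear_imp_has_derivative[OF bl(2)] dG])
    from bounded_linear.has_derivative[OF bl(1) this] show ?thesis
      unfolding f_def[abs_def] f'_def[abs_def] by (rule has_derivative_at_withinI)
  qed
  have "negligible (f ` S)"
  proof (rule baby_Sard[OF _ df])
    fix y assume y: "y \<in> S"
    have l: "linear (f' y)" using df has_derivative_linear by blast
    have "\<not> inj (f' y)"
    proof
      assume i: "inj (f' y)"
      have "inj (H (T' y))"
      proof (rule injI)
        fix a b assume "H (T' y) a = H (T' y) b"
        then have "f' y (T a) = f' y (T b)" by (simp add: f'_def T')
        then have "T a = T b" using i by (simp add: inj_eq)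
        then show "a = b" using T'(1) by metis
      qed
      then show False using y by (simp add: S_def)
    qed
    then show "rank (matrix (f' y)) < CARD('n fin_index)"
      using less_rank_noninjective[of "matrix (f' y)"] matrix_works[OF l[folded linear_matrix_vector_mul_eq]] by (simp add: inj_def)
  qed simp
  \<comment> \<open>Bounds the distortion of the relabelling, so that the ball of radius \<epsilon>
    / b is carried into the ball of radius \<epsilon>.\<close>
  obtain b where b: "b > 0" "\<And>y. norm (T' y) \<le> b * norm y" using linear_bounded_pos[OF lin(2)] by blast
  have "\<not> ball 0 (\<epsilon> / b) \<subseteq> f ` S"
  proof
    assume "ball 0 (\<epsilon> / b) \<subseteq> f ` S"
    then have "negligible (ball (0::real^('n fin_index)) (\<epsilon> / b))" using \<open>negligible (f ` S)\<close> negligible_subset by blast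
    then show False using open_not_negligible[of "ball (0::real^('n fin_index)) (\<epsilon> / b)"] divide_pos_pos[OF assms(2) b(1)] by (simp add: not_le)
  qed
  then obtain y where yb: "y \<in> ball 0 (\<epsilon> / b)" and y2: "y \<notin> f ` S" by blast
  have y: "norm y < \<epsilon> / b" "y \<notin> f ` S" using yb y2 by simp_all
  show ?thesis
  proof
    have "norm (T' y) \<le> b * norm y" by (rule b)
    also have "\<dots> < \<epsilon>" using y(1) b(1) by (simp add: field_simps)
    finally show "norm (T' y) < \<epsilon>" .
    fix x assume "G x = T' y"
    then have "y = f (T x)" by (simp add: f_def T')
    then have "T x \<notin> S" using y(2) by blast
    then show "inj (H x)" by (simp add: S_def T')
  qed
qed

section \<open>Symmetric forms with nonnegative trace on every plane\<close>

section \<open>Diagonalisation of Hessians of index at most one\<close>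

text \<open>Gram-Schmidt for the inner product given by \<open>Q\<close>.\<close>

lemma orthonormalise:
  fixes Q :: "'a::euclidean_space \<Rightarrow> 'a"
  assumes lin: "linear Q" and sy: "\<And>x y. x \<bullet> Q y = y \<bullet> Q x" and pd: "\<And>x. x \<noteq> 0 \<Longrightarrow> 0 < x \<bullet> Q x"
  shows "\<exists>L L'. linear L \<and> linear L' \<and> (\<forall>x. L' (L x) = x) \<and> (\<forall>x. L (L' x) = x) \<and> (\<forall>x y. L x \<bullet> Q (L y) = x \<bullet> (y::'a))"
proof -
  have ex: "S \<subseteq> Basis \<Longrightarrow> \<exists>f. \<forall>b\<in>S. \<forall>c\<in>S. f b \<bullet> Q (f c) = (if b = c then 1 else 0)" if "finite S" for S :: "'a set"
    using that
  proof induction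
    case (insert s S)
    then obtain f where f: "\<And>b c. b \<in> S \<Longrightarrow> c \<in> S \<Longrightarrow> f b \<bullet> Q (f c) = (if b = c then 1 else 0)" by auto
    have "dim (span (f ` S)) \<le> card S" using insert.hyps(1) by (metis card_image_le dim_le_card' dim_span finite_imageI order_trans)
    also have "card S < DIM('a)" using insert.prems insert.hyps by (intro psubset_card_mono) auto
    finally have "span (f ` S) \<noteq> UNIV" by (metis dim_UNIV less_irrefl)
    then obtain v where v: "v \<notin> span (f ` S)" by blast
    define z where "z = v - (\<Sum>c\<in>S. (v \<bullet> Q (f c)) *\<^sub>R f c)"
    have "(\<Sum>c\<in>S. (v \<bullet> Q (f c)) *\<^sub>R f c) \<in> span (f ` S)" by (intro span_sum span_scale span_base) auto
    then have "z \<noteq> 0" using v by (auto simp: z_def)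
    then have q: "0 < z \<bullet> Q z" by (rule pd)
    have zf: "z \<bullet> Q (f b) = 0" if "b \<in> S" for b
    proof -
      have "(\<Sum>c\<in>S. (v \<bullet> Q (f c)) * (f c \<bullet> Q (f b))) = (\<Sum>c\<in>S. if c = b then v \<bullet> Q (f c) else 0)"
        by (rule sum.cong) (auto simp: f that)
      also have "\<dots> = v \<bullet> Q (f b)" using that insert.hyps(1) by simp
      finally show ?thesis by (simp add: z_def inner_diff_left inner_sum_left)
    qed
    have fz: "f b \<bullet> Q z = 0" if "b \<in> S" for b using zf[OF that] sy[of "f b" z] by simp
    define f1 where "f1 = f(s := inverse (sqrt (z \<bullet> Q z)) *\<^sub>R z)"
    have "inverse (sqrt (z \<bullet> Q z)) * (inverse (sqrt (z \<bullet> Q z)) * (z \<bullet> Q z)) = 1"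
      using q by (simp add: field_simps flip: real_sqrt_mult)
    then have "\<forall>b\<in>insert s S. \<forall>c\<in>insert s S. f1 b \<bullet> Q (f1 c) = (if b = c then 1 else 0)"
      using insert.hyps(2) by (auto simp: f1_def linear_scale[OF lin] f zf fz)
    then show ?case by blast
  qed auto
  obtain f :: "'a \<Rightarrow> 'a" where "\<forall>b\<in>Basis. \<forall>c\<in>Basis. f b \<bullet> Q (f c) = (if b = c then 1 else 0)"
    using ex[OF finite_Basis order_refl] by blast
  then have f: "f b \<bullet> Q (f c) = (if b = c then 1 else 0)" if "b \<in> Basis" "c \<in> Basis" for b c using that by blast
  define L where "L x = (\<Sum>b\<in>Basis. (x \<bullet> b) *\<^sub>R f b)" for x :: 'a
  have LL: "L x \<bullet> Q (L y) = x \<bullet> y" for x y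
  proof -
    have "L x \<bullet> Q (L y) = (\<Sum>b\<in>Basis. (x \<bullet> b) * (\<Sum>c\<in>Basis. (y \<bullet> c) * (f b \<bullet> Q (f c))))"
    proof -
      have "f b \<bullet> Q (L y) = (\<Sum>c\<in>Basis. (y \<bullet> c) * (f b \<bullet> Q (f c)))" for b
        by (simp add: L_def inner_sum_right linear_sum[OF lin] linear_scale[OF lin])
      moreover have "L x \<bullet> Q (L y) = (\<Sum>b\<in>Basis. (x \<bullet> b) * (f b \<bullet> Q (L y)))"
        unfolding L_def[of x] inner_sum_left inner_scaleR_left ..
      ultimately show ?thesis by simp
    qed
    also have "\<dots> = (\<Sum>b\<in>Basis. (x \<bullet> b) * (\<Sum>c\<in>Basis. if b = c then y \<bullet> c else 0))"
      by (intro sum.cong refl arg_cong2[of _ _ _ _ "(*)"]) (auto simp: f)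
    also have "\<dots> = x \<bullet> y" by (simp add: euclidean_inner[of x y])
    finally show ?thesis .
  qed
  have lL: "linear L" by (rule linearI) (auto simp: L_def inner_add_left scaleR_add_left sum.distrib scaleR_sum_right)
  have "inj L" unfolding linear_injective_0[OF lL]
  proof (intro allI impI)
    fix x assume "L x = 0" then show "x = 0" using LL[of x x] by simp
  qed
  then obtain L' where "linear L'" "\<And>x. L' (L x) = x" "\<And>x. L (L' x) = x" using linear_injective_isomorphism[OF lL] by blast
  then show ?thesis by (intro exI[of _ L] exI[of _ L'] conjI) (use lL LL in auto)
qed

text \<open>If u is a negative direction, then \<open>Q\<close> is positive on the
  \<open>Q\<close>-orthogonal complement of u, since otherwise some plane would have negative trace.
  Reversing the sign of \<open>Q\<close> along u gives a positive definite form, and an orthonormal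
  basis for it diagonalises \<open>Q\<close>.\<close>

lemma diagonalise_index_le_1:
  fixes Q :: "'a::euclidean_space \<Rightarrow> 'a"
  assumes lin: "linear Q" and sy: "\<And>x y. x \<bullet> Q y = y \<bullet> Q x" and inj: "inj Q"
    and tr: "\<And>u v. norm u = 1 \<Longrightarrow> norm v = 1 \<Longrightarrow> u \<bullet> v = 0 \<Longrightarrow> 0 \<le> u \<bullet> Q u + v \<bullet> Q v"
  shows "\<exists>L L' a. linear L \<and> linear L' \<and> (\<forall>x. L' (L x) = x) \<and> (\<forall>x. L (L' x) = x) \<and> (a = 0 \<or> norm a = 1) \<and>
    (\<forall>x. L x \<bullet> Q (L x) = x \<bullet> x - 2 * (x \<bullet> (a::'a))\<^sup>2)"
proof (cases "\<exists>u. u \<bullet> Q u < 0")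
  case True
  then obtain u0 where u0: "u0 \<bullet> Q u0 < 0" by blast
  define u where "u = inverse (sqrt (- (u0 \<bullet> Q u0))) *\<^sub>R u0"
  have uu: "u \<bullet> Q u = -1"
  proof -
    have "inverse (sqrt (- (u0 \<bullet> Q u0))) * (inverse (sqrt (- (u0 \<bullet> Q u0))) * (- (u0 \<bullet> Q u0))) = 1"
      using u0 by (simp add: field_simps flip: real_sqrt_mult)
    then show ?thesis by (simp add: u_def linear_scale[OF lin])
  qed
  have u: "u \<noteq> 0" using uu by auto
  have pos: "0 < y \<bullet> Q y" if y: "y \<noteq> 0" "u \<bullet> Q y = 0" for y
  proof (rule ccontr)
    assume "\<not> 0 < y \<bullet> Q y"
    then have n: "y \<bullet> Q y \<le> 0" by simp
    define t where "t = (y \<bullet> u) / (u \<bullet> u)"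
    \<comment> \<open>The trace hypothesis needs Euclidean orthogonality to u. As y is
      \<open>Q\<close>-orthogonal to u, subtracting a multiple of u only lowers the value of the
      form.\<close>
    define z where "z = y - t *\<^sub>R u"
    have z0: "z \<noteq> 0"
    proof
      assume "z = 0"
      then have "y = t *\<^sub>R u" by (simp add: z_def)
      then show False using y uu by (auto simp: linear_scale[OF lin])
    qed
    have zu: "u \<bullet> z = 0" using u by (simp add: z_def t_def inner_diff_right inner_commute)
    have "z \<bullet> Q z = y \<bullet> Q y - t\<^sup>2"
      using y(2) sy[of y u] uu by (simp add: z_def linear_diff[OF lin] linear_scale[OF lin] inner_diff_left inner_diff_right power2_eq_square)
    then have zz: "z \<bullet> Q z \<le> 0" using n zero_le_power2[of t] by linarith
    have sc: "(inverse (norm x) *\<^sub>R x) \<bullet> Q (inverse (norm x) *\<^sub>R x) = (x \<bullet> Q x) / (norm x)\<^sup>2" for x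
      by (simp add: linear_scale[OF lin] power2_eq_square divide_inverse)
    have "0 \<le> (inverse (norm u) *\<^sub>R u) \<bullet> Q (inverse (norm u) *\<^sub>R u) + (inverse (norm z) *\<^sub>R z) \<bullet> Q (inverse (norm z) *\<^sub>R z)"
      by (rule tr) (use u z0 zu in auto)
    moreover have "(u \<bullet> Q u) / (norm u)\<^sup>2 < 0" using uu u by (simp add: divide_neg_pos)
    moreover have "(z \<bullet> Q z) / (norm z)\<^sup>2 \<le> 0" using zz by (simp add: divide_nonpos_nonneg)
    ultimately show False unfolding sc by linarith
  qed
  \<comment> \<open>The form with the sign along u reversed: u has value 1 for \<open>Q'\<close>,
    and nothing changes on vectors \<open>Q\<close>-orthogonal to u.\<close>
  define Q' where "Q' x = Q x + (2 * (u \<bullet> Q x)) *\<^sub>R Q u" for x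
  have Q': "x \<bullet> Q' y = x \<bullet> Q y + 2 * (u \<bullet> Q y) * (u \<bullet> Q x)" for x y
    using sy[of x u] by (simp add: Q'_def inner_add_right)
  have lin': "linear Q'"
    by (rule linearI) (auto simp: Q'_def linear_add[OF lin] linear_scale[OF lin] inner_add_right scaleR_add_left algebra_simps)
  have sy': "x \<bullet> Q' y = y \<bullet> Q' x" for x y using sy[of x y] by (simp add: Q')
  have pd': "0 < x \<bullet> Q' x" if "x \<noteq> 0" for x
  proof -
    define \<alpha> where "\<alpha> = u \<bullet> Q x"
    define y where "y = x + \<alpha> *\<^sub>R u"
    have uy: "u \<bullet> Q y = 0" using uu by (simp add: y_def \<alpha>_def linear_add[OF lin] linear_scale[OF lin] inner_add_right)
    have "y \<bullet> Q y = x \<bullet> Q x + \<alpha>\<^sup>2"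
      using uu sy[of x u] by (simp add: y_def linear_add[OF lin] linear_scale[OF lin] inner_add_right inner_add_left \<alpha>_def[symmetric] power2_eq_square)
    then have e: "x \<bullet> Q' x = y \<bullet> Q y + \<alpha>\<^sup>2" by (simp add: Q' \<alpha>_def[symmetric] power2_eq_square)
    show ?thesis
    proof (cases "y = 0")
      case True
      then have "\<alpha> \<noteq> 0" using that by (auto simp: y_def)
      then show ?thesis using e True by simp
    next
      case False
      then show ?thesis using e pos[OF False uy] by (simp add: add_pos_nonneg)
    qed
  qed
  obtain L L' :: "'a \<Rightarrow> 'a" where L: "linear L" "linear L'" "\<And>x. L' (L x) = x" "\<And>x. L (L' x) = x" "\<And>x y. L x \<bullet> Q' (L y) = x \<bullet> y"
    using orthonormalise[OF lin' sy' pd'] by metis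
  \<comment> \<open>In the new coordinates u becomes the vector \<open>L' u\<close>; its inner
    product with x recovers the \<open>Q\<close>-pairing with u, up to sign.\<close>
  have xa: "x \<bullet> L' u = - (u \<bullet> Q (L x))" for x
    using L(5)[of x "L' u"] by (simp add: L(4) Q' uu sy[of "L x" u])
  have "L' u \<bullet> L' u = 1" using xa[of "L' u"] by (simp add: L(4) uu)
  then have "norm (L' u) = 1" by (simp add: norm_eq_1)
  moreover have "L x \<bullet> Q (L x) = x \<bullet> x - 2 * (x \<bullet> L' u)\<^sup>2" for x
    using L(5)[of x x] by (simp add: Q' xa power2_eq_square)
  ultimately show ?thesis by (intro exI[of _ L] exI[of _ L'] exI[of _ "L' u"] conjI) (use L in auto)
next
  case False
  then have psd: "0 \<le> x \<bullet> Q x" for x by (simp add: not_less)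
  have pd: "0 < x \<bullet> Q x" if "x \<noteq> 0" for x
  proof (rule ccontr)
    assume "\<not> 0 < x \<bullet> Q x"
    then have z: "x \<bullet> Q x = 0" using psd[of x] by simp
    define q where "q = Q x \<bullet> Q x"
    define c where "c = Q x \<bullet> Q (Q x)"
    have "Q x \<noteq> 0" using inj that linear_injective_0[OF lin] by blast
    then have q: "q > 0" by (simp add: q_def)
    \<comment> \<open>A semidefinite form vanishing at x would become negative at x - t Q x for this
      small t.\<close>
    define t where "t = q / (c + 1)"
    have c: "c \<ge> 0" by (simp add: c_def psd)
    then have t: "t > 0" using q by (simp add: t_def)
    have "0 \<le> (x - t *\<^sub>R Q x) \<bullet> Q (x - t *\<^sub>R Q x)" by (rule psd)
    also have "\<dots> = t * (t * c - 2 * q)"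
      using z sy[of x "Q x"] by (simp add: linear_diff[OF lin] linear_scale[OF lin] inner_diff_left inner_diff_right q_def c_def algebra_simps)
    finally have "0 \<le> t * c - 2 * q" using t by (simp add: zero_le_mult_iff)
    moreover have "t * c \<le> q" using c q by (simp add: t_def field_simps)
    ultimately show False using q by linarith
  qed
  obtain L L' :: "'a \<Rightarrow> 'a" where L: "linear L" "linear L'" "\<And>x. L' (L x) = x" "\<And>x. L (L' x) = x" "\<And>x y. L x \<bullet> Q (L y) = x \<bullet> y"
    using orthonormalise[OF lin sy pd] by metis
  then show ?thesis by (intro exI[of _ L] exI[of _ L'] exI[of _ 0] conjI) (use L in auto)
qed

section \<open>Replacing a function near a nondegenerate critical point by its Taylor
  polynomial\<close>

section \<open>Quadratic germs at the critical points\<close>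

lemma grad_cong_open:
  assumes "smooth_at g x" "open U" "x \<in> U" "\<And>y. y \<in> U \<Longrightarrow> f y = g y"
  shows "grad f x = grad g x"
proof (rule grad_unique)
  show "smooth_at f x" by (rule smooth_at_cong_open[OF assms(1,2,3)]) (simp add: assms(4))
  show "(f has_derivative (\<lambda>v. grad g x \<bullet> v)) (at x)"
    by (rule has_derivative_transform_within_open[OF has_derivative_grad[OF assms(1)] assms(2,3)]) (simp add: assms(4))
qed

lemma grad_bump_shift:
  fixes F E :: "'a::euclidean_space \<Rightarrow> real"
  assumes F: "smooth_at F x" and E: "smooth_at E x" and \<delta>: "\<delta> > 0"
  shows "grad (\<lambda>x. F x + bump \<delta> (x - s) * E x) x = grad F x + bump \<delta> (x - s) *\<^sub>R grad E x + E x *\<^sub>R grad (bump \<delta>) (x - s)"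
proof (rule grad_unique)
  have sb: "smooth_at (bump \<delta>) y" for y :: 'a by (rule smooth_at_bump[OF \<delta> smooth_at_ident])
  show "smooth_at (\<lambda>x. F x + bump \<delta> (x - s) * E x) x" by (intro smooth_intros F E \<delta>)
  have i: "((\<lambda>x. x - s) has_derivative (\<lambda>v. v)) (at x)" by (auto intro!: derivative_eq_intros)
  have b: "((\<lambda>x. bump \<delta> (x - s)) has_derivative (\<lambda>v. grad (bump \<delta>) (x - s) \<bullet> v)) (at x)"
    by (rule has_derivative_compose[OF i has_derivative_grad[OF sb]])
  show "((\<lambda>x. F x + bump \<delta> (x - s) * E x) has_derivative
      (\<lambda>v. (grad F x + bump \<delta> (x - s) *\<^sub>R grad E x + E x *\<^sub>R grad (bump \<delta>) (x - s)) \<bullet> v)) (at x)"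
    by (rule has_derivative_eq_rhs[OF has_derivative_add[OF has_derivative_grad[OF F] has_derivative_mult[OF b has_derivative_grad[OF E]]]])
      (simp add: inner_add_left mult.commute add.assoc)
qed

lemma quadratic_grad:
  fixes H :: "'a::euclidean_space \<Rightarrow> 'a"
  assumes lin: "linear H" and sy: "\<And>u v. u \<bullet> H v = v \<bullet> H u"
  shows "smooth_at (\<lambda>x. a + (1/2) * ((x - s) \<bullet> H (x - s))) x" "grad (\<lambda>x. a + (1/2) * ((x - s) \<bullet> H (x - s))) x = H (x - s)"
proof -
  have bl: "bounded_linear H" using lin linear_conv_bounded_linear by blast
  have i: "((\<lambda>x. x - s) has_derivative (\<lambda>v. v)) (at x)" by (auto intro!: derivative_eq_intros)
  have "smooth_at (\<lambda>x. H (x - s)) x" by (rule smooth_at_compose[OF _ smooth_at_linear[OF lin]]) (intro smooth_intros)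
  then show sq: "smooth_at (\<lambda>x. a + (1/2) * ((x - s) \<bullet> H (x - s))) x" by (intro smooth_intros)
  have "((\<lambda>x. (x - s) \<bullet> H (x - s)) has_derivative (\<lambda>v. (x - s) \<bullet> H v + v \<bullet> H (x - s))) (at x)"
    by (rule has_derivative_inner[OF i bounded_linear.has_derivative[OF bl i]])
  then have d: "((\<lambda>x. a + (1/2) * ((x - s) \<bullet> H (x - s))) has_derivative (\<lambda>v. 0 + (1/2) * ((x - s) \<bullet> H v + v \<bullet> H (x - s)))) (at x)"
    by (intro has_derivative_add[OF has_derivative_const[of a]] has_derivative_mult_right)
  have e: "(\<lambda>v. 0 + (1/2) * ((x - s) \<bullet> H v + v \<bullet> H (x - s))) = (\<lambda>v. H (x - s) \<bullet> v)"
  proof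
    fix v show "0 + (1/2) * ((x - s) \<bullet> H v + v \<bullet> H (x - s)) = H (x - s) \<bullet> v"
      unfolding sy[of "x - s" v] inner_commute[of v "H (x - s)"] by simp
  qed
  show "grad (\<lambda>x. a + (1/2) * ((x - s) \<bullet> H (x - s))) x = H (x - s)" by (rule grad_unique[OF sq has_derivative_eq_rhs[OF d e]])
qed

text \<open>F is interpolated with its second Taylor polynomial plus a constant d. Near s the
  gradient is dominated by H (x - s), of norm at least k |x - s|, while all errors are a small
  multiple of |x - s|; so no critical point appears or disappears. The constant d moves the critical
  value off \<open>A\<close>.\<close>

lemma quadraticise:
  fixes F :: "'a::euclidean_space \<Rightarrow> real"
  assumes sm: "\<And>x. smooth_at F x" and cr: "grad F s = 0" and dG: "(grad F has_derivative H) (at s)"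
    and sy: "\<And>u v. u \<bullet> H v = v \<bullet> H u" and inj: "inj H" and \<rho>: "\<rho> > 0" and A: "finite A"
  obtains M r where "\<And>x. smooth_at M x" "\<And>x. \<rho> \<le> norm (x - s) \<Longrightarrow> M x = F x" "\<And>x. grad M x = 0 \<longleftrightarrow> grad F x = 0"
    "r > 0" "\<And>h. norm h < r \<Longrightarrow> M (s + h) = M s + (1/2) * (h \<bullet> H h)" "M s \<notin> A"
proof -
  have lin: "linear H" using dG has_derivative_linear by blast
  have H0: "H 0 = 0" by (rule linear_0[OF lin])
  obtain k where k: "k > 0" "\<And>h. k * norm h \<le> norm (H h)" using linear_inj_bounded_below_pos[OF lin inj] by blast
  obtain B where B: "B > 0" "\<And>\<delta> x. \<delta> > 0 \<Longrightarrow> norm (grad (bump \<delta>) (x::'a)) \<le> B / \<delta>" using grad_bump_bound by blast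
  \<comment> \<open>Gives \<gamma> + 2 B \<gamma> = k / 4: the gradient error, and the value error
    multiplied by the gradient of the bump, together use one quarter of k.\<close>
  define \<gamma> where "\<gamma> = k / 4 / (1 + 2 * B)"
  have "1 + 2 * B \<noteq> 0" using B(1) by linarith
  from nonzero_eq_divide_eq[OF this] \<gamma>_def have "\<gamma> * (1 + 2 * B) = k / 4" by blast
  then have \<gamma>2: "\<gamma> + 2 * B * \<gamma> = k / 4" by (simp add: algebra_simps)
  have \<gamma>: "\<gamma> > 0" using k(1) B(1) by (simp add: \<gamma>_def)
  have Bg: "2 * B * \<gamma> > 0" using B(1) \<gamma> by simp
  obtain d0 where d0: "d0 > 0" "\<And>y. norm (y - s) < d0 \<Longrightarrow> norm (grad F y - grad F s - H (y - s)) \<le> \<gamma> * norm (y - s)"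
    using dG \<gamma> unfolding has_derivative_at_alt by blast
  define \<delta> where "\<delta> = min d0 \<rho> / 4"
  have \<delta>: "\<delta> > 0" "2 * \<delta> < d0" "2 * \<delta> < \<rho>" using d0(1) \<rho> by (auto simp: \<delta>_def min_def)
  define q where "q x = F s + (1/2) * ((x - s) \<bullet> H (x - s))" for x
  have sq: "smooth_at q x" and gq: "grad q x = H (x - s)" for x
    unfolding q_def[abs_def] by (rule quadratic_grad[OF lin sy])+
  have v: "norm (grad F x - H (x - s)) \<le> \<gamma> * norm (x - s)" if "norm (x - s) < d0" for x
    using d0(2)[OF that] by (simp add: cr)
  have Fq: "\<bar>F x - q x\<bar> \<le> \<gamma> * norm (x - s) * norm (x - s)" if x: "norm (x - s) < d0" for x
  proof -
    have "norm ((F x - q x) - (F s - q s)) \<le> \<gamma> * norm (x - s) * norm (x - s)"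
    proof (rule differentiable_bound[where f="\<lambda>x. F x - q x" and x=x and y=s and S="cball s (norm (x - s))" and f'="\<lambda>y v. grad F y \<bullet> v - grad q y \<bullet> v"])
      fix y assume y: "y \<in> cball s (norm (x - s))"
      show "((\<lambda>x. F x - q x) has_derivative (\<lambda>v. grad F y \<bullet> v - grad q y \<bullet> v)) (at y within cball s (norm (x - s)))"
        by (rule has_derivative_at_withinI[OF has_derivative_diff[OF has_derivative_grad[OF sm] has_derivative_grad[OF sq]]])
      have ny: "norm (y - s) \<le> norm (x - s)" using y by (simp add: dist_norm norm_minus_commute)
      have "norm (grad F y - H (y - s)) \<le> \<gamma> * norm (y - s)" by (rule v) (use ny x in linarith)
      also have "\<dots> \<le> \<gamma> * norm (x - s)" using ny \<gamma> by (intro mult_left_mono) auto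
      finally have b: "norm (grad F y - H (y - s)) \<le> \<gamma> * norm (x - s)" .
      show "onorm (\<lambda>v. grad F y \<bullet> v - grad q y \<bullet> v) \<le> \<gamma> * norm (x - s)"
      proof (rule onorm_bound)
        show "0 \<le> \<gamma> * norm (x - s)" using \<gamma> by simp
        fix w
        have "norm (grad F y \<bullet> w - grad q y \<bullet> w) = \<bar>(grad F y - H (y - s)) \<bullet> w\<bar>" by (simp add: gq inner_diff_left)
        also have "\<dots> \<le> norm (grad F y - H (y - s)) * norm w" by (rule Cauchy_Schwarz_ineq2)
        also have "\<dots> \<le> \<gamma> * norm (x - s) * norm w" by (rule mult_right_mono[OF b]) simp
        finally show "norm (grad F y \<bullet> w - grad q y \<bullet> w) \<le> \<gamma> * norm (x - s) * norm w" .
      qed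
    qed (auto simp: dist_norm norm_minus_commute)
    moreover have "q s = F s" by (simp add: q_def)
    ultimately show ?thesis by simp
  qed
  \<comment> \<open>An interval is infinite, so some shift d avoids \<open>A\<close>. Its length is
    chosen so that d times the gradient of the bump costs another quarter of k.\<close>
  have "\<not> {0<..<k * \<delta>\<^sup>2 / (4 * B)} \<subseteq> (\<lambda>a. a - F s) ` A"
  proof
    assume "{0<..<k * \<delta>\<^sup>2 / (4 * B)} \<subseteq> (\<lambda>a. a - F s) ` A"
    then have "finite {0<..<k * \<delta>\<^sup>2 / (4 * B)}" using A finite_subset finite_imageI by blast
    moreover have "0 < k * \<delta>\<^sup>2 / (4 * B)" using k B \<delta> by simp
    ultimately show False using infinite_Ioo by blast
  qed
  then obtain d where dI: "d \<in> {0<..<k * \<delta>\<^sup>2 / (4 * B)}" and dA: "d \<notin> (\<lambda>a. a - F s) ` A" by blast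
  have d: "0 < d" "d < k * \<delta>\<^sup>2 / (4 * B)" using dI by simp_all
  have dB: "d * B / \<delta> \<le> k / 4 * \<delta>"
    using d B(1) \<delta>(1) by (simp add: field_simps power2_eq_square)
  define E where "E x = q x + d - F x" for x
  define M where "M x = F x + bump \<delta> (x - s) * E x" for x
  have sE: "smooth_at E x" for x unfolding E_def[abs_def] by (intro smooth_intros sq sm)
  have gE: "grad E x = H (x - s) - grad F x" for x
  proof (rule grad_unique[OF sE])
    have "(E has_derivative (\<lambda>v. grad q x \<bullet> v + 0 - grad F x \<bullet> v)) (at x)" unfolding E_def[abs_def]
      by (rule has_derivative_diff[OF has_derivative_add[OF has_derivative_grad[OF sq] has_derivative_const[of d]] has_derivative_grad[OF sm]])
    then show "(E has_derivative (\<lambda>v. (H (x - s) - grad F x) \<bullet> v)) (at x)" by (simp add: gq inner_diff_left)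
  qed
  have sM: "smooth_at M x" for x unfolding M_def[abs_def] by (intro smooth_intros sm sE \<delta>)
  have gM: "grad M x = grad F x + bump \<delta> (x - s) *\<^sub>R (H (x - s) - grad F x) + E x *\<^sub>R grad (bump \<delta>) (x - s)" for x
    unfolding M_def[abs_def] grad_bump_shift[OF sm sE \<delta>(1)] gE ..
  have Min: "M x = q x + d" if "norm (x - s) \<le> \<delta>" for x using bump_eq_1[OF \<delta>(1) that] by (simp add: M_def E_def)
  have Mout: "M x = F x" if "2 * \<delta> \<le> norm (x - s)" for x using bump_eq_0[OF \<delta>(1) that] by (simp add: M_def)
  have Ms: "M s = F s + d" using Min[of s] \<delta>(1) by (simp add: q_def H0)
  have gin: "grad M x = H (x - s)" if "norm (x - s) < \<delta>" for x
  proof -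
    have "grad M x = grad (\<lambda>x. q x + d) x"
      by (rule grad_cong_open[of _ _ "ball s \<delta>"]) (use that in \<open>auto intro!: smooth_intros sq Min simp: dist_norm norm_minus_commute\<close>)
    then show ?thesis by (simp add: grad_add_const[OF sq] gq)
  qed
  have crit: "grad M x = 0 \<longleftrightarrow> grad F x = 0" for x
  proof -
    consider "norm (x - s) > 2 * \<delta>" | "x = s" | "x \<noteq> s" "norm (x - s) \<le> 2 * \<delta>" by fastforce
    then show ?thesis
    proof cases
      case 1
      have "grad M x = grad F x"
      proof (rule grad_cong_open[OF sm])
        show "open (- cball s (2 * \<delta>))" by (intro open_Compl closed_cball)
        show "x \<in> - cball s (2 * \<delta>)" using 1 by (simp add: dist_norm norm_minus_commute)
        show "M y = F y" if "y \<in> - cball s (2 * \<delta>)" for y using that by (intro Mout) (simp add: dist_norm norm_minus_commute)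
      qed
      then show ?thesis by simp
    next
      case 2
      then show ?thesis using gin[of s] cr \<delta>(1) H0 by simp
    next
      case 3
      define n where "n = norm (x - s)"
      have n: "n > 0" "n \<le> 2 * \<delta>" "n < d0" using 3 \<delta> by (auto simp: n_def)
      define \<beta> where "\<beta> = bump \<delta> (x - s)"
      define y where "y = grad F x - H (x - s)"
      define g where "g = grad (bump \<delta>) (x - s)"
      have \<beta>: "0 \<le> \<beta>" "\<beta> \<le> 1" by (auto simp: \<beta>_def bump_bounds)
      have y: "norm y \<le> \<gamma> * n" using v[of x] n by (simp add: y_def n_def)
      have kH: "k * n \<le> norm (H (x - s))" using k(2) by (simp add: n_def)
      have kn: "0 < k * n" using k n by simp
      have \<gamma>k: "\<gamma> * n < k * n / 4"
      proof -
        have "\<gamma> < k / 4" using \<gamma>2 Bg by linarith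
        then have "\<gamma> * n < k / 4 * n" using n(1) by (rule mult_strict_right_mono)
        then show ?thesis by simp
      qed
      have F0: "grad F x \<noteq> 0"
      proof
        assume "grad F x = 0"
        then have "norm (H (x - s)) \<le> \<gamma> * n" using y by (simp add: y_def)
        then show False using kH \<gamma>k kn by linarith
      qed
      have M0: "grad M x \<noteq> 0"
      proof (cases "n < \<delta>")
        case True
        then have "grad M x = H (x - s)" by (intro gin) (simp add: n_def)
        then show ?thesis using kH kn by auto
      next
        case False
        have gb: "norm g \<le> B / \<delta>" unfolding g_def by (rule B(2)[OF \<delta>(1)])
        have "\<bar>E x\<bar> \<le> \<gamma> * n * n + d" using Fq[of x] n d(1) by (simp add: E_def n_def abs_le_iff)
        then have "norm (E x *\<^sub>R g) \<le> (\<gamma> * n * n + d) * (B / \<delta>)"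
          unfolding norm_scaleR using gb B \<delta> by (intro mult_mono) auto
        also have "\<dots> = n * (\<gamma> * B / \<delta>) * n + d * B / \<delta>" by (simp add: algebra_simps add_divide_distrib)
        also have "\<dots> \<le> (2 * \<delta>) * (\<gamma> * B / \<delta>) * n + k / 4 * \<delta>"
          using n B \<gamma> \<delta> dB by (intro add_mono mult_right_mono) auto
        also have "\<dots> = 2 * B * \<gamma> * n + k / 4 * \<delta>" using \<delta>(1) by (simp add: field_simps)
        also have "\<dots> \<le> 2 * B * \<gamma> * n + k / 4 * n" using False k by (intro add_left_mono mult_left_mono) auto
        finally have Eg: "norm (E x *\<^sub>R g) \<le> 2 * B * \<gamma> * n + k / 4 * n" .
        have yb: "norm ((1 - \<beta>) *\<^sub>R y) \<le> \<gamma> * n"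
        proof -
          have "norm ((1 - \<beta>) *\<^sub>R y) \<le> 1 * norm y" unfolding norm_scaleR using \<beta> by (intro mult_right_mono) auto
          then show ?thesis using y by simp
        qed
        have e: "grad M x = H (x - s) + ((1 - \<beta>) *\<^sub>R y + E x *\<^sub>R g)"
          unfolding gM by (simp add: \<beta>_def y_def g_def algebra_simps)
        \<comment> \<open>The errors thus total at most half of k n, less than the main term k
          n.\<close>
        have sum: "\<gamma> * n + 2 * B * \<gamma> * n = k / 4 * n" using arg_cong[OF \<gamma>2, of "\<lambda>z. z * n"] by (simp add: algebra_simps)
        show ?thesis
        proof
          assume "grad M x = 0"
          then have "H (x - s) = - ((1 - \<beta>) *\<^sub>R y + E x *\<^sub>R g)" using e unfolding eq_neg_iff_add_eq_0 by (simp only:)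
          then have "norm (H (x - s)) = norm ((1 - \<beta>) *\<^sub>R y + E x *\<^sub>R g)" by (simp only: norm_minus_cancel)
          also have "\<dots> \<le> norm ((1 - \<beta>) *\<^sub>R y) + norm (E x *\<^sub>R g)" by (rule norm_triangle_ineq)
          finally show False using kH yb Eg sum kn by linarith
        qed
      qed
      show ?thesis using F0 M0 by simp
    qed
  qed
  show ?thesis
  proof (rule that[OF sM _ crit \<delta>(1)])
    show "M x = F x" if "\<rho> \<le> norm (x - s)" for x by (rule Mout) (use that \<delta>(3) in linarith)
    show "M (s + h) = M s + (1/2) * (h \<bullet> H h)" if "norm h < \<delta>" for h
      using Min[of "s + h"] that by (simp add: Ms q_def)
    show "M s \<notin> A"
    proof
      assume "M s \<in> A"
      then have "d \<in> (\<lambda>a. a - F s) ` A" using Ms by (intro image_eqI[of _ _ "M s"]) auto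
      then show False using dA by blast
    qed
  qed
qed

text \<open>One point at a time. The balls are far enough apart that earlier germs remain untouched,
  and every new critical value is kept off the earlier ones.\<close>

lemma quadraticise_all:
  fixes F :: "'a::euclidean_space \<Rightarrow> real"
  assumes sm: "\<And>x. smooth_at F x" and "finite T" and \<rho>: "\<rho> > 0"
    and T: "\<And>s. s \<in> T \<Longrightarrow> grad F s = 0 \<and> (grad F has_derivative H s) (at s) \<and> (\<forall>u v. u \<bullet> H s v = v \<bullet> H s u) \<and> inj (H s)"
    and sep: "\<And>s t. s \<in> T \<Longrightarrow> t \<in> T \<Longrightarrow> s \<noteq> t \<Longrightarrow> 2 * \<rho> \<le> dist s t"
  shows "\<exists>M. (\<forall>x. smooth_at M x) \<and> (\<forall>x. (\<forall>s\<in>T. \<rho> \<le> norm (x - s)) \<longrightarrow> M x = F x) \<and> (\<forall>x. grad M x = 0 \<longleftrightarrow> grad F x = 0) \<and>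
    inj_on M T \<and> (\<forall>s\<in>T. \<exists>r>0. \<forall>h. norm h < r \<longrightarrow> M (s + h) = M s + (1/2) * (h \<bullet> H s h))"
  using assms(2) T sep
proof (induction T rule: finite_induct)
  case empty
  show ?case by (rule exI[of _ F]) (simp add: sm)
next
  case (insert s T)
  have "\<exists>M. (\<forall>x. smooth_at M x) \<and> (\<forall>x. (\<forall>s\<in>T. \<rho> \<le> norm (x - s)) \<longrightarrow> M x = F x) \<and> (\<forall>x. grad M x = 0 \<longleftrightarrow> grad F x = 0) \<and>
    inj_on M T \<and> (\<forall>s\<in>T. \<exists>r>0. \<forall>h. norm h < r \<longrightarrow> M (s + h) = M s + (1/2) * (h \<bullet> H s h))"
    by (rule insert.IH) (use insert.prems in blast)+
  then obtain M where M: "\<And>x. smooth_at M x" "\<And>x. (\<And>s. s \<in> T \<Longrightarrow> \<rho> \<le> norm (x - s)) \<Longrightarrow> M x = F x"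
    "\<And>x. grad M x = 0 \<longleftrightarrow> grad F x = 0" "inj_on M T"
    "\<And>s. s \<in> T \<Longrightarrow> \<exists>r>0. \<forall>h. norm h < r \<longrightarrow> M (s + h) = M s + (1/2) * (h \<bullet> H s h)" by metis
  have st: "2 * \<rho> \<le> norm (t - s)" if "t \<in> T" for t
    using insert.prems(2)[of t s] insert.hyps(2) that by (auto simp: dist_norm)
  have MF: "M x = F x" if x: "x \<in> ball s \<rho>" for x
  proof (rule M(2))
    fix t assume "t \<in> T"
    moreover have "norm (t - s) \<le> norm (x - t) + norm (x - s)" using norm_triangle_ineq4[of "x - s" "x - t"] by simp
    ultimately show "\<rho> \<le> norm (x - t)" using st[of t] x by (simp add: dist_norm norm_minus_commute)
  qed
  have sp: "grad F s = 0" "(grad F has_derivative H s) (at s)" "\<And>u v. u \<bullet> H s v = v \<bullet> H s u" "inj (H s)" using insert.prems(1)[of s] by auto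
  have gs: "grad M s = 0" using M(3) sp(1) by simp
  have dM: "(grad M has_derivative H s) (at s)"
  proof (rule has_derivative_transform_within_open[OF sp(2) open_ball[of s \<rho>]])
    show "s \<in> ball s \<rho>" using \<rho> by simp
    show "grad F x = grad M x" if "x \<in> ball s \<rho>" for x by (rule grad_cong_open[OF M(1) open_ball that]) (simp add: MF)
  qed
  obtain N r where N: "\<And>x. smooth_at N x" "\<And>x. \<rho> \<le> norm (x - s) \<Longrightarrow> N x = M x" "\<And>x. grad N x = 0 \<longleftrightarrow> grad M x = 0"
    "r > 0" "\<And>h. norm h < r \<Longrightarrow> N (s + h) = N s + (1/2) * (h \<bullet> H s h)" "N s \<notin> M ` T"
    using quadraticise[OF M(1) gs dM sp(3,4) \<rho> finite_imageI[OF insert.hyps(1), of M]] by metis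
  have NM: "N (t + h) = M (t + h)" if "t \<in> T" "norm h < \<rho>" for t h
  proof (rule N(2))
    have "norm (t - s) \<le> norm (t + h - s) + norm h" using norm_triangle_ineq4[of "t + h - s" h] by simp
    then show "\<rho> \<le> norm (t + h - s)" using st[OF that(1)] that(2) by linarith
  qed
  have NT: "N t = M t" if "t \<in> T" for t using NM[OF that, of 0] \<rho> by simp
  show ?case
  proof (intro exI[of _ N] conjI ballI allI impI)
    show "smooth_at N x" for x by (rule N)
    show "N x = F x" if "\<forall>t\<in>insert s T. \<rho> \<le> norm (x - t)" for x using that N(2)[of x] M(2)[of x] by simp
    show "grad N x = 0 \<longleftrightarrow> grad F x = 0" for x using N(3) M(3) by simp
    have "N ` T = M ` T" by (rule image_cong[OF refl NT])
    moreover have "inj_on N T" using M(4) NT inj_on_cong[of T N M] by blast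
    moreover have "T - {s} = T" using insert.hyps(2) by simp
    ultimately show "inj_on N (insert s T)" using N(6) by simp
    fix t assume t: "t \<in> insert s T"
    show "\<exists>r>0. \<forall>h. norm h < r \<longrightarrow> N (t + h) = N t + (1/2) * (h \<bullet> H t h)"
    proof (cases "t = s")
      case True then show ?thesis using N(4,5) by blast
    next
      case False
      then have tT: "t \<in> T" using t by simp
      obtain r' where r': "r' > 0" "\<And>h. norm h < r' \<Longrightarrow> M (t + h) = M t + (1/2) * (h \<bullet> H t h)" using M(5)[OF tT] by blast
      show ?thesis
        by (rule exI[of _ "min r' \<rho>"]) (use r' \<rho> NM[OF tT] NT[OF tT] in simp)
    qed
  qed
qed

section \<open>From the potential to a tame function\<close>

section \<open>Perturbation to a tame function\<close>

text \<open>Outside the ball of radius R, M - |x|^2 / 4 is nondecreasing along rays. Hence sublevel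
  sets are bounded, and those above the maximum of M on the ball are starlike about 0.\<close>

lemma radial_growth:
  fixes M :: "'a::euclidean_space \<Rightarrow> real"
  assumes sm: "\<And>x. smooth_at M x" and R: "R > 0" and g: "\<And>x. R \<le> norm x \<Longrightarrow> (norm x)\<^sup>2 / 2 \<le> grad M x \<bullet> x"
  shows "compact {x. M x \<le> b}" "\<exists>b'\<ge>b. contractible {x. M x \<le> b'}"
proof -
  have mono: "M (p *\<^sub>R u) - p\<^sup>2 / 4 \<le> M (p' *\<^sub>R u) - p'\<^sup>2 / 4" if u: "norm u = 1" and p: "R \<le> p" "p \<le> p'" for u p p'
  proof (rule DERIV_nonneg_imp_nondecreasing[OF p(2)])
    fix t assume t: "p \<le> t"
    have l: "((\<lambda>t. t *\<^sub>R u) has_derivative (\<lambda>v. v *\<^sub>R u)) (at t)" by (auto intro!: derivative_eq_intros)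
    have "((\<lambda>t. M (t *\<^sub>R u)) has_derivative (\<lambda>v. grad M (t *\<^sub>R u) \<bullet> v *\<^sub>R u)) (at t)"
      by (rule has_derivative_compose[OF l has_derivative_grad[OF sm]])
    then have "((\<lambda>t. M (t *\<^sub>R u)) has_real_derivative (grad M (t *\<^sub>R u) \<bullet> u)) (at t)"
      by (rule has_derivative_imp_has_field_derivative) simp
    moreover have "((\<lambda>t. t\<^sup>2 / 4) has_real_derivative (t / 2)) (at t)" by (auto intro!: derivative_eq_intros)
    ultimately have "((\<lambda>t. M (t *\<^sub>R u) - t\<^sup>2 / 4) has_real_derivative (grad M (t *\<^sub>R u) \<bullet> u - t / 2)) (at t)" by (rule DERIV_diff)
    moreover have "0 \<le> grad M (t *\<^sub>R u) \<bullet> u - t / 2"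
    proof -
      have t0: "t > 0" using t p R by linarith
      have "(norm (t *\<^sub>R u))\<^sup>2 / 2 \<le> grad M (t *\<^sub>R u) \<bullet> (t *\<^sub>R u)" by (rule g) (use t t0 p u in simp)
      then have "t * (t / 2) \<le> t * (grad M (t *\<^sub>R u) \<bullet> u)" using u t0 by (simp add: power2_eq_square)
      then show ?thesis using t0 by simp
    qed
    ultimately show "\<exists>y. ((\<lambda>t. M (t *\<^sub>R u) - t\<^sup>2 / 4) has_real_derivative y) (at t) \<and> 0 \<le> y" by blast
  qed
  have cont: "continuous_on X M" for X using smooth_at_continuous_on[OF sm] .
  have unit: "norm (inverse (norm x) *\<^sub>R x) = 1" "norm x *\<^sub>R (inverse (norm x) *\<^sub>R x) = x" if "R \<le> norm x" for x :: 'a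
  proof -
    have "x \<noteq> 0" using that R by auto
    then show "norm (inverse (norm x) *\<^sub>R x) = 1" "norm x *\<^sub>R (inverse (norm x) *\<^sub>R x) = x" by simp_all
  qed
  have ne: "cball (0::'a) R \<noteq> {}" using R by simp
  obtain m where m: "\<And>x. x \<in> cball 0 R \<Longrightarrow> m \<le> M x"
    using continuous_attains_inf[OF compact_cball ne cont] by metis
  obtain B where B: "\<And>x. x \<in> cball 0 R \<Longrightarrow> M x \<le> B"
    using continuous_attains_sup[OF compact_cball ne cont] by metis
  have "bounded {x. M x \<le> b}"
  proof (rule boundedI)
    fix x assume "x \<in> {x. M x \<le> b}"
    then have xb: "M x \<le> b" by simp
    show "norm x \<le> R + 1 + \<bar>4 * (b - m) + R\<^sup>2\<bar>"
    proof (cases "R \<le> norm x")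
      case True
      define p where "p = M (R *\<^sub>R (inverse (norm x) *\<^sub>R x))"
      have "p - R\<^sup>2 / 4 \<le> M x - (norm x)\<^sup>2 / 4"
        using mono[OF unit(1)[OF True] order_refl True] unfolding unit(2)[OF True] p_def .
      moreover have "m \<le> p" unfolding p_def
      proof (rule m)
        have "norm (R *\<^sub>R (inverse (norm x) *\<^sub>R x)) = R" using unit(1)[OF True] R by (simp del: norm_inverse)
        then show "R *\<^sub>R (inverse (norm x) *\<^sub>R x) \<in> cball 0 R" by simp
      qed
      moreover have "n \<le> 4 * (b - m) + r" if "p - r / 4 \<le> y - n / 4" "m \<le> p" "y \<le> b" for n r y :: real
        using that by (simp add: field_simps)
      ultimately have "(norm x)\<^sup>2 \<le> 4 * (b - m) + R\<^sup>2" using xb by blast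
      moreover have "norm x \<le> 1 + (norm x)\<^sup>2"
      proof -
        have "0 \<le> (norm x - 1)\<^sup>2" by simp
        then have "2 * norm x \<le> 1 + (norm x)\<^sup>2" by (simp add: power2_diff)
        then show ?thesis using zero_le_power2[of "norm x"] norm_ge_zero[of x] by linarith
      qed
      ultimately show ?thesis using R by linarith
    next
      case False then show ?thesis by linarith
    qed
  qed
  moreover have "closed {x. M x \<le> b}" by (intro closed_Collect_le cont continuous_on_const)
  ultimately show "compact {x. M x \<le> b}" by (simp add: compact_eq_bounded_closed)
  have "starlike {x. M x \<le> max b B}" unfolding starlike_def
  proof (intro bexI[of _ 0] ballI subsetI)
    show "0 \<in> {x. M x \<le> max b B}" using B[of 0] R by simp
    fix x y assume x: "x \<in> {x. M x \<le> max b B}" and "y \<in> closed_segment 0 x"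
    then obtain t where t: "0 \<le> t" "t \<le> 1" "y = t *\<^sub>R x" by (auto simp: closed_segment_def)
    show "y \<in> {x. M x \<le> max b B}"
    proof (cases "norm y \<le> R")
      case True then show ?thesis using B[of y] by simp
    next
      case False
      have "norm y \<le> norm x" using t by (simp add: mult_left_le_one_le)
      then have Rx: "R \<le> norm x" using False by linarith
      define u where "u = inverse (norm x) *\<^sub>R x"
      have xu: "norm x *\<^sub>R u = x" "norm u = 1" unfolding u_def by (rule unit[OF Rx])+
      have "norm y *\<^sub>R u = t *\<^sub>R (norm x *\<^sub>R u)" using t(1,3) by simp
      then have yu: "y = norm y *\<^sub>R u" using xu(1) t(3) by metis
      have "M (norm y *\<^sub>R u) - (norm y)\<^sup>2 / 4 \<le> M (norm x *\<^sub>R u) - (norm x)\<^sup>2 / 4"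
        using False \<open>norm y \<le> norm x\<close> by (intro mono xu) auto
      moreover have "(norm y)\<^sup>2 \<le> (norm x)\<^sup>2" using \<open>norm y \<le> norm x\<close> by (intro power_mono) auto
      ultimately have "M y \<le> M x" unfolding xu(1) yu[symmetric] by linarith
      then show ?thesis using x by simp
    qed
  qed
  then show "\<exists>b'\<ge>b. contractible {x. M x \<le> b'}" using starlike_imp_contractible by (intro exI[of _ "max b B"]) auto
qed

text \<open>An injective derivative isolates each solution, and a compact set of isolated points is
  finite.\<close>

lemma finite_regular_preimage:
  fixes G :: "'a::euclidean_space \<Rightarrow> 'a"
  assumes dG: "\<And>x. (G has_derivative H x) (at x)" and cp: "compact {x. G x = e}" and inj: "\<And>x. G x = e \<Longrightarrow> inj (H x)"
  shows "finite {x. G x = e}"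
proof (rule ccontr)
  assume "infinite {x. G x = e}"
  then obtain s where s: "G s = e" "s islimpt {x. G x = e}"
    using cp unfolding compact_eq_Bolzano_Weierstrass by blast
  obtain k where k: "k > 0" "\<And>h. k * norm h \<le> norm (H s h)"
    using linear_inj_bounded_below_pos[OF has_derivative_linear[OF dG] inj[OF s(1)]] by blast
  have "k / 2 > 0" using k by simp
  then obtain d where d: "d > 0" "\<And>y. norm (y - s) < d \<Longrightarrow> norm (G y - G s - H s (y - s)) \<le> k / 2 * norm (y - s)"
    using dG[of s] unfolding has_derivative_at_alt by blast
  obtain y where y: "G y = e" "y \<noteq> s" "dist y s < d" using s(2) d(1) unfolding islimpt_approachable by blast
  have "0 < k * norm (y - s)" using y(2) k(1) by simp
  moreover have "norm (H s (y - s)) \<le> (k * norm (y - s)) / 2" using d(2)[of y] y(1,3) s(1) by (simp add: dist_norm)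
  moreover have "k * norm (y - s) \<le> norm (H s (y - s))" by (rule k(2))
  ultimately show False by linarith
qed

text \<open>Subtracting e.x leaves the Hessian alone, so the trace condition still bounds the index
  by 1, and regularity of e makes the critical points nondegenerate. The growth at infinity
  survives, being quadratic. The further changes happen near the critical points, away from
  \<open>K\<close>.\<close>

lemma tame_perturbation:
  fixes P :: "'a::euclidean_space \<Rightarrow> real"
  assumes pot: "potential P G H" and inj: "\<And>x. G x = e \<Longrightarrow> inj (H x)"
    and K: "closed K" "\<And>x. x \<in> K \<Longrightarrow> G x \<noteq> e"
  obtains M where "tame M" "\<And>x. x \<in> K \<Longrightarrow> M x = P x - e \<bullet> x"
proof -
  have sP: "smooth_at P x" and dP: "(P has_derivative (\<lambda>v. G x \<bullet> v)) (at x)" and dG: "(G has_derivative H x) (at x)"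
    and sy: "u \<bullet> H x v = v \<bullet> H x u" for x u v using pot unfolding potential_def by blast+
  have tr: "0 \<le> u \<bullet> H x u + v \<bullet> H x v" if "norm u = 1" "norm v = 1" "u \<bullet> v = 0" for x u v
    using pot that unfolding potential_def by blast
  obtain R0 where R0: "\<And>x. R0 \<le> norm x \<Longrightarrow> (norm x)\<^sup>2 \<le> G x \<bullet> x" using pot unfolding potential_def by blast
  define F where "F x = P x - e \<bullet> x" for x
  have sF: "smooth_at F x" for x unfolding F_def[abs_def] by (intro smooth_intros sP)
  have gF: "grad F = (\<lambda>x. G x - e)"
  proof
    fix x
    have "(F has_derivative (\<lambda>v. G x \<bullet> v - e \<bullet> v)) (at x)" unfolding F_def[abs_def]
      by (intro has_derivative_diff dP has_derivative_inner_right has_derivative_ident)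
    then show "grad F x = G x - e" by (intro grad_unique[OF sF]) (simp add: inner_diff_left)
  qed
  have dgF: "(grad F has_derivative H x) (at x)" for x
  proof -
    have "((\<lambda>x. G x - e) has_derivative (\<lambda>v. H x v - 0)) (at x)" by (rule has_derivative_diff[OF dG has_derivative_const[of e]])
    then show ?thesis unfolding gF by simp
  qed
  \<comment> \<open>Beyond this radius the linear term takes away at most half of the radial
    growth.\<close>
  define R where "R = max R0 (2 * norm e) + 1"
  have R: "R0 \<le> R" "2 * norm e < R" by (auto simp: R_def)
  moreover have "R > 0" using R(2) norm_ge_zero[of e] by linarith
  ultimately have R: "R0 \<le> R" "2 * norm e < R" "R > 0" by blast+
  have rad: "(norm x)\<^sup>2 / 2 \<le> grad F x \<bullet> x" if x: "R \<le> norm x" for x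
  proof -
    have "e \<bullet> x \<le> norm e * norm x" by (rule norm_cauchy_schwarz)
    moreover have "2 * norm e * norm x \<le> norm x * norm x" using x R by (intro mult_right_mono) auto
    moreover have "(norm x)\<^sup>2 \<le> G x \<bullet> x" by (rule R0) (use x R in linarith)
    ultimately show ?thesis by (simp add: gF inner_diff_left power2_eq_square)
  qed
  define S0 where "S0 = {x. G x = e}"
  have S0R: "norm x < R" if "x \<in> S0" for x
  proof (rule ccontr)
    assume n: "\<not> norm x < R"
    then have "(norm x)\<^sup>2 / 2 \<le> 0" using rad[of x] that by (simp add: gF S0_def)
    moreover have "0 < (norm x)\<^sup>2" using n R by auto
    ultimately show False by linarith
  qed
  have cG: "continuous_on UNIV G" by (intro continuous_at_imp_continuous_on ballI has_derivative_continuous[OF dG])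
  have "closed S0" unfolding S0_def using continuous_closed_preimage_constant[OF cG closed_UNIV] by simp
  moreover have "bounded S0" by (rule boundedI[of _ R]) (use S0R in \<open>auto intro: less_imp_le\<close>)
  ultimately have cS: "compact S0" by (simp add: compact_eq_bounded_closed)
  have fin: "finite S0" using finite_regular_preimage[OF dG cS[unfolded S0_def] inj] by (simp add: S0_def)
  have "S0 \<inter> K = {}" using K(2) by (auto simp: S0_def)
  then obtain d1 where d1: "d1 > 0" "\<And>s x. s \<in> S0 \<Longrightarrow> x \<in> K \<Longrightarrow> d1 \<le> dist s x"
    using separate_compact_closed[OF cS K(1)] by metis
  \<comment> \<open>The inserted 1 keeps \<open>D\<close> nonempty when there are no two distinct
    critical points, and bounds \<rho>, so that all changes stay in a fixed ball.\<close>
  define D where "D = insert 1 ((\<lambda>p. dist (fst p) (snd p)) ` {p \<in> S0 \<times> S0. fst p \<noteq> snd p})"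
  have fD: "finite D" using fin by (simp add: D_def)
  have Dpos: "Min D > 0" using fD by (subst Min_gr_iff) (auto simp: D_def)
  have D1: "Min D \<le> 1" using fD by (intro Min_le) (auto simp: D_def)
  have Dst: "Min D \<le> dist s t" if "s \<in> S0" "t \<in> S0" "s \<noteq> t" for s t
    using fD by (rule Min_le) (use that in \<open>auto simp: D_def intro!: image_eqI[of _ _ "(s, t)"]\<close>)
  define \<rho> where "\<rho> = min d1 (Min D / 2)"
  have \<rho>: "\<rho> > 0" "\<rho> \<le> d1" "2 * \<rho> \<le> Min D" "\<rho> \<le> 1" using d1(1) Dpos D1 by (auto simp: \<rho>_def min_def)
  have "\<exists>M. (\<forall>x. smooth_at M x) \<and> (\<forall>x. (\<forall>s\<in>S0. \<rho> \<le> norm (x - s)) \<longrightarrow> M x = F x) \<and> (\<forall>x. grad M x = 0 \<longleftrightarrow> grad F x = 0) \<and>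
    inj_on M S0 \<and> (\<forall>s\<in>S0. \<exists>r>0. \<forall>h. norm h < r \<longrightarrow> M (s + h) = M s + (1/2) * (h \<bullet> H s h))"
  proof (rule quadraticise_all[OF sF fin \<rho>(1)])
    show "grad F s = 0 \<and> (grad F has_derivative H s) (at s) \<and> (\<forall>u v. u \<bullet> H s v = v \<bullet> H s u) \<and> inj (H s)" if "s \<in> S0" for s
      using that dgF sy inj by (simp add: gF[THEN fun_cong] S0_def)
    show "2 * \<rho> \<le> dist s t" if "s \<in> S0" "t \<in> S0" "s \<noteq> t" for s t using Dst[OF that] \<rho>(3) by linarith
  qed
  then obtain M where M: "\<And>x. smooth_at M x" "\<And>x. (\<And>s. s \<in> S0 \<Longrightarrow> \<rho> \<le> norm (x - s)) \<Longrightarrow> M x = F x"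
    "\<And>x. grad M x = 0 \<longleftrightarrow> grad F x = 0" "inj_on M S0"
    "\<And>s. s \<in> S0 \<Longrightarrow> \<exists>r>0. \<forall>h. norm h < r \<longrightarrow> M (s + h) = M s + (1/2) * (h \<bullet> H s h)" by metis
  have cM: "{x. grad M x = 0} = S0" using M(3) by (simp add: gF S0_def)
  have Mfar: "M x = F x" if "R + 1 < norm x" for x
  proof (rule M(2))
    fix s assume "s \<in> S0"
    then show "\<rho> \<le> norm (x - s)" using S0R[of s] norm_triangle_ineq2[of x s] \<rho>(4) that by linarith
  qed
  have radM: "(norm x)\<^sup>2 / 2 \<le> grad M x \<bullet> x" if x: "R + 2 \<le> norm x" for x
  proof -
    have "grad M x = grad F x"
    proof (rule grad_cong_open[OF sF])
      show "open (- cball (0::'a) (R + 1))" by (intro open_Compl closed_cball)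
      show "x \<in> - cball 0 (R + 1)" using x by simp
      show "M y = F y" if "y \<in> - cball 0 (R + 1)" for y by (rule Mfar) (use that in simp)
    qed
    then show ?thesis using rad[of x] x by simp
  qed
  have R2: "R + 2 > 0" using R(3) by simp
  have nf: "\<exists>L L' a r. normal_form M s L L' a r" if s: "s \<in> S0" for s
  proof -
    obtain r where r: "r > 0" "\<And>h. norm h < r \<Longrightarrow> M (s + h) = M s + (1/2) * (h \<bullet> H s h)" using M(5)[OF s] by blast
    \<comment> \<open>Half the Hessian, so that the Taylor polynomial is M s + h.Qh.\<close>
    define Q where "Q v = (1/2) *\<^sub>R H s v" for v
    have lH: "linear (H s)" using dG has_derivative_linear by blast
    have lQ: "linear Q" unfolding Q_def[abs_def] by (rule linear_compose_scale_right[OF lH])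
    have sQ: "u \<bullet> Q v = v \<bullet> Q u" for u v using sy by (simp add: Q_def)
    have iQ: "inj Q"
    proof (rule injI)
      fix u v assume "Q u = Q v"
      then have "H s u = H s v" by (simp add: Q_def)
      then show "u = v" using inj[of s] s by (simp add: S0_def inj_eq)
    qed
    have tQ: "0 \<le> u \<bullet> Q u + v \<bullet> Q v" if "norm u = 1" "norm v = 1" "u \<bullet> v = 0" for u v
      using tr[OF that, of s] by (simp add: Q_def)
    obtain L L' :: "'a \<Rightarrow> 'a" and a where L0: "linear L \<and> linear L' \<and> (\<forall>x. L' (L x) = x) \<and> (\<forall>x. L (L' x) = x) \<and>
        (a = 0 \<or> norm a = 1) \<and> (\<forall>x. L x \<bullet> Q (L x) = x \<bullet> x - 2 * (x \<bullet> a)\<^sup>2)"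
      using diagonalise_index_le_1[OF lQ sQ iQ tQ] by blast
    then have L: "linear L" "L x \<bullet> Q (L x) = x \<bullet> x - 2 * (x \<bullet> a)\<^sup>2" for x by blast+
    obtain b where b: "b > 0" "\<And>x. norm (L x) \<le> b * norm x" using linear_bounded_pos[OF L(1)] by blast
    have "M (s + L x) = M s + x \<bullet> x - 2 * (x \<bullet> a)\<^sup>2" if x: "norm x < r / b" for x
    proof -
      have "b * norm x < r" using x b(1) by (simp add: field_simps)
      then have "M (s + L x) = M s + (1/2) * (L x \<bullet> H s (L x))" by (intro r(2)) (use b(2)[of x] in linarith)
      then show ?thesis using L(2)[of x] by (simp add: Q_def)
    qed
    moreover have "0 < r / b" using r b by simp
    ultimately have "normal_form M s L L' a (r / b)" unfolding normal_form_def using L0 by blast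
    then show ?thesis by blast
  qed
  have "tame M" unfolding tame_def cM
    using M(1,4) fin nf radial_growth[OF M(1) R2 radM] cM by blast
  moreover have "M x = P x - e \<bullet> x" if "x \<in> K" for x
  proof -
    have "M x = F x" 
    proof (rule M(2))
      fix s assume "s \<in> S0"
      then show "\<rho> \<le> norm (x - s)" using d1(2)[OF _ that] \<rho>(2) by (fastforce simp: dist_norm norm_minus_commute)
    qed
    then show ?thesis by (simp add: F_def)
  qed
  ultimately show ?thesis using that by blast
qed

section \<open>Transfer to the given level set\<close>

section \<open>Level sets of the potential\<close>

text \<open>\<open>C\<close> is compact and relatively open in its level, so a small perturbation
  carries it to a nearby diffeomorphic set \<open>C1\<close>. On \<open>K\<close> the tame function
  is such a perturbation, and \<open>C1\<close>, being connected and clopen in a regular level of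
  it, is a component there.\<close>

lemma potential_level_component:
  fixes P :: "real^'n \<Rightarrow> real"
  assumes pot: "potential P G H" and n2: "2 \<le> CARD('n)"
    and C: "C \<in> components {x. P x = v}" and reg: "\<And>x. x \<in> C \<Longrightarrow> G x \<noteq> 0"
  shows "diffeomorphic_sets C (sphere (0::real^'n) 1)"
proof -
  have sP: "smooth_at P x" and dP: "(P has_derivative (\<lambda>v. G x \<bullet> v)) (at x)" and dG: "(G has_derivative H x) (at x)" for x
    using pot unfolding potential_def by blast+
  have gP: "grad P x = G x" for x by (rule grad_unique[OF sP dP])
  obtain R0 where R0: "\<And>x. R0 \<le> norm x \<Longrightarrow> (norm x)\<^sup>2 \<le> G x \<bullet> x" using pot unfolding potential_def by blast
  define R where "R = max R0 1"
  have R: "R > 0" by (simp add: R_def less_max_iff_disj)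
  have rad: "(norm x)\<^sup>2 / 2 \<le> grad P x \<bullet> x" if x: "R \<le> norm x" for x
  proof -
    have "(norm x)\<^sup>2 \<le> G x \<bullet> x" by (rule R0) (use x in \<open>simp add: R_def\<close>)
    then show ?thesis unfolding gP using zero_le_power2[of "norm x"] by linarith
  qed
  have cP: "compact {x. P x \<le> v}" by (rule radial_growth(1)[OF sP R rad])
  define g0 where "g0 x = P x + - v" for x
  have sg: "smooth_at g0 x" for x unfolding g0_def[abs_def] by (intro smooth_intros sP)
  have gg: "grad g0 x = G x" for x unfolding g0_def[abs_def] grad_add_const[OF sP] gP ..
  have Z: "{x. P x = v} = {x. g0 x = 0}" by (auto simp: g0_def)
  have C': "C \<in> components {x. g0 x = 0}" using C unfolding Z .
  have "openin (top_of_set {x. g0 x = 0}) C" by (rule regular_level_component_open[OF sg C']) (simp add: gg reg)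
  then obtain U where U: "open U" "C = {x. g0 x = 0} \<inter> U" unfolding openin_open by blast
  have CU: "C = {x \<in> U. g0 x = 0}" using U(2) by blast
  have "closed {x. g0 x = 0}" using continuous_closed_preimage_constant[OF smooth_at_continuous_on[OF sg] closed_UNIV] by simp
  then have "closed C" using C' closed_components by blast
  moreover have "C \<subseteq> {x. P x \<le> v}" using in_components_subset[OF C] by auto
  ultimately have cC: "compact C" using cP compact_Int_closed[of "{x. P x \<le> v}" C] by (simp add: Int_absorb1)
  have cG: "continuous_on X G" for X by (intro continuous_at_imp_continuous_on ballI has_derivative_continuous[OF dG])
  define V where "V = {x. G x \<noteq> 0}"
  have "closed {x. G x = 0}" using continuous_closed_preimage_constant[OF cG closed_UNIV] by simp
  moreover have "V = - {x. G x = 0}" by (auto simp: V_def)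
  ultimately have V: "open V" by (simp add: open_Compl)
  have CV: "C \<subseteq> V" using reg by (auto simp: V_def)
  have "\<exists>K \<epsilon>. compact K \<and> C \<subseteq> interior K \<and> K \<subseteq> U \<and> K \<subseteq> V \<and> \<epsilon> > 0 \<and>
    (\<forall>h. (\<forall>x\<in>K. smooth_at h x \<and> \<bar>h x\<bar> < \<epsilon> \<and> norm (grad h x) \<le> \<epsilon>) \<longrightarrow>
      {x \<in> K. g0 x + h x = 0} \<subseteq> interior K \<and> diffeomorphic_sets {x \<in> K. g0 x + h x = 0} C)"
    by (rule level_set_stability[OF U(1) _ cC CU _ V CV]) (simp_all add: sg gg reg)
  then obtain K \<epsilon> where K0: "compact K \<and> C \<subseteq> interior K \<and> K \<subseteq> U \<and> K \<subseteq> V \<and> \<epsilon> > 0 \<and>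
    (\<forall>h. (\<forall>x\<in>K. smooth_at h x \<and> \<bar>h x\<bar> < \<epsilon> \<and> norm (grad h x) \<le> \<epsilon>) \<longrightarrow>
      {x \<in> K. g0 x + h x = 0} \<subseteq> interior K \<and> diffeomorphic_sets {x \<in> K. g0 x + h x = 0} C)" by (elim exE)
  note K = K0[THEN conjunct1] K0[THEN conjunct2, THEN conjunct1] K0[THEN conjunct2, THEN conjunct2, THEN conjunct2, THEN conjunct1]
  note stab' = K0[THEN conjunct2, THEN conjunct2, THEN conjunct2, THEN conjunct2]
  note \<epsilon> = stab'[THEN conjunct1] and stab = stab'[THEN conjunct2]
  have "K \<noteq> {}" using in_components_nonempty[OF C] K(2) interior_subset by fast
  then obtain z where z: "z \<in> K" "\<And>x. x \<in> K \<Longrightarrow> norm (G z) \<le> norm (G x)"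
    using continuous_attains_inf[OF K(1) _ continuous_on_norm[OF cG]] by blast
  have Gz: "norm (G z) > 0" using z(1) K(3) by (auto simp: V_def)
  obtain b0 where b0: "b0 > 0" "\<And>x. x \<in> K \<Longrightarrow> norm x \<le> b0" using compact_imp_bounded[OF K(1)] bounded_pos by metis
  \<comment> \<open>The three bounds on e: no critical points of P - e.x in \<open>K\<close>, a
    small gradient of the perturbation, and |e.x| at most \<epsilon> / 2 on
    \<open>K\<close>.\<close>
  define \<epsilon>' where "\<epsilon>' = min (norm (G z)) (min \<epsilon> (\<epsilon> / (2 * b0)))"
  have \<epsilon>': "\<epsilon>' > 0" using Gz \<epsilon> b0(1) by (simp add: \<epsilon>'_def)
  obtain e where e: "norm e < \<epsilon>'" "\<And>x. G x = e \<Longrightarrow> inj (H x)" using regular_value_dense[OF dG \<epsilon>'] by metis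
  have e1: "norm e < norm (G z)" "norm e \<le> \<epsilon>" "norm e < \<epsilon> / (2 * b0)" using e(1) by (auto simp: \<epsilon>'_def)
  have ex: "\<bar>e \<bullet> x\<bar> \<le> \<epsilon> / 2" if "x \<in> K" for x
  proof -
    have "\<bar>e \<bullet> x\<bar> \<le> norm e * norm x" by (rule Cauchy_Schwarz_ineq2)
    also have "\<dots> \<le> \<epsilon> / (2 * b0) * b0" using e1(3) b0 that \<epsilon> by (intro mult_mono) (auto intro: less_imp_le)
    also have "\<dots> = \<epsilon> / 2" using b0(1) by simp
    finally show ?thesis .
  qed
  have Ge: "G x \<noteq> e" if "x \<in> K" for x using z(2)[OF that] e1(1) by auto
  obtain M where M: "tame M" "\<And>x. x \<in> K \<Longrightarrow> M x = P x - e \<bullet> x"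
    using tame_perturbation[OF pot e(2) compact_imp_closed[OF K(1)] Ge] by metis
  have sM: "smooth_at M x" for x using M(1) by (simp add: tame_def)
  have fin: "finite ((\<lambda>x. M x - v) ` {x. grad M x = 0})" using M(1) by (simp add: tame_def)
  \<comment> \<open>The level is shifted by a small \<tau> past the finitely many critical values;
    half of \<epsilon> is reserved for this.\<close>
  have "\<not> {0<..<\<epsilon> / 2} \<subseteq> (\<lambda>x. M x - v) ` {x. grad M x = 0}"
  proof
    assume "{0<..<\<epsilon> / 2} \<subseteq> (\<lambda>x. M x - v) ` {x. grad M x = 0}"
    then have "finite {0<..<\<epsilon> / 2}" using fin finite_subset by blast
    moreover have "0 < \<epsilon> / 2" using \<epsilon> by simp
    ultimately show False using infinite_Ioo by blast
  qed
  then obtain \<tau> where "\<tau> \<in> {0<..<\<epsilon> / 2}" and \<tau>M: "\<tau> \<notin> (\<lambda>x. M x - v) ` {x. grad M x = 0}" by blast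
  then have \<tau>: "0 < \<tau>" "\<tau> < \<epsilon> / 2" by simp_all
  define b where "b = v + \<tau>"
  have regM: "grad M x \<noteq> 0" if "M x = b" for x
  proof
    assume "grad M x = 0"
    then have "\<tau> \<in> (\<lambda>x. M x - v) ` {x. grad M x = 0}" using that by (intro image_eqI[of _ _ x]) (auto simp: b_def)
    then show False using \<tau>M by blast
  qed
  define h where "h x = - (e \<bullet> x) + - \<tau>" for x
  define C1 where "C1 = {x \<in> K. M x = b}"
  have "C1 = {x \<in> K. g0 x + h x = 0}" using M(2) by (auto simp: C1_def g0_def h_def b_def)
  moreover have "{x \<in> K. g0 x + h x = 0} \<subseteq> interior K \<and> diffeomorphic_sets {x \<in> K. g0 x + h x = 0} C"
  proof (rule stab[THEN spec[of _ h], THEN mp], rule ballI)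
    fix x assume x: "x \<in> K"
    have sh: "smooth_at h x" unfolding h_def[abs_def] by (intro smooth_intros)
    have "(h has_derivative (\<lambda>v. - (e \<bullet> v) + 0)) (at x)" unfolding h_def[abs_def]
      by (rule has_derivative_add[OF has_derivative_minus[OF has_derivative_inner_right[OF has_derivative_ident]] has_derivative_const[of "- \<tau>"]])
    then have "grad h x = - e" by (intro grad_unique[OF sh]) simp
    then show "smooth_at h x \<and> \<bar>h x\<bar> < \<epsilon> \<and> norm (grad h x) \<le> \<epsilon>" using sh e1(2) ex[OF x] \<tau> by (simp add: h_def)
  qed
  ultimately have C1: "C1 \<subseteq> interior K" "diffeomorphic_sets C1 C" by simp_all
  have con: "connected C1" by (rule diffeomorphic_sets_connected[OF diffeomorphic_sets_sym[OF C1(2)] in_components_connected[OF C]])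
  have ne: "C1 \<noteq> {}"
  proof
    assume "C1 = {}"
    then have "C = {}" using C1(2) unfolding diffeomorphic_sets_def by auto
    then show False using in_components_nonempty[OF C] by blast
  qed
  have C1i: "C1 = {x. M x = b} \<inter> interior K" using C1(1) interior_subset by (auto simp: C1_def)
  then have op: "openin (top_of_set {x. M x = b}) C1" by (simp add: openin_open_Int)
  have "closed {x. M x = b}" using continuous_closed_preimage_constant[OF smooth_at_continuous_on[OF sM] closed_UNIV] by simp
  moreover have "C1 = K \<inter> {x. M x = b}" by (auto simp: C1_def)
  ultimately have cl: "closed C1" using closed_Int[OF compact_imp_closed[OF K(1)]] by metis
  obtain y where y: "y \<in> C1" using ne by blast
  have yM: "y \<in> {x. M x = b}" using y by (simp add: C1_def)
  define D where "D = connected_component_set {x. M x = b} y"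
  have D: "D \<in> components {x. M x = b}" using yM by (auto simp: D_def components_iff)
  have yD: "y \<in> D" using yM by (simp add: D_def connected_component_refl_eq)
  have "C1 \<subseteq> D" by (rule components_maximal[OF D con]) (use y yD in \<open>auto simp: C1_def\<close>)
  moreover have "D \<subseteq> C1"
    using connected_clopen_cases[OF in_components_connected[OF D] in_components_subset[OF D] op cl] y yD by blast
  ultimately have "C1 \<in> components {x. M x = b}" using D by simp
  moreover have "all_spheres {x. M x = b}"
    by (rule tame_level_spheres[OF M(1) _ regM]) (use n2 in simp)
  ultimately have "diffeomorphic_sets C1 (sphere (0::real^'n) 1)" by (simp add: all_spheres_def)
  then show ?thesis using C1(2) diffeomorphic_sets_sym diffeomorphic_sets_trans by blast
qed

theorem theorem9p2:
  fixes w :: "nat \<Rightarrow> real^'n" and r :: nat and c :: real and f :: "real^'n \<Rightarrow> real"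
    and C :: "(real^'n) set"
  assumes n2: "CARD('n) \<ge> 2"
    and distinct: "inj_on w {1..r}"
    and f_def: "\<And>x. f x = (\<Sum>i=1..r. ln ((norm (x - w i))\<^sup>2))"
    and comp: "C \<in> components {x. x \<notin> w ` {1..r} \<and> f x = c}"
    and nocrit: "\<forall>x\<in>C. \<not> (f has_derivative (\<lambda>h. 0)) (at x)"
  shows "diffeomorphic_sets C (sphere (0::real^'n) 1)"
proof (cases "r = 0")
  \<comment> \<open>An empty sum is constant, so every point is critical and the hypothesis fails on
    the nonempty \<open>C\<close>.\<close>
  case True
  obtain x where "x \<in> C" using in_components_nonempty[OF comp] by blast
  moreover have "f = (\<lambda>x. 0)" using True by (simp add: f_def fun_eq_iff)
  then have "(f has_derivative (\<lambda>h. 0)) (at x)" by simp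
  ultimately show ?thesis using nocrit by blast
next
  case False
  \<comment> \<open>The exponential of \<open>f\<close>, extended by 0 to the points w i.\<close>
  define P where "P x = (\<Prod>i=1..r. (x - w i) \<bullet> (x - w i))" for x
  obtain G H where pot: "potential P G H" using potential_prod[of r w] False unfolding P_def[abs_def] by auto
  have dP: "(P has_derivative (\<lambda>v. G x \<bullet> v)) (at x)" for x using pot unfolding potential_def by blast
  define W where "W = w ` {1..r}"
  have pos: "P x > 0" and fP: "f x = ln (P x)" if "x \<notin> W" for x
  proof -
    have nz: "(x - w i) \<bullet> (x - w i) > 0" if "i \<in> {1..r}" for i using \<open>x \<notin> W\<close> that by (auto simp: W_def)
    then show "P x > 0" unfolding P_def by (intro prod_pos) auto
    have "ln (P x) = (\<Sum>i=1..r. ln ((x - w i) \<bullet> (x - w i)))" unfolding P_def by (intro ln_prod) (use nz in auto)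
    then show "f x = ln (P x)" by (simp add: f_def power2_norm_eq_inner)
  qed
  have PW: "P x = 0" if "x \<in> W" for x using that by (auto simp: W_def P_def)
  \<comment> \<open>As exp c is positive, the points w i are excluded automatically, and components
    may be taken in the whole space.\<close>
  have "{x. x \<notin> w ` {1..r} \<and> f x = c} = {x. P x = exp c}"
  proof (intro set_eqI iffI)
    fix x assume "x \<in> {x. x \<notin> w ` {1..r} \<and> f x = c}"
    then have "x \<notin> W" "f x = c" by (auto simp: W_def)
    then show "x \<in> {x. P x = exp c}" using pos[of x] fP[of x] exp_ln[of "P x"] by simp
  next
    fix x assume "x \<in> {x. P x = exp c}"
    then have x: "P x = exp c" by simp
    then have "x \<notin> W" using PW[of x] by auto
    then show "x \<in> {x. x \<notin> w ` {1..r} \<and> f x = c}" using fP[of x] x by (simp add: W_def)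
  qed
  then have C: "C \<in> components {x. P x = exp c}" using comp by simp
  show ?thesis
  proof (rule potential_level_component[OF pot n2 C])
    fix x assume x: "x \<in> C"
    then have Px: "P x = exp c" using in_components_subset[OF C] by blast
    then have xW: "x \<in> - W" using PW[of x] by auto
    have oW: "open (- W)" by (intro open_Compl finite_imp_closed) (simp add: W_def)
    show "G x \<noteq> 0"
    proof
      assume G0: "G x = 0"
      have "((\<lambda>x. ln (P x)) has_derivative (\<lambda>v. (G x \<bullet> v) * inverse (P x))) (at x)"
        using has_derivative_ln[OF _ dP, of x] Px by (simp add: divide_inverse)
      then have "((\<lambda>x. ln (P x)) has_derivative (\<lambda>v. 0)) (at x)" using G0 by simp
      then have "(f has_derivative (\<lambda>v. 0)) (at x)"
        by (rule has_derivative_transform_within_open[OF _ oW xW]) (simp add: fP)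
      then show False using nocrit x by blast
    qed
  qed
qed

end
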